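(* Let $\pi:Q\to M=Q/G$ be a right principal $G$-bundle equipped with a $G$-invariant horizontal distribution $\mathrm{H}Q\subset \mathrm{T}Q$ and a smooth $G$-invariant Lagrangian $L:\mathrm{T}Q\to\mathbb{R}$ (a standard Chaplygin system). Then $\mathcal B\equiv0$ and $\mathrm HL(\widetilde X)=0$ for every horizontal $\widetilde X$, and consequently, for a horizontal admissible path $\widetilde X(t)\in\mathrm H_{q(t)}Q$: (i) The standard admissible variation $\delta_{\xi}\widetilde X$ generated by $\xi(t)=\widetilde Y(t)+\widetilde b(t)$, with $\widetilde Y(t)\in\mathrm H_{q(t)}Q$ and $b(t)\in\mathfrak g$, is vakonomic if and only if $\dot b(t)+\mathcal R(q(t))(X(t),Y(t))=0$. (ii) If $\widetilde X(t)$ is a nonholonomic extremal, it is an unconstrained extremal if and only if $\mathrm FL(\widetilde X(t))=\mathrm{const}$. (iii) If $\widetilde X(t)$ is a nonholonomic extremal, it is a vakonomic extremal if and only if $\int_I\langle\mathrm FL(\widetilde X(t)),\mathcal R(q(t))(X(t),Y(t))\rangle\,\mathrm dt=0$ for each pair $\widetilde Y(t)\in\mathrm H_{q(t)}Q$, $b(t)\in\mathfrak g$ vanishing at the end-points and related by $\dot b(t)+\mathcal R(q(t))(X(t),Y(t))=0$. (iv) If $\widetilde X(t)$ is a vakonomic extremal associated with a multiplier $\lambda(t)\in\mathfrak g^*$, then $\lambda(t)=\mathrm FL(\widetilde X(t))+\mathrm{const}$.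
   Context: Everything is $C^\infty$; $I=[t_0,t_1]$ is a fixed interval; $R_g(q)=q\cdot g$. $G$-invariance means $(R_g)_*\widetilde X_q=\widetilde X_{q\cdot g}$ (for $\mathrm HQ$) and $L((R_g)_*Z)=L(Z)$ (for $L$). Variations. $\kappa_Q:\mathrm{TT}Q\to\mathrm{TT}Q$ is the canonical flip, $(q^a,\dot q^b,q'^c,\dot q'^d)\mapsto(q^a,q'^b,\dot q^c,\dot q'^d)$ in induced coordinates. If $\gamma(t)\in\mathrm{T}Q$ is the tangent lift of a curve $q(t)\in Q$ and $\xi(t)\in\mathrm{T}_{q(t)}Q$ is a curve (generator), the standard admissible variation generated by $\xi$ is $\delta_{\xi}\gamma(t)=\kappa_Q(\mathrm{T}_t\xi(t))\in\mathrm{T}_{\gamma(t)}\mathrm{T}Q$, where $\mathrm{T}_t\xi(t)\in\mathrm{TT}Q$ is the tangent lift of the curve $\xi$. The variation of the action is $\langle \mathrm{d}S_L(\gamma),\delta\gamma\rangle=\int_I\langle \mathrm{d}L(\gamma(t)),\delta\gamma(t)\rangle\,\mathrm{d}t$ (for a time-dependent Lagrangian, differentiate in the $\mathrm{T}Q$ variable). Chaplygin system. $\mathrm{V}Q=\ker\pi_*$; a horizontal distribution is a smooth distribution with $\mathrm{T}_qQ=\mathrm{H}_qQ\oplus\mathrm{V}_qQ$ for all $q$. A horizontal admissible path is a curve $\widetilde X(t)\in\mathrm{H}_{q(t)}Q$ which is the tangent lift of a curve $q(t)$. A variation $\delta_\xi\widetilde X$ is vakonomic if $\delta_{\xi}\widetilde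 X(t)\in\mathrm{T}_{\widetilde X(t)}\mathrm{H}Q$ for all $t$. A horizontal admissible path is an unconstrained extremal (for a possibly time-dependent Lagrangian) if $\langle\mathrm{d}S_L(\widetilde X),\delta_\xi\widetilde X\rangle=0$ for all generators $\xi(t)\in\mathrm{T}_{q(t)}Q$ with $\xi(t_0)=\xi(t_1)=0$; a nonholonomic extremal if this holds for all such $\xi$ with $\xi(t)\in\mathrm{H}_{q(t)}Q$; a vakonomic extremal if this holds for all such $\xi$ for which $\delta_\xi\widetilde X$ is vakonomic; a vakonomic extremal associated with a multiplier $\lambda:I\to\mathfrak g^*$ if it is an unconstrained extremal for $\widetilde L(Z,t)=L(Z)-\langle\lambda(t),\omega(Z)\rangle$. Notation. $\mathfrak g=\mathrm{T}_eG$ carries the left Lie algebra structure. For $a\in\mathfrak g$, $\widetilde a$ is the fundamental vector field on $Q$, with flow $q\mapsto q\cdot\exp(ta)$; this identifies $\mathrm{V}Q\approx Q\times\mathfrak g$; $\widetilde b(t)$ denotes the fundamental field of $b(t)$ at $q(t)$. $\omega:\mathrm{T}Q\to\mathfrak g$ is the projection onto the $\mathfrak g$-part in $\mathrm{T}Q=\mathrm{H}Q\oplus_Q(Q\times\mathfrak g)$. For $X\in\mathrm{T}_xM$ and $q\in\pi^{-1}(x)$, $\widetilde X_q\in\mathrm{H}_qQ$ is the horizontal lift. $X(t)=\pi_*\widetilde X(t)$, $Y(t)=\pi_*\widetilde Y(t)$. Maps (tensorial, so defined by extending $X,Y$ to vector fields on $M$): curvature $\mathcal R(q)(X,Y)=\omega([\widetilde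 X,\widetilde Y]-\widetilde{[X,Y]})(q)$, and $\mathcal B(q)(X,a)=\omega([\widetilde X,\widetilde a])(q)$. Derivatives of $L$: $\mathrm{F}L,\mathrm{H}L:\mathrm{H}Q\to\mathfrak g^*$, $\langle\mathrm{F}L(\widetilde X_q),b\rangle=\frac{\mathrm d}{\mathrm dt}\big|_0L(\widetilde X_q+t\,\widetilde b_q)$ and $\langle\mathrm{H}L(\widetilde X_q),b\rangle=\frac{\mathrm d}{\mathrm dt}\big|_0L(\widetilde X_{q\cdot\exp(tb)})$, where $\widetilde X_{q\cdot \exp(tb)}$ is the horizontal lift of the same $X$ to the point $q\cdot\exp(tb)$. *)

theory Defs
  imports "HOL-Analysis.Analysis" "HOL-Algebra.Group" "HOL-Library.Function_Algebras"
begin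

section \<open>Model spaces and smooth functions\<close>

text \<open>
  Charts take values in finite-dimensional inner product spaces. In contrast to
  \<^class>\<open>euclidean_space\<close> the dimension may be 0, so that discrete structure groups and
  zero-dimensional base manifolds are included.
\<close>

class model_space = real_inner + banach +
  assumes finite_spanning_set: "\<exists>B. finite B \<and> (\<forall>x. \<exists>r. x = (\<Sum>b\<in>B. r b *\<^sub>R b))"

lemma finite_span: "\<exists>B::'a::model_space set. finite B \<and> span B = UNIV"
proof -
  obtain B :: "'a set" where B: "finite B" "\<And>x. \<exists>r. x = (\<Sum>b\<in>B. r b *\<^sub>R b)"
    using finite_spanning_set by blast
  have "x \<in> span B" for x
  proof -
    obtain r where "x = (\<Sum>b\<in>B. r b *\<^sub>R b)" using B(2) by blast
    then show ?thesis by (simp only: span_sum span_scale span_base)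
  qed
  then show ?thesis using B(1) by blast
qed

instance euclidean_space \<subseteq> model_space
proof
  have "\<forall>x::'a. \<exists>r. x = (\<Sum>b\<in>Basis. r b *\<^sub>R b)"
    using euclidean_representation by metis
  then show "\<exists>B::'a set. finite B \<and> (\<forall>x. \<exists>r. x = (\<Sum>b\<in>B. r b *\<^sub>R b))"
    using finite_Basis by blast
qed

instance prod :: (model_space, model_space) model_space
proof
  obtain B :: "'a set" where B: "finite B" "span B = UNIV" using finite_span by blast
  obtain C :: "'b set" where C: "finite C" "span C = UNIV" using finite_span by blast
  let ?D = "(\<lambda>x. (x, 0)) ` B \<union> (\<lambda>y. (0, y)) ` C"
  have 1: "(x, 0) \<in> span ?D" for x
  proof -
    have "linear (\<lambda>x::'a. (x, 0::'b))" by (rule linearI) auto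
    then have "(\<lambda>x. (x, 0)) ` span B = span ((\<lambda>x. (x, 0::'b)) ` B)"
      by (rule span_linear_image[symmetric])
    then show ?thesis using B(2) span_mono[of "(\<lambda>x. (x, 0::'b)) ` B" ?D] by blast
  qed
  have 2: "(0, y) \<in> span ?D" for y
  proof -
    have "linear (\<lambda>y::'b. (0::'a, y))" by (rule linearI) auto
    then have "(\<lambda>y. (0, y)) ` span C = span ((\<lambda>y. (0::'a, y)) ` C)"
      by (rule span_linear_image[symmetric])
    then show ?thesis using C(2) span_mono[of "(\<lambda>y. (0::'a, y)) ` C" ?D] by blast
  qed
  have "z \<in> span ?D" for z
    using span_add[OF 1[of "fst z"] 2[of "snd z"]] by simp
  moreover have D: "finite ?D" using B(1) C(1) by simp
  ultimately have "\<forall>z. \<exists>r. z = (\<Sum>d\<in>?D. r d *\<^sub>R d)"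
    unfolding span_finite[OF D] by (auto simp only: image_iff)
  then show "\<exists>D::('a \<times> 'b) set. finite D \<and> (\<forall>z. \<exists>r. z = (\<Sum>d\<in>D. r d *\<^sub>R d))"
    using D by blast
qed

primrec Ck_on :: "nat \<Rightarrow> 'a::model_space set \<Rightarrow> ('a \<Rightarrow> 'b::model_space) \<Rightarrow> bool" where
  "Ck_on 0 U f \<longleftrightarrow> continuous_on U f"
| "Ck_on (Suc k) U f \<longleftrightarrow> (\<forall>x\<in>U. f differentiable (at x)) \<and>
     (\<forall>v. Ck_on k U (\<lambda>x. frechet_derivative f (at x) v))"

text \<open>
  On an arbitrary subset, such as a compact interval, smoothness means that there are local
  \<open>C\<^sup>\<infinity>\<close> extensions to open neighbourhoods.
\<close>

definition smooth_on :: "'a::model_space set \<Rightarrow> ('a \<Rightarrow> 'b::model_space) \<Rightarrow> bool" where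
  "smooth_on S f \<longleftrightarrow> (\<forall>x\<in>S. \<exists>U g. open U \<and> x \<in> U \<and> (\<forall>k. Ck_on k U g) \<and> (\<forall>y\<in>U \<inter> S. g y = f y))"

section \<open>Manifolds\<close>

text \<open>
  A chart is its domain together with the coordinate map (irrelevant outside the domain). A
  manifold is represented by an atlas; its points and its topology are recovered from it.
\<close>

type_synonym ('a, 'e) chart = "'a set \<times> ('a \<Rightarrow> 'e)"
type_synonym ('a, 'e) atlas = "('a, 'e) chart set"

definition chart_inv :: "('a, 'e) chart \<Rightarrow> 'e \<Rightarrow> 'a" where
  "chart_inv c = inv_into (fst c) (snd c)"

definition transition :: "('a, 'e) chart \<Rightarrow> ('a, 'e) chart \<Rightarrow> 'e \<Rightarrow> 'e" where
  "transition c d = (\<lambda>x. snd d (chart_inv c x))"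

definition points :: "('a, 'e) atlas \<Rightarrow> 'a set" where
  "points A = (\<Union>c\<in>A. fst c)"

definition atlas_topology :: "('a, 'e::model_space) atlas \<Rightarrow> 'a topology" where
  "atlas_topology A = topology (\<lambda>W. W \<subseteq> points A \<and> (\<forall>c\<in>A. open (snd c ` (W \<inter> fst c))))"

definition smooth_manifold :: "('a, 'e::model_space) atlas \<Rightarrow> bool" where
  "smooth_manifold A \<longleftrightarrow>
     (\<forall>c\<in>A. inj_on (snd c) (fst c)) \<and>
     (\<forall>c\<in>A. \<forall>d\<in>A. open (snd c ` (fst c \<inter> fst d)) \<and>
                     smooth_on (snd c ` (fst c \<inter> fst d)) (transition c d)) \<and>
     Hausdorff_space (atlas_topology A) \<and> second_countable (atlas_topology A)"

definition model_atlas :: "('e, 'e) atlas" where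
  "model_atlas = {(UNIV, \<lambda>x. x)}"

definition prod_atlas :: "('a, 'e) atlas \<Rightarrow> ('b, 'f) atlas \<Rightarrow> ('a \<times> 'b, 'e \<times> 'f) atlas" where
  "prod_atlas A B = (\<lambda>(c, d). (fst c \<times> fst d, map_prod (snd c) (snd d))) ` (A \<times> B)"

text \<open>\<open>f\<close> is a smooth map from the subset \<open>S\<close> of the manifold \<open>A\<close> to the manifold \<open>B\<close>;
  membership of \<open>f p\<close> in a chart domain of \<open>B\<close> entails that \<open>f\<close> maps \<open>S\<close> into \<open>points B\<close>.\<close>

definition smooth_map ::
  "('a, 'e::model_space) atlas \<Rightarrow> 'a set \<Rightarrow> ('b, 'f::model_space) atlas \<Rightarrow> ('a \<Rightarrow> 'b) \<Rightarrow> bool" where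
  "smooth_map A S B f \<longleftrightarrow>
     (\<forall>p\<in>S. \<exists>c\<in>A. \<exists>d\<in>B. p \<in> fst c \<and> f p \<in> fst d \<and>
        (\<exists>W. open W \<and> snd c p \<in> W \<and>
             (\<forall>p'\<in>S \<inter> fst c. snd c p' \<in> W \<longrightarrow> f p' \<in> fst d) \<and>
             smooth_on (W \<inter> snd c ` (S \<inter> fst c)) (\<lambda>x. snd d (f (chart_inv c x)))))"

section \<open>Tangent bundles\<close>

text \<open>
  A tangent vector at \<open>p\<close> is the family of its components in all charts around \<open>p\<close>, related by
  the derivatives of the transition maps, and 0 for charts that do not contain \<open>p\<close>. Its vector
  space operations are the pointwise ones.
\<close>

type_synonym ('a, 'e) tvec = "('a, 'e) chart \<Rightarrow> 'e"

definition tscale :: "real \<Rightarrow> ('a, 'e::real_vector) tvec \<Rightarrow> ('a, 'e) tvec" where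
  "tscale r v = (\<lambda>c. r *\<^sub>R v c)"

definition tangent_space :: "('a, 'e::model_space) atlas \<Rightarrow> 'a \<Rightarrow> ('a, 'e) tvec set" where
  "tangent_space A p = {v.
     (\<forall>c. \<not> (c \<in> A \<and> p \<in> fst c) \<longrightarrow> v c = 0) \<and>
     (\<forall>c\<in>A. \<forall>d\<in>A. p \<in> fst c \<inter> fst d \<longrightarrow>
        v d = frechet_derivative (transition c d) (at (snd c p)) (v c))}"

type_synonym ('a, 'e) tb = "'a \<times> ('a, 'e) tvec"

definition tangent_chart ::
  "('a, 'e::model_space) atlas \<Rightarrow> ('a, 'e) chart \<Rightarrow> (('a, 'e) tb, 'e \<times> 'e) chart" where
  "tangent_chart A c = ({(p, v). p \<in> fst c \<and> v \<in> tangent_space A p}, \<lambda>(p, v). (snd c p, v c))"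

definition tangent_atlas :: "('a, 'e::model_space) atlas \<Rightarrow> (('a, 'e) tb, 'e \<times> 'e) atlas" where
  "tangent_atlas A = tangent_chart A ` A"

definition differential ::
  "('a, 'e::model_space) atlas \<Rightarrow> ('b, 'f::model_space) atlas \<Rightarrow> ('a \<Rightarrow> 'b) \<Rightarrow> 'a \<Rightarrow>
     ('a, 'e) tvec \<Rightarrow> ('b, 'f) tvec" where
  "differential A B f p v = (\<lambda>d. if d \<in> B \<and> f p \<in> fst d
     then (let c = (SOME c. c \<in> A \<and> p \<in> fst c)
           in frechet_derivative (\<lambda>x. snd d (f (chart_inv c x))) (at (snd c p)) (v c))
     else 0)"

definition tangent_map ::
  "('a, 'e::model_space) atlas \<Rightarrow> ('b, 'f::model_space) atlas \<Rightarrow> ('a \<Rightarrow> 'b) \<Rightarrow>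
     ('a, 'e) tb \<Rightarrow> ('b, 'f) tb" where
  "tangent_map A B f Z = (f (fst Z), differential A B f (fst Z) (snd Z))"

definition d_fun :: "('a, 'e::model_space) atlas \<Rightarrow> ('a \<Rightarrow> real) \<Rightarrow> 'a \<Rightarrow> ('a, 'e) tvec \<Rightarrow> real" where
  "d_fun A f p v = differential A model_atlas f p v (UNIV, \<lambda>x. x)"

text \<open>The velocity is taken within the parameter set \<open>J\<close>, i.e. it is one-sided at end-points
  of an interval.\<close>

definition velocity ::
  "('a, 'e::model_space) atlas \<Rightarrow> real set \<Rightarrow> (real \<Rightarrow> 'a) \<Rightarrow> real \<Rightarrow> ('a, 'e) tvec" where
  "velocity A J \<gamma> t = (\<lambda>c. if c \<in> A \<and> \<gamma> t \<in> fst c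
     then vector_derivative (\<lambda>s. snd c (\<gamma> s)) (at t within J) else 0)"

definition tangent_lift ::
  "('a, 'e::model_space) atlas \<Rightarrow> real set \<Rightarrow> (real \<Rightarrow> 'a) \<Rightarrow> real \<Rightarrow> ('a, 'e) tb" where
  "tangent_lift A J \<gamma> t = (\<gamma> t, velocity A J \<gamma> t)"

text \<open>For an embedded submanifold \<open>S\<close> this is the tangent space of \<open>S\<close> at \<open>p\<close>.\<close>

definition tangent_to ::
  "('a, 'e::model_space) atlas \<Rightarrow> 'a set \<Rightarrow> 'a \<Rightarrow> ('a, 'e) tvec set" where
  "tangent_to A S p = {velocity A UNIV \<gamma> 0 | \<gamma>. \<gamma> 0 = p \<and>
     (\<exists>\<epsilon>>0. smooth_map model_atlas {-\<epsilon><..<\<epsilon>} A \<gamma> \<and> \<gamma> ` {-\<epsilon><..<\<epsilon>} \<subseteq> S)}"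

text \<open>
  In the chart of the iterated tangent bundle induced by \<open>c\<close>, the point \<open>((p, v), w)\<close> has
  coordinates \<open>((snd c p, v c), w (tangent_chart A c))\<close>; the flip exchanges \<open>v c\<close> with the first
  component of \<open>w (tangent_chart A c)\<close>.
\<close>

definition canonical_flip ::
  "('a, 'e::model_space) atlas \<Rightarrow> (('a, 'e) tb, 'e \<times> 'e) tb \<Rightarrow> (('a, 'e) tb, 'e \<times> 'e) tb" where
  "canonical_flip A = (\<lambda>((p, v), w).
     let v' = (\<lambda>c. fst (w (tangent_chart A c)))
     in ((p, v'), \<lambda>C. if C \<in> tangent_atlas A \<and> (p, v') \<in> fst C
          then (v (the_inv_into A (tangent_chart A) C), snd (w C)) else 0))"

section \<open>Vector fields\<close>

definition smooth_vector_field ::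
  "('a, 'e::model_space) atlas \<Rightarrow> 'a set \<Rightarrow> ('a \<Rightarrow> ('a, 'e) tvec) \<Rightarrow> bool" where
  "smooth_vector_field A U X \<longleftrightarrow> smooth_map A U (tangent_atlas A) (\<lambda>p. (p, X p))"

definition lie_bracket ::
  "('a, 'e::model_space) atlas \<Rightarrow> ('a \<Rightarrow> ('a, 'e) tvec) \<Rightarrow> ('a \<Rightarrow> ('a, 'e) tvec) \<Rightarrow>
     'a \<Rightarrow> ('a, 'e) tvec" where
  "lie_bracket A X Y p = (\<lambda>c. if c \<in> A \<and> p \<in> fst c
     then frechet_derivative (\<lambda>x. Y (chart_inv c x) c) (at (snd c p)) (X p c)
        - frechet_derivative (\<lambda>x. X (chart_inv c x) c) (at (snd c p)) (Y p c)
     else 0)"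

text \<open>A vector field, smooth near \<open>x\<close>, with value \<open>X\<close> at \<open>x\<close>. It is only used inside
  tensorial expressions, on which the choice has no influence.\<close>

definition extension :: "('a, 'e::model_space) atlas \<Rightarrow> 'a \<Rightarrow> ('a, 'e) tvec \<Rightarrow> 'a \<Rightarrow> ('a, 'e) tvec" where
  "extension A x X = (SOME F. F x = X \<and>
     (\<exists>U. openin (atlas_topology A) U \<and> x \<in> U \<and> smooth_vector_field A U F))"

section \<open>Lie groups\<close>

definition lie_group :: "'g monoid \<Rightarrow> ('g, 'h::model_space) atlas \<Rightarrow> bool" where
  "lie_group G A \<longleftrightarrow> group G \<and> smooth_manifold A \<and> points A = carrier G \<and>
     smooth_map (prod_atlas A A) (carrier G \<times> carrier G) A (\<lambda>(g, h). g \<otimes>\<^bsub>G\<^esub> h) \<and>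
     smooth_map A (carrier G) A (\<lambda>g. inv\<^bsub>G\<^esub> g)"

definition lie_alg :: "'g monoid \<Rightarrow> ('g, 'h::model_space) atlas \<Rightarrow> ('g, 'h) tvec set" where
  "lie_alg G A = tangent_space A \<one>\<^bsub>G\<^esub>"

definition one_parameter_subgroup ::
  "'g monoid \<Rightarrow> ('g, 'h::model_space) atlas \<Rightarrow> ('g, 'h) tvec \<Rightarrow> (real \<Rightarrow> 'g) \<Rightarrow> bool" where
  "one_parameter_subgroup G A a \<sigma> \<longleftrightarrow> smooth_map model_atlas UNIV A \<sigma> \<and>
     (\<forall>s t. \<sigma> (s + t) = \<sigma> s \<otimes>\<^bsub>G\<^esub> \<sigma> t) \<and> velocity A UNIV \<sigma> 0 = a"

definition lie_exp :: "'g monoid \<Rightarrow> ('g, 'h::model_space) atlas \<Rightarrow> ('g, 'h) tvec \<Rightarrow> 'g" where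
  "lie_exp G A a = (THE \<sigma>. one_parameter_subgroup G A a \<sigma>) 1"

text \<open>Linear functionals on the Lie algebra; only their values on it matter.\<close>

definition lie_dual :: "'g monoid \<Rightarrow> ('g, 'h::model_space) atlas \<Rightarrow> (('g, 'h) tvec \<Rightarrow> real) set" where
  "lie_dual G A = {\<mu>. (\<forall>a\<in>lie_alg G A. \<forall>b\<in>lie_alg G A. \<mu> (a + b) = \<mu> a + \<mu> b) \<and>
     (\<forall>r. \<forall>a\<in>lie_alg G A. \<mu> (tscale r a) = r * \<mu> a)}"

section \<open>Principal bundles\<close>

record ('q, 'e, 'm, 'd, 'g, 'h) bundle_data =
  tot :: "('q, 'e) atlas"
  base :: "('m, 'd) atlas"
  grp :: "'g monoid"
  grp_atlas :: "('g, 'h) atlas"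
  act :: "'q \<Rightarrow> 'g \<Rightarrow> 'q"
  proj :: "'q \<Rightarrow> 'm"

text \<open>That the fibres of \<open>proj\<close> are exactly the orbits, and that the action is free, follows from
  the existence of equivariant local trivialisations.\<close>

definition principal_bundle ::
  "('q, 'e::model_space, 'm, 'd::model_space, 'g, 'h::model_space) bundle_data \<Rightarrow> bool" where
  "principal_bundle P \<longleftrightarrow>
     smooth_manifold (tot P) \<and> smooth_manifold (base P) \<and> lie_group (grp P) (grp_atlas P) \<and>
     smooth_map (prod_atlas (tot P) (grp_atlas P)) (points (tot P) \<times> carrier (grp P)) (tot P)
       (\<lambda>(q, g). act P q g) \<and>
     (\<forall>q\<in>points (tot P). act P q \<one>\<^bsub>grp P\<^esub> = q) \<and>
     (\<forall>q\<in>points (tot P). \<forall>g\<in>carrier (grp P). \<forall>h\<in>carrier (grp P).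
        act P (act P q g) h = act P q (g \<otimes>\<^bsub>grp P\<^esub> h)) \<and>
     smooth_map (tot P) (points (tot P)) (base P) (proj P) \<and>
     (\<forall>x\<in>points (base P). \<exists>U \<Psi>. openin (atlas_topology (base P)) U \<and> x \<in> U \<and>
        bij_betw \<Psi> (U \<times> carrier (grp P)) {q \<in> points (tot P). proj P q \<in> U} \<and>
        smooth_map (prod_atlas (base P) (grp_atlas P)) (U \<times> carrier (grp P)) (tot P) \<Psi> \<and>
        smooth_map (tot P) {q \<in> points (tot P). proj P q \<in> U} (prod_atlas (base P) (grp_atlas P))
          (inv_into (U \<times> carrier (grp P)) \<Psi>) \<and>
        (\<forall>y\<in>U. \<forall>g\<in>carrier (grp P). proj P (\<Psi> (y, g)) = y) \<and>
        (\<forall>y\<in>U. \<forall>g\<in>carrier (grp P). \<forall>h\<in>carrier (grp P).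
           \<Psi> (y, g \<otimes>\<^bsub>grp P\<^esub> h) = act P (\<Psi> (y, g)) h))"

abbreviation liealg ::
  "('q, 'e, 'm, 'd, 'g, 'h::model_space) bundle_data \<Rightarrow> ('g, 'h) tvec set" where
  "liealg P \<equiv> lie_alg (grp P) (grp_atlas P)"

abbreviation expo ::
  "('q, 'e, 'm, 'd, 'g, 'h::model_space) bundle_data \<Rightarrow> ('g, 'h) tvec \<Rightarrow> 'g" where
  "expo P \<equiv> lie_exp (grp P) (grp_atlas P)"

definition vertical ::
  "('q, 'e::model_space, 'm, 'd::model_space, 'g, 'h) bundle_data \<Rightarrow> 'q \<Rightarrow> ('q, 'e) tvec set" where
  "vertical P q = {v \<in> tangent_space (tot P) q. differential (tot P) (base P) (proj P) q v = 0}"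

definition fundamental ::
  "('q, 'e::model_space, 'm, 'd, 'g, 'h::model_space) bundle_data \<Rightarrow> ('g, 'h) tvec \<Rightarrow> 'q \<Rightarrow> ('q, 'e) tvec" where
  "fundamental P a q = velocity (tot P) UNIV (\<lambda>t. act P q (expo P (tscale t a))) 0"

section \<open>Horizontal distributions\<close>

text \<open>Smoothness: locally there is a smooth frame \<open>X 0, \<dots>, X (n - 1)\<close>; the bijection expresses
  that it is a basis of \<open>H p\<close>.\<close>

definition smooth_distribution ::
  "('a, 'e::model_space) atlas \<Rightarrow> ('a \<Rightarrow> ('a, 'e) tvec set) \<Rightarrow> bool" where
  "smooth_distribution A H \<longleftrightarrow>
     (\<forall>p\<in>points A. \<exists>U n X. openin (atlas_topology A) U \<and> p \<in> U \<and>
        (\<forall>i<n::nat. smooth_vector_field A U (X i)) \<and>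
        (\<forall>p'\<in>U. bij_betw (\<lambda>a. \<Sum>i<n. tscale (a i) (X i p')) ({..<n} \<rightarrow>\<^sub>E UNIV) (H p')))"

definition horizontal_distribution ::
  "('q, 'e::model_space, 'm, 'd::model_space, 'g, 'h) bundle_data \<Rightarrow> ('q \<Rightarrow> ('q, 'e) tvec set) \<Rightarrow> bool" where
  "horizontal_distribution P H \<longleftrightarrow> smooth_distribution (tot P) H \<and>
     (\<forall>q\<in>points (tot P). H q \<subseteq> tangent_space (tot P) q \<and>
        (\<forall>v\<in>tangent_space (tot P) q. \<exists>!(h, w). h \<in> H q \<and> w \<in> vertical P q \<and> v = h + w))"

definition HQ ::
  "('q, 'e, 'm, 'd, 'g, 'h) bundle_data \<Rightarrow> ('q \<Rightarrow> ('q, 'e) tvec set) \<Rightarrow> ('q, 'e) tb set" where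
  "HQ P H = {(q, v). q \<in> points (tot P) \<and> v \<in> H q}"

definition hlift ::
  "('q, 'e::model_space, 'm, 'd::model_space, 'g, 'h) bundle_data \<Rightarrow> ('q \<Rightarrow> ('q, 'e) tvec set) \<Rightarrow>
     'q \<Rightarrow> ('m, 'd) tvec \<Rightarrow> ('q, 'e) tvec" where
  "hlift P H q X = (THE v. v \<in> H q \<and> differential (tot P) (base P) (proj P) q v = X)"

definition invariant_distribution ::
  "('q, 'e::model_space, 'm, 'd::model_space, 'g, 'h) bundle_data \<Rightarrow> ('q \<Rightarrow> ('q, 'e) tvec set) \<Rightarrow> bool" where
  "invariant_distribution P H \<longleftrightarrow>
     (\<forall>q\<in>points (tot P). \<forall>g\<in>carrier (grp P). \<forall>X\<in>tangent_space (base P) (proj P q).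
        differential (tot P) (tot P) (\<lambda>q. act P q g) q (hlift P H q X) = hlift P H (act P q g) X)"

definition omega ::
  "('q, 'e::model_space, 'm, 'd, 'g, 'h::model_space) bundle_data \<Rightarrow> ('q \<Rightarrow> ('q, 'e) tvec set) \<Rightarrow>
     ('q, 'e) tb \<Rightarrow> ('g, 'h) tvec" where
  "omega P H Z = (THE a. a \<in> liealg P \<and> (\<exists>h\<in>H (fst Z). snd Z = h + fundamental P a (fst Z)))"

definition curvature ::
  "('q, 'e::model_space, 'm, 'd::model_space, 'g, 'h::model_space) bundle_data \<Rightarrow>
     ('q \<Rightarrow> ('q, 'e) tvec set) \<Rightarrow> 'q \<Rightarrow> ('m, 'd) tvec \<Rightarrow> ('m, 'd) tvec \<Rightarrow> ('g, 'h) tvec" where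
  "curvature P H q X Y =
     (let X' = extension (base P) (proj P q) X;
          Y' = extension (base P) (proj P q) Y
      in omega P H (q,
           lie_bracket (tot P) (\<lambda>q'. hlift P H q' (X' (proj P q'))) (\<lambda>q'. hlift P H q' (Y' (proj P q'))) q
           - hlift P H q (lie_bracket (base P) X' Y' (proj P q))))"

definition B_map ::
  "('q, 'e::model_space, 'm, 'd::model_space, 'g, 'h::model_space) bundle_data \<Rightarrow>
     ('q \<Rightarrow> ('q, 'e) tvec set) \<Rightarrow> 'q \<Rightarrow> ('m, 'd) tvec \<Rightarrow> ('g, 'h) tvec \<Rightarrow> ('g, 'h) tvec" where
  "B_map P H q X a =
     (let X' = extension (base P) (proj P q) X
      in omega P H (q, lie_bracket (tot P) (\<lambda>q'. hlift P H q' (X' (proj P q'))) (fundamental P a) q))"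

section \<open>Lagrangians\<close>

definition invariant_lagrangian ::
  "('q, 'e::model_space, 'm, 'd, 'g, 'h) bundle_data \<Rightarrow> (('q, 'e) tb \<Rightarrow> real) \<Rightarrow> bool" where
  "invariant_lagrangian P L \<longleftrightarrow>
     (\<forall>Z\<in>points (tangent_atlas (tot P)). \<forall>g\<in>carrier (grp P).
        L (tangent_map (tot P) (tot P) (\<lambda>q. act P q g) Z) = L Z)"

definition standard_chaplygin_system ::
  "('q, 'e::model_space, 'm, 'd::model_space, 'g, 'h::model_space) bundle_data \<Rightarrow>
     ('q \<Rightarrow> ('q, 'e) tvec set) \<Rightarrow> (('q, 'e) tb \<Rightarrow> real) \<Rightarrow> bool" where
  "standard_chaplygin_system P H L \<longleftrightarrow> principal_bundle P \<and>
     horizontal_distribution P H \<and> invariant_distribution P H \<and>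
     smooth_map (tangent_atlas (tot P)) (points (tangent_atlas (tot P))) model_atlas L \<and>
     invariant_lagrangian P L"

definition FL ::
  "('q, 'e::model_space, 'm, 'd, 'g, 'h::model_space) bundle_data \<Rightarrow> (('q, 'e) tb \<Rightarrow> real) \<Rightarrow>
     ('q, 'e) tb \<Rightarrow> ('g, 'h) tvec \<Rightarrow> real" where
  "FL P L Z b = deriv (\<lambda>t. L (fst Z, snd Z + tscale t (fundamental P b (fst Z)))) 0"

definition HL ::
  "('q, 'e::model_space, 'm, 'd::model_space, 'g, 'h::model_space) bundle_data \<Rightarrow>
     ('q \<Rightarrow> ('q, 'e) tvec set) \<Rightarrow> (('q, 'e) tb \<Rightarrow> real) \<Rightarrow> ('q, 'e) tb \<Rightarrow> ('g, 'h) tvec \<Rightarrow> real" where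
  "HL P H L Z b =
     (let X = differential (tot P) (base P) (proj P) (fst Z) (snd Z)
      in deriv (\<lambda>t. let q' = act P (fst Z) (expo P (tscale t b)) in L (q', hlift P H q' X)) 0)"

section \<open>Admissible variations and extremals\<close>

text \<open>Curves in a tangent bundle carry their base points, so the base curve \<open>q\<close> of a path \<open>Z\<close>
  is \<open>\<lambda>t. fst (Z t)\<close>. \<open>J\<close> is always a compact interval.\<close>

definition horizontal_admissible_path ::
  "('q, 'e::model_space, 'm, 'd, 'g, 'h) bundle_data \<Rightarrow> ('q \<Rightarrow> ('q, 'e) tvec set) \<Rightarrow> real set \<Rightarrow>
     (real \<Rightarrow> ('q, 'e) tb) \<Rightarrow> bool" where
  "horizontal_admissible_path P H J Z \<longleftrightarrow>
     (\<exists>q. smooth_map model_atlas J (tot P) q \<and> (\<forall>t\<in>J. Z t = tangent_lift (tot P) J q t)) \<and>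
     (\<forall>t\<in>J. Z t \<in> HQ P H)"

definition generator ::
  "('a, 'e::model_space) atlas \<Rightarrow> real set \<Rightarrow> (real \<Rightarrow> ('a, 'e) tb) \<Rightarrow> (real \<Rightarrow> ('a, 'e) tb) \<Rightarrow> bool" where
  "generator A J Z \<xi> \<longleftrightarrow> smooth_map model_atlas J (tangent_atlas A) \<xi> \<and> (\<forall>t\<in>J. fst (\<xi> t) = fst (Z t))"

definition variation ::
  "('a, 'e::model_space) atlas \<Rightarrow> real set \<Rightarrow> (real \<Rightarrow> ('a, 'e) tb) \<Rightarrow> real \<Rightarrow> (('a, 'e) tb, 'e \<times> 'e) tb" where
  "variation A J \<xi> t = canonical_flip A (tangent_lift (tangent_atlas A) J \<xi> t)"

definition dS ::
  "('a, 'e::model_space) atlas \<Rightarrow> real set \<Rightarrow> (('a, 'e) tb \<Rightarrow> real \<Rightarrow> real) \<Rightarrow>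
     (real \<Rightarrow> ('a, 'e) tb) \<Rightarrow> (real \<Rightarrow> ('a, 'e) tb) \<Rightarrow> real" where
  "dS A J L Z \<xi> = integral J (\<lambda>t. d_fun (tangent_atlas A) (\<lambda>z. L z t) (Z t) (snd (variation A J \<xi> t)))"

definition vanishes_at_ends :: "real \<Rightarrow> real \<Rightarrow> (real \<Rightarrow> ('a, 'e::zero) tb) \<Rightarrow> bool" where
  "vanishes_at_ends t0 t1 \<xi> \<longleftrightarrow> snd (\<xi> t0) = 0 \<and> snd (\<xi> t1) = 0"

definition vakonomic_variation ::
  "('q, 'e::model_space, 'm, 'd, 'g, 'h) bundle_data \<Rightarrow> ('q \<Rightarrow> ('q, 'e) tvec set) \<Rightarrow> real set \<Rightarrow>
     (real \<Rightarrow> ('q, 'e) tb) \<Rightarrow> (real \<Rightarrow> ('q, 'e) tb) \<Rightarrow> bool" where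
  "vakonomic_variation P H J Z \<xi> \<longleftrightarrow>
     (\<forall>t\<in>J. snd (variation (tot P) J \<xi> t) \<in> tangent_to (tangent_atlas (tot P)) (HQ P H) (Z t))"

definition unconstrained_extremal ::
  "('q, 'e::model_space, 'm, 'd, 'g, 'h) bundle_data \<Rightarrow> real \<Rightarrow> real \<Rightarrow>
     (('q, 'e) tb \<Rightarrow> real \<Rightarrow> real) \<Rightarrow> (real \<Rightarrow> ('q, 'e) tb) \<Rightarrow> bool" where
  "unconstrained_extremal P t0 t1 L Z \<longleftrightarrow>
     (\<forall>\<xi>. generator (tot P) {t0..t1} Z \<xi> \<and> vanishes_at_ends t0 t1 \<xi> \<longrightarrow> dS (tot P) {t0..t1} L Z \<xi> = 0)"

definition nonholonomic_extremal ::
  "('q, 'e::model_space, 'm, 'd, 'g, 'h) bundle_data \<Rightarrow> ('q \<Rightarrow> ('q, 'e) tvec set) \<Rightarrow> real \<Rightarrow> real \<Rightarrow>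
     (('q, 'e) tb \<Rightarrow> real \<Rightarrow> real) \<Rightarrow> (real \<Rightarrow> ('q, 'e) tb) \<Rightarrow> bool" where
  "nonholonomic_extremal P H t0 t1 L Z \<longleftrightarrow>
     (\<forall>\<xi>. generator (tot P) {t0..t1} Z \<xi> \<and> vanishes_at_ends t0 t1 \<xi> \<and> (\<forall>t\<in>{t0..t1}. \<xi> t \<in> HQ P H)
        \<longrightarrow> dS (tot P) {t0..t1} L Z \<xi> = 0)"

definition vakonomic_extremal ::
  "('q, 'e::model_space, 'm, 'd, 'g, 'h) bundle_data \<Rightarrow> ('q \<Rightarrow> ('q, 'e) tvec set) \<Rightarrow> real \<Rightarrow> real \<Rightarrow>
     (('q, 'e) tb \<Rightarrow> real \<Rightarrow> real) \<Rightarrow> (real \<Rightarrow> ('q, 'e) tb) \<Rightarrow> bool" where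
  "vakonomic_extremal P H t0 t1 L Z \<longleftrightarrow>
     (\<forall>\<xi>. generator (tot P) {t0..t1} Z \<xi> \<and> vanishes_at_ends t0 t1 \<xi> \<and>
          vakonomic_variation P H {t0..t1} Z \<xi>
        \<longrightarrow> dS (tot P) {t0..t1} L Z \<xi> = 0)"

definition smooth_multiplier ::
  "('q, 'e, 'm, 'd, 'g, 'h::model_space) bundle_data \<Rightarrow> real set \<Rightarrow> (real \<Rightarrow> ('g, 'h) tvec \<Rightarrow> real) \<Rightarrow> bool" where
  "smooth_multiplier P J \<Lambda> \<longleftrightarrow> (\<forall>t\<in>J. \<Lambda> t \<in> lie_dual (grp P) (grp_atlas P)) \<and>
     (\<forall>a\<in>liealg P. smooth_on J (\<lambda>t. \<Lambda> t a))"

definition multiplier_extremal ::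
  "('q, 'e::model_space, 'm, 'd, 'g, 'h::model_space) bundle_data \<Rightarrow> ('q \<Rightarrow> ('q, 'e) tvec set) \<Rightarrow>
     real \<Rightarrow> real \<Rightarrow> (('q, 'e) tb \<Rightarrow> real) \<Rightarrow> (real \<Rightarrow> ('g, 'h) tvec \<Rightarrow> real) \<Rightarrow>
     (real \<Rightarrow> ('q, 'e) tb) \<Rightarrow> bool" where
  "multiplier_extremal P H t0 t1 L \<Lambda> Z \<longleftrightarrow> smooth_multiplier P {t0..t1} \<Lambda> \<and>
     unconstrained_extremal P t0 t1 (\<lambda>z t. L z - \<Lambda> t (omega P H z)) Z"

section \<open>Curves in the Lie algebra\<close>

definition smooth_lie_curve ::
  "('q, 'e, 'm, 'd, 'g, 'h::model_space) bundle_data \<Rightarrow> real set \<Rightarrow> (real \<Rightarrow> ('g, 'h) tvec) \<Rightarrow> bool" where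
  "smooth_lie_curve P J b \<longleftrightarrow> (\<forall>t\<in>J. b t \<in> liealg P) \<and> (\<forall>c. smooth_on J (\<lambda>t. b t c))"

definition lie_curve_deriv ::
  "real set \<Rightarrow> (real \<Rightarrow> ('g, 'h::model_space) tvec) \<Rightarrow> real \<Rightarrow> ('g, 'h) tvec" where
  "lie_curve_deriv J b t = (\<lambda>c. vector_derivative (\<lambda>s. b s c) (at t within J))"

text \<open>The generator \<open>Y + b\<close> obtained from a horizontal generator \<open>Y\<close> and the fundamental
  vectors of \<open>b\<close>.\<close>

definition add_fundamental ::
  "('q, 'e::model_space, 'm, 'd, 'g, 'h::model_space) bundle_data \<Rightarrow> (real \<Rightarrow> ('q, 'e) tb) \<Rightarrow>
     (real \<Rightarrow> ('g, 'h) tvec) \<Rightarrow> real \<Rightarrow> ('q, 'e) tb" where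
  "add_fundamental P Y b t = (fst (Y t), snd (Y t) + fundamental P (b t) (fst (Y t)))"

text \<open>\<open>\<R>(q(t))(X(t), Y(t))\<close>, where \<open>X(t)\<close> and \<open>Y(t)\<close> are the projections of the given curves.\<close>

definition curvature_along ::
  "('q, 'e::model_space, 'm, 'd::model_space, 'g, 'h::model_space) bundle_data \<Rightarrow>
     ('q \<Rightarrow> ('q, 'e) tvec set) \<Rightarrow> (real \<Rightarrow> ('q, 'e) tb) \<Rightarrow> (real \<Rightarrow> ('q, 'e) tb) \<Rightarrow> real \<Rightarrow> ('g, 'h) tvec" where
  "curvature_along P H Z Y t = curvature P H (fst (Z t))
     (snd (tangent_map (tot P) (base P) (proj P) (Z t)))
     (snd (tangent_map (tot P) (base P) (proj P) (Y t)))"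

end

theory Submission
  imports Defs
begin

text \<open>
  In coordinates \<open>\<omega>\<close> is a smooth family of linear maps \<open>Om x\<close> and the fundamental fields form a smooth
  family \<open>Fu x\<close> with \<open>Om x (Fu x w) = w\<close>. Invariance means that horizontal lifts and \<open>L\<close> are preserved
  by the flows of the fundamental fields; differentiating this gives \<open>\<B> = 0\<close>, \<open>HL = 0\<close>, and the vanishing of
  \<open>dL\<close> on the variation by a fundamental field of a constant Lie algebra element. Hence only \<open>b'\<close> enters:
  a variation generated by \<open>Y + b\<close> is tangent to the horizontal distribution iff \<open>b' + \<R>(X, Y) = 0\<close>, and
  \<open>dL\<close> changes by \<open>\<langle>FL, b'\<rangle>\<close> when \<open>b\<close> is added to a generator \<open>Y\<close>. Then (iii)
  is immediate, and (ii) and (iv) follow from the lemma of du Bois-Reymond for \<open>b = \<beta> a\<close> with \<open>a\<close> fixed.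
\<close>

section \<open>Calculus on model spaces\<close>

text \<open>Tangency of a variation to the horizontal distribution involves the derivative of
  \<open>Om\<close> in the direction of the generator, whereas differentiating
  \<open>Om (q t) (\<xi> t) = b t\<close> along the path produces its derivative in the direction of
  the velocity. Each depends on the chart; their difference is, up to sign, the exterior derivative
  of the connection form. On two horizontal vectors it is the curvature, on a horizontal and a
  fundamental vector it is \<B> and hence 0; this is why \<open>b\<close> itself drops out of (i)
  and only its derivative survives. Two existence questions stand before this computation.
  \<open>fundamental\<close> is defined through the exponential map, so one-parameter subgroups have
  to be constructed for all times, from a local flow line and the group law; then fundamental
  vectors become differentials of orbit maps. \<open>omega\<close> and \<open>hlift\<close> are
  defined pointwise by description, and their smoothness is obtained by inverting smooth families of
  linear maps between fixed model spaces.\<close>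

abbreviation fderiv :: "('a::real_normed_vector \<Rightarrow> 'b::real_normed_vector) \<Rightarrow> 'a \<Rightarrow> 'a \<Rightarrow> 'b"
  where "fderiv f x \<equiv> frechet_derivative f (at x)"

section \<open>Orthonormal bases and linear maps on model spaces\<close>

lemma orthonormal_spanning_set:
  fixes B :: "'a::real_inner set"
  assumes "finite B"
  shows "\<exists>C. finite C \<and> B \<subseteq> span C \<and> (\<forall>x\<in>C. \<forall>y\<in>C. x \<bullet> y = (if x = y then 1 else 0))"
  using assms
proof (induction B rule: finite_induct)
  case empty
  show ?case by (rule exI[of _ "{}"]) auto
next
  case (insert b B)
  then obtain C where C: "finite C" "B \<subseteq> span C"
    "\<And>x y. x \<in> C \<Longrightarrow> y \<in> C \<Longrightarrow> x \<bullet> y = (if x = y then 1 else 0)" by blast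
  \<comment> \<open>Gram-Schmidt: \<open>s\<close> is the orthogonal projection of \<open>b\<close>
    to \<open>span C\<close>. If the remainder \<open>u\<close> vanishes, \<open>C\<close> already
    spans; otherwise \<open>u\<close> is normalised and adjoined.\<close>
  define s where "s = (\<Sum>c\<in>C. (b \<bullet> c) *\<^sub>R c)"
  define u where "u = b - s"
  have s: "s \<in> span C" unfolding s_def by (intro span_sum span_scale span_base)
  have orth: "u \<bullet> c = 0" if "c \<in> C" for c
  proof -
    have "s \<bullet> c = (\<Sum>d\<in>C. (b \<bullet> d) * (if d = c then 1 else 0))"
      unfolding s_def inner_sum_left by (intro sum.cong refl) (simp add: C(3) that)
    also have "\<dots> = (\<Sum>d\<in>C. if d = c then b \<bullet> d else 0)" by (intro sum.cong) auto
    also have "\<dots> = b \<bullet> c" using that C(1) by (simp add: sum.delta)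
    finally show ?thesis by (simp add: u_def inner_diff_left)
  qed
  show ?case
  proof (cases "u = 0")
    case True
    then have "b \<in> span C" using s by (simp add: u_def)
    then show ?thesis using C by (intro exI[of _ C]) auto
  next
    case False
    define e where "e = (1 / norm u) *\<^sub>R u"
    have e1: "e \<bullet> e = 1" using False by (simp add: e_def dot_square_norm power2_eq_square)
    have e2: "e \<bullet> c = 0" "c \<bullet> e = 0" if "c \<in> C" for c
      using orth[OF that] by (simp_all add: e_def inner_commute)
    have "b = norm u *\<^sub>R e + s" using False by (simp add: e_def u_def)
    moreover have "norm u *\<^sub>R e + s \<in> span (insert e C)"
    proof (intro span_add)
      show "norm u *\<^sub>R e \<in> span (insert e C)" by (intro span_scale span_base) simp
      show "s \<in> span (insert e C)" using s span_mono[of C "insert e C"] by blast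
    qed
    ultimately have "insert b B \<subseteq> span (insert e C)"
      using C(2) span_mono[of C "insert e C"] by auto
    moreover have "e \<notin> C" using e1 e2[of e] by auto
    ultimately show ?thesis using C(1,3) e1 e2 by (intro exI[of _ "insert e C"]) auto
  qed
qed

text \<open>The class of \<open>Basis\<close> excludes dimension 0; in that dimension
  \<open>mbasis\<close> is empty. Any orthonormal choice serves, since only the expansion of vectors
  in it matters.\<close>

definition mbasis :: "'a::model_space set" where
  "mbasis = (SOME C. finite C \<and> span C = UNIV \<and> (\<forall>x\<in>C. \<forall>y\<in>C. x \<bullet> y = (if x = y then 1 else 0)))"

lemma mbasis: "finite (mbasis :: 'a::model_space set)" "span (mbasis :: 'a set) = UNIV"
    "\<lbrakk>b \<in> mbasis; c \<in> mbasis\<rbrakk> \<Longrightarrow> b \<bullet> c = (if b = (c::'a) then 1 else 0)"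
proof -
  obtain B :: "'a set" where B: "finite B" "span B = UNIV" using finite_span by blast
  obtain C where C: "finite C" "B \<subseteq> span C" "\<forall>x\<in>C. \<forall>y\<in>C. x \<bullet> y = (if x = y then 1 else 0)"
    using orthonormal_spanning_set[OF B(1)] by blast
  have "span C = UNIV" using B(2) C(2) by (metis span_mono span_span top.extremum_uniqueI)
  then have "\<exists>C::'a set. finite C \<and> span C = UNIV \<and> (\<forall>x\<in>C. \<forall>y\<in>C. x \<bullet> y = (if x = y then 1 else 0))"
    using C by blast
  from someI_ex[OF this]
  show "finite (mbasis :: 'a set)" "span (mbasis :: 'a set) = UNIV"
    "\<lbrakk>b \<in> mbasis; c \<in> mbasis\<rbrakk> \<Longrightarrow> b \<bullet> c = (if b = (c::'a) then 1 else 0)"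
    unfolding mbasis_def by blast+
qed

lemma mbasis_representation: "(x::'a::model_space) = (\<Sum>b\<in>mbasis. (x \<bullet> b) *\<^sub>R b)"
proof -
  have "x \<in> span mbasis" by (simp add: mbasis)
  then obtain r where r: "x = (\<Sum>b\<in>mbasis. r b *\<^sub>R b)"
    unfolding span_finite[OF mbasis(1)] by auto
  have "x \<bullet> c = r c" if "c \<in> mbasis" for c
  proof -
    have "x \<bullet> c = (\<Sum>b\<in>mbasis. r b * (if b = c then 1 else 0))"
      unfolding r inner_sum_left by (intro sum.cong refl) (simp add: mbasis(3) that)
    also have "\<dots> = (\<Sum>b\<in>mbasis. if b = c then r b else 0)" by (intro sum.cong) auto
    also have "\<dots> = r c" using that by (simp add: mbasis(1))
    finally show ?thesis .
  qed
  then have "(\<Sum>b\<in>mbasis. (x \<bullet> b) *\<^sub>R b) = (\<Sum>b\<in>mbasis. r b *\<^sub>R b)" by (intro sum.cong) auto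
  then show ?thesis using r by simp
qed

text \<open>Reduces a linear map to its finitely many values on the basis. Boundedness, smooth
  dependence on parameters and the chain rule for higher derivatives all rest on this
  expansion.\<close>

lemma linear_expand:
  fixes f :: "'a::model_space \<Rightarrow> 'b::real_vector"
  assumes "linear f" shows "f x = (\<Sum>b\<in>mbasis. (x \<bullet> b) *\<^sub>R f b)"
proof -
  have "f x = f (\<Sum>b\<in>mbasis. (x \<bullet> b) *\<^sub>R b)" using mbasis_representation[of x] by simp
  also have "\<dots> = (\<Sum>b\<in>mbasis. (x \<bullet> b) *\<^sub>R f b)"
    by (simp add: linear_sum[OF assms] linear_scale[OF assms])
  finally show ?thesis .
qed

lemma norm_mbasis: "b \<in> mbasis \<Longrightarrow> norm b = 1"
  using mbasis(3)[of b b] by (simp add: norm_eq_1)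

lemma linear_norm_le:
  fixes f :: "'a::model_space \<Rightarrow> 'b::real_normed_vector"
  assumes "linear f" shows "norm (f x) \<le> norm x * (\<Sum>b\<in>mbasis. norm (f b))"
proof -
  have "norm (f x) \<le> (\<Sum>b\<in>mbasis. norm ((x \<bullet> b) *\<^sub>R f b))"
    by (subst linear_expand[OF assms]) (rule norm_sum)
  also have "\<dots> \<le> (\<Sum>b\<in>mbasis. norm x * norm (f b))"
  proof (rule sum_mono)
    fix b :: 'a assume "b \<in> mbasis"
    then have "\<bar>x \<bullet> b\<bar> \<le> norm x" using Cauchy_Schwarz_ineq2[of x b] by (simp add: norm_mbasis)
    then show "norm ((x \<bullet> b) *\<^sub>R f b) \<le> norm x * norm (f b)" by (simp add: mult_right_mono)
  qed
  finally show ?thesis by (simp add: sum_distrib_left)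
qed

lemma linear_imp_bounded_linear:
  fixes f :: "'a::model_space \<Rightarrow> 'b::real_normed_vector"
  assumes "linear f" shows "bounded_linear f"
  using linear_norm_le[OF assms] assms
  by (auto simp: bounded_linear_def bounded_linear_axioms_def linear_def)

section \<open>Functions of class C^k on open sets\<close>

lemma Ck_on_cong:
  assumes "open U" "\<And>x. x \<in> U \<Longrightarrow> f x = g x"
  shows "Ck_on k U f \<longleftrightarrow> Ck_on k U g"
proof -
  have "Ck_on k U g" if "Ck_on k U f" "\<And>x. x \<in> U \<Longrightarrow> f x = g x" for f g :: "'a \<Rightarrow> 'b"
    using that
  proof (induction k arbitrary: f g)
    case 0
    then show ?case using continuous_on_cong by auto
  next
    case (Suc k)
    have D: "(g has_derivative fderiv f x) (at x)" if "x \<in> U" for x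
    proof -
      have "(f has_derivative fderiv f x) (at x)"
        using Suc.prems(1) that frechet_derivative_works by auto
      then show ?thesis by (rule has_derivative_transform_within_open[OF _ assms(1) that Suc.prems(2)])
    qed
    then have E: "fderiv g x = fderiv f x" if "x \<in> U" for x
      using frechet_derivative_at[OF D[OF that]] by simp
    have "Ck_on k U (\<lambda>x. fderiv g x v)" for v
      using Suc.prems(1) Suc.IH[of "\<lambda>x. fderiv f x v" "\<lambda>x. fderiv g x v"] E by simp
    then show ?case using D by (auto simp: differentiable_def)
  qed
  then show ?thesis using assms(2) by metis
qed

lemma Ck_on_transform:
  "\<lbrakk>open U; Ck_on k U f; \<And>x. x \<in> U \<Longrightarrow> f x = g x\<rbrakk> \<Longrightarrow> Ck_on k U g"
  using Ck_on_cong[of U f g k] by simp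

lemma Ck_on_subset: "Ck_on k U f \<Longrightarrow> V \<subseteq> U \<Longrightarrow> Ck_on k V f"
  by (induction k arbitrary: f) (auto intro: continuous_on_subset)

text \<open>The recursion for \<open>Ck_on\<close> does not mention lower orders. At order 0
  differentiability gives continuity; above that the descent is inherited from the directional
  derivatives.\<close>

lemma Ck_on_SucD: "Ck_on (Suc k) U f \<Longrightarrow> Ck_on k U f"
proof (induction k arbitrary: f)
  case 0
  then show ?case by (auto intro!: continuous_at_imp_continuous_on differentiable_imp_continuous_within)
next
  case (Suc k)
  then show ?case using Ck_on.simps(2) by blast
qed

lemma Ck_on_local:
  assumes "\<And>x. x \<in> U \<Longrightarrow> \<exists>V. open V \<and> x \<in> V \<and> Ck_on k V f"
  shows "Ck_on k U f"
  using assms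
proof (induction k arbitrary: f)
  case 0
  have "isCont f x" if "x \<in> U" for x
    using 0[OF that] by (auto simp: continuous_on_eq_continuous_at)
  then show ?case by (simp add: continuous_at_imp_continuous_on)
next
  case (Suc k)
  have "f differentiable (at x)" if "x \<in> U" for x using Suc.prems[OF that] by auto
  moreover have "Ck_on k U (\<lambda>x. fderiv f x v)" for v
  proof (rule Suc.IH)
    fix x assume "x \<in> U"
    then show "\<exists>V. open V \<and> x \<in> V \<and> Ck_on k V (\<lambda>x. fderiv f x v)" using Suc.prems[of x] by auto
  qed
  ultimately show ?case by simp
qed

lemma Ck_on_const: "Ck_on k U (\<lambda>x. c)"
proof (induction k arbitrary: c)
  case (Suc k)
  then show ?case by simp
qed simp

lemma Ck_on_add:
  assumes "open U" "Ck_on k U f" "Ck_on k U g"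
  shows "Ck_on k U (\<lambda>x. f x + g x)"
  using assms(2,3)
proof (induction k arbitrary: f g)
  case 0 then show ?case by (auto intro: continuous_on_add)
next
  case (Suc k)
  have "Ck_on k U (\<lambda>x. fderiv (\<lambda>x. f x + g x) x v)" for v
  proof -
    have "Ck_on k U (\<lambda>x. fderiv f x v + fderiv g x v)" using Suc by auto
    moreover have "fderiv f x v + fderiv g x v = fderiv (\<lambda>x. f x + g x) x v" if "x \<in> U" for x
    proof -
      have "((\<lambda>x. f x + g x) has_derivative (\<lambda>v. fderiv f x v + fderiv g x v)) (at x)"
        using Suc.prems that by (intro has_derivative_add) (auto simp: frechet_derivative_works[symmetric])
      from frechet_derivative_at[OF this] show ?thesis by metis
    qed
    ultimately show ?thesis by (rule Ck_on_transform[OF assms(1)])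
  qed
  then show ?case using Suc.prems by auto
qed

lemma Ck_on_sum:
  assumes "open U" "\<And>i. i \<in> I \<Longrightarrow> Ck_on k U (f i)"
  shows "Ck_on k U (\<lambda>x. \<Sum>i\<in>I. f i x)"
  using assms(2)
proof (induction I rule: infinite_finite_induct)
  case (insert i I)
  then show ?case using Ck_on_add[OF assms(1), of k "f i" "\<lambda>x. sum (\<lambda>i. f i x) I"] by simp
qed (simp_all add: Ck_on_const)

lemma Ck_on_bounded_linear:
  assumes "open U" "bounded_linear L" "Ck_on k U f"
  shows "Ck_on k U (\<lambda>x. L (f x))"
  using assms(3)
proof (induction k arbitrary: f)
  case 0 then show ?case using assms(2) by (auto intro: bounded_linear.continuous_on)
next
  case (Suc k)
  have D: "((\<lambda>x. L (f x)) has_derivative (\<lambda>v. L (fderiv f x v))) (at x)" if "x \<in> U" for x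
    using Suc.prems that
    by (intro bounded_linear.has_derivative[OF assms(2)]) (auto simp: frechet_derivative_works[symmetric])
  have "Ck_on k U (\<lambda>x. fderiv (\<lambda>x. L (f x)) x v)" for v
  proof -
    have "Ck_on k U (\<lambda>x. L (fderiv f x v))" using Suc by auto
    moreover have "L (fderiv f x v) = fderiv (\<lambda>x. L (f x)) x v" if "x \<in> U" for x
      using frechet_derivative_at[OF D[OF that]] by metis
    ultimately show ?thesis by (rule Ck_on_transform[OF assms(1)])
  qed
  then show ?case using D by (auto simp: differentiable_def)
qed

lemma Ck_on_bilinear:
  assumes "open U" "bounded_bilinear h" "Ck_on k U f" "Ck_on k U g"
  shows "Ck_on k U (\<lambda>x. h (f x) (g x))"
  using assms(3,4)
proof (induction k arbitrary: f g)
  case 0 then show ?case using assms(2) by (auto intro: bounded_bilinear.continuous_on)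
next
  case (Suc k)
  have D: "((\<lambda>x. h (f x) (g x)) has_derivative (\<lambda>v. h (f x) (fderiv g x v) + h (fderiv f x v) (g x))) (at x)"
    if "x \<in> U" for x
    using Suc.prems that
    by (intro bounded_bilinear.FDERIV[OF assms(2)]) (auto simp: frechet_derivative_works[symmetric])
  have "Ck_on k U (\<lambda>x. fderiv (\<lambda>x. h (f x) (g x)) x v)" for v
  proof -
    \<comment> \<open>Each product keeps one undifferentiated factor of class \<open>Suc k\<close>,
      which is lowered to \<open>k\<close> before the induction hypothesis applies.\<close>
    have "Ck_on k U (\<lambda>x. h (f x) (fderiv g x v) + h (fderiv f x v) (g x))"
      using Suc.prems Ck_on_SucD[OF Suc.prems(1)] Ck_on_SucD[OF Suc.prems(2)]
      by (intro Ck_on_add assms(1) Suc.IH) auto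
    moreover have "h (f x) (fderiv g x v) + h (fderiv f x v) (g x) = fderiv (\<lambda>x. h (f x) (g x)) x v"
      if "x \<in> U" for x
      using frechet_derivative_at[OF D[OF that]] by metis
    ultimately show ?thesis by (rule Ck_on_transform[OF assms(1)])
  qed
  then show ?case using D by (auto simp: differentiable_def)
qed

lemma Ck_on_Pair:
  assumes "open U" "Ck_on k U f" "Ck_on k U g"
  shows "Ck_on k U (\<lambda>x. (f x, g x))"
proof -
  have "Ck_on k U (\<lambda>x. (f x, 0) + (0, g x))"
    by (rule Ck_on_add[OF assms(1) Ck_on_bounded_linear[OF assms(1) _ assms(2)]
          Ck_on_bounded_linear[OF assms(1) _ assms(3)]])
      (intro bounded_linear_Pair bounded_linear_ident bounded_linear_zero)+
  then show ?thesis by simp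
qed

lemma linear_fderiv: "f differentiable (at x) \<Longrightarrow> linear (fderiv f x)"
  by (rule linear_frechet_derivative)

lemma Ck_on_compose:
  assumes "open U" "open V" "Ck_on k V g" "Ck_on k U f" "\<And>x. x \<in> U \<Longrightarrow> f x \<in> V"
  shows "Ck_on k U (\<lambda>x. g (f x))"
  using assms(3,4)
proof (induction k arbitrary: g)
  case 0 then show ?case using assms(5) by (auto intro: continuous_on_compose2)
next
  case (Suc k)
  have D: "((\<lambda>x. g (f x)) has_derivative (\<lambda>v. fderiv g (f x) (fderiv f x v))) (at x)" if "x \<in> U" for x
  proof -
    have "(f has_derivative fderiv f x) (at x)" "(g has_derivative fderiv g (f x)) (at (f x))"
      using Suc.prems assms(5) that by (auto simp: frechet_derivative_works[symmetric])
    from has_derivative_compose[OF this] show ?thesis .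
  qed
  have "Ck_on k U (\<lambda>x. fderiv (\<lambda>x. g (f x)) x v)" for v
  proof -
    \<comment> \<open>\<open>Ck_on\<close> controls derivatives in fixed directions only, while in
      the chain rule the direction \<open>fderiv f x v\<close> moves with \<open>x\<close>; the
      basis expansion leaves only the fixed directions \<open>b\<close>.\<close>
    have "Ck_on k U (\<lambda>x. \<Sum>b\<in>mbasis. (fderiv f x v \<bullet> b) *\<^sub>R fderiv g (f x) b)"
    proof (intro Ck_on_sum Ck_on_bilinear[OF assms(1) bounded_bilinear_scaleR] assms(1))
      fix b :: 'b assume "b \<in> mbasis"
      show "Ck_on k U (\<lambda>x. fderiv f x v \<bullet> b)"
        using Suc.prems Ck_on_bounded_linear[OF assms(1) bounded_linear_inner_left[of b], of k "\<lambda>x. fderiv f x v"] by auto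
      have "Ck_on k V (\<lambda>y. fderiv g y b)" using Suc.prems by auto
      then show "Ck_on k U (\<lambda>x. fderiv g (f x) b)" using Ck_on_SucD[OF Suc.prems(2)] by (intro Suc.IH) auto
    qed
    moreover have "(\<Sum>b\<in>mbasis. (fderiv f x v \<bullet> b) *\<^sub>R fderiv g (f x) b) = fderiv (\<lambda>x. g (f x)) x v"
      if "x \<in> U" for x
    proof -
      have "linear (fderiv g (f x))" using Suc.prems assms(5) that by (auto intro: linear_fderiv)
      then have "(\<Sum>b\<in>mbasis. (fderiv f x v \<bullet> b) *\<^sub>R fderiv g (f x) b) = fderiv g (f x) (fderiv f x v)"
        using linear_expand by metis
      also have "\<dots> = fderiv (\<lambda>x. g (f x)) x v" using frechet_derivative_at[OF D[OF that]] by metis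
      finally show ?thesis .
    qed
    ultimately show ?thesis by (rule Ck_on_transform[OF assms(1)])
  qed
  then show ?case using D by (auto simp: differentiable_def)
qed

subsection \<open>Smoothness on subsets\<close>

lemma smooth_on_openI: "\<lbrakk>open S; \<And>k. Ck_on k S f\<rbrakk> \<Longrightarrow> smooth_on S f"
  unfolding smooth_on_def by (intro ballI exI[of _ S] exI[of _ f]) simp

lemma smooth_onE:
  assumes "smooth_on S f" "x \<in> S"
  obtains U g where "open U" "x \<in> U" "\<forall>k. Ck_on k U g" "\<forall>y\<in>U \<inter> S. g y = f y"
proof -
  have "\<exists>U g. open U \<and> x \<in> U \<and> (\<forall>k. Ck_on k U g) \<and> (\<forall>y\<in>U \<inter> S. g y = f y)"
    using assms unfolding smooth_on_def by simp
  then obtain U g where "open U \<and> x \<in> U \<and> (\<forall>k. Ck_on k U g) \<and> (\<forall>y\<in>U \<inter> S. g y = f y)" by (elim exE)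
  then show thesis by (intro that[of U g]) auto
qed

lemma smooth_onI:
  assumes "\<And>x. x \<in> S \<Longrightarrow> \<exists>U g. open U \<and> x \<in> U \<and> (\<forall>k. Ck_on k U g) \<and> (\<forall>y\<in>U \<inter> S. g y = f y)"
  shows "smooth_on S f"
  unfolding smooth_on_def using assms by simp

text \<open>On an open set the local extensions agree with \<open>f\<close> itself near each point,
  so smoothness in the extension sense is the usual one.\<close>

lemma smooth_on_Ck:
  assumes "open S" "smooth_on S f" shows "Ck_on k S f"
proof (rule Ck_on_local)
  fix x assume x: "x \<in> S"
  obtain U g where "open U" "x \<in> U" "\<forall>k. Ck_on k U g" "\<forall>y\<in>U \<inter> S. g y = f y"
    by (rule smooth_onE[OF assms(2) x], rule that)
  then show "\<exists>V. open V \<and> x \<in> V \<and> Ck_on k V f"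
    using assms(1) \<open>x \<in> S\<close> Ck_on_cong[of "U \<inter> S" g f k] Ck_on_subset[of k U g "U \<inter> S"]
    by (intro exI[of _ "U \<inter> S"]) auto
qed

lemma smooth_on_cong: "\<lbrakk>\<And>x. x \<in> S \<Longrightarrow> f x = g x\<rbrakk> \<Longrightarrow> smooth_on S f \<longleftrightarrow> smooth_on S g"
  unfolding smooth_on_def by (intro ball_cong refl arg_cong[where f = Ex] ext conj_cong) auto

lemma smooth_on_subset:
  assumes "smooth_on S f" "T \<subseteq> S" shows "smooth_on T f"
proof (rule smooth_onI)
  fix x assume x': "x \<in> T"
  then have x: "x \<in> S" using assms(2) by auto
  obtain U g where "open U" "x \<in> U" "\<forall>k. Ck_on k U g" "\<forall>y\<in>U \<inter> S. g y = f y"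
    by (rule smooth_onE[OF assms(1) x], rule that)
  then show "\<exists>U g. open U \<and> x \<in> U \<and> (\<forall>k. Ck_on k U g) \<and> (\<forall>y\<in>U \<inter> T. g y = f y)"
    using assms(2) by (intro exI[of _ U] exI[of _ g]) auto
qed

lemma smooth_on_local:
  assumes "\<And>x. x \<in> S \<Longrightarrow> \<exists>W. open W \<and> x \<in> W \<and> smooth_on (S \<inter> W) f"
  shows "smooth_on S f"
proof (rule smooth_onI)
  fix x assume x: "x \<in> S"
  obtain W where W: "open W" "x \<in> W" "smooth_on (S \<inter> W) f" using assms[OF x] by blast
  obtain U g where U: "open U" "x \<in> U" "\<forall>k. Ck_on k U g" "\<forall>y\<in>U \<inter> (S \<inter> W). g y = f y"
    by (rule smooth_onE[OF W(3) IntI[OF x W(2)]], rule that)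
  show "\<exists>U g. open U \<and> x \<in> U \<and> (\<forall>k. Ck_on k U g) \<and> (\<forall>y\<in>U \<inter> S. g y = f y)"
  proof (intro exI conjI)
    show "\<forall>k. Ck_on k (U \<inter> W) g" by (intro allI Ck_on_subset[OF U(3)[rule_format]]) auto
  qed (use U W in auto)
qed

lemma smooth_on_continuous_on:
  assumes "smooth_on S f" shows "continuous_on S f"
  unfolding continuous_on_eq_continuous_within
proof
  fix x assume x: "x \<in> S"
  obtain U g where U: "open U" "x \<in> U" "\<forall>k. Ck_on k U g" "\<forall>y\<in>U \<inter> S. g y = f y"
    by (rule smooth_onE[OF assms x], rule that)
  have "isCont g x" using U(1,2) U(3)[rule_format, of 0] by (simp add: continuous_on_eq_continuous_at)
  then have "continuous (at x within S) g" by (rule continuous_at_imp_continuous_at_within)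
  moreover have "\<forall>\<^sub>F y in at x within S. g y = f y"
    using U unfolding eventually_at_topological by (intro exI[of _ U]) auto
  moreover have "g x = f x" using U x by auto
  ultimately show "continuous (at x within S) f"
    unfolding continuous_within using tendsto_cong by force
qed

lemma smooth_on_const [simp, intro]: "smooth_on S (\<lambda>x. c)"
  by (rule smooth_on_subset[OF smooth_on_openI[of UNIV]]) (auto simp: Ck_on_const)

lemma Ck_on_ident: "Ck_on k U (\<lambda>x. x)"
  by (cases k) (auto simp: Ck_on_const)

lemma smooth_on_linear: "linear f \<Longrightarrow> smooth_on S f"
  by (rule smooth_on_subset[OF smooth_on_openI[of UNIV]])
    (auto intro: Ck_on_bounded_linear[OF _ linear_imp_bounded_linear, OF _ _ Ck_on_ident])

lemma smooth_on_ident [simp, intro]: "smooth_on S (\<lambda>x. x)"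
  by (rule smooth_on_linear) (rule linear_id[unfolded id_def])

lemma smooth_on_compose:
  assumes "smooth_on T g" "smooth_on S f" "\<And>x. x \<in> S \<Longrightarrow> f x \<in> T"
  shows "smooth_on S (\<lambda>x. g (f x))"
proof (rule smooth_onI)
  fix x assume x: "x \<in> S"
  obtain U f' where U: "open U" "x \<in> U" "\<forall>k. Ck_on k U f'" "\<forall>y\<in>U \<inter> S. f' y = f y"
    by (rule smooth_onE[OF assms(2) x], rule that)
  obtain V g' where V: "open V" "f x \<in> V" "\<forall>k. Ck_on k V g'" "\<forall>y\<in>V \<inter> T. g' y = g y"
    by (rule smooth_onE[OF assms(1) assms(3)[OF x]], rule that)
  have "continuous_on U f'" using U(3)[rule_format, of 0] by simp
  then have o: "open (U \<inter> f' -` V)" using U(1) V(1) by (simp add: continuous_on_open_vimage Int_commute)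
  have "Ck_on k (U \<inter> f' -` V) (\<lambda>x. g' (f' x))" for k
    by (rule Ck_on_compose[OF o V(1) V(3)[rule_format] Ck_on_subset[OF U(3)[rule_format]]]) auto
  then show "\<exists>U h. open U \<and> x \<in> U \<and> (\<forall>k. Ck_on k U h) \<and> (\<forall>y\<in>U \<inter> S. h y = g (f y))"
    using o U V assms(3) x by (intro exI[of _ "U \<inter> f' -` V"] exI[of _ "\<lambda>x. g' (f' x)"]) auto
qed

lemma smooth_on_Pair:
  assumes "smooth_on S f" "smooth_on S g"
  shows "smooth_on S (\<lambda>x. (f x, g x))"
proof (rule smooth_onI)
  fix x assume x: "x \<in> S"
  obtain U f' where U: "open U" "x \<in> U" "\<forall>k. Ck_on k U f'" "\<forall>y\<in>U \<inter> S. f' y = f y"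
    by (rule smooth_onE[OF assms(1) x], rule that)
  obtain V g' where V: "open V" "x \<in> V" "\<forall>k. Ck_on k V g'" "\<forall>y\<in>V \<inter> S. g' y = g y"
    by (rule smooth_onE[OF assms(2) x], rule that)
  show "\<exists>U h. open U \<and> x \<in> U \<and> (\<forall>k. Ck_on k U h) \<and> (\<forall>y\<in>U \<inter> S. h y = (f y, g y))"
  proof (intro exI conjI)
    show "\<forall>k. Ck_on k (U \<inter> V) (\<lambda>x. (f' x, g' x))"
      by (intro allI Ck_on_Pair open_Int U(1) V(1) Ck_on_subset[OF U(3)[rule_format]]
          Ck_on_subset[OF V(3)[rule_format]]) auto
  qed (use U V in auto)
qed

lemma smooth_on_linear_compose: "linear L \<Longrightarrow> smooth_on S f \<Longrightarrow> smooth_on S (\<lambda>x. L (f x))"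
  using smooth_on_compose[OF smooth_on_linear[of L UNIV]] by auto

lemma smooth_on_fst: "smooth_on S f \<Longrightarrow> smooth_on S (\<lambda>x. fst (f x))"
  by (rule smooth_on_linear_compose[of fst]) (auto intro: linearI)

lemma smooth_on_snd: "smooth_on S f \<Longrightarrow> smooth_on S (\<lambda>x. snd (f x))"
  by (rule smooth_on_linear_compose[of snd]) (auto intro: linearI)

lemma smooth_on_bilinear:
  assumes "bounded_bilinear h" "smooth_on S f" "smooth_on S g"
  shows "smooth_on S (\<lambda>x. h (f x) (g x))"
proof -
  have "Ck_on k UNIV (\<lambda>z. h (fst z) (snd z))" for k
    by (rule Ck_on_bilinear[OF _ assms(1)])
      (auto intro: Ck_on_bounded_linear[OF _ _ Ck_on_ident] bounded_linear_fst bounded_linear_snd)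
  then have "smooth_on UNIV (\<lambda>z. h (fst z) (snd z))" by (auto intro: smooth_on_openI)
  from smooth_on_compose[OF this smooth_on_Pair[OF assms(2,3)]] show ?thesis by simp
qed

lemma smooth_on_scaleR:
  "smooth_on S f \<Longrightarrow> smooth_on S g \<Longrightarrow> smooth_on S (\<lambda>x. f x *\<^sub>R g x)"
  by (rule smooth_on_bilinear[OF bounded_bilinear_scaleR])

lemma smooth_on_add:
  "smooth_on S f \<Longrightarrow> smooth_on S g \<Longrightarrow> smooth_on S (\<lambda>x. f x + g x)"
  using smooth_on_linear_compose[of "\<lambda>z. fst z + snd z" S "\<lambda>x. (f x, g x)"] smooth_on_Pair[of S f g]
  by (simp add: linear_iff algebra_simps)

lemma smooth_on_diff:
  "smooth_on S f \<Longrightarrow> smooth_on S g \<Longrightarrow> smooth_on S (\<lambda>x. f x - g x)"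
  using smooth_on_linear_compose[of "\<lambda>z. fst z - snd z" S "\<lambda>x. (f x, g x)"] smooth_on_Pair[of S f g]
  by (simp add: linear_iff algebra_simps)

lemma smooth_on_sum:
  "(\<And>i. i \<in> I \<Longrightarrow> smooth_on S (f i)) \<Longrightarrow> smooth_on S (\<lambda>x. \<Sum>i\<in>I. f i x)"
proof (induction I rule: infinite_finite_induct)
  case (insert i I)
  then show ?case using smooth_on_add[of S "f i" "\<lambda>x. sum (\<lambda>i. f i x) I"] by simp
qed simp_all

lemma smooth_on_differentiable: "\<lbrakk>open S; smooth_on S f; x \<in> S\<rbrakk> \<Longrightarrow> f differentiable (at x)"
  using smooth_on_Ck[of S f "Suc 0"] by auto

lemma smooth_on_has_derivative: "\<lbrakk>open S; smooth_on S f; x \<in> S\<rbrakk> \<Longrightarrow> (f has_derivative fderiv f x) (at x)"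
  using smooth_on_differentiable frechet_derivative_works by blast

lemma smooth_on_fderiv: "\<lbrakk>open S; smooth_on S f\<rbrakk> \<Longrightarrow> smooth_on S (\<lambda>x. fderiv f x v)"
  by (rule smooth_on_openI, assumption) (use smooth_on_Ck[of S f "Suc k" for k] in simp)

text \<open>In finite dimensions a family of operators is smooth as soon as its value at each fixed
  vector is; expanding \<open>f x\<close> in the basis separates the two dependences on
  \<open>x\<close>.\<close>

lemma smooth_on_operator:
  fixes T :: "'a::model_space \<Rightarrow> 'b::model_space \<Rightarrow> 'c::model_space"
  assumes "\<And>x. x \<in> S \<Longrightarrow> linear (T x)" "\<And>e. smooth_on S (\<lambda>x. T x e)" "smooth_on S f"
  shows "smooth_on S (\<lambda>x. T x (f x))"
proof -
  have "smooth_on S (\<lambda>x. \<Sum>b\<in>mbasis. (f x \<bullet> b) *\<^sub>R T x b)"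
    by (intro smooth_on_sum smooth_on_scaleR assms(2) smooth_on_linear_compose[of "\<lambda>y. y \<bullet> _"] assms(3))
      (auto intro!: linearI simp: inner_add_left)
  moreover have "(\<Sum>b\<in>mbasis. (f x \<bullet> b) *\<^sub>R T x b) = T x (f x)" if "x \<in> S" for x
    using linear_expand[OF assms(1)[OF that], of "f x"] by simp
  ultimately show ?thesis using smooth_on_cong[of S "\<lambda>x. \<Sum>b\<in>mbasis. (f x \<bullet> b) *\<^sub>R T x b" "\<lambda>x. T x (f x)"] by simp
qed

lemma smooth_on_fderiv_apply:
  assumes "open U" "smooth_on U f" "smooth_on S g" "smooth_on S h" "\<And>x. x \<in> S \<Longrightarrow> g x \<in> U"
  shows "smooth_on S (\<lambda>x. fderiv f (g x) (h x))"
  by (rule smooth_on_operator[where T = "\<lambda>x. fderiv f (g x)"])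
    (use assms in \<open>auto intro: linear_fderiv smooth_on_differentiable
      smooth_on_compose[OF smooth_on_fderiv[OF assms(1,2)]]\<close>)

subsection \<open>Symmetry of second derivatives\<close>

text \<open>Two applications of the mean value theorem turn the second difference along
  \<open>v\<close> and \<open>w\<close> into \<open>h * h\<close> times the mixed derivative at a
  nearby point. The second difference is symmetric in \<open>v\<close> and \<open>w\<close>, the
  mixed derivative not yet known to be.\<close>

lemma second_difference:
  fixes g :: "'a::model_space \<Rightarrow> real"
  assumes U: "open U" "smooth_on U g" "x \<in> U" and e: "e > 0"
  shows "\<exists>\<delta>>0. \<forall>h. 0 < h \<and> h < \<delta> \<longrightarrow>
    \<bar>(g (x + h *\<^sub>R v + h *\<^sub>R w) - g (x + h *\<^sub>R v) - g (x + h *\<^sub>R w) + g x)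
       - h * h * fderiv (\<lambda>y. fderiv g y v) x w\<bar> \<le> h * h * e"
proof -
  define K where "K = (\<lambda>y. fderiv (\<lambda>y. fderiv g y v) y w)"
  have sv: "smooth_on U (\<lambda>y. fderiv g y v)" using smooth_on_fderiv[OF U(1,2)] .
  have "continuous_on U K" unfolding K_def
    by (intro smooth_on_continuous_on smooth_on_fderiv U(1) sv)
  then have "isCont K x" using U by (simp add: continuous_on_eq_continuous_at)
  then obtain d1 where d1: "d1 > 0" "\<And>y. dist y x < d1 \<Longrightarrow> dist (K y) (K x) < e"
    using e unfolding continuous_at_eps_delta by blast
  obtain d2 where d2: "d2 > 0" "ball x d2 \<subseteq> U" using U open_contains_ball by blast
  define d where "d = min d1 d2"
  have d: "d > 0" "\<And>y. y \<in> ball x d \<Longrightarrow> y \<in> U \<and> \<bar>K y - K x\<bar> < e"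
    using d1 d2 by (auto simp: d_def dist_commute dist_real_def subset_eq)
  \<comment> \<open>For \<open>h < \<delta>\<close> the whole parallelogram spanned by
    \<open>h *\<^sub>R v\<close> and \<open>h *\<^sub>R w\<close> stays in the ball of radius
    \<open>d\<close>; the summand 1 keeps the denominator positive.\<close>
  define \<delta> where "\<delta> = d / (norm v + norm w + 1)"
  have pos: "norm v + norm w + 1 > 0" using norm_ge_zero[of v] norm_ge_zero[of w] by linarith
  have in_ball: "x + s *\<^sub>R v + t *\<^sub>R w \<in> ball x d" if "0 \<le> s" "s \<le> h" "0 \<le> t" "t \<le> h" "h < \<delta>" for s t h
  proof -
    have "norm (s *\<^sub>R v + t *\<^sub>R w) \<le> s * norm v + t * norm w"
      using norm_triangle_ineq[of "s *\<^sub>R v" "t *\<^sub>R w"] that by simp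
    also have "\<dots> \<le> h * norm v + h * norm w" using that by (intro add_mono mult_right_mono) auto
    also have "\<dots> \<le> h * (norm v + norm w + 1)" using that by (simp add: algebra_simps)
    also have "\<dots> < \<delta> * (norm v + norm w + 1)" using that pos by (intro mult_strict_right_mono) auto
    also have "\<dots> = d" using pos by (simp add: \<delta>_def)
    moreover have "dist x (x + s *\<^sub>R v + t *\<^sub>R w) = norm (s *\<^sub>R v + t *\<^sub>R w)"
    proof -
      have "x - (x + s *\<^sub>R v + t *\<^sub>R w) = - (s *\<^sub>R v + t *\<^sub>R w)" by simp
      then show ?thesis by (metis dist_norm norm_minus_cancel)
    qed
    ultimately show ?thesis by simp
  qed
  show ?thesis
  proof (intro exI[of _ \<delta>] conjI allI impI)
    show "\<delta> > 0" using d pos by (simp add: \<delta>_def)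
    fix h assume h: "0 < h \<and> h < \<delta>"
    \<comment> \<open>The second difference is the increment of \<open>p\<close>, itself a first
      difference in the direction \<open>w\<close>. The mean value theorem along \<open>v\<close>
      produces \<open>p'\<close>, and along \<open>w\<close> it turns \<open>p'\<close> into a mixed
      derivative.\<close>
    define p where "p = (\<lambda>s. g (x + s *\<^sub>R v + h *\<^sub>R w) - g (x + s *\<^sub>R v))"
    define p' where "p' = (\<lambda>s. fderiv g (x + s *\<^sub>R v + h *\<^sub>R w) v - fderiv g (x + s *\<^sub>R v) v)"
    have D1: "((\<lambda>s. g (x + s *\<^sub>R v + t *\<^sub>R w)) has_real_derivative fderiv g (x + s *\<^sub>R v + t *\<^sub>R w) v) (at s)"
      if "0 \<le> s" "s \<le> h" "0 \<le> t" "t \<le> h" for s t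
    proof -
      have y: "x + s *\<^sub>R v + t *\<^sub>R w \<in> U" using in_ball[OF that] h d by blast
      have 1: "((\<lambda>s. x + s *\<^sub>R v + t *\<^sub>R w) has_derivative (\<lambda>r. r *\<^sub>R v)) (at s)"
        by (auto intro!: derivative_eq_intros)
      have 2: "((\<lambda>s. g (x + s *\<^sub>R v + t *\<^sub>R w)) has_derivative (\<lambda>r. fderiv g (x + s *\<^sub>R v + t *\<^sub>R w) (r *\<^sub>R v))) (at s)"
        using has_derivative_compose[OF 1 smooth_on_has_derivative[OF U(1,2) y]] .
      have "linear (fderiv g (x + s *\<^sub>R v + t *\<^sub>R w))"
        using smooth_on_differentiable[OF U(1,2) y] by (rule linear_fderiv)
      then show ?thesis using 2
        by (simp add: has_field_derivative_def linear_scale mult_commute_abs)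
    qed
    have D1': "((\<lambda>s. g (x + s *\<^sub>R v)) has_real_derivative fderiv g (x + s *\<^sub>R v) v) (at s)"
      if "0 \<le> s" "s \<le> h" for s
      using D1[of s 0] that h by simp
    have "\<exists>z. 0 < z \<and> z < h \<and> p h - p 0 = (h - 0) * p' z"
      using h by (intro MVT2) (auto simp: p_def p'_def intro!: DERIV_diff D1 D1')
    then obtain s where s: "0 < s" "s < h" "p h - p 0 = h * p' s" by auto
    have D2: "((\<lambda>t. fderiv g (x + s *\<^sub>R v + t *\<^sub>R w) v) has_real_derivative K (x + s *\<^sub>R v + t *\<^sub>R w)) (at t)"
      if "0 \<le> t" "t \<le> h" for t
    proof -
      have y: "x + s *\<^sub>R v + t *\<^sub>R w \<in> U" using in_ball[of s h t] that s h d by force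
      have 1: "((\<lambda>t. x + s *\<^sub>R v + t *\<^sub>R w) has_derivative (\<lambda>r. r *\<^sub>R w)) (at t)"
        by (auto intro!: derivative_eq_intros)
      have 2: "((\<lambda>t. fderiv g (x + s *\<^sub>R v + t *\<^sub>R w) v) has_derivative
          (\<lambda>r. fderiv (\<lambda>y. fderiv g y v) (x + s *\<^sub>R v + t *\<^sub>R w) (r *\<^sub>R w))) (at t)"
        using has_derivative_compose[OF 1 smooth_on_has_derivative[OF U(1) sv y]] .
      have "linear (fderiv (\<lambda>y. fderiv g y v) (x + s *\<^sub>R v + t *\<^sub>R w))"
        using smooth_on_differentiable[OF U(1) sv y] by (rule linear_fderiv)
      then show ?thesis using 2
        by (simp add: has_field_derivative_def linear_scale mult_commute_abs K_def)
    qed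
    have "\<exists>z. 0 < z \<and> z < h \<and> fderiv g (x + s *\<^sub>R v + h *\<^sub>R w) v - fderiv g (x + s *\<^sub>R v + 0 *\<^sub>R w) v
        = (h - 0) * K (x + s *\<^sub>R v + z *\<^sub>R w)"
      using h by (intro MVT2) (auto intro!: D2)
    then obtain t where t: "0 < t" "t < h" "p' s = h * K (x + s *\<^sub>R v + t *\<^sub>R w)"
      by (auto simp: p'_def)
    have "\<bar>K (x + s *\<^sub>R v + t *\<^sub>R w) - K x\<bar> < e" using in_ball[of s h t] s t h d by force
    moreover have "g (x + h *\<^sub>R v + h *\<^sub>R w) - g (x + h *\<^sub>R v) - g (x + h *\<^sub>R w) + g x = p h - p 0"
      by (simp add: p_def)
    moreover have "p h - p 0 - h * h * K x = h * h * (K (x + s *\<^sub>R v + t *\<^sub>R w) - K x)"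
      using s(3) t(3) by (simp add: algebra_simps)
    ultimately show "\<bar>(g (x + h *\<^sub>R v + h *\<^sub>R w) - g (x + h *\<^sub>R v) - g (x + h *\<^sub>R w) + g x)
       - h * h * fderiv (\<lambda>y. fderiv g y v) x w\<bar> \<le> h * h * e"
      by (simp add: fun_cong[OF K_def, symmetric] abs_mult mult_left_mono)
  qed
qed

lemma second_derivative_symmetric_real:
  fixes g :: "'a::model_space \<Rightarrow> real"
  assumes U: "open U" "smooth_on U g" "x \<in> U"
  shows "fderiv (\<lambda>y. fderiv g y v) x w = fderiv (\<lambda>y. fderiv g y w) x v"
proof (rule ccontr)
  let ?a = "fderiv (\<lambda>y. fderiv g y v) x w" and ?b = "fderiv (\<lambda>y. fderiv g y w) x v"
  assume "?a \<noteq> ?b"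
  \<comment> \<open>Two errors of size \<open>h * h * e\<close> cannot bridge the gap
    \<open>h * h * (3 * e)\<close>.\<close>
  define e where "e = \<bar>?a - ?b\<bar> / 3"
  have e: "e > 0" using \<open>?a \<noteq> ?b\<close> by (simp add: e_def)
  obtain d1 where d1: "d1 > 0" "\<And>h. 0 < h \<Longrightarrow> h < d1 \<Longrightarrow>
    \<bar>(g (x + h *\<^sub>R v + h *\<^sub>R w) - g (x + h *\<^sub>R v) - g (x + h *\<^sub>R w) + g x) - h * h * ?a\<bar> \<le> h * h * e"
    using second_difference[OF U e, of v w] by blast
  obtain d2 where d2: "d2 > 0" "\<And>h. 0 < h \<Longrightarrow> h < d2 \<Longrightarrow>
    \<bar>(g (x + h *\<^sub>R w + h *\<^sub>R v) - g (x + h *\<^sub>R w) - g (x + h *\<^sub>R v) + g x) - h * h * ?b\<bar> \<le> h * h * e"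
    using second_difference[OF U e, of w v] by blast
  define h where "h = min d1 d2 / 2"
  have h: "0 < h" "h < d1" "h < d2" using d1(1) d2(1) by (auto simp: h_def)
  have "x + h *\<^sub>R w + h *\<^sub>R v = x + h *\<^sub>R v + h *\<^sub>R w" by simp
  then have "\<bar>h * h * ?a - h * h * ?b\<bar> \<le> h * h * e + h * h * e"
    using d1(2)[OF h(1,2)] d2(2)[OF h(1,3)] by (simp only: abs_le_iff) linarith
  moreover have "\<bar>h * h * ?a - h * h * ?b\<bar> = h * h * (3 * e)"
    by (simp add: e_def abs_mult flip: right_diff_distrib)
  moreover have "h * h * e > 0" using h e by simp
  ultimately show False by (simp add: algebra_simps)
qed

text \<open>Pairing with an arbitrary \<open>u\<close> reduces to real functions; a vector is
  determined by its inner products.\<close>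

lemma second_derivative_symmetric:
  fixes f :: "'a::model_space \<Rightarrow> 'b::model_space"
  assumes U: "open U" "smooth_on U f" "x \<in> U"
  shows "fderiv (\<lambda>y. fderiv f y v) x w = fderiv (\<lambda>y. fderiv f y w) x v"
proof -
  have lin: "linear (\<lambda>y::'b. y \<bullet> u)" for u by (auto intro: linearI simp: inner_add_left)
  have eq: "fderiv (\<lambda>y. fderiv (\<lambda>z. f z \<bullet> u) y v) x w = fderiv (\<lambda>y. fderiv f y v) x w \<bullet> u" for u v w
  proof -
    have 1: "fderiv (\<lambda>z. f z \<bullet> u) y v = fderiv f y v \<bullet> u" if "y \<in> U" for y
      using frechet_derivative_at[OF bounded_linear.has_derivative[OF bounded_linear_inner_left
            smooth_on_has_derivative[OF U(1,2) that]]] by metis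
    have 2: "((\<lambda>y. fderiv f y v \<bullet> u) has_derivative (\<lambda>w. fderiv (\<lambda>y. fderiv f y v) x w \<bullet> u)) (at x)"
      by (intro bounded_linear.has_derivative[OF bounded_linear_inner_left]
          smooth_on_has_derivative[OF U(1) smooth_on_fderiv[OF U(1,2)] U(3)])
    have "((\<lambda>y. fderiv (\<lambda>z. f z \<bullet> u) y v) has_derivative (\<lambda>w. fderiv (\<lambda>y. fderiv f y v) x w \<bullet> u)) (at x)"
      by (rule has_derivative_transform_within_open[OF 2 U(1,3)]) (simp add: 1)
    from frechet_derivative_at[OF this] show ?thesis by metis
  qed
  have "fderiv (\<lambda>y. fderiv f y v) x w \<bullet> u = fderiv (\<lambda>y. fderiv f y w) x v \<bullet> u" for u
    using second_derivative_symmetric_real[OF U(1) smooth_on_linear_compose[OF lin U(2)] U(3), of u v w]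
    by (simp only: eq)
  then show ?thesis by (meson vector_eq_rdot)
qed

subsection \<open>Inverses of smooth families of linear maps\<close>

text \<open>Where one factor vanishes, continuity of the other suffices for the product rule.
  Inverse operators can thereby be differentiated when only their continuity is known.\<close>

lemma has_derivative_scaleR_zero:
  fixes f :: "'a::real_normed_vector \<Rightarrow> real" and g :: "'a \<Rightarrow> 'b::real_normed_vector"
  assumes f: "(f has_derivative f') (at x)" "f x = 0" and g: "isCont g x"
  shows "((\<lambda>y. f y *\<^sub>R g y) has_derivative (\<lambda>v. f' v *\<^sub>R g x)) (at x)"
proof -
  have bl: "bounded_linear f'" using f(1) by (rule has_derivative_bounded_linear)
  obtain K where K: "\<And>v. norm (f' v) \<le> norm v * K" using bounded_linear.bounded[OF bl] by blast
  have 1: "((\<lambda>y. norm ((f y - f x) - f' (y - x)) / norm (y - x)) \<longlongrightarrow> 0) (at x)"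
    using f(1) unfolding has_derivative_iff_norm by blast
  have 2: "(g \<longlongrightarrow> g x) (at x)" using g by (simp add: isCont_def)
  have lim: "((\<lambda>y. norm ((f y - f x) - f' (y - x)) / norm (y - x) * norm (g y)
      + K * norm (g y - g x)) \<longlongrightarrow> 0 * norm (g x) + K * norm (g x - g x)) (at x)"
    by (intro tendsto_intros 1 2)
  have "((\<lambda>y. norm ((f y *\<^sub>R g y - f x *\<^sub>R g x) - f' (y - x) *\<^sub>R g x) / norm (y - x)) \<longlongrightarrow> 0) (at x)"
  proof (rule Lim_null_comparison)
    show "((\<lambda>y. norm ((f y - f x) - f' (y - x)) / norm (y - x) * norm (g y) + K * norm (g y - g x)) \<longlongrightarrow> 0) (at x)"
      using lim by simp
    show "\<forall>\<^sub>F y in at x. norm (norm ((f y *\<^sub>R g y - f x *\<^sub>R g x) - f' (y - x) *\<^sub>R g x) / norm (y - x))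
        \<le> norm ((f y - f x) - f' (y - x)) / norm (y - x) * norm (g y) + K * norm (g y - g x)"
    proof (rule always_eventually, rule allI)
      fix y
      show "norm (norm ((f y *\<^sub>R g y - f x *\<^sub>R g x) - f' (y - x) *\<^sub>R g x) / norm (y - x))
        \<le> norm ((f y - f x) - f' (y - x)) / norm (y - x) * norm (g y) + K * norm (g y - g x)"
      proof (cases "y = x")
        case True then show ?thesis by simp
      next
        case False
        then have n: "norm (y - x) > 0" by simp
        have "(f y *\<^sub>R g y - f x *\<^sub>R g x) - f' (y - x) *\<^sub>R g x
            = ((f y - f x) - f' (y - x)) *\<^sub>R g y + f' (y - x) *\<^sub>R (g y - g x)"
          by (simp add: f(2) algebra_simps)
        then have "norm ((f y *\<^sub>R g y - f x *\<^sub>R g x) - f' (y - x) *\<^sub>R g x)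
            \<le> norm ((f y - f x) - f' (y - x)) * norm (g y) + norm (f' (y - x)) * norm (g y - g x)"
          by (metis norm_scaleR norm_triangle_ineq real_norm_def)
        also have "\<dots> \<le> norm ((f y - f x) - f' (y - x)) * norm (g y) + (norm (y - x) * K) * norm (g y - g x)"
          by (intro add_mono mult_right_mono K) auto
        finally have "norm ((f y *\<^sub>R g y - f x *\<^sub>R g x) - f' (y - x) *\<^sub>R g x) / norm (y - x)
          \<le> (norm ((f y - f x) - f' (y - x)) * norm (g y) + (norm (y - x) * K) * norm (g y - g x)) / norm (y - x)"
          using n by (intro divide_right_mono) auto
        also have "\<dots> = norm ((f y - f x) - f' (y - x)) / norm (y - x) * norm (g y) + K * norm (g y - g x)"
          using n by (simp add: field_simps)
        finally show ?thesis by simp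
      qed
    qed
  qed
  moreover have "bounded_linear (\<lambda>v. f' v *\<^sub>R g x)"
    using bounded_linear_compose[OF bounded_linear_scaleR_left bl] .
  ultimately show ?thesis unfolding has_derivative_iff_norm by blast
qed

context
  fixes S :: "'a::model_space \<Rightarrow> 'b::model_space \<Rightarrow> 'c::model_space" and U :: "'a set"
  assumes U: "open U" and linS: "\<And>x. x \<in> U \<Longrightarrow> linear (S x)" and bijS: "\<And>x. x \<in> U \<Longrightarrow> bij (S x)"
    and smS: "\<And>e. smooth_on U (\<lambda>x. S x e)"
begin

private lemma inv_S: "x \<in> U \<Longrightarrow> S x (inv_into UNIV (S x) e) = e" "x \<in> U \<Longrightarrow> inv_into UNIV (S x) (S x w) = w"
  using bijS by (auto simp: bij_is_surj surj_f_inv_f bij_is_inj inv_f_f)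

private lemma linear_inv_S: "x \<in> U \<Longrightarrow> linear (inv_into UNIV (S x))"
proof (rule linearI)
  assume x: "x \<in> U"
  fix e f :: 'c and r :: real
  show "inv_into UNIV (S x) (e + f) = inv_into UNIV (S x) e + inv_into UNIV (S x) f"
    using inv_S(2)[OF x, of "inv_into UNIV (S x) e + inv_into UNIV (S x) f"] by (simp add: linear_add[OF linS[OF x]] inv_S(1)[OF x])
  show "inv_into UNIV (S x) (r *\<^sub>R e) = r *\<^sub>R inv_into UNIV (S x) e"
    using inv_S(2)[OF x, of "r *\<^sub>R inv_into UNIV (S x) e"] by (simp add: linear_scale[OF linS[OF x]] inv_S(1)[OF x])
qed

private lemma isCont_S: "x \<in> U \<Longrightarrow> isCont (\<lambda>x. S x e) x"
  using smooth_on_continuous_on[OF smS] U by (simp add: continuous_on_eq_continuous_at)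

text \<open>A Neumann type estimate. \<open>M\<close> bounds the inverse at \<open>x0\<close>, and
  once \<open>M * d x < 1 / 2\<close> the perturbation absorbs at most half of
  \<open>norm w\<close>, which leaves the bound \<open>2 * M\<close> for the inverse at
  \<open>x\<close>.\<close>

private lemma inv_S_locally_bounded:
  assumes x0: "x0 \<in> U"
  shows "\<exists>M. \<forall>\<^sub>F x in at x0. x \<in> U \<and> (\<forall>e. norm (inv_into UNIV (S x) e) \<le> M * norm e)"
proof -
  define M where "M = (\<Sum>b\<in>mbasis. norm (inv_into UNIV (S x0) b))"
  define d where "d = (\<lambda>x. \<Sum>b\<in>mbasis. norm (S x b - S x0 b))"
  have M: "norm w \<le> M * norm (S x0 w)" for w
    using linear_norm_le[OF linear_inv_S[OF x0], of "S x0 w"] by (simp add: inv_S(2)[OF x0] M_def mult.commute)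
  have M0: "M \<ge> 0" unfolding M_def by (intro sum_nonneg) simp
  have "(d \<longlongrightarrow> (\<Sum>b\<in>mbasis. norm (S x0 b - S x0 b))) (at x0)"
    unfolding d_def by (intro tendsto_intros isCont_S[unfolded isCont_def] x0)
  then have "((\<lambda>x. M * d x) \<longlongrightarrow> M * 0) (at x0)" by (intro tendsto_intros) simp
  then have "\<forall>\<^sub>F x in at x0. M * d x < 1 / 2" by (rule order_tendstoD) simp
  moreover have "\<forall>\<^sub>F x in at x0. x \<in> U" using U x0 by (simp add: eventually_at_in_open')
  ultimately have "\<forall>\<^sub>F x in at x0. x \<in> U \<and> (\<forall>e. norm (inv_into UNIV (S x) e) \<le> (2 * M) * norm e)"
  proof eventually_elim
    case (elim x)
    have "norm w \<le> 2 * M * norm (S x w)" for w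
    proof -
      have "linear (\<lambda>w. S x w - S x0 w)" using linS elim x0 by (intro linear_compose_sub) auto
      from linear_norm_le[OF this, of w] have 1: "norm (S x w - S x0 w) \<le> norm w * d x" by (simp add: d_def)
      have "norm w \<le> M * norm (S x0 w)" by (rule M)
      also have "norm (S x0 w) \<le> norm (S x w) + norm w * d x"
        using norm_triangle_ineq4[of "S x w" "S x w - S x0 w"] 1 by simp
      then have "M * norm (S x0 w) \<le> M * (norm (S x w) + norm w * d x)" using M0 by (rule mult_left_mono)
      also have "\<dots> = M * norm (S x w) + norm w * (M * d x)" by (simp add: algebra_simps)
      also have "\<dots> \<le> M * norm (S x w) + norm w * (1 / 2)" using elim by (intro add_left_mono mult_left_mono) auto
      finally show ?thesis by simp
    qed
    from this[of "inv_into UNIV (S x) _"] show ?case using elim by (simp add: inv_S(1))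
  qed
  then show ?thesis by blast
qed

text \<open>With \<open>u\<close> the preimage of \<open>e\<close> at \<open>x0\<close>, the change
  of the inverse at \<open>e\<close> is the inverse at \<open>x\<close> applied to
  \<open>S x0 u - S x u\<close>. The local bound then carries the continuity of \<open>S\<close> at
  the fixed vector \<open>u\<close> over to the inverse.\<close>

private lemma isCont_inv_S:
  assumes x0: "x0 \<in> U" shows "isCont (\<lambda>x. inv_into UNIV (S x) e) x0"
proof -
  define u where "u = inv_into UNIV (S x0) e"
  obtain M where M: "\<forall>\<^sub>F x in at x0. x \<in> U \<and> (\<forall>e. norm (inv_into UNIV (S x) e) \<le> M * norm e)"
    using inv_S_locally_bounded[OF x0] by blast
  have "((\<lambda>x. inv_into UNIV (S x) e - u) \<longlongrightarrow> 0) (at x0)"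
  proof (rule Lim_null_comparison)
    have "((\<lambda>x. M * norm (S x0 u - S x u)) \<longlongrightarrow> M * norm (S x0 u - S x0 u)) (at x0)"
      by (intro tendsto_intros isCont_S[unfolded isCont_def] x0)
    then show "((\<lambda>x. M * norm (S x0 u - S x u)) \<longlongrightarrow> 0) (at x0)" by simp
    show "\<forall>\<^sub>F x in at x0. norm (inv_into UNIV (S x) e - u) \<le> M * norm (S x0 u - S x u)"
      using M
    proof eventually_elim
      case (elim x)
      have "inv_into UNIV (S x) e - u = inv_into UNIV (S x) (S x0 u - S x u)"
        using elim by (simp add: linear_diff[OF linear_inv_S] inv_S u_def x0)
      then show ?case using elim by simp
    qed
  qed
  then show ?thesis by (simp add: isCont_def u_def LIM_zero_iff)
qed

text \<open>The inverse at \<open>x\<close> applied to \<open>e\<close> equals \<open>u\<close>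
  minus the inverse at \<open>x\<close> applied to \<open>r x\<close>, and \<open>r\<close> vanishes
  at \<open>x0\<close>. Expanded in the basis, each summand is a differentiable function vanishing
  at \<open>x0\<close> times a continuous one.\<close>

private lemma has_derivative_inv_S:
  assumes x0: "x0 \<in> U"
  shows "((\<lambda>x. inv_into UNIV (S x) e) has_derivative
    (\<lambda>v. - inv_into UNIV (S x0) (fderiv (\<lambda>x. S x (inv_into UNIV (S x0) e)) x0 v))) (at x0)"
proof -
  define u where "u = inv_into UNIV (S x0) e"
  define r where "r = (\<lambda>x. S x u - S x0 u)"
  define R where "R = fderiv (\<lambda>x. S x u) x0"
  have r: "(r has_derivative R) (at x0)" unfolding r_def R_def
    using has_derivative_diff[OF smooth_on_has_derivative[OF U smS x0] has_derivative_const] by simp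
  have "((\<lambda>x. u - (\<Sum>b\<in>mbasis. (r x \<bullet> b) *\<^sub>R inv_into UNIV (S x) b)) has_derivative
      (\<lambda>v. 0 - (\<Sum>b\<in>mbasis. (R v \<bullet> b) *\<^sub>R inv_into UNIV (S x0) b))) (at x0)"
    by (intro has_derivative_diff has_derivative_const has_derivative_sum has_derivative_scaleR_zero
        bounded_linear.has_derivative[OF bounded_linear_inner_left r] isCont_inv_S x0) (simp add: r_def)
  moreover have "(\<lambda>v. 0 - (\<Sum>b\<in>mbasis. (R v \<bullet> b) *\<^sub>R inv_into UNIV (S x0) b)) = (\<lambda>v. - inv_into UNIV (S x0) (R v))"
    by (simp add: linear_expand[OF linear_inv_S[OF x0], symmetric])
  moreover have "u - (\<Sum>b\<in>mbasis. (r x \<bullet> b) *\<^sub>R inv_into UNIV (S x) b) = inv_into UNIV (S x) e" if "x \<in> U" for x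
  proof -
    have "(\<Sum>b\<in>mbasis. (r x \<bullet> b) *\<^sub>R inv_into UNIV (S x) b) = inv_into UNIV (S x) (r x)"
      by (rule linear_expand[OF linear_inv_S[OF that], symmetric])
    also have "\<dots> = u - inv_into UNIV (S x) e"
      using that x0 by (simp add: r_def u_def linear_diff[OF linear_inv_S] inv_S)
    finally show ?thesis by simp
  qed
  ultimately show ?thesis unfolding R_def u_def
    using has_derivative_transform_within_open[OF _ U x0] by force
qed

text \<open>Bootstrapping: the derivative of the inverse is expressed through the inverse and the
  derivatives of \<open>S\<close>, so class \<open>k\<close> at all vectors \<open>e\<close> yields
  class \<open>Suc k\<close>.\<close>

lemma smooth_on_inverse_operator: "smooth_on U (\<lambda>x. inv_into UNIV (S x) e)"
proof -
  have inner: "Ck_on k U f \<Longrightarrow> Ck_on k U (\<lambda>x. f x \<bullet> b)" for k and f :: "'a \<Rightarrow> 'd::model_space" and b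
    using Ck_on_bounded_linear[OF U bounded_linear_inner_left] .
  have "Ck_on k U (\<lambda>x. inv_into UNIV (S x) e)" for k e
  proof (induction k arbitrary: e)
    case 0
    then show ?case using isCont_inv_S U by (simp add: continuous_on_eq_continuous_at)
  next
    case (Suc k)
    have "Ck_on k U (\<lambda>x. fderiv (\<lambda>x. inv_into UNIV (S x) e) x v)" for v
    proof -
      \<comment> \<open>The derivative of \<open>S\<close> in the direction \<open>v\<close>,
        applied to the moving preimage of \<open>e\<close>. In basis form it involves the inverse
        only through coefficients covered by the induction hypothesis.\<close>
      define w where "w = (\<lambda>x. \<Sum>b\<in>mbasis. (inv_into UNIV (S x) e \<bullet> b) *\<^sub>R fderiv (\<lambda>x. S x b) x v)"
      have w: "Ck_on k U w" unfolding w_def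
        by (intro Ck_on_sum U Ck_on_bilinear[OF U bounded_bilinear_scaleR] inner Suc.IH
            smooth_on_Ck[OF U smooth_on_fderiv[OF U smS]])
      have "Ck_on k U (\<lambda>x. \<Sum>b\<in>mbasis. (- w x \<bullet> b) *\<^sub>R inv_into UNIV (S x) b)"
        by (intro Ck_on_sum U Ck_on_bilinear[OF U bounded_bilinear_scaleR] inner Suc.IH
            Ck_on_bounded_linear[OF U _ w] bounded_linear_minus bounded_linear_ident)
      moreover have "(\<Sum>b\<in>mbasis. (- w x \<bullet> b) *\<^sub>R inv_into UNIV (S x) b) = fderiv (\<lambda>x. inv_into UNIV (S x) e) x v"
        if x: "x \<in> U" for x
      proof -
        define u where "u = inv_into UNIV (S x) e"
        have 1: "((\<lambda>y. \<Sum>b\<in>mbasis. (u \<bullet> b) *\<^sub>R S y b) has_derivative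
            (\<lambda>v. \<Sum>b\<in>mbasis. (u \<bullet> b) *\<^sub>R fderiv (\<lambda>y. S y b) x v)) (at x)"
          by (intro has_derivative_sum has_derivative_scaleR_right smooth_on_has_derivative[OF U smS x])
        have "((\<lambda>y. S y u) has_derivative (\<lambda>v. \<Sum>b\<in>mbasis. (u \<bullet> b) *\<^sub>R fderiv (\<lambda>y. S y b) x v)) (at x)"
          by (rule has_derivative_transform_within_open[OF 1 U x]) (rule linear_expand[OF linS, symmetric])
        from fun_cong[OF frechet_derivative_at[OF this], of v] have "fderiv (\<lambda>y. S y u) x v = w x"
          unfolding w_def u_def by (rule sym)
        moreover have "fderiv (\<lambda>x. inv_into UNIV (S x) e) x v = - inv_into UNIV (S x) (fderiv (\<lambda>y. S y u) x v)"
          using frechet_derivative_at[OF has_derivative_inv_S[OF x, of e]] unfolding u_def by metis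
        moreover have "(\<Sum>b\<in>mbasis. (- w x \<bullet> b) *\<^sub>R inv_into UNIV (S x) b) = inv_into UNIV (S x) (- w x)"
          by (rule linear_expand[OF linear_inv_S[OF x], symmetric])
        ultimately show ?thesis by (simp add: linear_neg[OF linear_inv_S[OF x]])
      qed
      ultimately show ?thesis by (rule Ck_on_transform[OF U])
    qed
    moreover have "(\<lambda>x. inv_into UNIV (S x) e) differentiable (at x)" if "x \<in> U" for x
      using has_derivative_inv_S[OF that] by (auto simp: differentiable_def)
    ultimately show ?case by simp
  qed
  then show ?thesis by (rule smooth_on_openI[OF U])
qed

end

subsection \<open>Curves\<close>

lemma smooth_on_has_vector_derivative:
  fixes f :: "real \<Rightarrow> 'a::model_space"
  assumes "smooth_on J f" "t \<in> J"
  shows "(f has_vector_derivative vector_derivative f (at t within J)) (at t within J)"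
proof -
  obtain U g where g: "open U" "t \<in> U" "\<forall>k. Ck_on k U g" "\<forall>y\<in>U \<inter> J. g y = f y"
    by (rule smooth_onE[OF assms], rule that)
  have "g differentiable (at t)" using g(2) g(3)[rule_format, of "Suc 0"] by simp
  then have "(g has_derivative fderiv g t) (at t within J)"
    using frechet_derivative_works has_derivative_at_withinI by blast
  moreover have "\<forall>\<^sub>F y in at t within J. g y = f y"
    using g unfolding eventually_at_topological by (intro exI[of _ U]) auto
  ultimately have "(f has_derivative fderiv g t) (at t within J)"
    by (rule has_derivative_transform_eventually) (use g(2,4) assms(2) in simp_all)
  then have "f differentiable (at t within J)" by (auto simp: differentiable_def)
  then show ?thesis by (simp add: vector_derivative_works)
qed

text \<open>At an end-point the derivative within \<open>J\<close> is one-sided. Since no point of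
  \<open>J\<close> is isolated it is unique, hence equal to the derivative of a local extension,
  which is smooth.\<close>

lemma smooth_on_vector_derivative:
  fixes f :: "real \<Rightarrow> 'a::model_space"
  assumes "smooth_on J f" "\<And>t. t \<in> J \<Longrightarrow> at t within J \<noteq> bot"
  shows "smooth_on J (\<lambda>t. vector_derivative f (at t within J))"
proof (rule smooth_onI)
  fix t assume t: "t \<in> J"
  obtain U g where g: "open U" "t \<in> U" "\<forall>k. Ck_on k U g" "\<forall>y\<in>U \<inter> J. g y = f y"
    by (rule smooth_onE[OF assms(1) t], rule that)
  have "vector_derivative f (at s within J) = fderiv g s 1" if s: "s \<in> U" "s \<in> J" for s
  proof (rule vector_derivative_within[OF assms(2)[OF s(2)]])
    have "g differentiable (at s)" using s(1) g(3)[rule_format, of "Suc 0"] by simp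
    then have d: "(g has_derivative fderiv g s) (at s within J)" and l: "linear (fderiv g s)"
      using frechet_derivative_works has_derivative_at_withinI linear_fderiv by blast+
    have "fderiv g s h = h *\<^sub>R fderiv g s 1" for h
      using linear_scale[OF l, of h 1] by simp
    then have "(\<lambda>h. h *\<^sub>R fderiv g s 1) = fderiv g s" by (intro ext) (rule sym)
    then have "(g has_vector_derivative fderiv g s 1) (at s within J)"
      using d unfolding has_vector_derivative_def by (simp only:)
    moreover have "\<forall>\<^sub>F y in at s within J. g y = f y"
      using g s unfolding eventually_at_topological by (intro exI[of _ U]) auto
    moreover have "g s = f s" using g s by auto
    ultimately show "(f has_vector_derivative fderiv g s 1) (at s within J)"
      unfolding has_vector_derivative_def by (rule has_derivative_transform_eventually) (rule s(2))
  qed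
  then show "\<exists>U g. open U \<and> t \<in> U \<and> (\<forall>k. Ck_on k U g) \<and>
      (\<forall>y\<in>U \<inter> J. g y = vector_derivative f (at y within J))"
    using g smooth_on_Ck[OF g(1) smooth_on_fderiv[OF g(1) smooth_on_openI[OF g(1) g(3)[rule_format]]]]
    by (intro exI[of _ U] exI[of _ "\<lambda>s. fderiv g s 1"]) auto
qed

lemma Ck_on_antiderivative:
  fixes G :: "real \<Rightarrow> 'a::model_space"
  assumes "open I" "\<And>s. s \<in> I \<Longrightarrow> (G has_vector_derivative g s) (at s)" "Ck_on k I g"
  shows "Ck_on (Suc k) I G"
proof -
  have d: "(G has_derivative (\<lambda>v. v *\<^sub>R g s)) (at s)" if "s \<in> I" for s
    using assms(2)[OF that] by (simp add: has_vector_derivative_def)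
  have "Ck_on k I (\<lambda>s. fderiv G s v)" for v
  proof (rule Ck_on_transform[OF assms(1)])
    show "Ck_on k I (\<lambda>s. v *\<^sub>R g s)"
      by (intro Ck_on_bounded_linear[OF assms(1) _ assms(3)] bounded_linear_scaleR_right)
    show "v *\<^sub>R g s = fderiv G s v" if "s \<in> I" for s
      using frechet_derivative_at[OF d[OF that]] by metis
  qed
  then show ?thesis using d by (auto simp: differentiable_def)
qed

lemma at_within_interval_neq_bot: "\<lbrakk>t0 < t1; t \<in> {t0..t1}\<rbrakk> \<Longrightarrow> at t within {t0..t1::real} \<noteq> bot"
  using trivial_limit_within[of t "{t0..t1}"] islimpt_Icc[of t0 t1 t] by blast

lemma integral_has_vector_derivative_interior:
  fixes f :: "real \<Rightarrow> 'a::banach"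
  assumes "continuous_on {a..b} f" "x \<in> {a<..<b}"
  shows "((\<lambda>u. integral {a..u} f) has_vector_derivative f x) (at x)"
proof -
  have "((\<lambda>u. integral {a..u} f) has_vector_derivative f x) (at x within {a..b})"
    using assms by (intro integral_has_vector_derivative) auto
  moreover have "at x within {a..b} = at x" using assms(2) by (simp add: at_within_Icc_at)
  ultimately show ?thesis by simp
qed

text \<open>At an end-point \<beta> has only a one-sided derivative, so an extension must be
  produced: near \<open>t\<close> it is a primitive of a local extension \<open>g\<close> of \<phi>,
  shifted by a constant.\<close>

lemma smooth_on_antiderivative:
  fixes \<beta> :: "real \<Rightarrow> 'a::model_space"
  assumes d: "\<And>t. t \<in> {t0..t1} \<Longrightarrow> (\<beta> has_vector_derivative \<phi> t) (at t within {t0..t1})"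
    and s: "smooth_on {t0..t1} \<phi>"
  shows "smooth_on {t0..t1} \<beta>"
proof (rule smooth_onI)
  fix t assume t: "t \<in> {t0..t1}"
  obtain U g where g: "open U" "t \<in> U" "\<forall>k. Ck_on k U g" "\<forall>y\<in>U \<inter> {t0..t1}. g y = \<phi> y"
    by (rule smooth_onE[OF s t], rule that)
  obtain e where e: "e > 0" "cball t e \<subseteq> U" using g(1,2) open_contains_cball by blast
  have sub: "{t - e..t + e} \<subseteq> U" using e(2) by (auto simp: cball_def dist_real_def subset_eq abs_le_iff)
  define I where "I = {t - e<..<t + e}"
  have I: "open I" "I \<subseteq> U" "t \<in> I" using sub e by (auto simp: I_def)
  have cont: "continuous_on {t - e..t + e} g"
    using g(3)[rule_format, of 0] sub by (auto intro: continuous_on_subset)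
  \<comment> \<open>The primitive starts at \<open>t - e\<close>, possibly outside the interval, and
    is therefore differentiable from both sides at \<open>t\<close>. It differs from \<beta> by a
    constant on the convex set \<open>I \<inter> {t0..t1}\<close>.\<close>
  define G where "G = (\<lambda>u. integral {t - e..u} g)"
  have G: "(G has_vector_derivative g s) (at s)" if "s \<in> I" for s
    unfolding G_def using integral_has_vector_derivative_interior[OF cont] that by (simp add: I_def)
  have "((\<lambda>s. \<beta> s - G s) has_derivative (\<lambda>h. 0)) (at s within I \<inter> {t0..t1})" if "s \<in> I \<inter> {t0..t1}" for s
  proof -
    have "(G has_vector_derivative \<phi> s) (at s within I \<inter> {t0..t1})"
      using G[of s] that g(4) I(2) has_vector_derivative_at_within by fastforce
    moreover have "(\<beta> has_vector_derivative \<phi> s) (at s within I \<inter> {t0..t1})"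
      using d[of s] that by (auto intro: has_vector_derivative_within_subset)
    ultimately have "((\<lambda>s. \<beta> s - G s) has_vector_derivative \<phi> s - \<phi> s) (at s within I \<inter> {t0..t1})"
      by (intro has_vector_derivative_diff)
    then show ?thesis by (simp add: has_vector_derivative_def)
  qed
  then have "\<exists>c. \<forall>s\<in>I \<inter> {t0..t1}. \<beta> s - G s = c"
    by (intro has_derivative_zero_constant convex_Int) (auto simp: I_def)
  then obtain c where c: "\<And>s. s \<in> I \<inter> {t0..t1} \<Longrightarrow> \<beta> s = G s + c" by (metis add.commute diff_add_cancel)
  have "Ck_on k I (\<lambda>s. G s + c)" for k
    using Ck_on_SucD[OF Ck_on_antiderivative[OF I(1) G Ck_on_subset[OF g(3)[rule_format] I(2)]]]
    by (intro Ck_on_add I Ck_on_const) auto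
  then show "\<exists>U g. open U \<and> t \<in> U \<and> (\<forall>k. Ck_on k U g) \<and> (\<forall>y\<in>U \<inter> {t0..t1}. g y = \<beta> y)"
    using I c by (intro exI[of _ I] exI[of _ "\<lambda>s. G s + c"]) auto
qed

subsection \<open>Local flow lines\<close>

lemma smooth_locally_lipschitz:
  fixes V :: "'a::model_space \<Rightarrow> 'b::model_space"
  assumes N: "open N" "smooth_on N V" "e \<in> N"
  obtains r K where "r > 0" "K > 0" "cball e r \<subseteq> N"
    "\<And>x y. x \<in> cball e r \<Longrightarrow> y \<in> cball e r \<Longrightarrow> norm (V x - V y) \<le> K * norm (x - y)"
proof -
  \<comment> \<open>A continuous upper bound for the operator norm of the derivative; near
    \<open>e\<close> it exceeds its value there by less than 1, which gives the Lipschitz constant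
    \<open>k e + 1\<close>.\<close>
  define k where "k = (\<lambda>x. \<Sum>b\<in>mbasis. norm (fderiv V x b))"
  have "continuous_on N k" unfolding k_def
    by (intro continuous_intros smooth_on_continuous_on smooth_on_fderiv N)
  then have "isCont k e" using N by (simp add: continuous_on_eq_continuous_at)
  then obtain d1 where d1: "d1 > 0" "\<And>x. dist x e < d1 \<Longrightarrow> dist (k x) (k e) < 1"
    unfolding continuous_at_eps_delta by (meson zero_less_one)
  obtain d2 where d2: "d2 > 0" "cball e d2 \<subseteq> N" using N open_contains_cball by blast
  define r where "r = min (d1 / 2) d2"
  have r: "r > 0" "cball e r \<subseteq> N" using d1 d2 by (auto simp: r_def)
  have k: "k x \<le> k e + 1" if "x \<in> cball e r" for x
  proof -
    have "dist x e < d1" using that d1(1) by (simp add: r_def dist_commute)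
    then show ?thesis using d1(2)[of x] by (simp add: dist_real_def)
  qed
  have k0: "k e \<ge> 0" unfolding k_def by (intro sum_nonneg) simp
  have "norm (V x - V y) \<le> (k e + 1) * norm (x - y)" if "x \<in> cball e r" "y \<in> cball e r" for x y
  proof (rule differentiable_bound[OF convex_cball _ _ that])
    fix z assume z: "z \<in> cball e r"
    then have zN: "z \<in> N" using r by blast
    show "(V has_derivative fderiv V z) (at z within cball e r)"
      using smooth_on_has_derivative[OF N(1,2) zN] by (rule has_derivative_at_withinI)
    have "norm (fderiv V z v) \<le> (k e + 1) * norm v" for v
    proof -
      have "norm (fderiv V z v) \<le> norm v * k z"
        unfolding k_def by (intro linear_norm_le linear_fderiv smooth_on_differentiable[OF N(1,2) zN])
      also have "\<dots> \<le> norm v * (k e + 1)" using k[OF z] by (intro mult_left_mono) auto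
      finally show ?thesis by (simp add: mult.commute)
    qed
    then show "onorm (fderiv V z) \<le> k e + 1" using k0 by (intro onorm_bound) auto
  qed
  then show thesis using that[of r "k e + 1"] r k0 by auto
qed

text \<open>The difference is the oriented integral from 0 to \<tau>. Starting both integrals at
  \<open>-\<epsilon>\<close> treats positive and negative times by one formula.\<close>

lemma integral_from_zero_bound:
  fixes f :: "real \<Rightarrow> 'a::banach"
  assumes "continuous_on {-\<epsilon>..\<epsilon>} f" "\<And>t. t \<in> {-\<epsilon>..\<epsilon>} \<Longrightarrow> norm (f t) \<le> B" "\<tau> \<in> {-\<epsilon>..\<epsilon>}" "0 \<le> B" "0 \<le> \<epsilon>"
  shows "norm (integral {-\<epsilon>..\<tau>} f - integral {-\<epsilon>..0} f) \<le> B * \<epsilon>"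
proof (cases "0 \<le> \<tau>")
  case True
  have "f integrable_on {-\<epsilon>..\<tau>}"
    using assms by (intro integrable_continuous_real continuous_on_subset[OF assms(1)]) auto
  then have "integral {-\<epsilon>..0} f + integral {0..\<tau>} f = integral {-\<epsilon>..\<tau>} f"
    using True assms by (intro Henstock_Kurzweil_Integration.integral_combine) auto
  then have "norm (integral {-\<epsilon>..\<tau>} f - integral {-\<epsilon>..0} f) = norm (integral {0..\<tau>} f)"
    by (metis add_diff_cancel_left')
  also have "\<dots> \<le> B * (\<tau> - 0)"
    using True assms by (intro integral_bound continuous_on_subset[OF assms(1)]) auto
  also have "\<dots> \<le> B * \<epsilon>" using assms by (intro mult_left_mono) auto
  finally show ?thesis .
next
  case False
  have "f integrable_on {-\<epsilon>..0}"
    using assms by (intro integrable_continuous_real continuous_on_subset[OF assms(1)]) auto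
  then have "integral {-\<epsilon>..\<tau>} f + integral {\<tau>..0} f = integral {-\<epsilon>..0} f"
    using False assms by (intro Henstock_Kurzweil_Integration.integral_combine) auto
  then have "norm (integral {-\<epsilon>..\<tau>} f - integral {-\<epsilon>..0} f) = norm (integral {\<tau>..0} f)"
    by (metis add_diff_cancel_left' norm_minus_commute)
  also have "\<dots> \<le> B * (0 - \<tau>)"
    using False assms by (intro integral_bound continuous_on_subset[OF assms(1)]) auto
  also have "\<dots> \<le> B * \<epsilon>" using assms by (intro mult_left_mono) auto
  finally show ?thesis .
qed

text \<open>The Banach fixed point theorem for the integral equation, on both sides of time 0. The
  curves are bounded continuous functions on the whole real line with values in the ball, a closed
  and hence complete set.\<close>

lemma picard:
  fixes V :: "'a::banach \<Rightarrow> 'a"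
  assumes r: "r > 0" and K: "K > 0"
    and lip: "\<And>x y. x \<in> cball e r \<Longrightarrow> y \<in> cball e r \<Longrightarrow> norm (V x - V y) \<le> K * norm (x - y)"
  shows "\<exists>\<epsilon>>0. \<exists>x. x 0 = e \<and> continuous_on UNIV x \<and>
    (\<forall>t\<in>{-\<epsilon><..<\<epsilon>}. x t \<in> cball e r \<and> (x has_vector_derivative V (x t)) (at t))"
proof -
  define M where "M = norm (V e) + K * r"
  have M: "norm (V x) \<le> M" if "x \<in> cball e r" for x
  proof -
    have "norm (V x - V e) \<le> K * norm (x - e)" using that r by (intro lip) auto
    also have "\<dots> \<le> K * r" using that K by (intro mult_left_mono) (auto simp: dist_norm norm_minus_commute)
    finally show ?thesis using norm_triangle_ineq2[of "V x" "V e"] by (simp add: M_def)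
  qed
  have M0: "M \<ge> 0" using K r by (simp add: M_def)
  have contV: "continuous_on (cball e r) V"
    unfolding continuous_on_iff
  proof (intro ballI allI impI)
    fix x \<eta> :: _ assume x: "x \<in> cball e r" and "\<eta> > (0::real)"
    show "\<exists>d>0. \<forall>y\<in>cball e r. dist y x < d \<longrightarrow> dist (V y) (V x) < \<eta>"
    proof (intro exI[of _ "\<eta> / K"] conjI ballI impI)
      show "\<eta> / K > 0" using K \<open>\<eta> > 0\<close> by simp
      fix y assume "y \<in> cball e r" "dist y x < \<eta> / K"
      then have "K * norm (y - x) < \<eta>" using K by (simp add: dist_norm field_simps)
      then show "dist (V y) (V x) < \<eta>" using lip[OF \<open>y \<in> cball e r\<close> x] by (simp add: dist_norm)
    qed
  qed
  \<comment> \<open>\<open>M * \<epsilon> \<le> r\<close> keeps the integral operator inside the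
    ball, and \<open>K * \<epsilon> \<le> 1 / 2\<close> makes it a contraction. \<open>M + 1\<close>
    is positive even if \<open>M\<close> vanishes.\<close>
  define \<epsilon> where "\<epsilon> = min (r / (M + 1)) (1 / (2 * K))"
  have \<epsilon>: "\<epsilon> > 0" "M * \<epsilon> \<le> r" "K * \<epsilon> \<le> 1 / 2"
  proof -
    show "\<epsilon> > 0" using r K M0 by (simp add: \<epsilon>_def)
    have "M * \<epsilon> \<le> (M + 1) * (r / (M + 1))"
      using M0 r K by (intro mult_mono) (auto simp: \<epsilon>_def)
    then show "M * \<epsilon> \<le> r" using M0 by simp
    have "K * \<epsilon> \<le> K * (1 / (2 * K))" using K by (intro mult_left_mono) (auto simp: \<epsilon>_def)
    then show "K * \<epsilon> \<le> 1 / 2" using K by simp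
  qed
  \<comment> \<open>Freezing time outside \<open>{-\<epsilon>..\<epsilon>}\<close> makes the
    integral operator act on functions defined everywhere; the differential equation is read off
    only inside, where \<open>clamp\<close> is the identity.\<close>
  define clamp where "clamp = (\<lambda>t. max (-\<epsilon>) (min \<epsilon> t))"
  have clamp: "clamp t \<in> {-\<epsilon>..\<epsilon>}" "t \<in> {-\<epsilon>..\<epsilon>} \<Longrightarrow> clamp t = t" for t using \<epsilon> by (auto simp: clamp_def)
  have contclamp: "continuous_on UNIV clamp" unfolding clamp_def by (intro continuous_intros)
  define \<Phi> where "\<Phi> = (\<lambda>(u::real \<Rightarrow>\<^sub>C 'a) t. e + (integral {-\<epsilon>..clamp t} (\<lambda>s. V (u s)) - integral {-\<epsilon>..0} (\<lambda>s. V (u s))))"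
  define X where "X = PiC (UNIV::real set) (\<lambda>_. cball e r)"
  have XD: "apply_bcontfun u t \<in> cball e r" if "u \<in> X" for u t
    using that by (auto simp: X_def dest!: mem_PiCD)
  have contVu: "continuous_on A (\<lambda>s. V (apply_bcontfun u s))" if "u \<in> X" for u and A :: "real set"
    using XD[OF that] by (intro continuous_on_compose2[OF contV]) auto
  have \<Phi>_cball: "\<Phi> u t \<in> cball e r" if "u \<in> X" for u t
  proof -
    have "norm (\<Phi> u t - e) \<le> M * \<epsilon>" unfolding \<Phi>_def
      using integral_from_zero_bound[OF contVu[OF that] M[OF XD[OF that]] clamp(1) M0] \<epsilon> by simp
    then show ?thesis using \<epsilon> by (simp add: dist_norm norm_minus_commute)
  qed
  have \<Phi>_cont: "continuous_on UNIV (\<Phi> u)" if "u \<in> X" for u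
  proof -
    have "continuous_on {-\<epsilon>..\<epsilon>} (\<lambda>\<tau>. integral {-\<epsilon>..\<tau>} (\<lambda>s. V (u s)))"
      by (intro indefinite_integral_continuous_1 integrable_continuous_real contVu that)
    then have "continuous_on UNIV (\<lambda>t. integral {-\<epsilon>..clamp t} (\<lambda>s. V (u s)))"
      using clamp(1) by (intro continuous_on_compose2[OF _ contclamp]) auto
    then show ?thesis unfolding \<Phi>_def by (intro continuous_intros)
  qed
  have \<Phi>_bc: "\<Phi> u \<in> bcontfun" if "u \<in> X" for u
    using \<Phi>_cont[OF that] \<Phi>_cball[OF that] unfolding bcontfun_def
    by (auto intro!: bounded_subset[OF bounded_cball[of e r]])
  define F where "F = (\<lambda>u. Bcontfun (\<Phi> u))"
  have F: "apply_bcontfun (F u) = \<Phi> u" if "u \<in> X" for u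
    unfolding F_def using \<Phi>_bc[OF that] by (rule Bcontfun_inverse)
  have "\<exists>!u\<in>X. F u = u"
  proof (rule Banach_fix)
    show "complete X" unfolding X_def complete_eq_closed by (intro closed_PiC) auto
    have "const_bcontfun e \<in> X" using r by (auto simp: X_def mem_PiC_iff const_bcontfun.rep_eq)
    then show "X \<noteq> {}" by auto
    show "0 \<le> (1/2::real)" "1/2 < (1::real)" by auto
    show "F ` X \<subseteq> X" using F \<Phi>_cball by (auto simp: X_def mem_PiC_iff simp del: mem_cball)
    show "dist (F u) (F v) \<le> 1 / 2 * dist u v" if u: "u \<in> X" and v: "v \<in> X" for u v
    proof (rule dist_bound)
      fix t
      let ?I = "\<lambda>a b f. integral {a..b} f"
      have i: "(\<lambda>s. V (apply_bcontfun w s)) integrable_on {a..b}" if "w \<in> X" for w a b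
        by (intro integrable_continuous_real contVu that)
      have "\<Phi> u t - \<Phi> v t = ?I (-\<epsilon>) (clamp t) (\<lambda>s. V (u s) - V (v s)) - ?I (-\<epsilon>) 0 (\<lambda>s. V (u s) - V (v s))"
        unfolding \<Phi>_def by (simp add: Henstock_Kurzweil_Integration.integral_diff[OF i[OF u] i[OF v]])
      also have "norm \<dots> \<le> (K * dist u v) * \<epsilon>"
      proof (rule integral_from_zero_bound[OF _ _ clamp(1)])
        show "continuous_on {- \<epsilon>..\<epsilon>} (\<lambda>s. V (apply_bcontfun u s) - V (apply_bcontfun v s))"
          by (intro continuous_on_diff contVu u v)
        show "norm (V (apply_bcontfun u s) - V (apply_bcontfun v s)) \<le> K * dist u v" for s
        proof -
          have "norm (V (u s) - V (v s)) \<le> K * norm (u s - v s)" by (intro lip XD u v)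
          also have "\<dots> \<le> K * dist u v"
            using K dist_bounded[of u s v] by (intro mult_left_mono) (auto simp: dist_norm)
          finally show ?thesis .
        qed
      qed (use K \<epsilon> in auto)
      also have "\<dots> = (K * \<epsilon>) * dist u v" by simp
      also have "\<dots> \<le> 1 / 2 * dist u v" using \<epsilon> by (intro mult_right_mono) auto
      finally show "dist (apply_bcontfun (F u) t) (apply_bcontfun (F v) t) \<le> 1 / 2 * dist u v"
        by (simp add: F u v dist_norm)
    qed
  qed
  then obtain u where u: "u \<in> X" "F u = u" by blast
  have ut: "u t = \<Phi> u t" for t using F[OF u(1)] u(2) by simp
  have "u 0 = e" using ut[of 0] \<epsilon> by (simp add: \<Phi>_def clamp(2))
  moreover have "continuous_on UNIV (apply_bcontfun u)" by simp
  moreover have "(apply_bcontfun u has_vector_derivative V (u t)) (at t)" if t: "t \<in> {-\<epsilon><..<\<epsilon>}" for t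
  proof -
    have 1: "((\<lambda>\<tau>. integral {-\<epsilon>..\<tau>} (\<lambda>s. V (u s))) has_vector_derivative V (u t)) (at t)"
      using t by (intro integral_has_vector_derivative_interior[of _ \<epsilon>] contVu u(1))
    then have "((\<lambda>\<tau>. e + (integral {-\<epsilon>..\<tau>} (\<lambda>s. V (u s)) - integral {-\<epsilon>..0} (\<lambda>s. V (u s)))) has_vector_derivative V (u t)) (at t)"
      by (auto intro!: derivative_eq_intros)
    then show ?thesis
    proof (rule has_vector_derivative_transform_within_open[where S = "{-\<epsilon><..<\<epsilon>}"])
      fix s assume "s \<in> {-\<epsilon><..<\<epsilon>}"
      then have "clamp s = s" by (intro clamp(2)) auto
      then show "e + (integral {-\<epsilon>..s} (\<lambda>s. V (u s)) - integral {-\<epsilon>..0} (\<lambda>s. V (u s))) = u s"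
        using ut[of s] by (simp add: \<Phi>_def)
    qed (use t in auto)
  qed
  ultimately show ?thesis using \<epsilon>(1) XD[OF u(1)]
    by (intro exI[of _ \<epsilon>] conjI exI[of _ "apply_bcontfun u"] ballI) auto
qed

text \<open>Smoothness of the solution bootstraps from the equation: if \<open>x\<close> is of class
  \<open>k\<close>, so is \<open>V (x t)\<close>, and \<open>x\<close> as its antiderivative is of
  class \<open>Suc k\<close>.\<close>

lemma local_flow_line:
  fixes V :: "'a::model_space \<Rightarrow> 'a"
  assumes N: "open N" "smooth_on N V" "e \<in> N"
  shows "\<exists>\<epsilon>>0. \<exists>x. x 0 = e \<and> smooth_on {-\<epsilon><..<\<epsilon>} x \<and>
    (\<forall>t\<in>{-\<epsilon><..<\<epsilon>}. x t \<in> N \<and> (x has_vector_derivative V (x t)) (at t))"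
proof -
  obtain r K where rK: "r > 0" "K > 0" "cball e r \<subseteq> N"
    and lip: "\<And>x y. x \<in> cball e r \<Longrightarrow> y \<in> cball e r \<Longrightarrow> norm (V x - V y) \<le> K * norm (x - y)"
    using smooth_locally_lipschitz[OF N] by metis
  obtain \<epsilon> x where x: "\<epsilon> > 0" "x 0 = e" "continuous_on UNIV x"
    "\<And>t. t \<in> {-\<epsilon><..<\<epsilon>} \<Longrightarrow> x t \<in> cball e r"
    "\<And>t. t \<in> {-\<epsilon><..<\<epsilon>} \<Longrightarrow> (x has_vector_derivative V (x t)) (at t)"
    using picard[OF rK(1,2) lip] by metis
  have inN: "x t \<in> N" if "t \<in> {-\<epsilon><..<\<epsilon>}" for t using x(4)[OF that] rK(3) by blast
  have "Ck_on k {-\<epsilon><..<\<epsilon>} x" for k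
  proof (induction k)
    case 0
    then show ?case using x(3) by (auto intro: continuous_on_subset)
  next
    case (Suc k)
    show ?case
      by (rule Ck_on_antiderivative[OF _ x(5)])
        (auto intro!: Ck_on_compose[OF _ N(1) smooth_on_Ck[OF N(1,2)] Suc] inN)
  qed
  then have "smooth_on {-\<epsilon><..<\<epsilon>} x" by (intro smooth_on_openI) auto
  then show ?thesis using x inN by blast
qed

section \<open>Charts and smooth maps\<close>

text \<open>This condition passes to products and to tangent bundles, see
  \<open>smooth_atlas_prod\<close> and \<open>smooth_atlas_tangent\<close>, so one notion serves for
  all spaces that occur.\<close>

definition smooth_atlas :: "('a, 'e::model_space) atlas \<Rightarrow> bool" where
  "smooth_atlas A \<longleftrightarrow> (\<forall>c\<in>A. inj_on (snd c) (fst c)) \<and>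
     (\<forall>c\<in>A. \<forall>d\<in>A. open (snd c ` (fst c \<inter> fst d)) \<and>
                     smooth_on (snd c ` (fst c \<inter> fst d)) (transition c d))"

definition atlas_open :: "('a, 'e::model_space) atlas \<Rightarrow> 'a set \<Rightarrow> bool" where
  "atlas_open A S \<longleftrightarrow> S \<subseteq> points A \<and> (\<forall>c\<in>A. open (snd c ` (S \<inter> fst c)))"

lemma smooth_manifold_smooth_atlas: "smooth_manifold A \<Longrightarrow> smooth_atlas A"
  by (simp add: smooth_manifold_def smooth_atlas_def)

lemma smooth_atlasD:
  assumes "smooth_atlas A" "c \<in> A"
  shows "inj_on (snd c) (fst c)" "d \<in> A \<Longrightarrow> open (snd c ` (fst c \<inter> fst d))"
    "d \<in> A \<Longrightarrow> smooth_on (snd c ` (fst c \<inter> fst d)) (transition c d)" "open (snd c ` fst c)"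
  using assms unfolding smooth_atlas_def by (blast, blast, blast, metis Int_absorb)

lemma chart_inv_in: "x \<in> snd c ` P \<Longrightarrow> P \<subseteq> fst c \<Longrightarrow> chart_inv c x \<in> fst c"
  unfolding chart_inv_def by (intro inv_into_into) blast

lemma chart_inv_right: "x \<in> snd c ` P \<Longrightarrow> P \<subseteq> fst c \<Longrightarrow> snd c (chart_inv c x) = x"
  unfolding chart_inv_def by (intro f_inv_into_f) blast

lemma chart_inv_left: "smooth_atlas A \<Longrightarrow> c \<in> A \<Longrightarrow> p \<in> fst c \<Longrightarrow> chart_inv c (snd c p) = p"
  unfolding chart_inv_def by (intro inv_into_f_f smooth_atlasD(1))

lemma chart_inv_mem:
  "smooth_atlas A \<Longrightarrow> c \<in> A \<Longrightarrow> x \<in> snd c ` P \<Longrightarrow> P \<subseteq> fst c \<Longrightarrow> chart_inv c x \<in> P"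
  using chart_inv_left by fastforce

lemma chart_image_iff:
  "smooth_atlas A \<Longrightarrow> c \<in> A \<Longrightarrow> P \<subseteq> fst c \<Longrightarrow> p \<in> fst c \<Longrightarrow> snd c p \<in> snd c ` P \<longleftrightarrow> p \<in> P"
  using smooth_atlasD(1) by (fastforce dest: inj_onD)

lemma points_iff: "p \<in> points A \<longleftrightarrow> (\<exists>c\<in>A. p \<in> fst c)"
  by (auto simp: points_def)

section \<open>Open sets of an atlas and smooth maps in arbitrary charts\<close>

lemma istopology_atlas_open:
  assumes "smooth_atlas A"
  shows "istopology (\<lambda>W. W \<subseteq> points A \<and> (\<forall>c\<in>A. open (snd c ` (W \<inter> fst c))))"
  unfolding istopology_def
proof (intro conjI allI impI ballI)
  fix S T :: "'a set" and c
  assume S: "S \<subseteq> points A \<and> (\<forall>c\<in>A. open (snd c ` (S \<inter> fst c)))"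
    and T: "T \<subseteq> points A \<and> (\<forall>c\<in>A. open (snd c ` (T \<inter> fst c)))"
  show "S \<inter> T \<subseteq> points A" using S by auto
  assume c: "c \<in> A"
  have "snd c ` (S \<inter> T \<inter> fst c) = snd c ` (S \<inter> fst c) \<inter> snd c ` (T \<inter> fst c)"
    using smooth_atlasD(1)[OF assms c] by (auto simp: inj_on_def)
  then show "open (snd c ` (S \<inter> T \<inter> fst c))" using S T c by auto
next
  fix K :: "'a set set" and c
  assume K: "\<forall>S\<in>K. S \<subseteq> points A \<and> (\<forall>c\<in>A. open (snd c ` (S \<inter> fst c)))"
  show "\<Union>K \<subseteq> points A" using K by auto
  assume c: "c \<in> A"
  have "snd c ` (\<Union>K \<inter> fst c) = (\<Union>S\<in>K. snd c ` (S \<inter> fst c))" by auto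
  then show "open (snd c ` (\<Union>K \<inter> fst c))" using K c by auto
qed

lemma openin_atlas_topology: "smooth_atlas A \<Longrightarrow> openin (atlas_topology A) S \<longleftrightarrow> atlas_open A S"
  unfolding atlas_topology_def atlas_open_def by (simp add: topology_inverse'[OF istopology_atlas_open])

lemma atlas_open_points: "smooth_atlas A \<Longrightarrow> atlas_open A (points A)"
proof -
  assume A: "smooth_atlas A"
  have "points A \<inter> fst c = fst c" if "c \<in> A" for c using that by (auto simp: points_def)
  then show ?thesis using smooth_atlasD(4)[OF A] by (simp add: atlas_open_def)
qed

lemma atlas_open_domain: "smooth_atlas A \<Longrightarrow> c \<in> A \<Longrightarrow> atlas_open A (fst c)"
  using smooth_atlasD(2)[of A _ c] by (auto simp: atlas_open_def points_def Int_commute)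

lemma atlas_open_Int: "smooth_atlas A \<Longrightarrow> atlas_open A S \<Longrightarrow> atlas_open A T \<Longrightarrow> atlas_open A (S \<inter> T)"
  by (simp flip: openin_atlas_topology add: openin_Int)

text \<open>\<open>smooth_map\<close> only promises some pair of charts at each point. Composing
  with transitions on both sides transfers smoothness to any prescribed pair.\<close>

lemma smooth_mapE:
  assumes A: "smooth_atlas A" and B: "smooth_atlas B" and f: "smooth_map A S B f"
    and p: "p \<in> S" and c: "c \<in> A" "p \<in> fst c" and d: "d \<in> B" "f p \<in> fst d"
  obtains W where "open W" "snd c p \<in> W" "W \<subseteq> snd c ` fst c"
    "\<forall>x\<in>W. chart_inv c x \<in> S \<longrightarrow> f (chart_inv c x) \<in> fst d"
    "smooth_on (W \<inter> snd c ` (S \<inter> fst c)) (\<lambda>x. snd d (f (chart_inv c x)))"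
proof -
  obtain c' d' W' where c': "c' \<in> A" "p \<in> fst c'" and d': "d' \<in> B" "f p \<in> fst d'"
    and W': "open W'" "snd c' p \<in> W'" "\<And>p'. p' \<in> S \<inter> fst c' \<Longrightarrow> snd c' p' \<in> W' \<Longrightarrow> f p' \<in> fst d'"
      "smooth_on (W' \<inter> snd c' ` (S \<inter> fst c')) (\<lambda>x. snd d' (f (chart_inv c' x)))"
    using f p unfolding smooth_map_def by metis
  define g' where "g' = (\<lambda>x. snd d' (f (chart_inv c' x)))"
  define D' where "D' = W' \<inter> snd c' ` (S \<inter> fst c')"
  define P where "P = snd d' ` (fst d' \<inter> fst d)"
  have g'p: "g' (snd c' q) = snd d' (f q)" if "q \<in> fst c'" for q
    using chart_inv_left[OF A c'(1) that] by (simp add: g'_def)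
  have "continuous_on D' g'" using W'(4) smooth_on_continuous_on unfolding D'_def g'_def by blast
  moreover have "open P" unfolding P_def using smooth_atlasD(2)[OF B d'(1) d(1)] .
  moreover have "snd c' p \<in> D'" using W' c' p by (auto simp: D'_def)
  moreover have "g' (snd c' p) \<in> P" using g'p[OF c'(2)] d d' by (auto simp: P_def)
  \<comment> \<open>Continuity keeps the image in the overlap of the given chart \<open>d'\<close>
    and the wanted chart \<open>d\<close>, so that the transition from \<open>d'\<close> to
    \<open>d\<close> can be applied.\<close>
  ultimately obtain W1 where W1: "open W1" "snd c' p \<in> W1" "\<And>y. y \<in> D' \<Longrightarrow> y \<in> W1 \<Longrightarrow> g' y \<in> P"
    unfolding continuous_on_topological by metis
  define T where "T = snd c ` (fst c \<inter> fst c')"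
  have T: "open T" "smooth_on T (transition c c')" using smooth_atlasD(2,3)[OF A c(1) c'(1)] by (auto simp: T_def)
  define W where "W = T \<inter> transition c c' -` (W' \<inter> W1)"
  have "open W" unfolding W_def
    using continuous_open_preimage[OF smooth_on_continuous_on[OF T(2)] T(1)] W'(1) W1(1) by blast
  have TD: "chart_inv c x \<in> fst c \<inter> fst c'" "snd c (chart_inv c x) = x"
    "transition c c' x = snd c' (chart_inv c x)" if "x \<in> T" for x
    using chart_inv_mem[OF A c(1) that[unfolded T_def]] chart_inv_right[OF that[unfolded T_def]]
    by (auto simp: transition_def)
  have fd: "f (chart_inv c x) \<in> fst d \<inter> fst d'" "snd c' (chart_inv c x) \<in> D'"
    if x: "x \<in> W" "chart_inv c x \<in> S" for x
  proof -
    let ?q = "chart_inv c x"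
    have q: "?q \<in> fst c'" "snd c' ?q \<in> W'" "snd c' ?q \<in> W1" using x TD unfolding W_def by auto
    show D: "snd c' ?q \<in> D'" using q x by (auto simp: D'_def)
    have "f ?q \<in> fst d'" using W'(3)[of ?q] q x by auto
    moreover have "snd d' (f ?q) \<in> P" using W1(3)[OF D q(3)] g'p q by simp
    ultimately show "f ?q \<in> fst d \<inter> fst d'"
      using chart_image_iff[OF B d'(1), of "fst d' \<inter> fst d" "f ?q"] by (auto simp: P_def)
  qed
  show thesis
  proof
    show "open W" by fact
    show "snd c p \<in> W" using TD[of "snd c p"] c c' W' W1 chart_inv_left[OF A c]
      by (auto simp: W_def T_def)
    show "W \<subseteq> snd c ` fst c" by (auto simp: W_def T_def)
    show "\<forall>x\<in>W. chart_inv c x \<in> S \<longrightarrow> f (chart_inv c x) \<in> fst d" using fd by blast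
    let ?E = "W \<inter> snd c ` (S \<inter> fst c)"
    have E: "chart_inv c x \<in> S" if "x \<in> ?E" for x using chart_inv_mem[OF A c(1), of x "S \<inter> fst c"] that by auto
    have 1: "smooth_on ?E (\<lambda>x. transition d' d (g' (transition c c' x)))"
    proof (rule smooth_on_compose[OF smooth_atlasD(3)[OF B d'(1) d(1)]])
      show "smooth_on ?E (\<lambda>x. g' (transition c c' x))"
      proof (rule smooth_on_compose[OF W'(4)[folded g'_def D'_def]])
        show "smooth_on ?E (transition c c')" using T(2) by (rule smooth_on_subset) (auto simp: W_def)
        show "transition c c' x \<in> D'" if "x \<in> ?E" for x
          using fd(2)[of x] E[OF that] TD(3)[of x] that by (auto simp: W_def)
      qed
      show "g' (transition c c' x) \<in> snd d' ` (fst d' \<inter> fst d)" if "x \<in> ?E" for x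
        using fd(1)[of x] E[OF that] TD[of x] that g'p[of "chart_inv c x"] by (auto simp: W_def)
    qed
    have 2: "transition d' d (g' (transition c c' x)) = snd d (f (chart_inv c x))" if "x \<in> ?E" for x
      using fd(1)[of x] E[OF that] TD[of x] that g'p[of "chart_inv c x"] chart_inv_left[OF B d'(1), of "f (chart_inv c x)"]
      by (auto simp: W_def transition_def[of d' d])
    show "smooth_on ?E (\<lambda>x. snd d (f (chart_inv c x)))"
      using 1 smooth_on_cong[of ?E "\<lambda>x. transition d' d (g' (transition c c' x))", OF 2] by blast
  qed
qed

lemma smooth_map_points: "smooth_map A S B f \<Longrightarrow> p \<in> S \<Longrightarrow> p \<in> points A \<and> f p \<in> points B"
  unfolding smooth_map_def points_def by blast

lemma smooth_map_openE:
  assumes A: "smooth_atlas A" and B: "smooth_atlas B" and f: "smooth_map A S B f" and S: "atlas_open A S"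
    and p: "p \<in> S" and c: "c \<in> A" "p \<in> fst c" and d: "d \<in> B" "f p \<in> fst d"
  obtains W where "open W" "snd c p \<in> W" "W \<subseteq> snd c ` (S \<inter> fst c)"
    "\<forall>x\<in>W. f (chart_inv c x) \<in> fst d"
    "smooth_on W (\<lambda>x. snd d (f (chart_inv c x)))"
proof -
  obtain W where W: "open W" "snd c p \<in> W" "W \<subseteq> snd c ` fst c"
    "\<forall>x\<in>W. chart_inv c x \<in> S \<longrightarrow> f (chart_inv c x) \<in> fst d"
    "smooth_on (W \<inter> snd c ` (S \<inter> fst c)) (\<lambda>x. snd d (f (chart_inv c x)))"
    by (rule smooth_mapE[OF A B f p c d], rule that)
  have o: "open (snd c ` (S \<inter> fst c))" using S c by (auto simp: atlas_open_def)
  have in_S: "chart_inv c x \<in> S" if "x \<in> snd c ` (S \<inter> fst c)" for x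
    using chart_inv_mem[OF A c(1), of x "S \<inter> fst c"] that by auto
  show thesis by (rule that[OF open_Int[OF W(1) o] _ _ _ W(5)]) (use W c p in_S in auto)
qed

lemma smooth_map_subset:
  assumes "smooth_map A S B f" "T \<subseteq> S" shows "smooth_map A T B f"
  unfolding smooth_map_def
proof
  fix p assume "p \<in> T"
  then have "p \<in> S" using assms by auto
  then obtain c d W where *: "c \<in> A" "d \<in> B" "p \<in> fst c" "f p \<in> fst d" "open W" "snd c p \<in> W"
    "\<forall>p'\<in>S \<inter> fst c. snd c p' \<in> W \<longrightarrow> f p' \<in> fst d"
    "smooth_on (W \<inter> snd c ` (S \<inter> fst c)) (\<lambda>x. snd d (f (chart_inv c x)))"
    using assms unfolding smooth_map_def by metis
  have "smooth_on (W \<inter> snd c ` (T \<inter> fst c)) (\<lambda>x. snd d (f (chart_inv c x)))"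
    using *(8) by (rule smooth_on_subset) (use assms in auto)
  then show "\<exists>c\<in>A. \<exists>d\<in>B. p \<in> fst c \<and> f p \<in> fst d \<and> (\<exists>W. open W \<and> snd c p \<in> W \<and>
      (\<forall>p'\<in>T \<inter> fst c. snd c p' \<in> W \<longrightarrow> f p' \<in> fst d) \<and>
      smooth_on (W \<inter> snd c ` (T \<inter> fst c)) (\<lambda>x. snd d (f (chart_inv c x))))"
    using * assms(2) by (intro bexI[of _ c] bexI[of _ d] conjI exI[of _ W]) auto
qed

lemma smooth_mapI:
  assumes A: "smooth_atlas A"
    and *: "\<And>p. p \<in> S \<Longrightarrow> \<exists>c\<in>A. \<exists>d\<in>B. p \<in> fst c \<and> f p \<in> fst d \<and> (\<exists>W. open W \<and> snd c p \<in> W \<and>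
       (\<forall>x\<in>W \<inter> snd c ` (S \<inter> fst c). f (chart_inv c x) \<in> fst d) \<and>
       smooth_on (W \<inter> snd c ` (S \<inter> fst c)) (\<lambda>x. snd d (f (chart_inv c x))))"
  shows "smooth_map A S B f"
  unfolding smooth_map_def
proof
  fix p assume "p \<in> S"
  then obtain c d W where **: "c \<in> A" "d \<in> B" "p \<in> fst c" "f p \<in> fst d" "open W" "snd c p \<in> W"
       "\<forall>x\<in>W \<inter> snd c ` (S \<inter> fst c). f (chart_inv c x) \<in> fst d"
       "smooth_on (W \<inter> snd c ` (S \<inter> fst c)) (\<lambda>x. snd d (f (chart_inv c x)))"
    using *[of p] by blast
  have "f p' \<in> fst d" if "p' \<in> S \<inter> fst c" "snd c p' \<in> W" for p'
    using **(7)[rule_format, of "snd c p'"] that chart_inv_left[OF A **(1), of p'] by auto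
  then show "\<exists>c\<in>A. \<exists>d\<in>B. p \<in> fst c \<and> f p \<in> fst d \<and> (\<exists>W. open W \<and> snd c p \<in> W \<and>
      (\<forall>p'\<in>S \<inter> fst c. snd c p' \<in> W \<longrightarrow> f p' \<in> fst d) \<and>
      smooth_on (W \<inter> snd c ` (S \<inter> fst c)) (\<lambda>x. snd d (f (chart_inv c x))))"
    using ** by (intro bexI[of _ c] bexI[of _ d] conjI exI[of _ W]) auto
qed

lemma smooth_map_compose:
  assumes A: "smooth_atlas A" and B: "smooth_atlas B" and C: "smooth_atlas C"
    and f: "smooth_map A S B f" and g: "smooth_map B T C g" and ST: "\<And>p. p \<in> S \<Longrightarrow> f p \<in> T"
  shows "smooth_map A S C (\<lambda>p. g (f p))"
proof (rule smooth_mapI[OF A])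
  fix p assume p: "p \<in> S"
  obtain c where c: "c \<in> A" "p \<in> fst c" using smooth_map_points[OF f p] unfolding points_iff by blast
  obtain d where d: "d \<in> B" "f p \<in> fst d" using smooth_map_points[OF f p] unfolding points_iff by blast
  obtain e where e: "e \<in> C" "g (f p) \<in> fst e" using smooth_map_points[OF g ST[OF p]] unfolding points_iff by blast
  obtain W where W: "open W" "snd c p \<in> W" "W \<subseteq> snd c ` fst c"
    "\<forall>x\<in>W. chart_inv c x \<in> S \<longrightarrow> f (chart_inv c x) \<in> fst d"
    "smooth_on (W \<inter> snd c ` (S \<inter> fst c)) (\<lambda>x. snd d (f (chart_inv c x)))"
    by (rule smooth_mapE[OF A B f p c d], rule that)
  obtain V where V: "open V" "snd d (f p) \<in> V" "V \<subseteq> snd d ` fst d"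
    "\<forall>y\<in>V. chart_inv d y \<in> T \<longrightarrow> g (chart_inv d y) \<in> fst e"
    "smooth_on (V \<inter> snd d ` (T \<inter> fst d)) (\<lambda>y. snd e (g (chart_inv d y)))"
    by (rule smooth_mapE[OF B C g ST[OF p] d e], rule that)
  define D where "D = W \<inter> snd c ` (S \<inter> fst c)"
  define h where "h = (\<lambda>x. snd d (f (chart_inv c x)))"
  have inS: "chart_inv c x \<in> S \<inter> fst c" if "x \<in> snd c ` (S \<inter> fst c)" for x
    using chart_inv_mem[OF A c(1) that] by auto
  have "continuous_on D h" using W(5) smooth_on_continuous_on unfolding D_def h_def by blast
  moreover have "snd c p \<in> D" "h (snd c p) \<in> V"
    using W V p c chart_inv_left[OF A c] by (auto simp: D_def h_def)
  ultimately obtain W1 where W1: "open W1" "snd c p \<in> W1" "\<And>x. x \<in> D \<Longrightarrow> x \<in> W1 \<Longrightarrow> h x \<in> V"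
    using V(1) unfolding continuous_on_topological by metis
  let ?E = "(W \<inter> W1) \<inter> snd c ` (S \<inter> fst c)"
  have E: "h x \<in> V" "chart_inv d (h x) = f (chart_inv c x)" "f (chart_inv c x) \<in> T"
    "f (chart_inv c x) \<in> fst d" if "x \<in> ?E" for x
    using that W1(3)[of x] W(4)[rule_format, of x] inS[of x] ST chart_inv_left[OF B d(1)] by (auto simp: D_def h_def)
  have "smooth_on ?E (\<lambda>x. snd e (g (chart_inv d (h x))))"
  proof (rule smooth_on_compose[OF V(5)])
    show "smooth_on ?E h" using W(5) unfolding h_def by (rule smooth_on_subset) auto
    show "h x \<in> V \<inter> snd d ` (T \<inter> fst d)" if "x \<in> ?E" for x
      using E[OF that] by (auto simp: h_def)
  qed
  then have "smooth_on ?E (\<lambda>x. snd e (g (f (chart_inv c x))))"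
    using smooth_on_cong[of ?E "\<lambda>x. snd e (g (chart_inv d (h x)))" "\<lambda>x. snd e (g (f (chart_inv c x)))"] E(2) by auto
  moreover have "g (f (chart_inv c x)) \<in> fst e" if "x \<in> ?E" for x
    using V(4)[rule_format, of "h x"] E[OF that] by simp
  ultimately show "\<exists>c\<in>A. \<exists>e\<in>C. p \<in> fst c \<and> g (f p) \<in> fst e \<and> (\<exists>W. open W \<and> snd c p \<in> W \<and>
       (\<forall>x\<in>W \<inter> snd c ` (S \<inter> fst c). g (f (chart_inv c x)) \<in> fst e) \<and>
       smooth_on (W \<inter> snd c ` (S \<inter> fst c)) (\<lambda>x. snd e (g (f (chart_inv c x)))))"
    using c e W W1 by (intro bexI[of _ c] bexI[of _ e] conjI exI[of _ "W \<inter> W1"]) auto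
qed

lemma smooth_map_cong:
  assumes A: "smooth_atlas A" and f: "smooth_map A S B f" and eq: "\<And>p. p \<in> S \<Longrightarrow> f p = g p"
  shows "smooth_map A S B g"
  unfolding smooth_map_def
proof
  fix p assume p: "p \<in> S"
  then obtain c d W where *: "c \<in> A" "d \<in> B" "p \<in> fst c" "f p \<in> fst d" "open W" "snd c p \<in> W"
    "\<forall>p'\<in>S \<inter> fst c. snd c p' \<in> W \<longrightarrow> f p' \<in> fst d"
    "smooth_on (W \<inter> snd c ` (S \<inter> fst c)) (\<lambda>x. snd d (f (chart_inv c x)))"
    using f unfolding smooth_map_def by metis
  have "smooth_on (W \<inter> snd c ` (S \<inter> fst c)) (\<lambda>x. snd d (g (chart_inv c x)))"
    using *(8) smooth_on_cong[of "W \<inter> snd c ` (S \<inter> fst c)" "\<lambda>x. snd d (f (chart_inv c x))" "\<lambda>x. snd d (g (chart_inv c x))"]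
      eq chart_inv_mem[OF A *(1), of _ "S \<inter> fst c"] by auto
  then show "\<exists>c\<in>A. \<exists>d\<in>B. p \<in> fst c \<and> g p \<in> fst d \<and> (\<exists>W. open W \<and> snd c p \<in> W \<and>
      (\<forall>p'\<in>S \<inter> fst c. snd c p' \<in> W \<longrightarrow> g p' \<in> fst d) \<and>
      smooth_on (W \<inter> snd c ` (S \<inter> fst c)) (\<lambda>x. snd d (g (chart_inv c x))))"
    using * eq p by (intro bexI[of _ c] bexI[of _ d] conjI exI[of _ W]) auto
qed

lemma smooth_map_ident:
  assumes A: "smooth_atlas A" and S: "S \<subseteq> points A" shows "smooth_map A S A (\<lambda>p. p)"
proof (rule smooth_mapI[OF A])
  fix p assume "p \<in> S"
  then obtain c where c: "c \<in> A" "p \<in> fst c" using S by (metis points_iff subsetD)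
  have 1: "snd c (chart_inv c x) = x" "chart_inv c x \<in> fst c" if "x \<in> UNIV \<inter> snd c ` (S \<inter> fst c)" for x
    using that chart_inv_right[of x c "S \<inter> fst c"] chart_inv_in[of x c "S \<inter> fst c"] by auto
  then have "smooth_on (UNIV \<inter> snd c ` (S \<inter> fst c)) (\<lambda>x. snd c (chart_inv c x))"
    using smooth_on_cong[of "UNIV \<inter> snd c ` (S \<inter> fst c)" "\<lambda>x. snd c (chart_inv c x)" "\<lambda>x. x"] by simp
  then show "\<exists>c\<in>A. \<exists>d\<in>A. p \<in> fst c \<and> p \<in> fst d \<and> (\<exists>W. open W \<and> snd c p \<in> W \<and>
       (\<forall>x\<in>W \<inter> snd c ` (S \<inter> fst c). chart_inv c x \<in> fst d) \<and>
       smooth_on (W \<inter> snd c ` (S \<inter> fst c)) (\<lambda>x. snd d (chart_inv c x)))"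
    using 1 c by (intro bexI[of _ c] conjI exI[of _ UNIV]) auto
qed

lemma smooth_map_const:
  assumes "smooth_atlas A" "S \<subseteq> points A" "b \<in> points B"
  shows "smooth_map A S B (\<lambda>p. b)"
proof (rule smooth_mapI[OF assms(1)])
  fix p assume "p \<in> S"
  then obtain c where c: "c \<in> A" "p \<in> fst c" using assms(2) by (metis points_iff subsetD)
  obtain d where d: "d \<in> B" "b \<in> fst d" using assms(3) unfolding points_iff by blast
  show "\<exists>c\<in>A. \<exists>d\<in>B. p \<in> fst c \<and> b \<in> fst d \<and> (\<exists>W. open W \<and> snd c p \<in> W \<and>
       (\<forall>x\<in>W \<inter> snd c ` (S \<inter> fst c). b \<in> fst d) \<and>
       smooth_on (W \<inter> snd c ` (S \<inter> fst c)) (\<lambda>x. snd d b))"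
    using c d by (intro bexI[of _ c] bexI[of _ d] conjI exI[of _ UNIV]) auto
qed

lemma atlas_open_vimage:
  assumes A: "smooth_atlas A" and B: "smooth_atlas B" and f: "smooth_map A S B f" and S: "atlas_open A S"
    and T: "atlas_open B T"
  shows "atlas_open A {p \<in> S. f p \<in> T}"
  unfolding atlas_open_def
proof (intro conjI ballI)
  show "{p \<in> S. f p \<in> T} \<subseteq> points A" using S by (auto simp: atlas_open_def)
  fix c assume c: "c \<in> A"
  show "open (snd c ` ({p \<in> S. f p \<in> T} \<inter> fst c))"
  proof (rule topological_space_class.openI)
    fix x assume "x \<in> snd c ` ({p \<in> S. f p \<in> T} \<inter> fst c)"
    then obtain p where p: "p \<in> S" "f p \<in> T" "p \<in> fst c" "x = snd c p" by auto
    obtain d where d: "d \<in> B" "f p \<in> fst d" using smooth_map_points[OF f p(1)] unfolding points_iff by blast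
    obtain W where W: "open W" "snd c p \<in> W" "W \<subseteq> snd c ` (S \<inter> fst c)"
      "\<forall>x\<in>W. f (chart_inv c x) \<in> fst d"
      "smooth_on W (\<lambda>x. snd d (f (chart_inv c x)))"
      by (rule smooth_map_openE[OF A B f S p(1) c p(3) d], rule that)
    define V where "V = W \<inter> (\<lambda>x. snd d (f (chart_inv c x))) -` (snd d ` (T \<inter> fst d))"
    have "open V" unfolding V_def
      using continuous_open_preimage[OF smooth_on_continuous_on[OF W(5)] W(1)] T d by (auto simp: atlas_open_def)
    moreover have "x \<in> V" using W p d chart_inv_left[OF A c p(3)] by (auto simp: V_def)
    moreover have "V \<subseteq> snd c ` ({p \<in> S. f p \<in> T} \<inter> fst c)"
    proof
      fix y assume y: "y \<in> V"
      let ?q = "chart_inv c y"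
      have "y \<in> snd c ` (S \<inter> fst c)" using y W by (auto simp: V_def)
      then have "?q \<in> S \<inter> fst c" "snd c ?q = y"
        using chart_inv_mem[OF A c, of y "S \<inter> fst c"] chart_inv_right[of y c "S \<inter> fst c"] by auto
      moreover have "f ?q \<in> T" using y W(4)[rule_format, of y] chart_image_iff[OF B d(1), of "T \<inter> fst d" "f ?q"]
        by (auto simp: V_def)
      ultimately show "y \<in> snd c ` ({p \<in> S. f p \<in> T} \<inter> fst c)" by force
    qed
    ultimately show "\<exists>V. open V \<and> x \<in> V \<and> V \<subseteq> snd c ` ({p \<in> S. f p \<in> T} \<inter> fst c)" by blast
  qed
qed

subsection \<open>Model spaces, products and curves\<close>

lemma chart_inv_model [simp]: "chart_inv (UNIV, \<lambda>x. x) = (\<lambda>x. x)"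
  by (auto simp: chart_inv_def intro!: ext inv_into_f_f)

lemma mem_model_atlas [simp]: "c \<in> model_atlas \<longleftrightarrow> c = (UNIV, \<lambda>x. x)"
  by (simp add: model_atlas_def)

lemma points_model [simp]: "points model_atlas = UNIV"
  by (simp add: points_def model_atlas_def)

lemma smooth_atlas_model: "smooth_atlas (model_atlas :: ('e::model_space, 'e) atlas)"
  by (auto simp: smooth_atlas_def transition_def)

lemma smooth_curveE:
  assumes B: "smooth_atlas B" and f: "smooth_map model_atlas S B f" and p: "p \<in> S" and d: "d \<in> B" "f p \<in> fst d"
  obtains W where "open W" "p \<in> W" "\<forall>x\<in>W \<inter> S. f x \<in> fst d" "smooth_on (W \<inter> S) (\<lambda>x. snd d (f x))"
  by (rule smooth_mapE[OF smooth_atlas_model B f p _ _ d, of "(UNIV, \<lambda>x. x)"]) (auto intro: that)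

lemma smooth_curveI:
  assumes "\<And>p. p \<in> S \<Longrightarrow> \<exists>d\<in>B. f p \<in> fst d \<and> (\<exists>W. open W \<and> p \<in> W \<and> (\<forall>x\<in>W \<inter> S. f x \<in> fst d) \<and>
    smooth_on (W \<inter> S) (\<lambda>x. snd d (f x)))"
  shows "smooth_map model_atlas S B f"
  by (rule smooth_mapI[OF smooth_atlas_model]) (use assms in auto)

lemma smooth_functionE:
  assumes A: "smooth_atlas A" and f: "smooth_map A S model_atlas f" and S: "atlas_open A S"
    and p: "p \<in> S" and c: "c \<in> A" "p \<in> fst c"
  obtains W where "open W" "snd c p \<in> W" "W \<subseteq> snd c ` (S \<inter> fst c)" "smooth_on W (\<lambda>x. f (chart_inv c x))"
  by (rule smooth_map_openE[OF A smooth_atlas_model f S p c, of "(UNIV, \<lambda>x. x)"]) (auto intro: that)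

abbreviation prod_chart :: "('a, 'e) chart \<Rightarrow> ('b, 'f) chart \<Rightarrow> ('a \<times> 'b, 'e \<times> 'f) chart" where
  "prod_chart c d \<equiv> (fst c \<times> fst d, map_prod (snd c) (snd d))"

lemma mem_prod_atlas: "C \<in> prod_atlas A B \<longleftrightarrow> (\<exists>c\<in>A. \<exists>d\<in>B. C = prod_chart c d)"
  by (auto simp: prod_atlas_def)

lemma prod_chart_in: "c \<in> A \<Longrightarrow> d \<in> B \<Longrightarrow> prod_chart c d \<in> prod_atlas A B"
  by (auto simp: mem_prod_atlas)

lemma map_prod_image_Times: "map_prod f g ` (P \<times> R) = (f ` P) \<times> (g ` R)"
  by force

lemma prod_chart_inv:
  assumes "smooth_atlas A" "smooth_atlas B" "c \<in> A" "d \<in> B" "x \<in> snd c ` fst c" "y \<in> snd d ` fst d"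
  shows "chart_inv (prod_chart c d) (x, y) = (chart_inv c x, chart_inv d y)"
proof -
  obtain p q where pq: "p \<in> fst c" "x = snd c p" "q \<in> fst d" "y = snd d q" using assms by auto
  have "inj_on (map_prod (snd c) (snd d)) (fst c \<times> fst d)"
    using smooth_atlasD(1)[OF assms(1,3)] smooth_atlasD(1)[OF assms(2,4)] by (auto simp: inj_on_def)
  then have "chart_inv (prod_chart c d) (map_prod (snd c) (snd d) (p, q)) = (p, q)"
    unfolding chart_inv_def using pq by (simp only: fst_conv snd_conv) (intro inv_into_f_f, auto)
  then show ?thesis using pq chart_inv_left[OF assms(1,3)] chart_inv_left[OF assms(2,4)] by simp
qed

lemma smooth_atlas_prod:
  assumes A: "smooth_atlas A" and B: "smooth_atlas B" shows "smooth_atlas (prod_atlas A B)"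
  unfolding smooth_atlas_def
proof (intro conjI ballI)
  fix C assume "C \<in> prod_atlas A B"
  then obtain c d where cd: "c \<in> A" "d \<in> B" "C = prod_chart c d" by (auto simp: mem_prod_atlas)
  show "inj_on (snd C) (fst C)"
    using smooth_atlasD(1)[OF A cd(1)] smooth_atlasD(1)[OF B cd(2)] by (auto simp: inj_on_def cd(3))
  fix C' assume "C' \<in> prod_atlas A B"
  then obtain c' d' where cd': "c' \<in> A" "d' \<in> B" "C' = prod_chart c' d'" by (auto simp: mem_prod_atlas)
  have im: "snd C ` (fst C \<inter> fst C') = snd c ` (fst c \<inter> fst c') \<times> snd d ` (fst d \<inter> fst d')"
    by (simp add: cd cd' Times_Int_Times map_prod_image_Times)
  show "open (snd C ` (fst C \<inter> fst C'))" unfolding im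
    by (rule open_Times[OF smooth_atlasD(2)[OF A cd(1) cd'(1)] smooth_atlasD(2)[OF B cd(2) cd'(2)]])
  have 1: "smooth_on (snd C ` (fst C \<inter> fst C')) (\<lambda>z. (transition c c' (fst z), transition d d' (snd z)))"
    unfolding im
    by (rule smooth_on_Pair[OF smooth_on_compose[OF smooth_atlasD(3)[OF A cd(1) cd'(1)] smooth_on_fst[OF smooth_on_ident]]
      smooth_on_compose[OF smooth_atlasD(3)[OF B cd(2) cd'(2)] smooth_on_snd[OF smooth_on_ident]]])
      (auto simp: mem_Times_iff)
  have 2: "transition C C' z = (transition c c' (fst z), transition d d' (snd z))"
    if "z \<in> snd C ` (fst C \<inter> fst C')" for z
  proof -
    obtain x y where z: "z = (x, y)" "x \<in> snd c ` fst c" "y \<in> snd d ` fst d"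
      using \<open>z \<in> _\<close> unfolding im by auto
    show ?thesis unfolding z(1) transition_def cd(3) prod_chart_inv[OF A B cd(1,2) z(2,3)] by (simp add: cd')
  qed
  show "smooth_on (snd C ` (fst C \<inter> fst C')) (transition C C')"
    by (rule smooth_on_cong[THEN iffD2, OF 2 1])
qed

lemma points_prod: "points (prod_atlas A B) = points A \<times> points B"
proof (rule Set.set_eqI)
  fix z show "z \<in> points (prod_atlas A B) \<longleftrightarrow> z \<in> points A \<times> points B"
    by (cases z) (force simp: points_iff mem_prod_atlas)
qed

lemma atlas_open_Times:
  assumes "atlas_open A S" "atlas_open B T" shows "atlas_open (prod_atlas A B) (S \<times> T)"
  unfolding atlas_open_def points_prod
proof (intro conjI ballI)
  show "S \<times> T \<subseteq> points A \<times> points B" using assms by (auto simp: atlas_open_def)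
  fix C assume "C \<in> prod_atlas A B"
  then obtain c d where "c \<in> A" "d \<in> B" "C = prod_chart c d" by (auto simp: mem_prod_atlas)
  then show "open (snd C ` (S \<times> T \<inter> fst C))" using assms
    by (simp add: atlas_open_def Times_Int_Times map_prod_image_Times open_Times)
qed

lemma smooth_map_Pair:
  assumes A: "smooth_atlas A" and B: "smooth_atlas B" and C: "smooth_atlas C"
    and f: "smooth_map A S B f" and g: "smooth_map A S C g"
  shows "smooth_map A S (prod_atlas B C) (\<lambda>p. (f p, g p))"
proof (rule smooth_mapI[OF A])
  fix p assume p: "p \<in> S"
  obtain c where c: "c \<in> A" "p \<in> fst c" using smooth_map_points[OF f p] unfolding points_iff by blast
  obtain d where d: "d \<in> B" "f p \<in> fst d" using smooth_map_points[OF f p] unfolding points_iff by blast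
  obtain e where e: "e \<in> C" "g p \<in> fst e" using smooth_map_points[OF g p] unfolding points_iff by blast
  obtain W where W: "open W" "snd c p \<in> W" "W \<subseteq> snd c ` fst c"
    "\<forall>x\<in>W. chart_inv c x \<in> S \<longrightarrow> f (chart_inv c x) \<in> fst d"
    "smooth_on (W \<inter> snd c ` (S \<inter> fst c)) (\<lambda>x. snd d (f (chart_inv c x)))"
    by (rule smooth_mapE[OF A B f p c d], rule that)
  obtain V where V: "open V" "snd c p \<in> V" "V \<subseteq> snd c ` fst c"
    "\<forall>x\<in>V. chart_inv c x \<in> S \<longrightarrow> g (chart_inv c x) \<in> fst e"
    "smooth_on (V \<inter> snd c ` (S \<inter> fst c)) (\<lambda>x. snd e (g (chart_inv c x)))"
    by (rule smooth_mapE[OF A C g p c e], rule that)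
  have inS: "chart_inv c x \<in> S" if "x \<in> snd c ` (S \<inter> fst c)" for x
    using chart_inv_mem[OF A c(1) that] by auto
  have "smooth_on ((W \<inter> V) \<inter> snd c ` (S \<inter> fst c)) (\<lambda>x. (snd d (f (chart_inv c x)), snd e (g (chart_inv c x))))"
    by (intro smooth_on_Pair smooth_on_subset[OF W(5)] smooth_on_subset[OF V(5)]) auto
  then show "\<exists>c\<in>A. \<exists>D\<in>prod_atlas B C. p \<in> fst c \<and> (f p, g p) \<in> fst D \<and> (\<exists>W. open W \<and> snd c p \<in> W \<and>
       (\<forall>x\<in>W \<inter> snd c ` (S \<inter> fst c). (f (chart_inv c x), g (chart_inv c x)) \<in> fst D) \<and>
       smooth_on (W \<inter> snd c ` (S \<inter> fst c)) (\<lambda>x. snd D (f (chart_inv c x), g (chart_inv c x))))"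
    using c d e W V inS
    by (intro bexI[of _ c] bexI[of _ "prod_chart d e"] conjI exI[of _ "W \<inter> V"])
      (auto simp: prod_chart_in)
qed

lemma smooth_map_snd:
  assumes A: "smooth_atlas A" and B: "smooth_atlas B"
  shows "smooth_map (prod_atlas A B) (points A \<times> points B) B snd"
proof (rule smooth_mapI[OF smooth_atlas_prod[OF A B]])
  fix z assume "z \<in> points A \<times> points B"
  then obtain p q c d where z: "z = (p, q)" "c \<in> A" "d \<in> B" "p \<in> fst c" "q \<in> fst d" by (auto simp: points_iff)
  let ?C = "prod_chart c d" and ?S = "points A \<times> points B"
  have im: "x \<in> (snd c ` fst c) \<times> (snd d ` fst d)" if "x \<in> snd ?C ` (?S \<inter> fst ?C)" for x
    using that by auto
  have "snd (chart_inv ?C x) = chart_inv d (snd x)" "chart_inv d (snd x) \<in> fst d" "snd d (chart_inv d (snd x)) = snd x"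
    if "x \<in> snd ?C ` (?S \<inter> fst ?C)" for x
    using prod_chart_inv[OF A B z(2,3), of "fst x" "snd x"] im[OF that] chart_inv_in[of _ d "fst d"]
      chart_inv_right[of _ d "fst d"] by auto
  note * = this
  have "smooth_on (UNIV \<inter> snd ?C ` (?S \<inter> fst ?C)) (\<lambda>x. snd d (snd (chart_inv ?C x)))"
    by (rule smooth_on_cong[THEN iffD2, OF _ smooth_on_snd[OF smooth_on_ident]]) (use * in simp)
  then show "\<exists>c\<in>prod_atlas A B. \<exists>d\<in>B. z \<in> fst c \<and> snd z \<in> fst d \<and> (\<exists>W. open W \<and> snd c z \<in> W \<and>
       (\<forall>x\<in>W \<inter> snd c ` (points A \<times> points B \<inter> fst c). snd (chart_inv c x) \<in> fst d) \<and>
       smooth_on (W \<inter> snd c ` (points A \<times> points B \<inter> fst c)) (\<lambda>x. snd d (snd (chart_inv c x))))"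
    using z * by (intro bexI[of _ ?C] bexI[of _ d] conjI exI[of _ UNIV]) (auto simp: prod_chart_in)
qed

section \<open>Tangent vectors\<close>

lemma smooth_map_domE:
  assumes "smooth_map A S B f" "p \<in> S" obtains c where "c \<in> A" "p \<in> fst c"
  using smooth_map_points[OF assms] that by (auto simp only: points_iff)

lemma smooth_map_codE:
  assumes "smooth_map A S B f" "p \<in> S" obtains d where "d \<in> B" "f p \<in> fst d"
  using smooth_map_points[OF assms] that by (auto simp only: points_iff)

text \<open>Holds also where the functions are not differentiable: \<open>frechet_derivative\<close>
  is a choice that depends only on which maps are derivatives, and this is a local matter.\<close>

lemma fderiv_cong_open:
  assumes "open W" "x \<in> W" "\<And>y. y \<in> W \<Longrightarrow> f y = g y"
  shows "fderiv f x = fderiv g x"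
proof -
  have "(f has_derivative f') (at x) \<longleftrightarrow> (g has_derivative f') (at x)" for f'
    using has_derivative_transform_within_open[of f f' x UNIV W g] has_derivative_transform_within_open[of g f' x UNIV W f] assms
    by auto
  then show ?thesis by (simp add: frechet_derivative_def)
qed

lemma fderiv_cong_apply:
  "\<lbrakk>open W; x \<in> W; \<And>y. y \<in> W \<Longrightarrow> f y = g y\<rbrakk> \<Longrightarrow> fderiv f x v = fderiv g x v"
  using fderiv_cong_open[of W x f g] by simp

lemma fderiv_compose:
  assumes "f differentiable (at x)" "g differentiable (at (f x))"
  shows "fderiv (\<lambda>x. g (f x)) x v = fderiv g (f x) (fderiv f x v)"
  using frechet_derivative_at[OF has_derivative_compose[OF assms[unfolded frechet_derivative_works]]] by metis

lemma transition_snd: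
  "smooth_atlas A \<Longrightarrow> c \<in> A \<Longrightarrow> p \<in> fst c \<Longrightarrow> transition c d (snd c p) = snd d p"
  by (simp add: transition_def chart_inv_left)

lemma transition_differentiable:
  "\<lbrakk>smooth_atlas A; c \<in> A; d \<in> A; p \<in> fst c; p \<in> fst d\<rbrakk> \<Longrightarrow> transition c d differentiable (at (snd c p))"
  by (rule smooth_on_differentiable[OF smooth_atlasD(2,3)[of A c d]]) auto

lemma transition_chain:
  assumes A: "smooth_atlas A" and c: "c \<in> A" "d \<in> A" "e \<in> A" and p: "p \<in> fst c" "p \<in> fst d" "p \<in> fst e"
  shows "fderiv (transition c e) (snd c p) v = fderiv (transition d e) (snd d p) (fderiv (transition c d) (snd c p) v)"
proof -
  let ?W = "snd c ` (fst c \<inter> fst d) \<inter> snd c ` (fst c \<inter> fst e)"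
  have "fderiv (transition c e) (snd c p) v = fderiv (\<lambda>x. transition d e (transition c d x)) (snd c p) v"
  proof (rule fderiv_cong_apply[of ?W])
    show "open ?W" using smooth_atlasD(2)[OF A c(1)] c by blast
    show "snd c p \<in> ?W" using p by auto
    fix x assume "x \<in> ?W"
    then have "chart_inv c x \<in> fst d"
      using chart_inv_mem[OF A c(1), of x "fst c \<inter> fst d"] by auto
    then show "transition c e x = transition d e (transition c d x)"
      by (simp add: transition_def chart_inv_left[OF A c(2)])
  qed
  also have "\<dots> = fderiv (transition d e) (transition c d (snd c p)) (fderiv (transition c d) (snd c p) v)"
    by (rule fderiv_compose) (use transition_differentiable[OF A] transition_snd[OF A c(1) p(1)] c p in auto)
  finally show ?thesis by (simp add: transition_snd[OF A c(1) p(1)])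
qed

lemma transition_self:
  assumes A: "smooth_atlas A" and c: "c \<in> A" and p: "p \<in> fst c"
  shows "fderiv (transition c c) (snd c p) v = v"
proof -
  have "fderiv (transition c c) (snd c p) = fderiv (\<lambda>x. x) (snd c p)"
    by (rule fderiv_cong_open[OF smooth_atlasD(4)[OF A c]]) (use p chart_inv_right[of _ c "fst c"] in \<open>auto simp: transition_def\<close>)
  then show ?thesis by simp
qed

lemma tangent_spaceD:
  assumes "v \<in> tangent_space A p" "c \<in> A" "p \<in> fst c" "d \<in> A" "p \<in> fst d"
  shows "v d = fderiv (transition c d) (snd c p) (v c)"
  using assms unfolding tangent_space_def by blast

lemma tangent_space_outside: "v \<in> tangent_space A p \<Longrightarrow> \<not> (c \<in> A \<and> p \<in> fst c) \<Longrightarrow> v c = 0"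
  unfolding tangent_space_def by blast

lemma tangent_space_eqI:
  assumes "v \<in> tangent_space A p" "w \<in> tangent_space A p" "c \<in> A" "p \<in> fst c" "v c = w c"
  shows "v = w"
proof
  fix d show "v d = w d"
    using tangent_spaceD[OF assms(1,3,4), of d] tangent_spaceD[OF assms(2,3,4), of d]
      tangent_space_outside[OF assms(1), of d] tangent_space_outside[OF assms(2), of d] assms(5)
    by (cases "d \<in> A \<and> p \<in> fst d") auto
qed

text \<open>By the cocycle identity \<open>transition_chain\<close>, compatibility of all components
  with a single chart implies their mutual compatibility.\<close>

lemma tangent_spaceI:
  assumes A: "smooth_atlas A" and c: "c \<in> A" "p \<in> fst c"
    and v: "\<And>d. d \<in> A \<Longrightarrow> p \<in> fst d \<Longrightarrow> v d = fderiv (transition c d) (snd c p) (v c)"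
      "\<And>d. \<not> (d \<in> A \<and> p \<in> fst d) \<Longrightarrow> v d = 0"
  shows "v \<in> tangent_space A p"
  unfolding tangent_space_def
proof (intro CollectI conjI ballI allI impI)
  fix d e assume de: "d \<in> A" "e \<in> A" "p \<in> fst d \<inter> fst e"
  then show "v e = fderiv (transition d e) (snd d p) (v d)"
    using transition_chain[OF A c(1) de(1,2) c(2), of "v c"] v(1)[of d] v(1)[of e] by simp
qed (rule v)

text \<open>Inverse of the coordinate isomorphism \<open>v \<mapsto> v c\<close> from
  \<open>tangent_space A p\<close> onto the model space.\<close>

definition tvec :: "('a, 'e::model_space) atlas \<Rightarrow> ('a, 'e) chart \<Rightarrow> 'a \<Rightarrow> 'e \<Rightarrow> ('a, 'e) tvec" where
  "tvec A c p e = (\<lambda>d. if d \<in> A \<and> p \<in> fst d then fderiv (transition c d) (snd c p) e else 0)"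

lemma tvec_apply:
  "\<lbrakk>smooth_atlas A; c \<in> A; p \<in> fst c\<rbrakk> \<Longrightarrow> tvec A c p e c = e"
  by (simp add: tvec_def transition_self)

lemma tvec_in: "\<lbrakk>smooth_atlas A; c \<in> A; p \<in> fst c\<rbrakk> \<Longrightarrow> tvec A c p e \<in> tangent_space A p"
  by (rule tangent_spaceI[of A c]) (auto simp: tvec_def transition_self)

lemma tvec_eq: "\<lbrakk>smooth_atlas A; c \<in> A; p \<in> fst c; v \<in> tangent_space A p\<rbrakk> \<Longrightarrow> tvec A c p (v c) = v"
  by (rule tangent_space_eqI[OF tvec_in _ _ _ tvec_apply]) auto

lemma tangent_space_subspace:
  assumes A: "smooth_atlas A" and p: "p \<in> points A"
  shows "0 \<in> tangent_space A p"
    "\<lbrakk>v \<in> tangent_space A p; w \<in> tangent_space A p\<rbrakk> \<Longrightarrow> v + w \<in> tangent_space A p"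
    "\<lbrakk>v \<in> tangent_space A p; w \<in> tangent_space A p\<rbrakk> \<Longrightarrow> v - w \<in> tangent_space A p"
    "v \<in> tangent_space A p \<Longrightarrow> tscale r v \<in> tangent_space A p"
proof -
  have lin: "linear (fderiv (transition c d) (snd c p))" if "c \<in> A" "d \<in> A" "p \<in> fst c" "p \<in> fst d" for c d
    using transition_differentiable[OF A that] by (rule linear_fderiv)
  obtain c where c: "c \<in> A" "p \<in> fst c" using p by (auto simp: points_iff)
  show "0 \<in> tangent_space A p"
    by (rule tangent_spaceI[OF A c]) (auto simp: linear_0[OF lin[OF c(1) _ c(2)]])
  show "v + w \<in> tangent_space A p" if "v \<in> tangent_space A p" "w \<in> tangent_space A p"
    by (rule tangent_spaceI[OF A c]) (use tangent_spaceD[OF that(1) c] tangent_spaceD[OF that(2) c]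
        tangent_space_outside[OF that(1)] tangent_space_outside[OF that(2)] in
        \<open>auto simp: linear_add[OF lin[OF c(1) _ c(2)]]\<close>)
  show "v - w \<in> tangent_space A p" if "v \<in> tangent_space A p" "w \<in> tangent_space A p"
    by (rule tangent_spaceI[OF A c]) (use tangent_spaceD[OF that(1) c] tangent_spaceD[OF that(2) c]
        tangent_space_outside[OF that(1)] tangent_space_outside[OF that(2)] in
        \<open>auto simp: linear_diff[OF lin[OF c(1) _ c(2)]]\<close>)
  show "tscale r v \<in> tangent_space A p" if "v \<in> tangent_space A p"
    by (rule tangent_spaceI[OF A c]) (use tangent_spaceD[OF that c] tangent_space_outside[OF that] in
        \<open>auto simp: tscale_def linear_scale[OF lin[OF c(1) _ c(2)]]\<close>)
qed

subsection \<open>The tangent bundle\<close>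

lemma tangent_chart_simps [simp]:
  "(p, v) \<in> fst (tangent_chart A c) \<longleftrightarrow> p \<in> fst c \<and> v \<in> tangent_space A p"
  "snd (tangent_chart A c) (p, v) = (snd c p, v c)"
  by (auto simp: tangent_chart_def)

lemma tangent_chart_mem: "Z \<in> fst (tangent_chart A c) \<longleftrightarrow> fst Z \<in> fst c \<and> snd Z \<in> tangent_space A (fst Z)"
  by (cases Z) simp

lemma snd_tangent_chart: "snd (tangent_chart A c) Z = (snd c (fst Z), snd Z c)"
  by (cases Z) simp

lemma tangent_chart_in: "c \<in> A \<Longrightarrow> tangent_chart A c \<in> tangent_atlas A"
  by (simp add: tangent_atlas_def)

lemma zero_in_tangent_space: "smooth_atlas A \<Longrightarrow> 0 \<in> tangent_space A p"
  by (cases "p \<in> points A") (auto simp: tangent_space_subspace(1), auto simp: tangent_space_def points_iff)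

text \<open>\<open>canonical_flip\<close> recovers \<open>c\<close> from its induced chart by
  \<open>the_inv_into\<close>, which requires this injectivity. The zero family is a tangent vector
  at every \<open>p\<close>, so the domain of \<open>c\<close> can be read off from that of the
  induced chart.\<close>

lemma tangent_chart_inj:
  assumes A: "smooth_atlas A" and eq: "tangent_chart A c = tangent_chart A d" shows "c = d"
proof (rule prod_eqI)
  have "snd (tangent_chart A c) (p, v) = snd (tangent_chart A d) (p, v)" for p v using eq by simp
  then show "snd c = snd d" by (auto simp: fun_eq_iff)
  have "(p, 0) \<in> fst (tangent_chart A c) \<longleftrightarrow> (p, 0) \<in> fst (tangent_chart A d)" for p using eq by simp
  then show "fst c = fst d" by (auto simp: zero_in_tangent_space[OF A])
qed

lemma tangent_chart_overlap:
  assumes A: "smooth_atlas A" and c: "c \<in> A"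
  shows "snd (tangent_chart A c) ` (fst (tangent_chart A c) \<inter> fst (tangent_chart A d))
    = snd c ` (fst c \<inter> fst d) \<times> UNIV"
proof (intro equalityI subsetI)
  fix z :: "'b \<times> 'b" assume "z \<in> snd c ` (fst c \<inter> fst d) \<times> UNIV"
  then obtain p e where "p \<in> fst c" "p \<in> fst d" "z = (snd c p, e)" by auto
  then show "z \<in> snd (tangent_chart A c) ` (fst (tangent_chart A c) \<inter> fst (tangent_chart A d))"
    using tvec_in[OF A c] tvec_apply[OF A c] by (intro image_eqI[of _ _ "(p, tvec A c p e)"]) auto
qed auto

lemma tangent_chart_inv:
  assumes A: "smooth_atlas A" and c: "c \<in> A" and x: "x \<in> snd c ` fst c"
  shows "chart_inv (tangent_chart A c) (x, e) = (chart_inv c x, tvec A c (chart_inv c x) e)"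
proof -
  have inj: "inj_on (snd (tangent_chart A c)) (fst (tangent_chart A c))"
  proof (rule inj_onI, clarify)
    fix p v q w assume *: "(p, v) \<in> fst (tangent_chart A c)" "(q, w) \<in> fst (tangent_chart A c)"
      "snd (tangent_chart A c) (p, v) = snd (tangent_chart A c) (q, w)"
    then have "p = q" using smooth_atlasD(1)[OF A c] by (auto dest: inj_onD)
    then show "p = q \<and> v = w" using * tangent_space_eqI[of v A p w c] c by auto
  qed
  let ?p = "chart_inv c x"
  have p: "?p \<in> fst c" "snd c ?p = x" using chart_inv_in[OF x] chart_inv_right[OF x] by auto
  have "chart_inv (tangent_chart A c) (snd (tangent_chart A c) (?p, tvec A c ?p e)) = (?p, tvec A c ?p e)"
    unfolding chart_inv_def[of "tangent_chart A c"] using p tvec_in[OF A c] by (intro inv_into_f_f inj) auto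
  then show ?thesis using p tvec_apply[OF A c] by simp
qed

lemma smooth_atlas_tangent:
  assumes A: "smooth_atlas A" shows "smooth_atlas (tangent_atlas A)"
  unfolding smooth_atlas_def
proof (intro conjI ballI)
  fix C assume "C \<in> tangent_atlas A"
  then obtain c where c: "c \<in> A" "C = tangent_chart A c" by (auto simp: tangent_atlas_def)
  show "inj_on (snd C) (fst C)" unfolding c
  proof (rule inj_onI, clarify)
    fix p v q w assume *: "(p, v) \<in> fst (tangent_chart A c)" "(q, w) \<in> fst (tangent_chart A c)"
      "snd (tangent_chart A c) (p, v) = snd (tangent_chart A c) (q, w)"
    then have "p = q" using smooth_atlasD(1)[OF A c(1)] by (auto dest: inj_onD)
    then show "p = q \<and> v = w" using * tangent_space_eqI[of v A p w c] c by auto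
  qed
  fix D assume "D \<in> tangent_atlas A"
  then obtain d where d: "d \<in> A" "D = tangent_chart A d" by (auto simp: tangent_atlas_def)
  let ?W = "snd c ` (fst c \<inter> fst d)"
  have W: "open ?W" "smooth_on ?W (transition c d)" using smooth_atlasD(2,3)[OF A c(1) d(1)] .
  show "open (snd C ` (fst C \<inter> fst D))" unfolding c d tangent_chart_overlap[OF A c(1)]
    using W(1) by (intro open_Times) auto
  show "smooth_on (snd C ` (fst C \<inter> fst D)) (transition C D)"
    unfolding c d tangent_chart_overlap[OF A c(1)]
  proof (rule smooth_on_cong[THEN iffD2])
    show "smooth_on (?W \<times> UNIV) (\<lambda>z. (transition c d (fst z), fderiv (transition c d) (fst z) (snd z)))"
      by (intro smooth_on_Pair smooth_on_compose[OF W(2)] smooth_on_fderiv_apply[OF W]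
          smooth_on_fst smooth_on_snd smooth_on_ident) auto
    fix z :: "'b \<times> 'b" assume "z \<in> ?W \<times> UNIV"
    then obtain x e where z: "z = (x, e)" "x \<in> ?W" by auto
    then have x: "x \<in> snd c ` fst c" by auto
    have "chart_inv c x \<in> fst d" using chart_inv_mem[OF A c(1) z(2)] by auto
    then show "transition (tangent_chart A c) (tangent_chart A d) z
        = (transition c d (fst z), fderiv (transition c d) (fst z) (snd z))"
      unfolding z(1) transition_def[of "tangent_chart A c"] tangent_chart_inv[OF A c(1) x]
      using d(1) chart_inv_right[OF x] by (simp add: transition_def[of c d] tvec_def)
  qed
qed

lemma points_tangent:
  "Z \<in> points (tangent_atlas A) \<longleftrightarrow> fst Z \<in> points A \<and> snd Z \<in> tangent_space A (fst Z)"
  by (auto simp: points_iff tangent_atlas_def tangent_chart_mem)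

subsection \<open>Differentials\<close>

lemma coord_differentiable:
  assumes A: "smooth_atlas A" and B: "smooth_atlas B" and f: "smooth_map A S B f" and S: "atlas_open A S"
    and p: "p \<in> S" and c: "c \<in> A" "p \<in> fst c" and d: "d \<in> B" "f p \<in> fst d"
  shows "(\<lambda>x. snd d (f (chart_inv c x))) differentiable (at (snd c p))"
  by (rule smooth_map_openE[OF A B f S p c d]) (rule smooth_on_differentiable)

text \<open>\<open>differential\<close> computes in one chosen chart \<open>c0\<close>. The
  transition from \<open>c\<close> to \<open>c0\<close> and the chain rule show that every chart
  gives the same result.\<close>

lemma differential_chart:
  assumes A: "smooth_atlas A" and B: "smooth_atlas B" and f: "smooth_map A S B f" and S: "atlas_open A S"
    and p: "p \<in> S" and c: "c \<in> A" "p \<in> fst c" and d: "d \<in> B" "f p \<in> fst d" and v: "v \<in> tangent_space A p"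
  shows "differential A B f p v d = fderiv (\<lambda>x. snd d (f (chart_inv c x))) (snd c p) (v c)"
proof -
  define c0 where "c0 = (SOME c. c \<in> A \<and> p \<in> fst c)"
  have c0: "c0 \<in> A" "p \<in> fst c0" using someI[of "\<lambda>c. c \<in> A \<and> p \<in> fst c" c] c by (auto simp: c0_def)
  let ?g = "\<lambda>c x. snd d (f (chart_inv c x))"
  have "fderiv (?g c) (snd c p) (v c) = fderiv (\<lambda>x. ?g c0 (transition c c0 x)) (snd c p) (v c)"
  proof (rule fderiv_cong_apply[OF smooth_atlasD(2)[OF A c(1) c0(1)]])
    show "snd c p \<in> snd c ` (fst c \<inter> fst c0)" using c c0 by auto
    fix x assume "x \<in> snd c ` (fst c \<inter> fst c0)"
    then have "chart_inv c x \<in> fst c0" using chart_inv_mem[OF A c(1)] by fastforce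
    then show "?g c x = ?g c0 (transition c c0 x)" by (simp add: transition_def chart_inv_left[OF A c0(1)])
  qed
  also have "\<dots> = fderiv (?g c0) (transition c c0 (snd c p)) (fderiv (transition c c0) (snd c p) (v c))"
    by (rule fderiv_compose)
      (use transition_differentiable[OF A c(1) c0(1) c(2) c0(2)] transition_snd[OF A c]
        coord_differentiable[OF A B f S p c0 d] in auto)
  also have "\<dots> = fderiv (?g c0) (snd c0 p) (v c0)"
    using tangent_spaceD[OF v c c0] transition_snd[OF A c] by simp
  finally show ?thesis using d by (simp add: differential_def c0_def Let_def)
qed

lemma differential_outside: "\<not> (d \<in> B \<and> f p \<in> fst d) \<Longrightarrow> differential A B f p v d = 0"
  unfolding differential_def by (rule if_not_P)

lemma differential_in:
  assumes A: "smooth_atlas A" and B: "smooth_atlas B" and f: "smooth_map A S B f" and S: "atlas_open A S"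
    and p: "p \<in> S" and v: "v \<in> tangent_space A p"
  shows "differential A B f p v \<in> tangent_space B (f p)"
proof -
  obtain c where c: "c \<in> A" "p \<in> fst c" by (rule smooth_map_domE[OF f p], rule that)
  obtain e where e: "e \<in> B" "f p \<in> fst e" by (rule smooth_map_codE[OF f p], rule that)
  show ?thesis
  proof (rule tangent_spaceI[OF B e])
    fix d assume d: "d \<in> B" "f p \<in> fst d"
    obtain W where W: "open W" "snd c p \<in> W" "W \<subseteq> snd c ` (S \<inter> fst c)"
      "\<forall>x\<in>W. f (chart_inv c x) \<in> fst e" "smooth_on W (\<lambda>x. snd e (f (chart_inv c x)))"
      by (rule smooth_map_openE[OF A B f S p c e], rule that)
    have "fderiv (\<lambda>x. snd d (f (chart_inv c x))) (snd c p) (v c)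
        = fderiv (\<lambda>x. transition e d (snd e (f (chart_inv c x)))) (snd c p) (v c)"
      by (rule fderiv_cong_apply[OF W(1,2)]) (use W(4) transition_snd[OF B e(1)] in auto)
    also have "\<dots> = fderiv (transition e d) (snd e (f p)) (fderiv (\<lambda>x. snd e (f (chart_inv c x))) (snd c p) (v c))"
      using fderiv_compose[OF coord_differentiable[OF A B f S p c e], of "transition e d"]
        transition_differentiable[OF B e(1) d(1) e(2) d(2)] by (simp add: chart_inv_left[OF A c])
    finally show "differential A B f p v d = fderiv (transition e d) (snd e (f p)) (differential A B f p v e)"
      by (simp add: differential_chart[OF A B f S p c d v] differential_chart[OF A B f S p c e v])
  qed (rule differential_outside)
qed

lemma differential_compose:
  assumes A: "smooth_atlas A" and B: "smooth_atlas B" and C: "smooth_atlas C"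
    and f: "smooth_map A S B f" and S: "atlas_open A S" and g: "smooth_map B T C g" and T: "atlas_open B T"
    and p: "p \<in> S" "f p \<in> T" and v: "v \<in> tangent_space A p"
  shows "differential A C (\<lambda>p. g (f p)) p v = differential B C g (f p) (differential A B f p v)"
proof
  fix e
  let ?S = "{q \<in> S. f q \<in> T}"
  have S': "atlas_open A ?S" by (rule atlas_open_vimage[OF A B f S T])
  have gf: "smooth_map A ?S C (\<lambda>p. g (f p))"
    by (rule smooth_map_compose[OF A B C smooth_map_subset[OF f] g]) auto
  show "differential A C (\<lambda>p. g (f p)) p v e = differential B C g (f p) (differential A B f p v) e"
  proof (cases "e \<in> C \<and> g (f p) \<in> fst e")
    case True
    then have e: "e \<in> C" "g (f p) \<in> fst e" by auto
    obtain c where c: "c \<in> A" "p \<in> fst c" by (rule smooth_map_domE[OF f p(1)], rule that)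
    obtain d where d: "d \<in> B" "f p \<in> fst d" by (rule smooth_map_codE[OF f p(1)], rule that)
    obtain W where W: "open W" "snd c p \<in> W" "W \<subseteq> snd c ` (S \<inter> fst c)"
      "\<forall>x\<in>W. f (chart_inv c x) \<in> fst d" "smooth_on W (\<lambda>x. snd d (f (chart_inv c x)))"
      by (rule smooth_map_openE[OF A B f S p(1) c d], rule that)
    have "fderiv (\<lambda>x. snd e (g (f (chart_inv c x)))) (snd c p) (v c)
        = fderiv (\<lambda>x. (\<lambda>y. snd e (g (chart_inv d y))) (snd d (f (chart_inv c x)))) (snd c p) (v c)"
      by (rule fderiv_cong_apply[OF W(1,2)]) (use W(4) chart_inv_left[OF B d(1)] in auto)
    also have "\<dots> = fderiv (\<lambda>y. snd e (g (chart_inv d y))) (snd d (f p))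
        (fderiv (\<lambda>x. snd d (f (chart_inv c x))) (snd c p) (v c))"
      using fderiv_compose[OF coord_differentiable[OF A B f S p(1) c d], of "\<lambda>y. snd e (g (chart_inv d y))"]
        coord_differentiable[OF B C g T p(2) d e] by (simp add: chart_inv_left[OF A c])
    finally show ?thesis
      using p by (simp add: differential_chart[OF A C gf S' _ c e v] differential_chart[OF A B f S p(1) c d v]
          differential_chart[OF B C g T p(2) d e differential_in[OF A B f S p(1) v]])
  qed (auto simp: differential_outside)
qed

lemma differential_linear:
  assumes A: "smooth_atlas A" and B: "smooth_atlas B" and f: "smooth_map A S B f" and S: "atlas_open A S"
    and p: "p \<in> S" and v: "v \<in> tangent_space A p" "w \<in> tangent_space A p"
  shows "differential A B f p (v + w) = differential A B f p v + differential A B f p w"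
    "differential A B f p (v - w) = differential A B f p v - differential A B f p w"
    "differential A B f p (tscale r v) = tscale r (differential A B f p v)"
proof -
  obtain c where c: "c \<in> A" "p \<in> fst c" by (rule smooth_map_domE[OF f p], rule that)
  have pA: "p \<in> points A" using smooth_map_points[OF f p] by simp
  note sub = tangent_space_subspace[OF A pA]
  have lin: "linear (fderiv (\<lambda>x. snd d (f (chart_inv c x))) (snd c p))" if "d \<in> B" "f p \<in> fst d" for d
    using coord_differentiable[OF A B f S p c that] by (rule linear_fderiv)
  note * = differential_chart[OF A B f S p c]
  show "differential A B f p (v + w) = differential A B f p v + differential A B f p w"
  proof
    fix d show "differential A B f p (v + w) d = (differential A B f p v + differential A B f p w) d"
      using *[of d] lin[of d] v sub(2)[OF v] differential_outside[of d B f p A]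
      by (cases "d \<in> B \<and> f p \<in> fst d") (simp_all add: linear_add)
  qed
  show "differential A B f p (v - w) = differential A B f p v - differential A B f p w"
  proof
    fix d show "differential A B f p (v - w) d = (differential A B f p v - differential A B f p w) d"
      using *[of d] lin[of d] v sub(3)[OF v] differential_outside[of d B f p A]
      by (cases "d \<in> B \<and> f p \<in> fst d") (simp_all add: linear_diff)
  qed
  show "differential A B f p (tscale r v) = tscale r (differential A B f p v)"
  proof
    fix d show "differential A B f p (tscale r v) d = tscale r (differential A B f p v) d"
      using *[of d] lin[of d] v sub(4)[OF v(1), of r] differential_outside[of d B f p A]
      by (cases "d \<in> B \<and> f p \<in> fst d") (simp_all add: linear_scale tscale_def)
  qed
qed

text \<open>The definition sees only the germ of the map at \<open>p\<close>, so maps can be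
  rewritten under \<open>differential\<close> before their smoothness is discussed.\<close>

lemma differential_cong:
  assumes A: "smooth_atlas A" and S: "atlas_open A S" and p: "p \<in> S" and eq: "\<And>q. q \<in> S \<Longrightarrow> f q = g q"
  shows "differential A B f p = differential A B g p"
proof (intro ext)
  fix v and d :: "('c, 'd) chart"
  define c0 where "c0 = (SOME c. c \<in> A \<and> p \<in> fst c)"
  have "p \<in> points A" using S p by (auto simp: atlas_open_def)
  then obtain c where "c \<in> A" "p \<in> fst c" by (auto simp: points_iff)
  then have c0: "c0 \<in> A" "p \<in> fst c0" using someI[of "\<lambda>c. c \<in> A \<and> p \<in> fst c" c] by (auto simp: c0_def)
  have "fderiv (\<lambda>x. snd d (f (chart_inv c0 x))) (snd c0 p) = fderiv (\<lambda>x. snd d (g (chart_inv c0 x))) (snd c0 p)"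
  proof (rule fderiv_cong_open)
    show "open (snd c0 ` (S \<inter> fst c0))" using S c0 by (auto simp: atlas_open_def)
    show "snd c0 p \<in> snd c0 ` (S \<inter> fst c0)" using c0 p by auto
    fix x assume "x \<in> snd c0 ` (S \<inter> fst c0)"
    then have "chart_inv c0 x \<in> S" using chart_inv_mem[OF A c0(1), of x "S \<inter> fst c0"] by auto
    then show "snd d (f (chart_inv c0 x)) = snd d (g (chart_inv c0 x))" using eq by simp
  qed
  then show "differential A B f p v d = differential A B g p v d"
    using eq[OF p] by (simp add: differential_def Let_def c0_def[symmetric])
qed

lemma differential_ident:
  assumes A: "smooth_atlas A" and v: "v \<in> tangent_space A p" and p: "p \<in> points A"
  shows "differential A A (\<lambda>p. p) p v = v"
proof
  fix d
  show "differential A A (\<lambda>p. p) p v d = v d"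
  proof (cases "d \<in> A \<and> p \<in> fst d")
    case True
    then have d: "d \<in> A" "p \<in> fst d" by auto
    have "differential A A (\<lambda>p. p) p v d = fderiv (transition d d) (snd d p) (v d)"
      using differential_chart[OF A A smooth_map_ident[OF A order_refl] atlas_open_points[OF A] p d d v]
      by (simp add: transition_def[abs_def])
    then show ?thesis by (simp add: transition_self[OF A d])
  qed (use tangent_space_outside[OF v] in \<open>auto simp: differential_outside\<close>)
qed

lemma differential_const: "differential A B (\<lambda>p. b) p v = 0"
  by (auto simp: differential_def Let_def fun_eq_iff)

subsection \<open>Velocities\<close>

lemma at_within_Int_open: "open W \<Longrightarrow> t \<in> W \<Longrightarrow> at t within (W \<inter> J) = at t within J"
  by (rule at_within_nhd[of t W]) auto

lemma at_within_open_neq_bot: "open J \<Longrightarrow> t \<in> J \<Longrightarrow> at t within J \<noteq> (bot :: real filter)"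
  using at_within_open[of t J] by (simp only: at_neq_bot not_False_eq_True)

lemma velocity_has_derivative:
  assumes A: "smooth_atlas A" and g: "smooth_map model_atlas J A \<gamma>" and t: "t \<in> J" and c: "c \<in> A" "\<gamma> t \<in> fst c"
  shows "((\<lambda>s. snd c (\<gamma> s)) has_vector_derivative velocity A J \<gamma> t c) (at t within J)"
proof -
  obtain W where W: "open W" "t \<in> W" "\<forall>s\<in>W \<inter> J. \<gamma> s \<in> fst c" "smooth_on (W \<inter> J) (\<lambda>s. snd c (\<gamma> s))"
    by (rule smooth_curveE[OF A g t c], rule that)
  have "((\<lambda>s. snd c (\<gamma> s)) has_vector_derivative vector_derivative (\<lambda>s. snd c (\<gamma> s)) (at t within W \<inter> J)) (at t within W \<inter> J)"
    by (rule smooth_on_has_vector_derivative[OF W(4)]) (use t W in auto)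
  then show ?thesis using c by (simp add: velocity_def at_within_Int_open[OF W(1,2)])
qed

lemma velocity_eqI:
  assumes "((\<lambda>s. snd c (\<gamma> s)) has_vector_derivative v) (at t within J)" "at t within J \<noteq> bot" "c \<in> A" "\<gamma> t \<in> fst c"
  shows "velocity A J \<gamma> t c = v"
  using assms by (simp add: velocity_def vector_derivative_within)

lemma velocity_outside: "\<not> (c \<in> A \<and> \<gamma> t \<in> fst c) \<Longrightarrow> velocity A J \<gamma> t c = 0"
  unfolding velocity_def by (rule if_not_P)

text \<open>A chain rule that covers one-sided velocities as well: it suffices that \<open>t\<close>
  is a limit point of \<open>J\<close>.\<close>

lemma velocity_compose:
  assumes A: "smooth_atlas A" and B: "smooth_atlas B" and g: "smooth_map model_atlas J A \<gamma>"
    and f: "smooth_map A S B f" and S: "atlas_open A S" and t: "t \<in> J" "\<gamma> t \<in> S" "at t within J \<noteq> bot"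
    and v: "velocity A J \<gamma> t \<in> tangent_space A (\<gamma> t)"
  shows "velocity B J (\<lambda>s. f (\<gamma> s)) t = differential A B f (\<gamma> t) (velocity A J \<gamma> t)"
proof
  fix e
  show "velocity B J (\<lambda>s. f (\<gamma> s)) t e = differential A B f (\<gamma> t) (velocity A J \<gamma> t) e"
  proof (cases "e \<in> B \<and> f (\<gamma> t) \<in> fst e")
    case True
    then have e: "e \<in> B" "f (\<gamma> t) \<in> fst e" by auto
    obtain c where c: "c \<in> A" "\<gamma> t \<in> fst c" by (rule smooth_map_codE[OF g t(1)], rule that)
    obtain W where W: "open W" "t \<in> W" "\<forall>s\<in>W \<inter> J. \<gamma> s \<in> fst c" "smooth_on (W \<inter> J) (\<lambda>s. snd c (\<gamma> s))"
      by (rule smooth_curveE[OF A g t(1) c], rule that)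
    let ?f = "\<lambda>x. snd e (f (chart_inv c x))"
    have "((?f \<circ> (\<lambda>s. snd c (\<gamma> s))) has_vector_derivative fderiv ?f (snd c (\<gamma> t)) (velocity A J \<gamma> t c)) (at t within J)"
      using coord_differentiable[OF A B f S t(2) c e] frechet_derivative_works
      by (intro vector_derivative_diff_chain_within velocity_has_derivative[OF A g t(1) c])
        (blast intro: has_derivative_at_withinI)
    moreover have "\<forall>\<^sub>F s in at t within J. (?f \<circ> (\<lambda>s. snd c (\<gamma> s))) s = snd e (f (\<gamma> s))"
      unfolding eventually_at_topological
      by (intro exI[of _ W]) (use W chart_inv_left[OF A c(1)] in auto)
    ultimately have "((\<lambda>s. snd e (f (\<gamma> s))) has_vector_derivative fderiv ?f (snd c (\<gamma> t)) (velocity A J \<gamma> t c)) (at t within J)"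
      unfolding has_vector_derivative_def
      by (rule has_derivative_transform_eventually) (simp_all add: chart_inv_left[OF A c] t)
    from velocity_eqI[OF this t(3) e] show ?thesis by (simp add: differential_chart[OF A B f S t(2) c e v])
  qed (auto simp: differential_outside velocity_outside)
qed

lemma velocity_in:
  assumes A: "smooth_atlas A" and g: "smooth_map model_atlas J A \<gamma>" and t: "t \<in> J" "at t within J \<noteq> bot"
  shows "velocity A J \<gamma> t \<in> tangent_space A (\<gamma> t)"
proof -
  obtain c where c: "c \<in> A" "\<gamma> t \<in> fst c" by (rule smooth_map_codE[OF g t(1)], rule that)
  obtain W where W: "open W" "t \<in> W" "\<forall>s\<in>W \<inter> J. \<gamma> s \<in> fst c" "smooth_on (W \<inter> J) (\<lambda>s. snd c (\<gamma> s))"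
    by (rule smooth_curveE[OF A g t(1) c], rule that)
  show ?thesis
  proof (rule tangent_spaceI[OF A c])
    fix d assume d: "d \<in> A" "\<gamma> t \<in> fst d"
    have "((transition c d \<circ> (\<lambda>s. snd c (\<gamma> s))) has_vector_derivative
        fderiv (transition c d) (snd c (\<gamma> t)) (velocity A J \<gamma> t c)) (at t within J)"
      using transition_differentiable[OF A c(1) d(1) c(2) d(2)] frechet_derivative_works
      by (intro vector_derivative_diff_chain_within velocity_has_derivative[OF A g t(1) c])
        (blast intro: has_derivative_at_withinI)
    moreover have "\<forall>\<^sub>F s in at t within J. (transition c d \<circ> (\<lambda>s. snd c (\<gamma> s))) s = snd d (\<gamma> s)"
      unfolding eventually_at_topological
      by (intro exI[of _ W]) (use W transition_snd[OF A c(1)] in auto)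
    ultimately have "((\<lambda>s. snd d (\<gamma> s)) has_vector_derivative
        fderiv (transition c d) (snd c (\<gamma> t)) (velocity A J \<gamma> t c)) (at t within J)"
      unfolding has_vector_derivative_def
      by (rule has_derivative_transform_eventually) (simp_all add: transition_snd[OF A c] t)
    from velocity_eqI[OF this t(2) d]
    show "velocity A J \<gamma> t d = fderiv (transition c d) (snd c (\<gamma> t)) (velocity A J \<gamma> t c)" .
  qed (rule velocity_outside)
qed

lemma velocity_open: "open J \<Longrightarrow> t \<in> J \<Longrightarrow> velocity A J \<gamma> t = velocity A UNIV \<gamma> t"
  using at_within_open[of t J] unfolding velocity_def by (simp only:)

lemma smooth_map_chart_inv:
  assumes A: "smooth_atlas A" and c: "c \<in> A" and x: "smooth_on I x" "\<And>s. s \<in> I \<Longrightarrow> x s \<in> snd c ` fst c"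
  shows "smooth_map model_atlas I A (\<lambda>s. chart_inv c (x s))"
proof (rule smooth_curveI)
  fix s assume "s \<in> I"
  then have 1: "chart_inv c (x s) \<in> fst c" "snd c (chart_inv c (x s)) = x s" if "s \<in> I" for s
    using chart_inv_in[OF x(2)[OF that]] chart_inv_right[OF x(2)[OF that]] by auto
  have "smooth_on (UNIV \<inter> I) (\<lambda>s. snd c (chart_inv c (x s)))"
    by (rule smooth_on_cong[THEN iffD2, of _ _ x]) (use 1 x in auto)
  then show "\<exists>d\<in>A. chart_inv c (x s) \<in> fst d \<and> (\<exists>W. open W \<and> s \<in> W \<and>
      (\<forall>x'\<in>W \<inter> I. chart_inv c (x x') \<in> fst d) \<and> smooth_on (W \<inter> I) (\<lambda>s. snd d (chart_inv c (x s))))"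
    using c 1 \<open>s \<in> I\<close> by (intro bexI[of _ c] conjI exI[of _ UNIV]) auto
qed

text \<open>A straight segment in a chart, kept inside \<open>S\<close> by a small \<epsilon>. It
  lets identities between differentials be derived from identities between velocities.\<close>

lemma tangent_vector_curve:
  assumes A: "smooth_atlas A" and S: "atlas_open A S" and p: "p \<in> S" and v: "v \<in> tangent_space A p"
  shows "\<exists>\<epsilon>>0. \<exists>\<gamma>. smooth_map model_atlas {-\<epsilon><..<\<epsilon>} A \<gamma> \<and> \<gamma> 0 = p \<and> (\<forall>s\<in>{-\<epsilon><..<\<epsilon>}. \<gamma> s \<in> S) \<and>
    velocity A {-\<epsilon><..<\<epsilon>} \<gamma> 0 = v"
proof -
  obtain c where c: "c \<in> A" "p \<in> fst c" using S p unfolding atlas_open_def by (metis points_iff subsetD)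
  define x :: "real \<Rightarrow> 'b"  where "x = (\<lambda>s. snd c p + s *\<^sub>R v c)"
  let ?W = "snd c ` (S \<inter> fst c)"
  have "open ?W" using S c by (auto simp: atlas_open_def)
  moreover have "continuous_on UNIV x" unfolding x_def by (intro continuous_intros)
  ultimately have "open (x -` ?W)" by (simp add: open_vimage)
  moreover have "0 \<in> x -` ?W" using c p by (auto simp: x_def)
  ultimately obtain \<epsilon> where e: "\<epsilon> > 0" "ball 0 \<epsilon> \<subseteq> x -` ?W" using open_contains_ball by blast
  let ?I = "{-\<epsilon><..<\<epsilon>}"
  have I: "x s \<in> ?W" if "s \<in> ?I" for s using e(2) that by (auto simp: subset_eq dist_real_def)
  define \<gamma> where "\<gamma> = (\<lambda>s. chart_inv c (x s))"
  have g: "\<gamma> s \<in> S \<inter> fst c" "snd c (\<gamma> s) = x s" if "s \<in> ?I" for s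
    using chart_inv_mem[OF A c(1) I[OF that]] chart_inv_right[OF I[OF that]] by (auto simp: \<gamma>_def)
  have g0: "\<gamma> 0 = p" using chart_inv_left[OF A c] by (simp add: \<gamma>_def x_def)
  have sm: "smooth_map model_atlas ?I A \<gamma>" unfolding \<gamma>_def
  proof (rule smooth_map_chart_inv[OF A c(1)])
    show "smooth_on ?I x" unfolding x_def
      by (intro smooth_on_add smooth_on_scaleR smooth_on_ident smooth_on_const)
    show "x s \<in> snd c ` fst c" if "s \<in> ?I" for s using I[OF that] by blast
  qed
  have nb: "at 0 within ?I \<noteq> bot" using e(1) by (intro at_within_open_neq_bot) auto
  have "(x has_vector_derivative v c) (at 0)" unfolding x_def by (auto intro!: derivative_eq_intros)
  then have "((\<lambda>s. snd c (\<gamma> s)) has_vector_derivative v c) (at 0)"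
    by (rule has_vector_derivative_transform_within_open[of _ _ _ ?I]) (use e g in auto)
  then have "velocity A ?I \<gamma> 0 c = v c"
    using g0 c by (intro velocity_eqI[where \<gamma> = \<gamma>, OF _ nb]) (auto intro: has_vector_derivative_at_within)
  then have "velocity A ?I \<gamma> 0 = v"
    using tangent_space_eqI[of "velocity A ?I \<gamma> 0" A p v c] velocity_in[OF A sm _ nb] e(1) g0 v c by simp
  with e(1) sm g0 g(1) show ?thesis by (intro exI[of _ \<epsilon>] conjI exI[of _ \<gamma>]) auto
qed

subsection \<open>Maps of two variables\<close>

lemma smooth_map_partial:
  assumes B: "smooth_atlas B" and C: "smooth_atlas C" and E: "smooth_atlas E"
    and F: "smooth_map (prod_atlas B C) (S \<times> T) E F"
  shows "S \<subseteq> points B \<Longrightarrow> c \<in> T \<Longrightarrow> c \<in> points C \<Longrightarrow> smooth_map B S E (\<lambda>b. F (b, c))"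
    "T \<subseteq> points C \<Longrightarrow> b \<in> S \<Longrightarrow> b \<in> points B \<Longrightarrow> smooth_map C T E (\<lambda>c. F (b, c))"
proof -
  show "smooth_map B S E (\<lambda>b. F (b, c))" if "S \<subseteq> points B" "c \<in> T" "c \<in> points C"
    by (rule smooth_map_compose[OF B smooth_atlas_prod[OF B C] E smooth_map_Pair[OF B B C
            smooth_map_ident[OF B that(1)] smooth_map_const[OF B that(1,3)]] F]) (use that in auto)
  show "smooth_map C T E (\<lambda>c. F (b, c))" if "T \<subseteq> points C" "b \<in> S" "b \<in> points B"
    by (rule smooth_map_compose[OF C smooth_atlas_prod[OF B C] E smooth_map_Pair[OF C B C
            smooth_map_const[OF C that(1,3)] smooth_map_ident[OF C that(1)]] F]) (use that in auto)
qed

lemma fderiv_partial: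
  assumes W: "open W" "smooth_on W f" "(x, y) \<in> W"
  shows "fderiv (\<lambda>x'. f (x', y)) x u = fderiv f (x, y) (u, 0)"
    "fderiv (\<lambda>y'. f (x, y')) y w = fderiv f (x, y) (0, w)"
proof -
  note D = smooth_on_has_derivative[OF W]
  have "((\<lambda>x'. (x', y)) has_derivative (\<lambda>u. (u, 0))) (at x)"
    by (auto intro!: derivative_eq_intros)
  from frechet_derivative_at[OF has_derivative_compose[OF this D]]
  show "fderiv (\<lambda>x'. f (x', y)) x u = fderiv f (x, y) (u, 0)" by metis
  have "((\<lambda>y'. (x, y')) has_derivative (\<lambda>u. (0, u))) (at y)"
    by (auto intro!: derivative_eq_intros)
  from frechet_derivative_at[OF has_derivative_compose[OF this D]]
  show "fderiv (\<lambda>y'. f (x, y')) y w = fderiv f (x, y) (0, w)" by metis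
qed

text \<open>The Leibniz rule: in a product chart the total derivative is the sum of two partial
  derivatives, and each of these is the differential of a partial map.\<close>

lemma velocity_Pair:
  assumes B: "smooth_atlas B" and C: "smooth_atlas C" and E: "smooth_atlas E"
    and F: "smooth_map (prod_atlas B C) (S \<times> T) E F" and S: "atlas_open B S" and T: "atlas_open C T"
    and \<beta>: "smooth_map model_atlas J B \<beta>" and \<gamma>: "smooth_map model_atlas J C \<gamma>"
    and t: "t \<in> J" "\<beta> t \<in> S" "\<gamma> t \<in> T" "at t within J \<noteq> bot"
  shows "velocity E J (\<lambda>s. F (\<beta> s, \<gamma> s)) t =
    differential B E (\<lambda>b. F (b, \<gamma> t)) (\<beta> t) (velocity B J \<beta> t) +
    differential C E (\<lambda>c. F (\<beta> t, c)) (\<gamma> t) (velocity C J \<gamma> t)"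
proof
  fix e
  have sub: "S \<subseteq> points B" "T \<subseteq> points C" using S T by (auto simp: atlas_open_def)
  have F1: "smooth_map B S E (\<lambda>b. F (b, \<gamma> t))" and F2: "smooth_map C T E (\<lambda>c. F (\<beta> t, c))"
    using smooth_map_partial[OF B C E F] sub t by auto
  show "velocity E J (\<lambda>s. F (\<beta> s, \<gamma> s)) t e =
    (differential B E (\<lambda>b. F (b, \<gamma> t)) (\<beta> t) (velocity B J \<beta> t) +
    differential C E (\<lambda>c. F (\<beta> t, c)) (\<gamma> t) (velocity C J \<gamma> t)) e"
  proof (cases "e \<in> E \<and> F (\<beta> t, \<gamma> t) \<in> fst e")
    case False
    then show ?thesis by (simp add: velocity_outside differential_outside)
  next
    case True
    then have e: "e \<in> E" "F (\<beta> t, \<gamma> t) \<in> fst e" by auto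
    obtain b where b: "b \<in> B" "\<beta> t \<in> fst b" by (rule smooth_map_codE[OF \<beta> t(1)], rule that)
    obtain c where c: "c \<in> C" "\<gamma> t \<in> fst c" by (rule smooth_map_codE[OF \<gamma> t(1)], rule that)
    let ?C = "prod_chart b c"
    define f where "f = (\<lambda>z. snd e (F (chart_inv ?C z)))"
    obtain W where W: "open W" "snd ?C (\<beta> t, \<gamma> t) \<in> W" "W \<subseteq> snd ?C ` (S \<times> T \<inter> fst ?C)"
      "\<forall>z\<in>W. F (chart_inv ?C z) \<in> fst e" "smooth_on W f"
      unfolding f_def
      by (rule smooth_map_openE[OF smooth_atlas_prod[OF B C] E F atlas_open_Times[OF S T] _ prod_chart_in[OF b(1) c(1)] _ e])
        (use t b c in \<open>auto intro: that\<close>)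
    define x0 where "x0 = snd b (\<beta> t)"
    define y0 where "y0 = snd c (\<gamma> t)"
    have z0: "(x0, y0) \<in> W" using W(2) by (simp add: x0_def y0_def)
    have finv: "f (snd b p, snd c q) = snd e (F (p, q))" if "p \<in> fst b" "q \<in> fst c" for p q
      using that prod_chart_inv[OF B C b(1) c(1), of "snd b p" "snd c q"]
      by (simp add: f_def chart_inv_left[OF B b(1)] chart_inv_left[OF C c(1)])
    obtain W1 where W1: "open W1" "t \<in> W1" "\<forall>s\<in>W1 \<inter> J. \<beta> s \<in> fst b" "smooth_on (W1 \<inter> J) (\<lambda>s. snd b (\<beta> s))"
      by (rule smooth_curveE[OF B \<beta> t(1) b], rule that)
    obtain W2 where W2: "open W2" "t \<in> W2" "\<forall>s\<in>W2 \<inter> J. \<gamma> s \<in> fst c" "smooth_on (W2 \<inter> J) (\<lambda>s. snd c (\<gamma> s))"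
      by (rule smooth_curveE[OF C \<gamma> t(1) c], rule that)
    define vb where "vb = velocity B J \<beta> t b"
    define vc where "vc = velocity C J \<gamma> t c"
    have Df: "f differentiable (at (x0, y0))" using smooth_on_differentiable[OF W(1,5) z0] .
    have "((f \<circ> (\<lambda>s. (snd b (\<beta> s), snd c (\<gamma> s)))) has_vector_derivative fderiv f (x0, y0) (vb, vc)) (at t within J)"
    proof (rule vector_derivative_diff_chain_within)
      show "((\<lambda>s. (snd b (\<beta> s), snd c (\<gamma> s))) has_vector_derivative (vb, vc)) (at t within J)"
        unfolding vb_def vc_def
        by (intro has_vector_derivative_Pair velocity_has_derivative[OF B \<beta> t(1) b] velocity_has_derivative[OF C \<gamma> t(1) c])
      show "(f has_derivative fderiv f (x0, y0)) (at (snd b (\<beta> t), snd c (\<gamma> t)) within (\<lambda>s. (snd b (\<beta> s), snd c (\<gamma> s))) ` J)"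
        using Df unfolding x0_def y0_def frechet_derivative_works by (rule has_derivative_at_withinI)
    qed
    moreover have "\<forall>\<^sub>F s in at t within J. (f \<circ> (\<lambda>s. (snd b (\<beta> s), snd c (\<gamma> s)))) s = snd e (F (\<beta> s, \<gamma> s))"
      unfolding eventually_at_topological
      by (intro exI[of _ "W1 \<inter> W2"]) (use W1 W2 finv in auto)
    ultimately have "((\<lambda>s. snd e (F (\<beta> s, \<gamma> s))) has_vector_derivative fderiv f (x0, y0) (vb, vc)) (at t within J)"
      unfolding has_vector_derivative_def
      by (rule has_derivative_transform_eventually) (simp_all add: finv b c t)
    from velocity_eqI[OF this t(4) e] have "velocity E J (\<lambda>s. F (\<beta> s, \<gamma> s)) t e = fderiv f (x0, y0) (vb, vc)" .
    also have "\<dots> = fderiv f (x0, y0) (vb, 0) + fderiv f (x0, y0) (0, vc)"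
      using linear_add[OF linear_fderiv[OF Df], of "(vb, 0)" "(0, vc)"] by simp
    also have "fderiv f (x0, y0) (vb, 0) = fderiv (\<lambda>x. snd e (F (chart_inv b x, \<gamma> t))) x0 vb"
    proof -
      have "fderiv f (x0, y0) (vb, 0) = fderiv (\<lambda>x. f (x, y0)) x0 vb"
        using fderiv_partial(1)[OF W(1,5) z0] by simp
      also have "\<dots> = fderiv (\<lambda>x. snd e (F (chart_inv b x, \<gamma> t))) x0 vb"
      proof (rule fderiv_cong_apply[OF smooth_atlasD(4)[OF B b(1)]])
        show "x0 \<in> snd b ` fst b" using b by (auto simp: x0_def)
        show "f (x, y0) = snd e (F (chart_inv b x, \<gamma> t))" if "x \<in> snd b ` fst b" for x
          using finv[of "chart_inv b x" "\<gamma> t"] chart_inv_in[OF that] chart_inv_right[OF that] c by (simp add: y0_def)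
      qed
      finally show ?thesis .
    qed
    also have "\<dots> = differential B E (\<lambda>b. F (b, \<gamma> t)) (\<beta> t) (velocity B J \<beta> t) e"
      unfolding x0_def vb_def
      by (rule differential_chart[OF B E F1 S t(2) b _ _ velocity_in[OF B \<beta> t(1,4)], symmetric]) (use e in auto)
    also have "fderiv f (x0, y0) (0, vc) = fderiv (\<lambda>y. snd e (F (\<beta> t, chart_inv c y))) y0 vc"
    proof -
      have "fderiv f (x0, y0) (0, vc) = fderiv (\<lambda>y. f (x0, y)) y0 vc"
        using fderiv_partial(2)[OF W(1,5) z0] by simp
      also have "\<dots> = fderiv (\<lambda>y. snd e (F (\<beta> t, chart_inv c y))) y0 vc"
      proof (rule fderiv_cong_apply[OF smooth_atlasD(4)[OF C c(1)]])
        show "y0 \<in> snd c ` fst c" using c by (auto simp: y0_def)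
        show "f (x0, y) = snd e (F (\<beta> t, chart_inv c y))" if "y \<in> snd c ` fst c" for y
          using finv[of "\<beta> t" "chart_inv c y"] chart_inv_in[OF that] chart_inv_right[OF that] b by (simp add: x0_def)
      qed
      finally show ?thesis .
    qed
    also have "\<dots> = differential C E (\<lambda>c. F (\<beta> t, c)) (\<gamma> t) (velocity C J \<gamma> t) e"
      unfolding y0_def vc_def
      by (rule differential_chart[OF C E F2 T t(3) c _ _ velocity_in[OF C \<gamma> t(1,4)], symmetric]) (use e in auto)
    finally show ?thesis by simp
  qed
qed

text \<open>The vector \<open>v\<close> is realised by a curve \<gamma>; the claim is then
  \<open>velocity_Pair\<close> for the curves \<open>f \<circ> \<gamma>\<close> and
  \<open>g \<circ> \<gamma>\<close>.\<close>

lemma differential_Pair: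
  assumes A: "smooth_atlas A" and B: "smooth_atlas B" and C: "smooth_atlas C" and E: "smooth_atlas E"
    and F: "smooth_map (prod_atlas B C) (S \<times> T) E F" and S: "atlas_open B S" and T: "atlas_open C T"
    and R: "atlas_open A R" and f: "smooth_map A R B f" and g: "smooth_map A R C g"
    and fS: "\<And>p. p \<in> R \<Longrightarrow> f p \<in> S" and gT: "\<And>p. p \<in> R \<Longrightarrow> g p \<in> T"
    and p: "p \<in> R" and v: "v \<in> tangent_space A p"
  shows "differential A E (\<lambda>p. F (f p, g p)) p v =
    differential B E (\<lambda>b. F (b, g p)) (f p) (differential A B f p v) +
    differential C E (\<lambda>c. F (f p, c)) (g p) (differential A C g p v)"
proof -
  obtain \<epsilon> \<gamma> where *: "\<epsilon> > 0" "smooth_map model_atlas {-\<epsilon><..<\<epsilon>} A \<gamma>" "\<gamma> 0 = p" "\<forall>s\<in>{-\<epsilon><..<\<epsilon>}. \<gamma> s \<in> R"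
    "velocity A {-\<epsilon><..<\<epsilon>} \<gamma> 0 = v" using tangent_vector_curve[OF A R p v] by blast
  let ?I = "{-\<epsilon><..<\<epsilon>}"
  have I: "0 \<in> ?I" "at 0 within ?I \<noteq> bot" using *(1) at_within_open_neq_bot[of ?I 0] by auto
  have v': "velocity A ?I \<gamma> 0 \<in> tangent_space A (\<gamma> 0)" using * v by simp
  have p': "\<gamma> 0 \<in> R" using p * by simp
  have F': "smooth_map A R E (\<lambda>p. F (f p, g p))"
    by (rule smooth_map_compose[OF A smooth_atlas_prod[OF B C] E smooth_map_Pair[OF A B C f g] F]) (use fS gT in auto)
  have fg: "smooth_map model_atlas ?I B (\<lambda>s. f (\<gamma> s))" "smooth_map model_atlas ?I C (\<lambda>s. g (\<gamma> s))"
    using *(4) by (auto intro: smooth_map_compose[OF smooth_atlas_model A _ *(2)] B C f g)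
  have "differential A E (\<lambda>p. F (f p, g p)) p v = velocity E ?I (\<lambda>s. F (f (\<gamma> s), g (\<gamma> s))) 0"
    using velocity_compose[OF A E *(2) F' R I(1) p' I(2) v'] by (simp add: *)
  also have "\<dots> = differential B E (\<lambda>b. F (b, g p)) (f p) (velocity B ?I (\<lambda>s. f (\<gamma> s)) 0) +
    differential C E (\<lambda>c. F (f p, c)) (g p) (velocity C ?I (\<lambda>s. g (\<gamma> s)) 0)"
    using velocity_Pair[OF B C E F S T fg I(1) _ _ I(2)] fS gT p by (simp add: *)
  also have "velocity B ?I (\<lambda>s. f (\<gamma> s)) 0 = differential A B f p v"
    using velocity_compose[OF A B *(2) f R I(1) p' I(2) v'] by (simp add: *)
  also have "velocity C ?I (\<lambda>s. g (\<gamma> s)) 0 = differential A C g p v"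
    using velocity_compose[OF A C *(2) g R I(1) p' I(2) v'] by (simp add: *)
  finally show ?thesis .
qed

text \<open>In a chart the zero derivative makes the curve constant on small intervals, and
  connectedness of the parameter set spreads this to all of it.\<close>

lemma zero_velocity_constant:
  assumes A: "smooth_atlas A" and I: "open I" "connected I" and h: "smooth_map model_atlas I A h"
    and z: "\<And>t. t \<in> I \<Longrightarrow> velocity A I h t = 0" and st: "s \<in> I" "t \<in> I"
  shows "h s = h t"
proof -
  have "h constant_on I"
  proof (rule locally_constant_imp_constant[OF I(2)])
    fix a assume a: "a \<in> I"
    obtain c where c: "c \<in> A" "h a \<in> fst c" by (rule smooth_map_codE[OF h a], rule that)
    obtain W where W: "open W" "a \<in> W" "\<forall>s\<in>W \<inter> I. h s \<in> fst c" "smooth_on (W \<inter> I) (\<lambda>s. snd c (h s))"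
      by (rule smooth_curveE[OF A h a c], rule that)
    have "open (W \<inter> I)" "a \<in> W \<inter> I" using W I a by auto
    then obtain e where e: "e > 0" "ball a e \<subseteq> W \<inter> I" using open_contains_ball by blast
    have "((\<lambda>s. snd c (h s)) has_derivative (\<lambda>_. 0)) (at r within ball a e)" if r: "r \<in> ball a e" for r
    proof -
      have rI: "r \<in> I" "h r \<in> fst c" using r e(2) W(3) by blast+
      have "((\<lambda>s. snd c (h s)) has_vector_derivative 0) (at r within I)"
        using velocity_has_derivative[OF A h rI(1) c(1) rI(2)] z[OF rI(1)] by simp
      then have "((\<lambda>s. snd c (h s)) has_vector_derivative 0) (at r within ball a e)"
        by (rule has_vector_derivative_within_subset) (use e in auto)
      then show ?thesis by (simp add: has_vector_derivative_def)
    qed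
    then have "\<exists>k. \<forall>r\<in>ball a e. snd c (h r) = k" by (intro has_derivative_zero_constant) auto
    then have eq: "snd c (h r) = snd c (h a)" if "r \<in> ball a e" for r
      using that e(1) by (metis centre_in_ball)
    have "h r = h a" if r: "r \<in> ball a e" for r
    proof -
      have "h r \<in> fst c" using r e(2) W(3) by blast
      then show ?thesis using eq[OF r] c smooth_atlasD(1)[OF A c(1)] by (meson inj_onD)
    qed
    moreover have "openin (top_of_set I) (ball a e)" using e(2) by (intro open_subset open_ball) blast
    moreover have "a \<in> ball a e" using e(1) by simp
    ultimately show "\<exists>T. openin (top_of_set I) T \<and> a \<in> T \<and> (\<forall>x\<in>T. h x = h a)" by blast
  qed
  then show ?thesis using st by (auto simp: constant_on_def)
qed

lemma smooth_map_model: "smooth_on S f \<Longrightarrow> smooth_map model_atlas S model_atlas f"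
  by (rule smooth_curveI) (auto intro!: exI[of _ UNIV])

text \<open>Translations (\<open>k = 1\<close>) are used for shifted integral curves, dilations
  (\<open>s = 0\<close>) for one-parameter subgroups of scaled generators.\<close>

lemma affine_reparametrisation:
  assumes A: "smooth_atlas A" and g: "smooth_map model_atlas I A \<gamma>" and I: "open I" "open I'"
    and aff: "\<And>r. r \<in> I' \<Longrightarrow> s + k * r \<in> I"
  shows "smooth_map model_atlas I' A (\<lambda>r. \<gamma> (s + k * r))"
    "t \<in> I' \<Longrightarrow> velocity A I' (\<lambda>r. \<gamma> (s + k * r)) t = tscale k (velocity A I \<gamma> (s + k * t))"
proof -
  have "smooth_on I' (\<lambda>r::real. s + k *\<^sub>R r)"
    by (intro smooth_on_add smooth_on_scaleR smooth_on_const smooth_on_ident)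
  then have "smooth_map model_atlas I' model_atlas (\<lambda>r. s + k * r)" by (intro smooth_map_model) simp
  then show "smooth_map model_atlas I' A (\<lambda>r. \<gamma> (s + k * r))"
    by (rule smooth_map_compose[OF smooth_atlas_model smooth_atlas_model A _ g]) (rule aff)
  assume t: "t \<in> I'"
  show "velocity A I' (\<lambda>r. \<gamma> (s + k * r)) t = tscale k (velocity A I \<gamma> (s + k * t))"
  proof
    fix c
    show "velocity A I' (\<lambda>r. \<gamma> (s + k * r)) t c = tscale k (velocity A I \<gamma> (s + k * t)) c"
    proof (cases "c \<in> A \<and> \<gamma> (s + k * t) \<in> fst c")
      case True
      then have c: "c \<in> A" "\<gamma> (s + k * t) \<in> fst c" by auto
      have "((\<lambda>r. snd c (\<gamma> r)) has_vector_derivative velocity A I \<gamma> (s + k * t) c) (at (s + k * t))"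
        using velocity_has_derivative[OF A g aff[OF t] c] at_within_open[OF aff[OF t] I(1)] by simp
      moreover have "((\<lambda>r. s + k * r) has_vector_derivative k) (at t)"
        by (auto intro!: derivative_eq_intros)
      ultimately have "((\<lambda>r. snd c (\<gamma> (s + k * r))) has_vector_derivative k *\<^sub>R velocity A I \<gamma> (s + k * t) c) (at t)"
        using vector_diff_chain_at[of "\<lambda>r. s + k * r" k t "\<lambda>r. snd c (\<gamma> r)"] by (simp add: o_def)
      then have "((\<lambda>r. snd c (\<gamma> (s + k * r))) has_vector_derivative k *\<^sub>R velocity A I \<gamma> (s + k * t) c) (at t within I')"
        by (rule has_vector_derivative_at_within)
      from velocity_eqI[OF this at_within_open_neq_bot[OF I(2) t] c] show ?thesis by (simp add: tscale_def)
    qed (simp add: velocity_outside tscale_def)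
  qed
qed

lemma smooth_curve_local:
  assumes A: "smooth_atlas A"
    and loc: "\<And>t. t \<in> S \<Longrightarrow> \<exists>W. open W \<and> t \<in> W \<and> smooth_map model_atlas (W \<inter> S) A f"
  shows "smooth_map model_atlas S A f"
proof (rule smooth_curveI)
  fix t assume t: "t \<in> S"
  then obtain W where W: "open W" "t \<in> W" "smooth_map model_atlas (W \<inter> S) A f" using loc by blast
  have t': "t \<in> W \<inter> S" using t W by simp
  obtain d where d: "d \<in> A" "f t \<in> fst d" by (rule smooth_map_codE[OF W(3) t'], rule that)
  obtain V where V: "open V" "t \<in> V" "\<forall>x\<in>V \<inter> (W \<inter> S). f x \<in> fst d" "smooth_on (V \<inter> (W \<inter> S)) (\<lambda>x. snd d (f x))"
    by (rule smooth_curveE[OF A W(3) t' d], rule that)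
  show "\<exists>d\<in>A. f t \<in> fst d \<and> (\<exists>W. open W \<and> t \<in> W \<and> (\<forall>x\<in>W \<inter> S. f x \<in> fst d) \<and> smooth_on (W \<inter> S) (\<lambda>x. snd d (f x)))"
    using d V W by (intro bexI[of _ d] conjI exI[of _ "V \<inter> W"]) (auto simp: Int_assoc)
qed

section \<open>One-parameter subgroups\<close>

locale smooth_group =
  fixes G :: "'g monoid" and A :: "('g, 'h::model_space) atlas"
  assumes lie_group: "lie_group G A"
begin

lemma group: "group G" and atlas: "smooth_atlas A" and points: "points A = carrier G"
  using lie_group by (auto simp: lie_group_def smooth_manifold_smooth_atlas)

lemma mult_smooth: "smooth_map (prod_atlas A A) (carrier G \<times> carrier G) A (\<lambda>(g, h). g \<otimes>\<^bsub>G\<^esub> h)"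
  and inv_smooth: "smooth_map A (carrier G) A (\<lambda>g. inv\<^bsub>G\<^esub> g)"
  using lie_group by (auto simp: lie_group_def)

lemma open_carrier: "atlas_open A (carrier G)"
  using atlas_open_points[OF atlas] by (simp add: points)

lemma one_closed: "\<one>\<^bsub>G\<^esub> \<in> carrier G" using group by (simp add: group.is_monoid)

lemma ltrans_smooth:
  assumes "g \<in> carrier G" shows "smooth_map A (carrier G) A (\<lambda>h. g \<otimes>\<^bsub>G\<^esub> h)"
  using smooth_map_partial(2)[OF atlas atlas atlas mult_smooth, of g] assms by (simp add: points)

lemma quotient_smooth:
  "smooth_map (prod_atlas A A) (carrier G \<times> carrier G) A (\<lambda>(g, h). g \<otimes>\<^bsub>G\<^esub> inv\<^bsub>G\<^esub> h)"
proof -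
  note AA = smooth_atlas_prod[OF atlas atlas]
  \<comment> \<open>The first projection is recovered from the group operations as
    \<open>(g \<otimes> h) \<otimes> inv h\<close>, using only the second projection.\<close>
  have fst: "smooth_map (prod_atlas A A) (carrier G \<times> carrier G) A fst"
  proof -
    have "smooth_map (prod_atlas A A) (carrier G \<times> carrier G) A (\<lambda>z. (\<lambda>(g, h). g \<otimes>\<^bsub>G\<^esub> h) ((\<lambda>(g, h). g \<otimes>\<^bsub>G\<^esub> h) z, inv\<^bsub>G\<^esub> snd z))"
      by (rule smooth_map_compose[OF AA AA atlas smooth_map_Pair[OF AA atlas atlas mult_smooth
              smooth_map_compose[OF AA atlas atlas smooth_map_snd[OF atlas atlas, unfolded points] inv_smooth]] mult_smooth])
        (use group in \<open>auto simp: group.is_monoid monoid.m_closed\<close>)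
    then show ?thesis
      by (rule smooth_map_cong[OF AA]) (use group in \<open>auto simp: group.is_monoid monoid.m_closed monoid.m_assoc group.r_inv\<close>)
  qed
  have "smooth_map (prod_atlas A A) (carrier G \<times> carrier G) A (\<lambda>z. (\<lambda>(g, h). g \<otimes>\<^bsub>G\<^esub> h) (fst z, inv\<^bsub>G\<^esub> snd z))"
    by (rule smooth_map_compose[OF AA AA atlas smooth_map_Pair[OF AA atlas atlas fst
            smooth_map_compose[OF AA atlas atlas smooth_map_snd[OF atlas atlas, unfolded points] inv_smooth]] mult_smooth])
      (use group in auto)
  then show ?thesis by (simp add: split_def)
qed

section \<open>Left-invariant fields and their integral curves\<close>

definition ldiff :: "'g \<Rightarrow> ('g, 'h) tvec \<Rightarrow> ('g, 'h) tvec" where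
  "ldiff g = differential A A (\<lambda>h. g \<otimes>\<^bsub>G\<^esub> h) \<one>\<^bsub>G\<^esub>"

text \<open>These are the integral curves of the left-invariant vector field generated by
  \<open>a\<close>, whose value at \<open>g\<close> is \<open>ldiff g a\<close>.\<close>

definition left_invariant_curve :: "real set \<Rightarrow> ('g, 'h) tvec \<Rightarrow> (real \<Rightarrow> 'g) \<Rightarrow> bool" where
  "left_invariant_curve I a u \<longleftrightarrow> smooth_map model_atlas I A u \<and> (\<forall>t\<in>I. velocity A I u t = ldiff (u t) a)"

lemma left_invariant_curveD:
  assumes "left_invariant_curve I a u"
  shows "smooth_map model_atlas I A u" "t \<in> I \<Longrightarrow> velocity A I u t = ldiff (u t) a" "t \<in> I \<Longrightarrow> u t \<in> carrier G"
  using assms smooth_map_points[of model_atlas I A u t] by (auto simp: left_invariant_curve_def points)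

text \<open>Both velocities of \<open>u\<close> and \<open>v\<close> are those of right multiplication by one and the same curve,
  which cancels in the quotient.\<close>

lemma left_invariant_quotient_constant:
  assumes a: "a \<in> lie_alg G A" and I: "open I" "connected I"
    and u: "left_invariant_curve I a u" and v: "left_invariant_curve I a v" and st: "s \<in> I" "t \<in> I"
  shows "u s \<otimes>\<^bsub>G\<^esub> inv\<^bsub>G\<^esub> v s = u t \<otimes>\<^bsub>G\<^esub> inv\<^bsub>G\<^esub> v t"
proof -
  interpret group G by (rule group)
  let ?Q = "\<lambda>(g, h). g \<otimes>\<^bsub>G\<^esub> inv\<^bsub>G\<^esub> h"
  note AA = smooth_atlas_prod[OF atlas atlas]
  note uD = left_invariant_curveD[OF u] and vD = left_invariant_curveD[OF v]
  show ?thesis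
  proof (rule zero_velocity_constant[OF atlas I _ _ st, where h = "\<lambda>s. u s \<otimes>\<^bsub>G\<^esub> inv\<^bsub>G\<^esub> v s"])
    have "smooth_map model_atlas I A (\<lambda>s. ?Q (u s, v s))"
      by (rule smooth_map_compose[OF smooth_atlas_model AA atlas smooth_map_Pair[OF smooth_atlas_model atlas atlas uD(1) vD(1)] quotient_smooth])
        (use uD vD in auto)
    then show "smooth_map model_atlas I A (\<lambda>s. u s \<otimes>\<^bsub>G\<^esub> inv\<^bsub>G\<^esub> v s)" by simp
    fix r assume r: "r \<in> I"
    have ur: "u r \<in> carrier G" "v r \<in> carrier G" using uD(3) vD(3) r by auto
    have "velocity A I (\<lambda>s. ?Q (u s, v s)) r =
      differential A A (\<lambda>b. ?Q (b, v r)) (u r) (ldiff (u r) a) + differential A A (\<lambda>c. ?Q (u r, c)) (v r) (ldiff (v r) a)"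
      using velocity_Pair[OF atlas atlas atlas quotient_smooth open_carrier open_carrier uD(1) vD(1) r ur
          at_within_open_neq_bot[OF I(1) r]] uD(2)[OF r] vD(2)[OF r] by simp
    also have "\<dots> = differential A A (\<lambda>p. ?Q (u r \<otimes>\<^bsub>G\<^esub> p, v r \<otimes>\<^bsub>G\<^esub> p)) \<one>\<^bsub>G\<^esub> a"
      using differential_Pair[OF atlas atlas atlas atlas quotient_smooth open_carrier open_carrier open_carrier
          ltrans_smooth[OF ur(1)] ltrans_smooth[OF ur(2)] _ _ one_closed a[unfolded lie_alg_def]] ur
      by (simp add: ldiff_def)
    also have "\<dots> = differential A A (\<lambda>p. u r \<otimes>\<^bsub>G\<^esub> inv\<^bsub>G\<^esub> v r) \<one>\<^bsub>G\<^esub> a"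
    proof -
      have "?Q (u r \<otimes>\<^bsub>G\<^esub> p, v r \<otimes>\<^bsub>G\<^esub> p) = u r \<otimes>\<^bsub>G\<^esub> inv\<^bsub>G\<^esub> v r" if "p \<in> carrier G" for p
      proof -
        have "p \<otimes>\<^bsub>G\<^esub> (inv\<^bsub>G\<^esub> p \<otimes>\<^bsub>G\<^esub> inv\<^bsub>G\<^esub> v r) = inv\<^bsub>G\<^esub> v r"
          using ur that by (simp flip: m_assoc)
        then show ?thesis using ur that by (simp add: inv_mult_group m_assoc)
      qed
      then show ?thesis
        by (intro fun_cong[OF differential_cong[OF atlas open_carrier one_closed]])
    qed
    finally show "velocity A I (\<lambda>s. u s \<otimes>\<^bsub>G\<^esub> inv\<^bsub>G\<^esub> v s) r = 0" by (simp add: differential_const)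
  qed
qed

lemma left_invariant_shift:
  assumes u: "left_invariant_curve I a u" and I: "open I" "open I'" and sub: "\<And>r. r \<in> I' \<Longrightarrow> s + r \<in> I"
  shows "left_invariant_curve I' a (\<lambda>r. u (s + r))"
  unfolding left_invariant_curve_def
  using affine_reparametrisation[OF atlas left_invariant_curveD(1)[OF u] I, of s 1] sub left_invariant_curveD(2)[OF u]
  by (simp add: tscale_def)

text \<open>The differential equation is solved in a chart around the unit, which is enough for
  small times; tangent vectors are then compared through this single component.\<close>

lemma local_left_invariant_curve:
  assumes a: "a \<in> lie_alg G A"
  shows "\<exists>\<epsilon>>0. \<exists>\<sigma>. left_invariant_curve {-\<epsilon><..<\<epsilon>} a \<sigma> \<and> \<sigma> 0 = \<one>\<^bsub>G\<^esub>"
proof -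
  interpret group G by (rule group)
  obtain k where k: "k \<in> A" "\<one>\<^bsub>G\<^esub> \<in> fst k" using one_closed points by (metis points_iff)
  let ?C = "prod_chart k k" and ?m = "\<lambda>(g, h). g \<otimes>\<^bsub>G\<^esub> h"
  note AA = smooth_atlas_prod[OF atlas atlas]
  define m where "m = (\<lambda>z. snd k (?m (chart_inv ?C z)))"
  obtain W where W: "open W" "snd ?C (\<one>\<^bsub>G\<^esub>, \<one>\<^bsub>G\<^esub>) \<in> W" "W \<subseteq> snd ?C ` (carrier G \<times> carrier G \<inter> fst ?C)"
      "\<forall>z\<in>W. ?m (chart_inv ?C z) \<in> fst k" "smooth_on W m"
    unfolding m_def
    by (rule smooth_map_openE[OF AA atlas mult_smooth atlas_open_Times[OF open_carrier open_carrier] _ prod_chart_in[OF k(1) k(1)] _ k(1),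
          of "(\<one>\<^bsub>G\<^esub>, \<one>\<^bsub>G\<^esub>)"]) (use k in \<open>auto intro: that\<close>)
  define e where "e = snd k \<one>\<^bsub>G\<^esub>"
  \<comment> \<open>The left-invariant field in coordinates: the partial derivative of
    multiplication in its second argument, taken at the unit. Smoothness of multiplication makes it
    a smooth field.\<close>
  define V where "V = (\<lambda>x. fderiv m (x, e) (0, a k))"
  define N where "N = (\<lambda>x. (x, e)) -` W"
  have N: "open N" unfolding N_def by (intro open_vimage W(1) continuous_intros)
  have eN: "e \<in> N" using W(2) by (simp add: N_def e_def)
  have V: "smooth_on N V" unfolding V_def
    by (rule smooth_on_fderiv_apply[OF W(1,5) smooth_on_Pair[OF smooth_on_ident smooth_on_const] smooth_on_const])
      (simp add: N_def)
  obtain \<epsilon> x where x: "\<epsilon> > 0" "x 0 = e" "smooth_on {-\<epsilon><..<\<epsilon>} x"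
    "\<forall>t\<in>{-\<epsilon><..<\<epsilon>}. x t \<in> N \<and> (x has_vector_derivative V (x t)) (at t)"
    using local_flow_line[OF N V eN] by blast
  let ?I = "{-\<epsilon><..<\<epsilon>}"
  define \<sigma> where "\<sigma> = (\<lambda>t. chart_inv k (x t))"
  have im: "x t \<in> snd k ` fst k" if "t \<in> ?I" for t
  proof -
    have "(x t, e) \<in> W" using x(4) that by (auto simp: N_def)
    then show ?thesis using W(3) by (auto simp: map_prod_def)
  qed
  have \<sigma>: "\<sigma> t \<in> fst k" "snd k (\<sigma> t) = x t" if "t \<in> ?I" for t
    using chart_inv_in[OF im[OF that]] chart_inv_right[OF im[OF that]] by (auto simp: \<sigma>_def)
  have sm: "smooth_map model_atlas ?I A \<sigma>" unfolding \<sigma>_def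
    by (rule smooth_map_chart_inv[OF atlas k(1) x(3) im])
  have "velocity A ?I \<sigma> t = ldiff (\<sigma> t) a" if t: "t \<in> ?I" for t
  proof -
    have nb: "at t within ?I \<noteq> bot" by (rule at_within_open_neq_bot[OF _ t]) simp
    have c: "\<sigma> t \<in> carrier G" using \<sigma>(1)[OF t] k points by (metis points_iff)
    have 1: "(x has_vector_derivative V (x t)) (at t)" using x(4) t by blast
    have "((\<lambda>s. snd k (\<sigma> s)) has_vector_derivative V (x t)) (at t within ?I)"
      by (rule has_vector_derivative_at_within, rule has_vector_derivative_transform_within_open[OF 1 _ t])
        (use \<sigma> in auto)
    from velocity_eqI[OF this nb k(1) \<sigma>(1)[OF t]] have vel: "velocity A ?I \<sigma> t k = V (x t)" by simp
    have z: "(x t, e) \<in> W" using x(4) t by (auto simp: N_def)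
    have "ldiff (\<sigma> t) a k = fderiv (\<lambda>y. snd k (\<sigma> t \<otimes>\<^bsub>G\<^esub> chart_inv k y)) e (a k)"
      unfolding ldiff_def e_def
      by (rule differential_chart[OF atlas atlas ltrans_smooth[OF c] open_carrier one_closed k k(1) _ a[unfolded lie_alg_def]])
        (use \<sigma>(1)[OF t] c in simp)
    also have "\<dots> = fderiv (\<lambda>y. m (x t, y)) e (a k)"
    proof (rule fderiv_cong_apply[OF smooth_atlasD(4)[OF atlas k(1)]])
      show "e \<in> snd k ` fst k" using k by (auto simp: e_def)
      show "snd k (\<sigma> t \<otimes>\<^bsub>G\<^esub> chart_inv k y) = m (x t, y)" if "y \<in> snd k ` fst k" for y
        unfolding m_def prod_chart_inv[OF atlas atlas k(1) k(1) im[OF t] that] by (simp add: \<sigma>_def)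
    qed
    also have "\<dots> = V (x t)" using fderiv_partial(2)[OF W(1,5) z] by (simp add: V_def)
    finally have "velocity A ?I \<sigma> t k = ldiff (\<sigma> t) a k" using vel by simp
    moreover have "ldiff (\<sigma> t) a \<in> tangent_space A (\<sigma> t)"
      using differential_in[OF atlas atlas ltrans_smooth[OF c] open_carrier one_closed a[unfolded lie_alg_def]] c
      by (simp add: ldiff_def)
    ultimately show ?thesis
      using tangent_space_eqI[OF velocity_in[OF atlas sm t nb] _ k(1) \<sigma>(1)[OF t]] by simp
  qed
  moreover have "\<sigma> 0 = \<one>\<^bsub>G\<^esub>" using chart_inv_left[OF atlas k] by (simp add: \<sigma>_def x e_def)
  ultimately show ?thesis using x(1) sm unfolding left_invariant_curve_def by blast
qed

text \<open>For fixed \<open>s\<close> the curves \<open>\<sigma> (s + r)\<close> and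
  \<open>\<sigma> r\<close> solve the same left-invariant equation, so their quotient keeps its
  value \<open>\<sigma> s\<close> from time 0. Halving \<epsilon> ensures that \<open>s + r\<close>
  stays in the domain.\<close>

lemma local_one_parameter_subgroup:
  assumes a: "a \<in> lie_alg G A"
  shows "\<exists>\<delta>>0. \<exists>\<sigma>. left_invariant_curve {-\<delta><..<\<delta>} a \<sigma> \<and> \<sigma> 0 = \<one>\<^bsub>G\<^esub> \<and>
    (\<forall>s t. \<bar>s\<bar> < \<delta> \<and> \<bar>t\<bar> < \<delta> \<and> \<bar>s + t\<bar> < \<delta> \<longrightarrow> \<sigma> (s + t) = \<sigma> s \<otimes>\<^bsub>G\<^esub> \<sigma> t)"
proof -
  interpret group G by (rule group)
  obtain \<epsilon> \<sigma> where \<sigma>: "\<epsilon> > 0" "left_invariant_curve {-\<epsilon><..<\<epsilon>} a \<sigma>" "\<sigma> 0 = \<one>\<^bsub>G\<^esub>"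
    using local_left_invariant_curve[OF a] by blast
  let ?I = "{-\<epsilon><..<\<epsilon>}" and ?J = "{-(\<epsilon>/2)<..<\<epsilon>/2}"
  have v: "left_invariant_curve ?J a \<sigma>"
    using left_invariant_shift[OF \<sigma>(2), of ?J 0] \<sigma>(1) by simp
  have "\<sigma> (s + t) = \<sigma> s \<otimes>\<^bsub>G\<^esub> \<sigma> t" if st: "\<bar>s\<bar> < \<epsilon>/2" "\<bar>t\<bar> < \<epsilon>/2" for s t
  proof -
    have u: "left_invariant_curve ?J a (\<lambda>r. \<sigma> (s + r))"
      by (rule left_invariant_shift[OF \<sigma>(2)]) (use st in \<open>auto simp: abs_less_iff\<close>)
    have J: "0 \<in> ?J" "t \<in> ?J" using \<sigma>(1) st by (auto simp: abs_less_iff)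
    have c: "\<sigma> (s + t) \<in> carrier G" "\<sigma> t \<in> carrier G" "\<sigma> s \<in> carrier G"
      using st by (auto intro!: left_invariant_curveD(3)[OF \<sigma>(2)] simp only: greaterThanLessThan_iff)
    have "\<sigma> (s + t) \<otimes>\<^bsub>G\<^esub> inv\<^bsub>G\<^esub> \<sigma> t = \<sigma> (s + 0) \<otimes>\<^bsub>G\<^esub> inv\<^bsub>G\<^esub> \<sigma> 0"
      by (rule left_invariant_quotient_constant[OF a _ _ u v J(2,1)]) auto
    then have "\<sigma> (s + t) \<otimes>\<^bsub>G\<^esub> inv\<^bsub>G\<^esub> \<sigma> t = \<sigma> s" using c \<sigma>(3) by simp
    then show ?thesis using c inv_solve_right' by metis
  qed
  then show ?thesis using \<sigma> v by (intro exI[of _ "\<epsilon>/2"] conjI exI[of _ \<sigma>]) auto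
qed

text \<open>Differentiate \<open>\<tau> (t + r) = \<tau> t \<otimes> \<tau> r\<close> in
  \<open>r\<close> at 0.\<close>

lemma one_parameter_subgroup_left_invariant:
  assumes \<tau>: "one_parameter_subgroup G A a \<tau>"
  shows "left_invariant_curve UNIV a \<tau>" "\<tau> 0 = \<one>\<^bsub>G\<^esub>"
proof -
  interpret group G by (rule group)
  have sm: "smooth_map model_atlas UNIV A \<tau>" and hom: "\<And>s t. \<tau> (s + t) = \<tau> s \<otimes>\<^bsub>G\<^esub> \<tau> t"
    and v0: "velocity A UNIV \<tau> 0 = a" using \<tau> by (auto simp: one_parameter_subgroup_def)
  have c: "\<tau> t \<in> carrier G" for t using smooth_map_points[OF sm, of t] by (simp add: points)
  have "\<tau> 0 \<otimes>\<^bsub>G\<^esub> \<tau> 0 = \<tau> 0" using hom[of 0 0] by simp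
  then show one: "\<tau> 0 = \<one>\<^bsub>G\<^esub>" using c[of 0] by (metis l_cancel_one')
  have "velocity A UNIV \<tau> t = ldiff (\<tau> t) a" for t
  proof -
    have "velocity A UNIV \<tau> t = velocity A UNIV (\<lambda>r. \<tau> (t + 1 * r)) 0"
      using affine_reparametrisation(2)[OF atlas sm open_UNIV open_UNIV, of t 1 0] by (simp add: tscale_def)
    also have "(\<lambda>r. \<tau> (t + 1 * r)) = (\<lambda>r. \<tau> t \<otimes>\<^bsub>G\<^esub> \<tau> r)" by (simp add: hom)
    also have "velocity A UNIV \<dots> 0 = differential A A (\<lambda>h. \<tau> t \<otimes>\<^bsub>G\<^esub> h) (\<tau> 0) (velocity A UNIV \<tau> 0)"
      by (rule velocity_compose[OF atlas atlas sm ltrans_smooth[OF c] open_carrier _ c])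
        (use velocity_in[OF atlas sm] in auto)
    finally show ?thesis by (simp add: v0 one ldiff_def)
  qed
  then show "left_invariant_curve UNIV a \<tau>" using sm by (simp add: left_invariant_curve_def)
qed

lemma one_parameter_subgroup_unique:
  assumes a: "a \<in> lie_alg G A" and "one_parameter_subgroup G A a \<tau>" "one_parameter_subgroup G A a \<tau>'"
  shows "\<tau> = \<tau>'"
proof
  interpret group G by (rule group)
  fix t
  note l = one_parameter_subgroup_left_invariant[OF assms(2)] and l' = one_parameter_subgroup_left_invariant[OF assms(3)]
  have c: "\<tau> t \<in> carrier G" "\<tau>' t \<in> carrier G"
    using left_invariant_curveD(3)[OF l(1)] left_invariant_curveD(3)[OF l'(1)] by auto
  have "\<tau> t \<otimes>\<^bsub>G\<^esub> inv\<^bsub>G\<^esub> \<tau>' t = \<tau> 0 \<otimes>\<^bsub>G\<^esub> inv\<^bsub>G\<^esub> \<tau>' 0"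
    by (rule left_invariant_quotient_constant[OF a _ _ l(1) l'(1)]) auto
  then have "\<tau> t \<otimes>\<^bsub>G\<^esub> inv\<^bsub>G\<^esub> \<tau>' t = \<one>\<^bsub>G\<^esub>" by (simp add: l(2) l'(2))
  then have "\<tau> t = \<one>\<^bsub>G\<^esub> \<otimes>\<^bsub>G\<^esub> \<tau>' t" using c inv_solve_right' one_closed by metis
  then show "\<tau> t = \<tau>' t" using c by simp
qed

text \<open>The local subgroup is extended to all times by repeated halving of the time and squaring
  of the group element, which the homomorphism property forces.\<close>

lemma one_parameter_subgroup_exists:
  assumes a: "a \<in> lie_alg G A"
  shows "\<exists>\<tau>. one_parameter_subgroup G A a \<tau>"
proof -
  interpret group G by (rule group)
  obtain \<delta> \<sigma> where \<delta>: "\<delta> > 0" and \<sigma>: "left_invariant_curve {-\<delta><..<\<delta>} a \<sigma>" "\<sigma> 0 = \<one>\<^bsub>G\<^esub>"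
    and hom: "\<And>s t. \<bar>s\<bar> < \<delta> \<Longrightarrow> \<bar>t\<bar> < \<delta> \<Longrightarrow> \<bar>s + t\<bar> < \<delta> \<Longrightarrow> \<sigma> (s + t) = \<sigma> s \<otimes>\<^bsub>G\<^esub> \<sigma> t"
    using local_one_parameter_subgroup[OF a] by blast
  let ?I = "{-\<delta><..<\<delta>}"
  have c: "\<sigma> t \<in> carrier G" if "\<bar>t\<bar> < \<delta>" for t
    using left_invariant_curveD(3)[OF \<sigma>(1)] that by (auto simp: abs_less_iff)
  \<comment> \<open>The value at \<open>t\<close> dictated by the group law once
    \<open>t / 2 ^ n\<close> lies in the domain of \<sigma>. From that \<open>n\<close> on it does
    not change, because \<sigma> doubles correctly.\<close>
  define E where "E = (\<lambda>n t. \<sigma> (t / 2 ^ n) [^]\<^bsub>G\<^esub> (2 ^ n :: nat))"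
  define ok where "ok = (\<lambda>n t. \<bar>t / 2 ^ n\<bar> < \<delta>)"
  have ok_mono: "ok (m + n) t" if "ok n t" for m n t
  proof -
    have "\<bar>t / 2 ^ (m + n)\<bar> = \<bar>t / 2 ^ n\<bar> / 2 ^ m" by (simp add: power_add abs_divide)
    also have "\<dots> \<le> \<bar>t / 2 ^ n\<bar> / 1" by (intro divide_left_mono) auto
    finally show ?thesis using that by (simp add: ok_def)
  qed
  have ok_ex: "\<exists>n. ok n t" for t
  proof -
    obtain n where "\<bar>t\<bar> / \<delta> < 2 ^ n" using real_arch_pow[of 2 "\<bar>t\<bar> / \<delta>"] by auto
    then have "ok n t" using \<delta> by (simp add: ok_def abs_divide field_simps)
    then show ?thesis by blast
  qed
  have E_step: "E (m + n) t = E n t" if "ok n t" for m n t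
  proof (induction m)
    case (Suc m)
    let ?k = "m + n" and ?y = "t / 2 ^ (Suc (m + n))"
    have y: "\<bar>?y\<bar> < \<delta>" "\<bar>?y + ?y\<bar> < \<delta>" "?y + ?y = t / 2 ^ ?k"
      using ok_mono[OF that, of "Suc m"] ok_mono[OF that, of m] by (simp_all add: ok_def)
    have "E (Suc m + n) t = (\<sigma> ?y [^]\<^bsub>G\<^esub> (2::nat)) [^]\<^bsub>G\<^esub> (2 ^ ?k :: nat)"
      using nat_pow_pow[OF c[OF y(1)], of 2 "2 ^ ?k"] by (simp add: E_def)
    also have "\<sigma> ?y [^]\<^bsub>G\<^esub> (2::nat) = \<sigma> (?y + ?y)"
      using hom[OF y(1,1,2)] c[OF y(1)] by (simp add: numeral_2_eq_2)
    finally show ?case using Suc y(3) by (simp add: E_def)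
  qed simp
  define \<Sigma> where "\<Sigma> = (\<lambda>t. E (LEAST n. ok n t) t)"
  have \<Sigma>: "\<Sigma> t = E n t" if "ok n t" for n t
  proof -
    define l where "l = (LEAST n. ok n t)"
    have "ok l t" using that unfolding l_def by (rule LeastI)
    moreover have "l \<le> n" using that unfolding l_def by (rule Least_le)
    then have "n = (n - l) + l" by simp
    ultimately have "E n t = E l t" using E_step by metis
    then show ?thesis by (simp add: \<Sigma>_def l_def)
  qed
  have \<Sigma>\<sigma>: "\<Sigma> t = \<sigma> t" if "\<bar>t\<bar> < \<delta>" for t
    using \<Sigma>[of 0 t] that c[OF that] by (simp add: ok_def E_def)
  have \<Sigma>_hom: "\<Sigma> (s + t) = \<Sigma> s \<otimes>\<^bsub>G\<^esub> \<Sigma> t" for s t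
  proof -
    obtain n1 n2 n3 where "ok n1 s" "ok n2 t" "ok n3 (s + t)" using ok_ex by meson
    then have ok: "ok (n1 + n2 + n3) s" "ok (n1 + n2 + n3) t" "ok (n1 + n2 + n3) (s + t)"
      using ok_mono[of n1 s "n2 + n3"] ok_mono[of n2 t "n1 + n3"] ok_mono[of n3 "s + t" "n1 + n2"]
      by (simp_all add: ac_simps)
    define n where "n = n1 + n2 + n3"
    let ?s = "s / 2 ^ n" and ?t = "t / 2 ^ n"
    have b: "\<bar>?s\<bar> < \<delta>" "\<bar>?t\<bar> < \<delta>" "\<bar>?s + ?t\<bar> < \<delta>" "\<bar>?t + ?s\<bar> < \<delta>"
    proof -
      have eq: "?s + ?t = (s + t) / 2 ^ n" "?t + ?s = (s + t) / 2 ^ n" by (simp_all add: add_divide_distrib)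
      show "\<bar>?s\<bar> < \<delta>" "\<bar>?t\<bar> < \<delta>" "\<bar>?s + ?t\<bar> < \<delta>" "\<bar>?t + ?s\<bar> < \<delta>"
        using ok[folded n_def] unfolding ok_def eq by simp_all
    qed
    \<comment> \<open>Both products equal \<sigma> at the same sum of times. Commutation is what
      lets the power of the product be distributed in a possibly non-commutative group.\<close>
    have comm: "\<sigma> ?s \<otimes>\<^bsub>G\<^esub> \<sigma> ?t = \<sigma> ?t \<otimes>\<^bsub>G\<^esub> \<sigma> ?s"
      using hom[OF b(1,2,3)] hom[OF b(2,1,4)] by (simp add: add.commute)
    have "\<Sigma> (s + t) = (\<sigma> ?s \<otimes>\<^bsub>G\<^esub> \<sigma> ?t) [^]\<^bsub>G\<^esub> (2 ^ n :: nat)"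
      using \<Sigma>[OF ok(3)] hom[OF b(1,2,3)] by (simp add: E_def n_def add_divide_distrib)
    also have "\<dots> = \<sigma> ?s [^]\<^bsub>G\<^esub> (2 ^ n :: nat) \<otimes>\<^bsub>G\<^esub> \<sigma> ?t [^]\<^bsub>G\<^esub> (2 ^ n :: nat)"
      by (rule pow_mult_distrib[OF comm c[OF b(1)] c[OF b(2)]])
    also have "\<dots> = \<Sigma> s \<otimes>\<^bsub>G\<^esub> \<Sigma> t" using \<Sigma>[OF ok(1)] \<Sigma>[OF ok(2)] by (simp add: E_def n_def)
    finally show ?thesis .
  qed
  have \<Sigma>c: "\<Sigma> t \<in> carrier G" for t
    using ok_ex[of t] \<Sigma> c by (auto simp: ok_def E_def)
  \<comment> \<open>Near \<open>t0\<close> the extended curve is the left translate by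
    \<open>\<Sigma> t0\<close> of the local one, so it inherits its smoothness.\<close>
  have sm: "smooth_map model_atlas UNIV A \<Sigma>"
  proof (rule smooth_curve_local[OF atlas])
    fix t0 :: real
    let ?W = "{t0 - \<delta><..<t0 + \<delta>}"
    have "smooth_map model_atlas ?W A (\<lambda>r. \<sigma> (- t0 + 1 * r))"
      by (rule affine_reparametrisation(1)[OF atlas left_invariant_curveD(1)[OF \<sigma>(1)]]) auto
    then have "smooth_map model_atlas ?W A (\<lambda>r. \<Sigma> t0 \<otimes>\<^bsub>G\<^esub> \<sigma> (- t0 + 1 * r))"
      by (rule smooth_map_compose[OF smooth_atlas_model atlas atlas _ ltrans_smooth[OF \<Sigma>c]])
        (auto intro!: c simp: abs_less_iff)
    moreover have "\<Sigma> t0 \<otimes>\<^bsub>G\<^esub> \<sigma> (- t0 + 1 * r) = \<Sigma> r" if "r \<in> ?W" for r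
      using \<Sigma>_hom[of t0 "r - t0"] \<Sigma>\<sigma>[of "r - t0"] that by (simp add: abs_less_iff)
    ultimately have "smooth_map model_atlas ?W A \<Sigma>" by (rule smooth_map_cong[OF smooth_atlas_model])
    then show "\<exists>W. open W \<and> t0 \<in> W \<and> smooth_map model_atlas (W \<inter> UNIV) A \<Sigma>"
      using \<delta> by (intro exI[of _ ?W]) auto
  qed
  have v: "velocity A UNIV \<Sigma> 0 = a"
  proof -
    have z: "0 \<in> ?I" using \<delta> by simp
    have "velocity A UNIV \<Sigma> 0 = velocity A ?I \<Sigma> 0" by (rule velocity_open[OF _ z, symmetric]) simp
    also have "\<dots> = velocity A ?I \<sigma> 0"
    proof (rule ext)
      fix k
      show "velocity A ?I \<Sigma> 0 k = velocity A ?I \<sigma> 0 k"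
      proof (cases "k \<in> A \<and> \<sigma> 0 \<in> fst k")
        case True
        then have k: "k \<in> A" "\<sigma> 0 \<in> fst k" "\<Sigma> 0 \<in> fst k" using \<Sigma>\<sigma>[of 0] \<delta> by auto
        have "((\<lambda>s. snd k (\<sigma> s)) has_vector_derivative velocity A ?I \<sigma> 0 k) (at 0 within ?I)"
          by (rule velocity_has_derivative[OF atlas left_invariant_curveD(1)[OF \<sigma>(1)] z k(1,2)])
        then have "((\<lambda>s. snd k (\<Sigma> s)) has_vector_derivative velocity A ?I \<sigma> 0 k) (at 0 within ?I)"
          by (rule has_vector_derivative_transform[OF z, rotated]) (simp add: \<Sigma>\<sigma> abs_less_iff)
        from velocity_eqI[OF this at_within_open_neq_bot[OF _ z] k(1,3)] show ?thesis by simp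
      next
        case False
        then show ?thesis using \<Sigma>\<sigma>[of 0] \<delta> by (simp add: velocity_outside)
      qed
    qed
    also have "\<dots> = ldiff \<one>\<^bsub>G\<^esub> a" using left_invariant_curveD(2)[OF \<sigma>(1) z] \<sigma>(2) by simp
    also have "\<dots> = differential A A (\<lambda>h. h) \<one>\<^bsub>G\<^esub> a"
      unfolding ldiff_def by (intro fun_cong[OF differential_cong[OF atlas open_carrier one_closed]]) simp
    also have "\<dots> = a" using differential_ident[OF atlas] a one_closed by (simp add: lie_alg_def points)
    finally show ?thesis .
  qed
  show ?thesis using sm v \<Sigma>_hom unfolding one_parameter_subgroup_def by blast
qed

text \<open>The subgroup generated by \<open>tscale t a\<close> is
  \<open>r \<mapsto> \<tau> (t * r)\<close>; \<open>lie_exp\<close> evaluates it at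
  \<open>r = 1\<close>.\<close>

lemma lie_exp_tscale:
  assumes a: "a \<in> lie_alg G A" and \<tau>: "one_parameter_subgroup G A a \<tau>"
  shows "lie_exp G A (tscale t a) = \<tau> t"
proof -
  have sm: "smooth_map model_atlas UNIV A \<tau>" and hom: "\<And>s t. \<tau> (s + t) = \<tau> s \<otimes>\<^bsub>G\<^esub> \<tau> t"
    and v0: "velocity A UNIV \<tau> 0 = a" using \<tau> by (auto simp: one_parameter_subgroup_def)
  have "one_parameter_subgroup G A (tscale t a) (\<lambda>r. \<tau> (0 + t * r))"
    unfolding one_parameter_subgroup_def
    using affine_reparametrisation[OF atlas sm open_UNIV open_UNIV, of 0 t] by (simp add: v0 hom distrib_left)
  moreover have "tscale t a \<in> lie_alg G A"
    using a tangent_space_subspace(4)[OF atlas] one_closed by (simp add: lie_alg_def points)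
  ultimately have "(THE \<sigma>. one_parameter_subgroup G A (tscale t a) \<sigma>) = (\<lambda>r. \<tau> (0 + t * r))"
    using one_parameter_subgroup_unique by (intro the_equality) blast+
  then show ?thesis by (simp add: lie_exp_def)
qed

lemma one_parameter_subgroup_lie_exp:
  assumes a: "a \<in> lie_alg G A"
  shows "one_parameter_subgroup G A a (\<lambda>t. lie_exp G A (tscale t a))"
proof -
  obtain \<tau> where \<tau>: "one_parameter_subgroup G A a \<tau>" using one_parameter_subgroup_exists[OF a] by blast
  then have "(\<lambda>t. lie_exp G A (tscale t a)) = \<tau>" using lie_exp_tscale[OF a \<tau>] by blast
  then show ?thesis using \<tau> by simp
qed

end

section \<open>Principal bundles\<close>

locale principal =
  fixes P :: "('q, 'e::model_space, 'm, 'd::model_space, 'g, 'h::model_space) bundle_data"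
  assumes principal_bundle: "principal_bundle P"
begin

lemma tot_atlas: "smooth_atlas (tot P)" and base_atlas: "smooth_atlas (base P)"
  and lie_group_grp: "lie_group (grp P) (grp_atlas P)"
  using principal_bundle by (auto simp: principal_bundle_def smooth_manifold_smooth_atlas)

sublocale grp: smooth_group "grp P" "grp_atlas P"
  by unfold_locales (rule lie_group_grp)

sublocale G: group "grp P"
  by (rule grp.group)

lemma act_smooth: "smooth_map (prod_atlas (tot P) (grp_atlas P)) (points (tot P) \<times> carrier (grp P)) (tot P) (\<lambda>(q, g). act P q g)"
  and act_one: "q \<in> points (tot P) \<Longrightarrow> act P q \<one>\<^bsub>grp P\<^esub> = q"
  and act_act: "\<lbrakk>q \<in> points (tot P); g \<in> carrier (grp P); h \<in> carrier (grp P)\<rbrakk>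
    \<Longrightarrow> act P (act P q g) h = act P q (g \<otimes>\<^bsub>grp P\<^esub> h)"
  and proj_smooth: "smooth_map (tot P) (points (tot P)) (base P) (proj P)"
  using principal_bundle by (auto simp: principal_bundle_def)

lemma proj_in: "q \<in> points (tot P) \<Longrightarrow> proj P q \<in> points (base P)"
  using smooth_map_points[OF proj_smooth] by simp

lemma open_tot: "atlas_open (tot P) (points (tot P))"
  by (rule atlas_open_points[OF tot_atlas])

lemma act_smooth_left:
  "g \<in> carrier (grp P) \<Longrightarrow> smooth_map (tot P) (points (tot P)) (tot P) (\<lambda>q. act P q g)"
  using smooth_map_partial(1)[OF tot_atlas grp.atlas tot_atlas act_smooth order_refl, of g] by (simp add: grp.points)

lemma act_smooth_right:
  "q \<in> points (tot P) \<Longrightarrow> smooth_map (grp_atlas P) (carrier (grp P)) (tot P) (\<lambda>g. act P q g)"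
  using smooth_map_partial(2)[OF tot_atlas grp.atlas tot_atlas act_smooth _, of q] by (simp add: grp.points)

text \<open>\<Theta> is the inverse of the trivialisation \<Psi>, and \<open>g\<close> is the fibre
  coordinate of \<open>q\<close>. Writing \<open>q\<close> as \<open>\<Psi> (proj P q, g)\<close> is
  how equivariance is brought to bear on a given point.\<close>

lemma trivialisation:
  assumes q: "q \<in> points (tot P)"
  obtains U \<Psi> \<Theta> g where "atlas_open (base P) U" "proj P q \<in> U" "g \<in> carrier (grp P)" "\<Psi> (proj P q, g) = q"
    "smooth_map (prod_atlas (base P) (grp_atlas P)) (U \<times> carrier (grp P)) (tot P) \<Psi>"
    "smooth_map (tot P) {q \<in> points (tot P). proj P q \<in> U} (prod_atlas (base P) (grp_atlas P)) \<Theta>"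
    "\<forall>q\<in>points (tot P). proj P q \<in> U \<longrightarrow> \<Theta> q \<in> U \<times> carrier (grp P) \<and> \<Psi> (\<Theta> q) = q"
    "\<forall>y\<in>U. \<forall>g\<in>carrier (grp P). \<Theta> (\<Psi> (y, g)) = (y, g) \<and> proj P (\<Psi> (y, g)) = y \<and> \<Psi> (y, g) \<in> points (tot P)"
    "\<forall>y\<in>U. \<forall>g\<in>carrier (grp P). \<forall>h\<in>carrier (grp P). \<Psi> (y, g \<otimes>\<^bsub>grp P\<^esub> h) = act P (\<Psi> (y, g)) h"
proof -
  have "\<exists>U \<Psi>. openin (atlas_topology (base P)) U \<and> proj P q \<in> U \<and>
        bij_betw \<Psi> (U \<times> carrier (grp P)) {q \<in> points (tot P). proj P q \<in> U} \<and>
        smooth_map (prod_atlas (base P) (grp_atlas P)) (U \<times> carrier (grp P)) (tot P) \<Psi> \<and>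
        smooth_map (tot P) {q \<in> points (tot P). proj P q \<in> U} (prod_atlas (base P) (grp_atlas P))
          (inv_into (U \<times> carrier (grp P)) \<Psi>) \<and>
        (\<forall>y\<in>U. \<forall>g\<in>carrier (grp P). proj P (\<Psi> (y, g)) = y) \<and>
        (\<forall>y\<in>U. \<forall>g\<in>carrier (grp P). \<forall>h\<in>carrier (grp P).
           \<Psi> (y, g \<otimes>\<^bsub>grp P\<^esub> h) = act P (\<Psi> (y, g)) h)"
    using principal_bundle proj_in[OF q] unfolding principal_bundle_def by simp
  then obtain U \<Psi> where *: "openin (atlas_topology (base P)) U" "proj P q \<in> U"
        "bij_betw \<Psi> (U \<times> carrier (grp P)) {q \<in> points (tot P). proj P q \<in> U}"
        "smooth_map (prod_atlas (base P) (grp_atlas P)) (U \<times> carrier (grp P)) (tot P) \<Psi>"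
        "smooth_map (tot P) {q \<in> points (tot P). proj P q \<in> U} (prod_atlas (base P) (grp_atlas P))
          (inv_into (U \<times> carrier (grp P)) \<Psi>)"
        "\<forall>y\<in>U. \<forall>g\<in>carrier (grp P). proj P (\<Psi> (y, g)) = y"
        "\<forall>y\<in>U. \<forall>g\<in>carrier (grp P). \<forall>h\<in>carrier (grp P).
           \<Psi> (y, g \<otimes>\<^bsub>grp P\<^esub> h) = act P (\<Psi> (y, g)) h"
    by (elim exE conjE)
  define \<Theta> where "\<Theta> = inv_into (U \<times> carrier (grp P)) \<Psi>"
  have inj: "inj_on \<Psi> (U \<times> carrier (grp P))" and im: "\<Psi> ` (U \<times> carrier (grp P)) = {q \<in> points (tot P). proj P q \<in> U}"
    using *(3) by (auto simp: bij_betw_def)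
  have 1: "\<Theta> q' \<in> U \<times> carrier (grp P) \<and> \<Psi> (\<Theta> q') = q'" if "q' \<in> points (tot P)" "proj P q' \<in> U" for q'
  proof -
    have "q' \<in> \<Psi> ` (U \<times> carrier (grp P))" unfolding im using that by simp
    then show ?thesis unfolding \<Theta>_def by (intro conjI inv_into_into f_inv_into_f)
  qed
  have 2: "\<Theta> (\<Psi> (y, g)) = (y, g) \<and> proj P (\<Psi> (y, g)) = y \<and> \<Psi> (y, g) \<in> points (tot P)"
    if "y \<in> U" "g \<in> carrier (grp P)" for y g
  proof -
    have "(y, g) \<in> U \<times> carrier (grp P)" using that by simp
    then have "\<Theta> (\<Psi> (y, g)) = (y, g)" "\<Psi> (y, g) \<in> \<Psi> ` (U \<times> carrier (grp P))"
      unfolding \<Theta>_def by (rule inv_into_f_f[OF inj], rule imageI)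
    then show ?thesis using *(6) that unfolding im by simp
  qed
  obtain y g where yg: "\<Theta> q = (y, g)" by (cases "\<Theta> q")
  have "y \<in> U" "g \<in> carrier (grp P)" "\<Psi> (y, g) = q" using 1[OF q *(2)] yg by auto
  then have "\<Psi> (proj P q, g) = q" using 2[of y g] by auto
  show thesis
    by (rule that[of U g \<Psi> \<Theta>])
      (use * 1 2 \<open>g \<in> carrier (grp P)\<close> \<open>\<Psi> (proj P q, g) = q\<close> openin_atlas_topology[OF base_atlas] \<Theta>_def in auto)
qed

text \<open>Not among the axioms of \<open>principal_bundle\<close>: in a trivialisation the action
  only multiplies the group coordinate, and the base coordinate is the projection.\<close>

lemma proj_act:
  assumes q: "q \<in> points (tot P)" and h: "h \<in> carrier (grp P)"
  shows "proj P (act P q h) = proj P q"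
proof -
  obtain U \<Psi> \<Theta> g where t: "proj P q \<in> U" "g \<in> carrier (grp P)" "\<Psi> (proj P q, g) = q"
    "\<forall>y\<in>U. \<forall>g\<in>carrier (grp P). \<Theta> (\<Psi> (y, g)) = (y, g) \<and> proj P (\<Psi> (y, g)) = y \<and> \<Psi> (y, g) \<in> points (tot P)"
    "\<forall>y\<in>U. \<forall>g\<in>carrier (grp P). \<forall>h\<in>carrier (grp P). \<Psi> (y, g \<otimes>\<^bsub>grp P\<^esub> h) = act P (\<Psi> (y, g)) h"
    by (rule trivialisation[OF q], rule that)
  have "act P q h = \<Psi> (proj P q, g \<otimes>\<^bsub>grp P\<^esub> h)" using t h by simp
  then show ?thesis using t(1,2,4) h by simp
qed

section \<open>The Lie algebra, fundamental vectors and vertical spaces\<close>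

lemma liealg_one: "liealg P = tangent_space (grp_atlas P) \<one>\<^bsub>grp P\<^esub>"
  by (simp add: lie_alg_def)

lemma liealg_subspace:
  "0 \<in> liealg P" "\<lbrakk>a \<in> liealg P; b \<in> liealg P\<rbrakk> \<Longrightarrow> a + b \<in> liealg P"
  "\<lbrakk>a \<in> liealg P; b \<in> liealg P\<rbrakk> \<Longrightarrow> a - b \<in> liealg P" "a \<in> liealg P \<Longrightarrow> tscale r a \<in> liealg P"
  using tangent_space_subspace[OF grp.atlas, of "\<one>\<^bsub>grp P\<^esub>"] by (simp_all add: liealg_one grp.points)

text \<open>The exponential curve is replaced by the orbit map, of which it only samples the
  velocity at the unit. Linearity in \<open>a\<close> and smoothness in \<open>q\<close> then follow
  from properties of differentials.\<close>

lemma fundamental_eq: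
  assumes a: "a \<in> liealg P" and q: "q \<in> points (tot P)"
  shows "fundamental P a q = differential (grp_atlas P) (tot P) (\<lambda>g. act P q g) \<one>\<^bsub>grp P\<^esub> a"
proof -
  define \<tau> where "\<tau> = (\<lambda>t. expo P (tscale t a))"
  have "one_parameter_subgroup (grp P) (grp_atlas P) a \<tau>"
    unfolding \<tau>_def by (rule grp.one_parameter_subgroup_lie_exp[OF a])
  then have t: "smooth_map model_atlas UNIV (grp_atlas P) \<tau>" "velocity (grp_atlas P) UNIV \<tau> 0 = a" "\<tau> 0 = \<one>\<^bsub>grp P\<^esub>"
    using grp.one_parameter_subgroup_left_invariant(2) by (auto simp: one_parameter_subgroup_def)
  have "velocity (tot P) UNIV (\<lambda>t. act P q (\<tau> t)) 0
      = differential (grp_atlas P) (tot P) (\<lambda>g. act P q g) (\<tau> 0) (velocity (grp_atlas P) UNIV \<tau> 0)"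
    by (rule velocity_compose[OF grp.atlas tot_atlas t(1) act_smooth_right[OF q] grp.open_carrier])
      (use velocity_in[OF grp.atlas t(1), of 0] t(2,3) in auto)
  then show ?thesis unfolding fundamental_def t by (simp only: \<tau>_def)
qed

lemma expo_in: "a \<in> liealg P \<Longrightarrow> expo P (tscale t a) \<in> carrier (grp P)"
  using grp.one_parameter_subgroup_lie_exp[of a] smooth_map_points[of model_atlas UNIV "grp_atlas P" "\<lambda>t. expo P (tscale t a)" t]
  by (simp add: one_parameter_subgroup_def grp.points)

lemma fundamental_in: "a \<in> liealg P \<Longrightarrow> q \<in> points (tot P) \<Longrightarrow> fundamental P a q \<in> tangent_space (tot P) q"
  using differential_in[OF grp.atlas tot_atlas act_smooth_right grp.open_carrier G.one_closed, of q a]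
  by (simp add: fundamental_eq act_one liealg_one)

lemma fundamental_linear:
  assumes "a \<in> liealg P" "b \<in> liealg P" and q: "q \<in> points (tot P)"
  shows "fundamental P (a + b) q = fundamental P a q + fundamental P b q"
    "fundamental P (a - b) q = fundamental P a q - fundamental P b q"
    "fundamental P (tscale r a) q = tscale r (fundamental P a q)"
  using differential_linear[OF grp.atlas tot_atlas act_smooth_right[OF q] grp.open_carrier G.one_closed, of a b] assms
    liealg_subspace
  by (simp_all add: fundamental_eq liealg_one)

lemma fundamental_zero: "q \<in> points (tot P) \<Longrightarrow> fundamental P 0 q = 0"
  using fundamental_linear(2)[of 0 0 q] liealg_subspace(1) by simp

lemma fundamental_vertical:
  assumes a: "a \<in> liealg P" and q: "q \<in> points (tot P)"
  shows "fundamental P a q \<in> vertical P q"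
proof -
  have "differential (tot P) (base P) (proj P) q (fundamental P a q)
      = differential (grp_atlas P) (base P) (\<lambda>g. proj P (act P q g)) \<one>\<^bsub>grp P\<^esub> a"
    using differential_compose[OF grp.atlas tot_atlas base_atlas act_smooth_right[OF q] grp.open_carrier proj_smooth
        open_tot G.one_closed] q a by (simp add: fundamental_eq act_one liealg_one)
  also have "\<dots> = differential (grp_atlas P) (base P) (\<lambda>g. proj P q) \<one>\<^bsub>grp P\<^esub> a"
    by (intro fun_cong[OF differential_cong[OF grp.atlas grp.open_carrier G.one_closed]] proj_act q)
  finally show ?thesis using fundamental_in[OF a q] by (simp add: vertical_def differential_const)
qed

lemma ldiff_inverse:
  assumes g: "g \<in> carrier (grp P)" and h: "h \<in> carrier (grp P)" and w: "w \<in> tangent_space (grp_atlas P) h"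
  shows "differential (grp_atlas P) (grp_atlas P) (\<lambda>x. inv\<^bsub>grp P\<^esub> g \<otimes>\<^bsub>grp P\<^esub> x) (g \<otimes>\<^bsub>grp P\<^esub> h)
    (differential (grp_atlas P) (grp_atlas P) (\<lambda>x. g \<otimes>\<^bsub>grp P\<^esub> x) h w) = w"
proof -
  have "differential (grp_atlas P) (grp_atlas P) (\<lambda>x. inv\<^bsub>grp P\<^esub> g \<otimes>\<^bsub>grp P\<^esub> (g \<otimes>\<^bsub>grp P\<^esub> x)) h w
    = differential (grp_atlas P) (grp_atlas P) (\<lambda>x. inv\<^bsub>grp P\<^esub> g \<otimes>\<^bsub>grp P\<^esub> x) (g \<otimes>\<^bsub>grp P\<^esub> h)
    (differential (grp_atlas P) (grp_atlas P) (\<lambda>x. g \<otimes>\<^bsub>grp P\<^esub> x) h w)"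
    by (rule differential_compose[OF grp.atlas grp.atlas grp.atlas grp.ltrans_smooth[OF g] grp.open_carrier
          grp.ltrans_smooth[OF G.inv_closed[OF g]] grp.open_carrier h _ w]) (use g h in simp)
  moreover have "differential (grp_atlas P) (grp_atlas P) (\<lambda>x. inv\<^bsub>grp P\<^esub> g \<otimes>\<^bsub>grp P\<^esub> (g \<otimes>\<^bsub>grp P\<^esub> x)) h w
    = differential (grp_atlas P) (grp_atlas P) (\<lambda>x. x) h w"
    by (intro fun_cong[OF differential_cong[OF grp.atlas grp.open_carrier h]]) (use g in \<open>simp flip: G.m_assoc\<close>)
  moreover have "\<dots> = w" using differential_ident[OF grp.atlas w] h by (simp add: grp.points)
  ultimately show ?thesis by simp
qed

text \<open>In a trivialisation the group coordinate of \<open>act P q h\<close> is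
  \<open>g \<otimes> h\<close>, and the differential of a left translation is invertible.\<close>

lemma fundamental_inj:
  assumes a: "a \<in> liealg P" and q: "q \<in> points (tot P)" and z: "fundamental P a q = 0"
  shows "a = 0"
proof -
  obtain U \<Psi> \<Theta> g where t: "atlas_open (base P) U" "proj P q \<in> U" "g \<in> carrier (grp P)" "\<Psi> (proj P q, g) = q"
    "smooth_map (tot P) {q \<in> points (tot P). proj P q \<in> U} (prod_atlas (base P) (grp_atlas P)) \<Theta>"
    "\<forall>q\<in>points (tot P). proj P q \<in> U \<longrightarrow> \<Theta> q \<in> U \<times> carrier (grp P) \<and> \<Psi> (\<Theta> q) = q"
    "\<forall>y\<in>U. \<forall>g\<in>carrier (grp P). \<Theta> (\<Psi> (y, g)) = (y, g) \<and> proj P (\<Psi> (y, g)) = y \<and> \<Psi> (y, g) \<in> points (tot P)"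
    "\<forall>y\<in>U. \<forall>g\<in>carrier (grp P). \<forall>h\<in>carrier (grp P). \<Psi> (y, g \<otimes>\<^bsub>grp P\<^esub> h) = act P (\<Psi> (y, g)) h"
    by (rule trivialisation[OF q], rule that)
  let ?D = "{q \<in> points (tot P). proj P q \<in> U}"
  note BG = smooth_atlas_prod[OF base_atlas grp.atlas]
  have D: "atlas_open (tot P) ?D" by (rule atlas_open_vimage[OF tot_atlas base_atlas proj_smooth open_tot t(1)])
  have U: "U \<subseteq> points (base P)" using t(1) by (simp add: atlas_open_def)
  have sm: "smooth_map (tot P) ?D (grp_atlas P) (\<lambda>q. snd (\<Theta> q))"
    by (rule smooth_map_compose[OF tot_atlas BG grp.atlas t(5) smooth_map_snd[OF base_atlas grp.atlas]])
      (use t(6) U in \<open>auto simp: grp.points mem_Times_iff\<close>)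
  have "differential (grp_atlas P) (grp_atlas P) (\<lambda>h. snd (\<Theta> (act P q h))) \<one>\<^bsub>grp P\<^esub> a
      = differential (tot P) (grp_atlas P) (\<lambda>q. snd (\<Theta> q)) q (fundamental P a q)"
    using differential_compose[OF grp.atlas tot_atlas grp.atlas act_smooth_right[OF q] grp.open_carrier sm D
        G.one_closed] q a t(2) by (simp add: fundamental_eq act_one liealg_one)
  also have "\<dots> = 0"
    unfolding z using differential_linear(2)[OF tot_atlas grp.atlas sm D _ zero_in_tangent_space[OF tot_atlas] zero_in_tangent_space[OF tot_atlas], of q]
    q t(2) by simp
  also have "differential (grp_atlas P) (grp_atlas P) (\<lambda>h. snd (\<Theta> (act P q h))) \<one>\<^bsub>grp P\<^esub> a
     = differential (grp_atlas P) (grp_atlas P) (\<lambda>h. g \<otimes>\<^bsub>grp P\<^esub> h) \<one>\<^bsub>grp P\<^esub> a"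
  proof (intro fun_cong[OF differential_cong[OF grp.atlas grp.open_carrier G.one_closed]])
    fix h assume h: "h \<in> carrier (grp P)"
    have "act P q h = \<Psi> (proj P q, g \<otimes>\<^bsub>grp P\<^esub> h)" using t(2,3,4,8) h by simp
    then show "snd (\<Theta> (act P q h)) = g \<otimes>\<^bsub>grp P\<^esub> h" using t(2,3,7) h by simp
  qed
  finally have 0: "differential (grp_atlas P) (grp_atlas P) (\<lambda>h. g \<otimes>\<^bsub>grp P\<^esub> h) \<one>\<^bsub>grp P\<^esub> a = 0" .
  have "a = differential (grp_atlas P) (grp_atlas P) (\<lambda>x. inv\<^bsub>grp P\<^esub> g \<otimes>\<^bsub>grp P\<^esub> x) (g \<otimes>\<^bsub>grp P\<^esub> \<one>\<^bsub>grp P\<^esub>) 0"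
    using ldiff_inverse[OF t(3) G.one_closed a[unfolded liealg_one]] by (simp only: 0)
  also have "\<dots> = 0"
    using differential_linear(2)[OF grp.atlas grp.atlas grp.ltrans_smooth[OF G.inv_closed[OF t(3)]] grp.open_carrier
        G.m_closed[OF t(3) G.one_closed] zero_in_tangent_space[OF grp.atlas] zero_in_tangent_space[OF grp.atlas]] by simp
  finally show ?thesis .
qed

text \<open>In a trivialisation \<open>v\<close> splits into a part along the base, which vanishes for vertical \<open>v\<close>,
  and a part along the fibre.\<close>

lemma vertical_imp_fundamental:
  assumes v: "v \<in> vertical P q" and q: "q \<in> points (tot P)"
  shows "\<exists>a\<in>liealg P. v = fundamental P a q"
proof -
  obtain U \<Psi> \<Theta> g where t: "atlas_open (base P) U" "proj P q \<in> U" "g \<in> carrier (grp P)" "\<Psi> (proj P q, g) = q"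
    "smooth_map (prod_atlas (base P) (grp_atlas P)) (U \<times> carrier (grp P)) (tot P) \<Psi>"
    "smooth_map (tot P) {q \<in> points (tot P). proj P q \<in> U} (prod_atlas (base P) (grp_atlas P)) \<Theta>"
    "\<forall>q\<in>points (tot P). proj P q \<in> U \<longrightarrow> \<Theta> q \<in> U \<times> carrier (grp P) \<and> \<Psi> (\<Theta> q) = q"
    "\<forall>y\<in>U. \<forall>g\<in>carrier (grp P). \<Theta> (\<Psi> (y, g)) = (y, g) \<and> proj P (\<Psi> (y, g)) = y \<and> \<Psi> (y, g) \<in> points (tot P)"
    "\<forall>y\<in>U. \<forall>g\<in>carrier (grp P). \<forall>h\<in>carrier (grp P). \<Psi> (y, g \<otimes>\<^bsub>grp P\<^esub> h) = act P (\<Psi> (y, g)) h"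
    by (rule trivialisation[OF q], rule that)
  let ?D = "{q \<in> points (tot P). proj P q \<in> U}" and ?G = "grp_atlas P"
  note BG = smooth_atlas_prod[OF base_atlas grp.atlas]
  have vt: "v \<in> tangent_space (tot P) q" "differential (tot P) (base P) (proj P) q v = 0"
    using v by (auto simp: vertical_def)
  have D: "atlas_open (tot P) ?D" by (rule atlas_open_vimage[OF tot_atlas base_atlas proj_smooth open_tot t(1)])
  have qD: "q \<in> ?D" using q t(2) by simp
  have U: "U \<subseteq> points (base P)" using t(1) by (simp add: atlas_open_def)
  have sm: "smooth_map (tot P) ?D ?G (\<lambda>q. snd (\<Theta> q))"
    by (rule smooth_map_compose[OF tot_atlas BG grp.atlas t(6) smooth_map_snd[OF base_atlas grp.atlas]])
      (use t(7) U in \<open>auto simp: grp.points mem_Times_iff\<close>)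
  have sp: "smooth_map (tot P) ?D (base P) (proj P)" by (rule smooth_map_subset[OF proj_smooth]) auto
  have \<Theta>q: "snd (\<Theta> q) = g" using t(2,3,4,8) by force
  have rec: "\<Psi> (proj P p, snd (\<Theta> p)) = p" if "p \<in> ?D" for p
  proof -
    have p: "\<Theta> p \<in> U \<times> carrier (grp P)" "\<Psi> (\<Theta> p) = p" using t(7) that by auto
    then have "proj P p = fst (\<Theta> p)" using t(8) by (cases "\<Theta> p") auto
    then show ?thesis using p by simp
  qed
  define w where "w = differential (tot P) ?G (\<lambda>q. snd (\<Theta> q)) q v"
  have w: "w \<in> tangent_space ?G g" unfolding w_def
    using differential_in[OF tot_atlas grp.atlas sm D qD vt(1)] \<Theta>q by simp
  have S1: "smooth_map (base P) U (tot P) (\<lambda>y. \<Psi> (y, g))" and S2: "smooth_map ?G (carrier (grp P)) (tot P) (\<lambda>h. \<Psi> (proj P q, h))"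
    using smooth_map_partial[OF base_atlas grp.atlas tot_atlas t(5)] U t(2,3) by (auto simp: grp.points)
  have "v = differential (tot P) (tot P) (\<lambda>p. p) q v" using differential_ident[OF tot_atlas vt(1) q] by simp
  also have "\<dots> = differential (tot P) (tot P) (\<lambda>p. \<Psi> (proj P p, snd (\<Theta> p))) q v"
    by (intro fun_cong[OF differential_cong[OF tot_atlas D qD]]) (simp only: rec)
  also have "\<dots> = differential (base P) (tot P) (\<lambda>y. \<Psi> (y, snd (\<Theta> q))) (proj P q) (differential (tot P) (base P) (proj P) q v) +
    differential ?G (tot P) (\<lambda>h. \<Psi> (proj P q, h)) (snd (\<Theta> q)) (differential (tot P) ?G (\<lambda>q. snd (\<Theta> q)) q v)"
    by (rule differential_Pair[OF tot_atlas base_atlas grp.atlas tot_atlas t(5) t(1) grp.open_carrier D sp sm _ _ qD vt(1)])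
      (use t(7) in auto)
  also have "\<dots> = differential ?G (tot P) (\<lambda>h. \<Psi> (proj P q, h)) g w"
    using differential_linear(2)[OF base_atlas tot_atlas S1 t(1,2) zero_in_tangent_space[OF base_atlas] zero_in_tangent_space[OF base_atlas]]
    by (simp add: vt(2) \<Theta>q w_def)
  \<comment> \<open>Since \<open>q\<close> is \<open>\<Psi> (proj P q, g)\<close>, equivariance
    moves along the fibre by acting on \<open>q\<close> with \<open>inv g \<otimes> h\<close>. The
    fibre direction thus becomes a direction along the orbit map at the unit.\<close>
  also have "\<dots> = differential ?G (tot P) (\<lambda>h. act P q (inv\<^bsub>grp P\<^esub> g \<otimes>\<^bsub>grp P\<^esub> h)) g w"
  proof (intro fun_cong[OF differential_cong[OF grp.atlas grp.open_carrier t(3)]])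
    fix h assume h: "h \<in> carrier (grp P)"
    have "act P q (inv\<^bsub>grp P\<^esub> g \<otimes>\<^bsub>grp P\<^esub> h) = \<Psi> (proj P q, g \<otimes>\<^bsub>grp P\<^esub> (inv\<^bsub>grp P\<^esub> g \<otimes>\<^bsub>grp P\<^esub> h))"
      using t(2,3,4,9) h by simp
    also have "g \<otimes>\<^bsub>grp P\<^esub> (inv\<^bsub>grp P\<^esub> g \<otimes>\<^bsub>grp P\<^esub> h) = h" using h t(3) by (simp flip: G.m_assoc)
    finally show "\<Psi> (proj P q, h) = act P q (inv\<^bsub>grp P\<^esub> g \<otimes>\<^bsub>grp P\<^esub> h)" by simp
  qed
  also have "\<dots> = differential ?G (tot P) (\<lambda>h. act P q h) (inv\<^bsub>grp P\<^esub> g \<otimes>\<^bsub>grp P\<^esub> g)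
      (differential ?G ?G (\<lambda>h. inv\<^bsub>grp P\<^esub> g \<otimes>\<^bsub>grp P\<^esub> h) g w)"
    by (rule differential_compose[OF grp.atlas grp.atlas tot_atlas grp.ltrans_smooth[OF G.inv_closed[OF t(3)]] grp.open_carrier
          act_smooth_right[OF q] grp.open_carrier t(3) _ w]) (use t(3) in simp)
  finally have eq: "v = differential ?G (tot P) (\<lambda>h. act P q h) \<one>\<^bsub>grp P\<^esub> (differential ?G ?G (\<lambda>h. inv\<^bsub>grp P\<^esub> g \<otimes>\<^bsub>grp P\<^esub> h) g w)"
    using t(3) by simp
  have a: "differential ?G ?G (\<lambda>h. inv\<^bsub>grp P\<^esub> g \<otimes>\<^bsub>grp P\<^esub> h) g w \<in> liealg P"
    using differential_in[OF grp.atlas grp.atlas grp.ltrans_smooth[OF G.inv_closed[OF t(3)]] grp.open_carrier t(3) w] t(3)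
    by (simp add: liealg_one)
  show ?thesis using eq by (intro bexI[OF _ a]) (simp add: fundamental_eq[OF a q])
qed

text \<open>The local section \<open>y \<mapsto> \<Psi> (y, g)\<close> passes through
  \<open>q\<close>; its differential applied to \<open>X\<close> is a preimage.\<close>

lemma proj_surj:
  assumes X: "X \<in> tangent_space (base P) (proj P q)" and q: "q \<in> points (tot P)"
  shows "\<exists>v\<in>tangent_space (tot P) q. differential (tot P) (base P) (proj P) q v = X"
proof -
  obtain U \<Psi> \<Theta> g where t: "atlas_open (base P) U" "proj P q \<in> U" "g \<in> carrier (grp P)" "\<Psi> (proj P q, g) = q"
    "smooth_map (prod_atlas (base P) (grp_atlas P)) (U \<times> carrier (grp P)) (tot P) \<Psi>"
    "\<forall>y\<in>U. \<forall>g\<in>carrier (grp P). \<Theta> (\<Psi> (y, g)) = (y, g) \<and> proj P (\<Psi> (y, g)) = y \<and> \<Psi> (y, g) \<in> points (tot P)"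
    by (rule trivialisation[OF q], rule that)
  have U: "U \<subseteq> points (base P)" using t(1) by (simp add: atlas_open_def)
  have S1: "smooth_map (base P) U (tot P) (\<lambda>y. \<Psi> (y, g))"
    using smooth_map_partial(1)[OF base_atlas grp.atlas tot_atlas t(5) U t(3)] t(3) by (simp add: grp.points)
  let ?v = "differential (base P) (tot P) (\<lambda>y. \<Psi> (y, g)) (proj P q) X"
  have "?v \<in> tangent_space (tot P) q" using differential_in[OF base_atlas tot_atlas S1 t(1,2) X] t(4) by simp
  moreover have "differential (tot P) (base P) (proj P) q ?v = differential (base P) (base P) (\<lambda>y. proj P (\<Psi> (y, g))) (proj P q) X"
    using differential_compose[OF base_atlas tot_atlas base_atlas S1 t(1) proj_smooth open_tot t(2) _ X] q t(4) by simp
  moreover have "\<dots> = differential (base P) (base P) (\<lambda>y. y) (proj P q) X"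
    by (intro fun_cong[OF differential_cong[OF base_atlas t(1,2)]]) (use t(3,6) in simp)
  moreover have "\<dots> = X" by (rule differential_ident[OF base_atlas X proj_in[OF q]])
  ultimately show ?thesis by (intro bexI[of _ ?v]) auto
qed

end

section \<open>Horizontal distributions\<close>

lemma linear_inv_into:
  assumes f: "linear f" and b: "bij f" shows "linear (inv_into UNIV f)"
proof (rule linearI)
  have i: "f (inv_into UNIV f e) = e" "inv_into UNIV f (f w) = w" for e w
    using b by (auto simp: bij_is_surj surj_f_inv_f bij_is_inj inv_f_f)
  show "inv_into UNIV f (x + y) = inv_into UNIV f x + inv_into UNIV f y" for x y
    using i(2)[of "inv_into UNIV f x + inv_into UNIV f y"] by (simp add: linear_add[OF f] i(1))
  show "inv_into UNIV f (r *\<^sub>R x) = r *\<^sub>R inv_into UNIV f x" for r x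
    using i(2)[of "r *\<^sub>R inv_into UNIV f x"] by (simp add: linear_scale[OF f] i(1))
qed

lemma sum_tvec_apply: "(\<Sum>i\<in>I. f i) c = (\<Sum>i\<in>I. f i c)" for f :: "'i \<Rightarrow> 'c \<Rightarrow> 'e::comm_monoid_add"
  by (induction I rule: infinite_finite_induct) auto

lemma tscale_add: "tscale r (v + w) = tscale r v + tscale r w"
  by (simp add: tscale_def fun_eq_iff scaleR_add_right)

lemma tvec_linear:
  assumes A: "smooth_atlas A" and c: "c \<in> A" "p \<in> fst c"
  shows "tvec A c p (e + e') = tvec A c p e + tvec A c p e'" "tvec A c p (r *\<^sub>R e) = tscale r (tvec A c p e)"
    "tvec A c p 0 = 0"
proof -
  have p: "p \<in> points A" using c by (auto simp: points_iff)
  note * = tangent_space_eqI[OF tvec_in[OF A c] _ c] and s = tangent_space_subspace[OF A p] and i = tvec_in[OF A c]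
  show "tvec A c p (e + e') = tvec A c p e + tvec A c p e'" by (rule *) (auto simp: tvec_apply[OF A c] intro!: s i)
  show "tvec A c p (r *\<^sub>R e) = tscale r (tvec A c p e)" by (rule *) (auto simp: tvec_apply[OF A c] tscale_def intro!: s(4)[unfolded tscale_def] i)
  show "tvec A c p 0 = 0" by (rule *) (auto simp: tvec_apply[OF A c] intro!: s)
qed

lemma vector_field_smooth:
  assumes A: "smooth_atlas A" and V: "atlas_open A V" and X: "smooth_vector_field A V X" and c: "c \<in> A"
  shows "smooth_on (snd c ` (V \<inter> fst c)) (\<lambda>x. X (chart_inv c x) c)" "p \<in> V \<Longrightarrow> X p \<in> tangent_space A p"
proof -
  have sm: "smooth_map A V (tangent_atlas A) (\<lambda>p. (p, X p))" using X by (simp add: smooth_vector_field_def)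
  have in_T: "X p \<in> tangent_space A p" if "p \<in> V" for p
    using smooth_map_points[OF sm that] by (simp add: points_tangent)
  then show "p \<in> V \<Longrightarrow> X p \<in> tangent_space A p" .
  show "smooth_on (snd c ` (V \<inter> fst c)) (\<lambda>x. X (chart_inv c x) c)"
  proof (rule smooth_on_local)
    fix x assume "x \<in> snd c ` (V \<inter> fst c)"
    then obtain p where p: "p \<in> V" "p \<in> fst c" "x = snd c p" by auto
    have d: "(p, X p) \<in> fst (tangent_chart A c)" using p in_T by simp
    obtain W where W: "open W" "snd c p \<in> W"
      "smooth_on W (\<lambda>x. snd (tangent_chart A c) (chart_inv c x, X (chart_inv c x)))"
      by (rule smooth_map_openE[OF A smooth_atlas_tangent[OF A] sm V p(1) c p(2) tangent_chart_in[OF c] d], rule that)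
    have "smooth_on W (\<lambda>x. X (chart_inv c x) c)" using smooth_on_snd[OF W(3)] by simp
    then show "\<exists>W. open W \<and> x \<in> W \<and> smooth_on (snd c ` (V \<inter> fst c) \<inter> W) (\<lambda>x. X (chart_inv c x) c)"
      using W p by (intro exI[of _ W]) (auto intro: smooth_on_subset)
  qed
qed

locale connection = principal P
  for P :: "('q, 'e::model_space, 'm, 'd::model_space, 'g, 'h::model_space) bundle_data" +
  fixes H :: "'q \<Rightarrow> ('q, 'e) tvec set"
  assumes horizontal: "horizontal_distribution P H" and invariant: "invariant_distribution P H"
begin

abbreviation combination :: "nat \<Rightarrow> (nat \<Rightarrow> 'q \<Rightarrow> ('q, 'e) tvec) \<Rightarrow> 'q \<Rightarrow> (nat \<Rightarrow> real) \<Rightarrow> ('q, 'e) tvec" where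
  "combination n X p a \<equiv> \<Sum>i<n. tscale (a i) (X i p)"

text \<open>The coefficients are restricted to \<open>{..<n}\<close> because the frame bijection
  lives on extensional functions; outside this set they do not enter the sum.\<close>

lemma combination_linear:
  "combination n X p (\<lambda>i\<in>{..<n}. a i + b i) = combination n X p a + combination n X p b"
  "combination n X p (\<lambda>i\<in>{..<n}. r * a i) = tscale r (combination n X p a)"
  by (auto simp: fun_eq_iff sum_tvec_apply tscale_def scaleR_left_distrib sum.distrib scaleR_right.sum)

lemma frame:
  assumes "p \<in> points (tot P)"
  obtains U n X where "atlas_open (tot P) U" "p \<in> U" "\<forall>i<n. smooth_vector_field (tot P) U (X i)"
    "\<forall>p\<in>U. bij_betw (combination n X p) ({..<n} \<rightarrow>\<^sub>E UNIV) (H p)"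
proof -
  have "\<exists>U n X. openin (atlas_topology (tot P)) U \<and> p \<in> U \<and>
        (\<forall>i<n::nat. smooth_vector_field (tot P) U (X i)) \<and>
        (\<forall>p'\<in>U. bij_betw (combination n X p') ({..<n} \<rightarrow>\<^sub>E UNIV) (H p'))"
    using horizontal assms unfolding horizontal_distribution_def smooth_distribution_def by simp
  then obtain U n X where "openin (atlas_topology (tot P)) U" "p \<in> U"
        "\<forall>i<n::nat. smooth_vector_field (tot P) U (X i)"
        "\<forall>p'\<in>U. bij_betw (combination n X p') ({..<n} \<rightarrow>\<^sub>E UNIV) (H p')" by (elim exE conjE)
  then show thesis by (intro that[of U n X]) (simp_all add: openin_atlas_topology[OF tot_atlas])
qed

lemma H_tangent: "q \<in> points (tot P) \<Longrightarrow> v \<in> H q \<Longrightarrow> v \<in> tangent_space (tot P) q"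
  using horizontal unfolding horizontal_distribution_def by blast

text \<open>Linearity of \<open>H q\<close> is not part of \<open>horizontal_distribution\<close>;
  it is a consequence of the local frame, which describes \<open>H q\<close> as the set of linear
  combinations.\<close>

lemma H_subspace:
  assumes q: "q \<in> points (tot P)"
  shows "v \<in> H q \<Longrightarrow> w \<in> H q \<Longrightarrow> v + w \<in> H q" "v \<in> H q \<Longrightarrow> tscale r v \<in> H q" "0 \<in> H q"
    "v \<in> H q \<Longrightarrow> w \<in> H q \<Longrightarrow> v - w \<in> H q"
proof -
  obtain U n X where "q \<in> U" "\<forall>p\<in>U. bij_betw (combination n X p) ({..<n} \<rightarrow>\<^sub>E UNIV) (H p)"
    by (rule frame[OF q], rule that)
  then have im: "combination n X q ` ({..<n} \<rightarrow>\<^sub>E UNIV) = H q" by (simp add: bij_betw_def)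
  have ex: "\<exists>a. v = combination n X q a" if "v \<in> H q" for v
    using that unfolding im[symmetric] by (elim imageE) (rule exI)
  have mem: "combination n X q a \<in> H q" if "a \<in> {..<n} \<rightarrow>\<^sub>E UNIV" for a
    unfolding im[symmetric] using that by (rule imageI)
  show add: "v + w \<in> H q" if vw: "v \<in> H q" "w \<in> H q" for v w
  proof -
    obtain a where a: "v = combination n X q a" using ex[OF vw(1)] by (elim exE)
    obtain b where b: "w = combination n X q b" using ex[OF vw(2)] by (elim exE)
    show ?thesis unfolding a b combination_linear(1)[symmetric] by (rule mem) (auto simp: PiE_iff extensional_def)
  qed
  show scale: "tscale r v \<in> H q" if v: "v \<in> H q" for r v
  proof -
    obtain a where a: "v = combination n X q a" using ex[OF v] by (elim exE)
    show ?thesis unfolding a combination_linear(2)[symmetric] by (rule mem) (auto simp: PiE_iff extensional_def)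
  qed
  have "combination n X q (\<lambda>i\<in>{..<n}. 0) \<in> H q" by (rule mem) (auto simp: PiE_iff extensional_def)
  from scale[OF this, of 0] show "0 \<in> H q" by (simp add: tscale_def zero_fun_def)
  show "v - w \<in> H q" if "v \<in> H q" "w \<in> H q"
    using add[OF that(1) scale[OF that(2), of "-1"]] by (simp add: tscale_def fun_diff_def plus_fun_def)
qed

lemma decomposition:
  assumes q: "q \<in> points (tot P)" and v: "v \<in> tangent_space (tot P) q"
  obtains h a where "h \<in> H q" "a \<in> liealg P" "v = h + fundamental P a q"
proof -
  have "\<exists>!(h, w). h \<in> H q \<and> w \<in> vertical P q \<and> v = h + w"
    using horizontal q v unfolding horizontal_distribution_def by blast
  then obtain h w where "h \<in> H q" "w \<in> vertical P q" "v = h + w" by auto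
  then show thesis using vertical_imp_fundamental[OF _ q, of w] that by blast
qed

text \<open>Uniqueness of the splitting into horizontal and vertical parts, followed by injectivity
  of \<open>a \<mapsto> fundamental P a q\<close>.\<close>

lemma decomposition_unique:
  assumes q: "q \<in> points (tot P)" and "h \<in> H q" "h' \<in> H q" and a: "a \<in> liealg P" "a' \<in> liealg P"
    and eq: "h + fundamental P a q = h' + fundamental P a' q"
  shows "h = h'" "a = a'"
proof -
  let ?v = "h + fundamental P a q"
  have "?v \<in> tangent_space (tot P) q"
    using tangent_space_subspace(2)[OF tot_atlas q H_tangent[OF q assms(2)] fundamental_in[OF a(1) q]] .
  then have ex: "\<exists>!(h, w). h \<in> H q \<and> w \<in> vertical P q \<and> ?v = h + w"
    using horizontal q unfolding horizontal_distribution_def by blast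
  have "(h, fundamental P a q) = (h', fundamental P a' q)"
    by (rule ex1E[OF ex]) (use assms fundamental_vertical[OF a(1) q] fundamental_vertical[OF a(2) q] in \<open>auto split: prod.splits\<close>)
  then have "h = h'" and f: "fundamental P a q = fundamental P a' q" by auto
  then show "h = h'" by simp
  have "fundamental P (a - a') q = 0" using fundamental_linear(2)[OF a q] f by simp
  then show "a = a'" using fundamental_inj[OF liealg_subspace(3)[OF a] q] by simp
qed

section \<open>The connection form at a point\<close>

lemma omega_eq:
  assumes q: "q \<in> points (tot P)" and h: "h \<in> H q" and a: "a \<in> liealg P" and v: "v = h + fundamental P a q"
  shows "omega P H (q, v) = a"
  unfolding omega_def
proof (rule the_equality)
  show "a \<in> liealg P \<and> (\<exists>h\<in>H (fst (q, v)). snd (q, v) = h + fundamental P a (fst (q, v)))" using h a v by auto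
  show "b = a" if "b \<in> liealg P \<and> (\<exists>h\<in>H (fst (q, v)). snd (q, v) = h + fundamental P b (fst (q, v)))" for b
    using that decomposition_unique(2)[OF q _ h _ a] v by auto
qed

lemma omega_decomposition:
  assumes q: "q \<in> points (tot P)" and v: "v \<in> tangent_space (tot P) q"
  shows "omega P H (q, v) \<in> liealg P" "v - fundamental P (omega P H (q, v)) q \<in> H q"
proof -
  obtain h a where *: "h \<in> H q" "a \<in> liealg P" "v = h + fundamental P a q" by (rule decomposition[OF q v], rule that)
  show "omega P H (q, v) \<in> liealg P" "v - fundamental P (omega P H (q, v)) q \<in> H q"
    unfolding omega_eq[OF q *] using * by simp_all
qed

lemma omega_linear:
  assumes q: "q \<in> points (tot P)" and v: "v \<in> tangent_space (tot P) q" and w: "w \<in> tangent_space (tot P) q"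
  shows "omega P H (q, v + w) = omega P H (q, v) + omega P H (q, w)"
    "omega P H (q, v - w) = omega P H (q, v) - omega P H (q, w)"
    "omega P H (q, tscale r v) = tscale r (omega P H (q, v))"
proof -
  obtain h a where *: "h \<in> H q" "a \<in> liealg P" "v = h + fundamental P a q" by (rule decomposition[OF q v], rule that)
  obtain k b where **: "k \<in> H q" "b \<in> liealg P" "w = k + fundamental P b q" by (rule decomposition[OF q w], rule that)
  note e = omega_eq[OF q *] omega_eq[OF q **]
  show "omega P H (q, v + w) = omega P H (q, v) + omega P H (q, w)"
    by (simp only: e, rule omega_eq[OF q H_subspace(1)[OF q *(1) **(1)] liealg_subspace(2)[OF *(2) **(2)]])
      (simp add: *(3) **(3) fundamental_linear(1)[OF *(2) **(2) q])
  show "omega P H (q, v - w) = omega P H (q, v) - omega P H (q, w)"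
    by (simp only: e, rule omega_eq[OF q H_subspace(4)[OF q *(1) **(1)] liealg_subspace(3)[OF *(2) **(2)]])
      (simp add: *(3) **(3) fundamental_linear(2)[OF *(2) **(2) q])
  show "omega P H (q, tscale r v) = tscale r (omega P H (q, v))"
    by (simp only: e, rule omega_eq[OF q H_subspace(2)[OF q *(1), of r] liealg_subspace(4)[OF *(2)]])
      (simp add: *(3) fundamental_linear(3)[OF *(2) *(2) q] tscale_add)
qed

lemma omega_fundamental: "q \<in> points (tot P) \<Longrightarrow> a \<in> liealg P \<Longrightarrow> omega P H (q, fundamental P a q) = a"
  by (rule omega_eq[OF _ H_subspace(3)]) auto

lemma omega_horizontal: "q \<in> points (tot P) \<Longrightarrow> h \<in> H q \<Longrightarrow> omega P H (q, h) = 0"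
  by (rule omega_eq[OF _ _ liealg_subspace(1)]) (auto simp: fundamental_zero)

lemma omega_zero_iff:
  "q \<in> points (tot P) \<Longrightarrow> v \<in> tangent_space (tot P) q \<Longrightarrow> omega P H (q, v) = 0 \<longleftrightarrow> v \<in> H q"
  using omega_decomposition(2)[of q v] omega_horizontal by (auto simp: fundamental_zero)

section \<open>Horizontal lifts at a point\<close>

abbreviation dproj :: "'q \<Rightarrow> ('q, 'e) tvec \<Rightarrow> ('m, 'd) tvec" where
  "dproj q \<equiv> differential (tot P) (base P) (proj P) q"

lemma dproj_fundamental: "q \<in> points (tot P) \<Longrightarrow> a \<in> liealg P \<Longrightarrow> dproj q (fundamental P a q) = 0"
  using fundamental_vertical by (simp add: vertical_def)

lemma dproj_in: "q \<in> points (tot P) \<Longrightarrow> v \<in> tangent_space (tot P) q \<Longrightarrow> dproj q v \<in> tangent_space (base P) (proj P q)"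
  by (rule differential_in[OF tot_atlas base_atlas proj_smooth open_tot])

lemma dproj_linear:
  assumes "q \<in> points (tot P)" "v \<in> tangent_space (tot P) q" "w \<in> tangent_space (tot P) q"
  shows "dproj q (v + w) = dproj q v + dproj q w" "dproj q (v - w) = dproj q v - dproj q w"
  using differential_linear[OF tot_atlas base_atlas proj_smooth open_tot] assms by auto

lemma horizontal_dproj_zero:
  assumes q: "q \<in> points (tot P)" and v: "v \<in> H q" and z: "dproj q v = 0"
  shows "v = 0"
proof -
  have "v \<in> vertical P q" using H_tangent[OF q v] z by (simp add: vertical_def)
  then obtain a where a: "a \<in> liealg P" "v = fundamental P a q" using vertical_imp_fundamental[OF _ q] by blast
  then have "v + fundamental P 0 q = 0 + fundamental P a q" by (simp add: fundamental_zero[OF q])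
  from decomposition_unique(1)[OF q v H_subspace(3)[OF q] liealg_subspace(1) a(1) this] show ?thesis .
qed

lemma hlift_eq:
  assumes q: "q \<in> points (tot P)" and v: "v \<in> H q" "dproj q v = X"
  shows "hlift P H q X = v"
  unfolding hlift_def
proof (rule the_equality)
  fix w assume w: "w \<in> H q \<and> dproj q w = X"
  have "dproj q (w - v) = 0"
    using dproj_linear(2)[OF q, of w v] H_tangent[OF q] w v by simp
  then show "w = v" using horizontal_dproj_zero[OF q H_subspace(4)[OF q, of w v]] w v by simp
qed (use v in simp)

lemma hlift:
  assumes q: "q \<in> points (tot P)" and X: "X \<in> tangent_space (base P) (proj P q)"
  shows "hlift P H q X \<in> H q" "dproj q (hlift P H q X) = X"
proof -
  obtain v where v: "v \<in> tangent_space (tot P) q" "dproj q v = X" using proj_surj[OF X q] by blast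
  obtain h a where h: "h \<in> H q" "a \<in> liealg P" "v = h + fundamental P a q" by (rule decomposition[OF q v(1)], rule that)
  have "dproj q h = X"
    using dproj_linear(1)[OF q H_tangent[OF q h(1)] fundamental_in[OF h(2) q]] v(2) h(3) dproj_fundamental[OF q h(2)] by simp
  then show "hlift P H q X \<in> H q" "dproj q (hlift P H q X) = X" using hlift_eq[OF q h(1)] h(1) by auto
qed

end

subsection \<open>Coordinate expressions\<close>

text \<open>Fixes one chart of the total space and one chart of the group around the unit. The
  component in \<open>k\<close> identifies the Lie algebra with the model space of the group, so the
  connection becomes a family of maps between model spaces.\<close>

locale charted_connection = connection P H
  for P :: "('q, 'e::model_space, 'm, 'd::model_space, 'g, 'h::model_space) bundle_data" and H +
  fixes c :: "('q, 'e) chart" and k :: "('g, 'h) chart"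
  assumes c: "c \<in> tot P" and k: "k \<in> grp_atlas P" "\<one>\<^bsub>grp P\<^esub> \<in> fst k"
begin

definition pt :: "'e \<Rightarrow> 'q" where "pt x = chart_inv c x"
definition U :: "'e set" where "U = snd c ` fst c"
definition e0 :: 'h where "e0 = snd k \<one>\<^bsub>grp P\<^esub>"
definition vec :: "'e \<Rightarrow> 'e \<Rightarrow> ('q, 'e) tvec" where "vec x e = tvec (tot P) c (pt x) e"
definition alg :: "'h \<Rightarrow> ('g, 'h) tvec" where "alg w = tvec (grp_atlas P) k \<one>\<^bsub>grp P\<^esub> w"
definition ac :: "'e \<times> 'h \<Rightarrow> 'e" where "ac z = snd c (act P (pt (fst z)) (chart_inv k (snd z)))"
definition Fu :: "'e \<Rightarrow> 'h \<Rightarrow> 'e" where "Fu x w = fundamental P (alg w) (pt x) c"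
definition Om :: "'e \<Rightarrow> 'e \<Rightarrow> 'h" where "Om x e = omega P H (pt x, vec x e) k"

lemma open_U: "open U" unfolding U_def by (rule smooth_atlasD(4)[OF tot_atlas c])

lemma pt: assumes "x \<in> U" shows "pt x \<in> fst c" "snd c (pt x) = x" "pt x \<in> points (tot P)"
  using chart_inv_in[OF assms[unfolded U_def]] chart_inv_right[OF assms[unfolded U_def]] c
  by (auto simp: pt_def points_iff)

lemma pt_snd: "q \<in> fst c \<Longrightarrow> pt (snd c q) = q" "q \<in> fst c \<Longrightarrow> snd c q \<in> U"
  by (auto simp: pt_def U_def chart_inv_left[OF tot_atlas c])

lemma vec:
  assumes "x \<in> U"
  shows "vec x e \<in> tangent_space (tot P) (pt x)" "vec x e c = e"
    "v \<in> tangent_space (tot P) (pt x) \<Longrightarrow> vec x (v c) = v"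
    "vec x (e + e') = vec x e + vec x e'" "vec x (r *\<^sub>R e) = tscale r (vec x e)" "vec x 0 = 0"
  using tvec_in[OF tot_atlas c] tvec_apply[OF tot_atlas c] tvec_eq[OF tot_atlas c] tvec_linear[OF tot_atlas c] pt[OF assms]
  by (auto simp: vec_def)

lemma vec_eqI: "\<lbrakk>x \<in> U; v \<in> tangent_space (tot P) (pt x); w \<in> tangent_space (tot P) (pt x); v c = w c\<rbrakk> \<Longrightarrow> v = w"
  using vec(3) by metis

lemma alg:
  "alg w \<in> liealg P" "alg w k = w" "a \<in> liealg P \<Longrightarrow> alg (a k) = a"
  "alg (w + w') = alg w + alg w'" "alg (r *\<^sub>R w) = tscale r (alg w)" "alg 0 = 0"
  using tvec_in[OF grp.atlas k] tvec_apply[OF grp.atlas k] tvec_eq[OF grp.atlas k] tvec_linear[OF grp.atlas k]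
  by (auto simp: alg_def liealg_one)

lemma alg_eqI: "a \<in> liealg P \<Longrightarrow> b \<in> liealg P \<Longrightarrow> a k = b k \<Longrightarrow> a = b"
  using alg(3) by metis

text \<open>The unit moves no point, so by continuity the action keeps points near \<open>x\<close>
  in the domain of \<open>c\<close> for group elements near the unit; there \<open>ac\<close> is
  meaningful and smooth.\<close>

lemma ac_local:
  assumes x: "x \<in> U"
  obtains W where "open W" "(x, e0) \<in> W" "smooth_on W ac"
    "\<forall>z\<in>W. fst z \<in> U \<and> snd z \<in> snd k ` fst k \<and> act P (pt (fst z)) (chart_inv k (snd z)) \<in> fst c"
proof -
  let ?C = "prod_chart c k" and ?F = "\<lambda>(q, g). act P q g" and ?S = "points (tot P) \<times> carrier (grp P)"
  note QG = smooth_atlas_prod[OF tot_atlas grp.atlas]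
  have S: "atlas_open (prod_atlas (tot P) (grp_atlas P)) ?S" by (rule atlas_open_Times[OF open_tot grp.open_carrier])
  have p: "(pt x, \<one>\<^bsub>grp P\<^esub>) \<in> ?S" "(pt x, \<one>\<^bsub>grp P\<^esub>) \<in> fst ?C" "?F (pt x, \<one>\<^bsub>grp P\<^esub>) \<in> fst c"
    using pt[OF x] k act_one[OF pt(3)[OF x]] by auto
  obtain W where W: "open W" "snd ?C (pt x, \<one>\<^bsub>grp P\<^esub>) \<in> W" "W \<subseteq> snd ?C ` (?S \<inter> fst ?C)"
    "\<forall>z\<in>W. ?F (chart_inv ?C z) \<in> fst c" "smooth_on W (\<lambda>z. snd c (?F (chart_inv ?C z)))"
    by (rule smooth_map_openE[OF QG tot_atlas act_smooth S p(1) prod_chart_in[OF c k(1)] p(2) c p(3)], rule that)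
  have im: "fst z \<in> U \<and> snd z \<in> snd k ` fst k" if "z \<in> W" for z
    using W(3) that by (fastforce simp: U_def)
  have inv: "chart_inv ?C z = (pt (fst z), chart_inv k (snd z))" if "z \<in> W" for z
    using prod_chart_inv[OF tot_atlas grp.atlas c k(1), of "fst z" "snd z"] im[OF that] by (simp add: U_def pt_def)
  have ac: "smooth_on W ac"
    by (rule smooth_on_cong[THEN iffD2, OF _ W(5)]) (simp add: inv ac_def)
  show thesis
    by (rule that[OF W(1) _ ac]) (use W(2,4) im inv pt(2)[OF x] in \<open>auto simp: e0_def\<close>)
qed

text \<open>Fundamental fields are the partial derivative of the action in the group direction. This
  gives their smoothness and later allows derivatives in the space and group directions to be
  interchanged.\<close>

lemma Fu_eq:
  assumes W: "open W" "smooth_on W ac" "(x, e0) \<in> W" and x: "x \<in> U"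
  shows "Fu x w = fderiv ac (x, e0) (0, w)"
proof -
  have "Fu x w = fderiv (\<lambda>y. snd c (act P (pt x) (chart_inv k y))) (snd k \<one>\<^bsub>grp P\<^esub>) (alg w k)"
    unfolding Fu_def fundamental_eq[OF alg(1) pt(3)[OF x]]
    by (rule differential_chart[OF grp.atlas tot_atlas act_smooth_right[OF pt(3)[OF x]] grp.open_carrier G.one_closed k c])
      (use act_one[OF pt(3)[OF x]] pt(1)[OF x] alg(1) in \<open>simp_all add: liealg_one\<close>)
  also have "\<dots> = fderiv (\<lambda>y. ac (x, y)) e0 w" by (simp add: ac_def alg(2) e0_def)
  also have "\<dots> = fderiv ac (x, e0) (0, w)" by (rule fderiv_partial(2)[OF W])
  finally show ?thesis .
qed

lemma Fu_smooth: "smooth_on U (\<lambda>x. Fu x w)"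
proof (rule smooth_on_local)
  fix x assume x: "x \<in> U"
  obtain W where W: "open W" "(x, e0) \<in> W" "smooth_on W ac" by (rule ac_local[OF x], rule that)
  let ?N = "(\<lambda>y. (y, e0)) -` W"
  have "open ?N" by (intro open_vimage W(1) continuous_intros)
  moreover have "smooth_on (U \<inter> ?N) (\<lambda>x. Fu x w)"
  proof (rule smooth_on_cong[THEN iffD2])
    show "Fu y w = fderiv ac (y, e0) (0, w)" if "y \<in> U \<inter> ?N" for y using Fu_eq[OF W(1,3)] that by auto
    show "smooth_on (U \<inter> ?N) (\<lambda>y. fderiv ac (y, e0) (0, w))"
      by (rule smooth_on_fderiv_apply[OF W(1,3) smooth_on_Pair[OF smooth_on_ident smooth_on_const] smooth_on_const]) auto
  qed
  ultimately show "\<exists>N. open N \<and> x \<in> N \<and> smooth_on (U \<inter> N) (\<lambda>x. Fu x w)" using W(2) by (intro exI[of _ ?N]) auto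
qed

lemma Fu_linear: "x \<in> U \<Longrightarrow> linear (Fu x)"
  using fundamental_linear[OF alg(1) alg(1) pt(3)]
  by (intro linearI) (simp_all add: Fu_def alg(4,5) tscale_def)

lemma Fu_alg: "a \<in> liealg P \<Longrightarrow> Fu x (a k) = fundamental P a (pt x) c"
  by (simp add: Fu_def alg(3))

lemma vec_Fu: "x \<in> U \<Longrightarrow> vec x (Fu x w) = fundamental P (alg w) (pt x)"
  unfolding Fu_def by (rule vec(3)[OF _ fundamental_in[OF alg(1) pt(3)]])

lemma Om_linear: "x \<in> U \<Longrightarrow> linear (Om x)"
  using omega_linear[OF pt(3) vec(1) vec(1)]
  by (intro linearI) (simp_all add: Om_def vec(4,5) tscale_def)

lemma Om_Fu: "x \<in> U \<Longrightarrow> Om x (Fu x w) = w"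
  by (simp add: Om_def vec_Fu omega_fundamental[OF pt(3) alg(1)] alg(2))

lemma Om_omega: "x \<in> U \<Longrightarrow> v \<in> tangent_space (tot P) (pt x) \<Longrightarrow> omega P H (pt x, v) = alg (Om x (v c))"
  by (simp add: Om_def vec(3) alg(3) omega_decomposition(1) pt(3))

lemma Om_zero_iff: "x \<in> U \<Longrightarrow> v \<in> tangent_space (tot P) (pt x) \<Longrightarrow> Om x (v c) = 0 \<longleftrightarrow> v \<in> H (pt x)"
  using omega_zero_iff[OF pt(3)] Om_omega alg(2,6) by metis

text \<open>The frame of \<open>H\<close> and the fundamental fields trivialise the tangent bundle near a point, and
  \<open>Om\<close> is a fixed linear projection composed with the inverse of this trivialisation.\<close>

lemma Om_smooth: "smooth_on U (\<lambda>x. Om x e)"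
proof (rule smooth_on_local)
  fix x0 assume x0: "x0 \<in> U"
  obtain V n X where V: "atlas_open (tot P) V" "pt x0 \<in> V" "\<forall>i<n. smooth_vector_field (tot P) V (X i)"
    and bij: "\<forall>p\<in>V. bij_betw (combination n X p) ({..<n} \<rightarrow>\<^sub>E UNIV) (H p)"
    by (rule frame[OF pt(3)[OF x0]], rule that)
  let ?E = "{..<n} \<rightarrow>\<^sub>E (UNIV :: real set)"
  define N where "N = snd c ` (V \<inter> fst c)"
  have N: "open N" "N \<subseteq> U" using V(1) c by (auto simp: N_def atlas_open_def U_def)
  have NV: "pt x \<in> V" if "x \<in> N" for x
    using chart_inv_mem[OF tot_atlas c, of x "V \<inter> fst c"] that by (auto simp: N_def pt_def)
  have x0N: "x0 \<in> N" using V(2) pt(1,2)[OF x0] by (force simp: N_def)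
  define \<Phi> where "\<Phi> = (\<lambda>x. combination n X (pt x))"
  have bij\<Phi>: "bij_betw (\<Phi> x) ?E (H (pt x))" if "x \<in> N" for x unfolding \<Phi>_def using bspec[OF bij NV[OF that]] .
  define T where "T = (\<lambda>x (a, w). (\<Sum>i<n. a i *\<^sub>R X i (pt x) c) + Fu x w)"
  have TT: "\<Phi> x a \<in> H (pt x)" "T x (a, w) = (\<Phi> x a + fundamental P (alg w) (pt x)) c"
    if "x \<in> N" "a \<in> ?E" for x a w
  proof -
    show "\<Phi> x a \<in> H (pt x)"
      using imageI[OF that(2), of "\<Phi> x"] by (simp only: bij_betw_imp_surj_on[OF bij\<Phi>[OF that(1)]])
    show "T x (a, w) = (\<Phi> x a + fundamental P (alg w) (pt x)) c"
      by (simp add: T_def \<Phi>_def sum_tvec_apply tscale_def Fu_def)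
  qed
  have T_tangent: "\<Phi> x a + fundamental P (alg w) (pt x) \<in> tangent_space (tot P) (pt x)"
    if "x \<in> N" "a \<in> ?E" for x a w
    using that N pt(3)[of x] by (intro tangent_space_subspace(2)[OF tot_atlas] H_tangent TT(1) fundamental_in alg(1)) auto
  have T_unique: "a = a' \<and> w = w'" if x: "x \<in> N" and a: "a \<in> ?E" "a' \<in> ?E" and eq: "T x (a, w) = T x (a', w')" for x a a' w w'
  proof -
    have xU: "x \<in> U" using x N by auto
    have "\<Phi> x a + fundamental P (alg w) (pt x) = \<Phi> x a' + fundamental P (alg w') (pt x)"
      by (rule vec_eqI[OF xU T_tangent[OF x a(1)] T_tangent[OF x a(2)]]) (use eq TT(2)[OF x] a in simp)
    from decomposition_unique[OF pt(3)[OF xU] TT(1)[OF x a(1)] TT(1)[OF x a(2)] alg(1) alg(1) this]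
    have *: "\<Phi> x a = \<Phi> x a'" "alg w = alg w'" .
    have "a = a'" using bij_betw_imp_inj_on[OF bij\<Phi>[OF x]] *(1) a unfolding inj_on_def by simp
    moreover have "w = w'" using arg_cong[OF *(2), of "\<lambda>f. f k"] by (simp only: alg(2))
    ultimately show ?thesis by (rule conjI)
  qed
  have T_ex: "\<exists>aw. fst aw \<in> ?E \<and> T x aw = u" if x: "x \<in> N" for x u
  proof -
    have xU: "x \<in> U" using x N by auto
    obtain h b where h: "h \<in> H (pt x)" "b \<in> liealg P" "vec x u = h + fundamental P b (pt x)"
      by (rule decomposition[OF pt(3)[OF xU] vec(1)[OF xU]], rule that)
    have "h \<in> \<Phi> x ` ?E" using h(1) by (simp only: bij_betw_imp_surj_on[OF bij\<Phi>[OF x]])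
    then obtain a where a: "h = \<Phi> x a" "a \<in> ?E" by (rule imageE)
    have "T x (a, b k) = u" using TT(2)[OF x a(2), of "b k"] h a vec(2)[OF xU, of u] by (simp add: alg(3))
    then show ?thesis using a(2) by (intro exI[of _ "(a, b k)"]) simp
  qed
  \<comment> \<open>The pairs of frame coefficients and Lie algebra coordinates do not range over a
    type of class \<open>model_space\<close>. Inverting \<open>T x0\<close> at the base point
    identifies them with \<open>'e\<close>, so that \<open>S x\<close> acts on one fixed space and
    \<open>smooth_on_inverse_operator\<close> applies.\<close>
  have "\<forall>u. \<exists>aw. fst aw \<in> ?E \<and> T x0 aw = u" using T_ex[OF x0N] by blast
  then obtain \<gamma> where \<gamma>: "\<And>u. fst (\<gamma> u) \<in> ?E" "\<And>u. T x0 (\<gamma> u) = u" by metis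
  have \<gamma>_eqI: "fst (\<gamma> u) = a \<and> snd (\<gamma> u) = w" if "a \<in> ?E" "T x0 (a, w) = u" for u a w
    using T_unique[OF x0N \<gamma>(1) that(1), of u "snd (\<gamma> u)" w] \<gamma>(2)[of u] that(2) by simp
  have T_lin: "T x (\<lambda>i\<in>{..<n}. a i + a' i, w + w') = T x (a, w) + T x (a', w')"
    "T x (\<lambda>i\<in>{..<n}. r * a i, r *\<^sub>R w) = r *\<^sub>R T x (a, w)" if "x \<in> U" for x a a' w w' r
    using linear_add[OF Fu_linear[OF that]] linear_scale[OF Fu_linear[OF that]]
    by (simp_all add: T_def scaleR_left_distrib sum.distrib scaleR_add_right scaleR_right.sum)
  have \<gamma>_lin: "fst (\<gamma> (u + u')) = (\<lambda>i\<in>{..<n}. fst (\<gamma> u) i + fst (\<gamma> u') i) \<and> snd (\<gamma> (u + u')) = snd (\<gamma> u) + snd (\<gamma> u')"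
    "fst (\<gamma> (r *\<^sub>R u)) = (\<lambda>i\<in>{..<n}. r * fst (\<gamma> u) i) \<and> snd (\<gamma> (r *\<^sub>R u)) = r *\<^sub>R snd (\<gamma> u)" for u u' r
    by (rule \<gamma>_eqI; simp add: T_lin[OF x0] \<gamma>(2))+
  define S where "S = (\<lambda>x u. T x (\<gamma> u))"
  have linS: "linear (S x)" if "x \<in> N" for x
  proof (rule linearI)
    have xU: "x \<in> U" using that N(2) by blast
    fix u u' r
    have "\<gamma> (u + u') = (\<lambda>i\<in>{..<n}. fst (\<gamma> u) i + fst (\<gamma> u') i, snd (\<gamma> u) + snd (\<gamma> u'))"
      by (rule prod_eqI) (simp_all only: \<gamma>_lin fst_conv snd_conv)
    then show "S x (u + u') = S x u + S x u'" by (simp only: S_def T_lin(1)[OF xU] prod.collapse)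
    have "\<gamma> (r *\<^sub>R u) = (\<lambda>i\<in>{..<n}. r * fst (\<gamma> u) i, r *\<^sub>R snd (\<gamma> u))"
      by (rule prod_eqI) (simp_all only: \<gamma>_lin fst_conv snd_conv)
    then show "S x (r *\<^sub>R u) = r *\<^sub>R S x u" by (simp only: S_def T_lin(2)[OF xU] prod.collapse)
  qed
  have bijS: "bij (S x)" if x: "x \<in> N" for x
  proof (rule bijI)
    show "inj (S x)"
    proof (rule injI)
      fix u u' assume "S x u = S x u'"
      then have "\<gamma> u = \<gamma> u'" using T_unique[OF x \<gamma>(1) \<gamma>(1), of u "snd (\<gamma> u)" u' "snd (\<gamma> u')"] by (simp add: S_def prod_eq_iff)
      then show "u = u'" using \<gamma>(2) by metis
    qed
    have "\<exists>u. S x u = v" for v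
    proof -
      obtain aw where aw: "fst aw \<in> ?E" "T x aw = v" using T_ex[OF x] by blast
      have "\<gamma> (T x0 aw) = aw" using \<gamma>_eqI[of "fst aw" "snd aw"] aw(1) by (simp add: prod_eq_iff)
      then show ?thesis using aw(2) by (intro exI[of _ "T x0 aw"]) (simp add: S_def)
    qed
    then show "surj (S x)" by (metis surjI)
  qed
  have smS: "smooth_on N (\<lambda>x. S x u)" for u
  proof -
    have "smooth_on N (\<lambda>x. X i (pt x) c)" if "i < n" for i
      using vector_field_smooth(1)[OF tot_atlas V(1) _ c] V(3) that unfolding N_def pt_def by blast
    then show ?thesis unfolding S_def T_def case_prod_beta
      by (intro smooth_on_add smooth_on_sum smooth_on_scaleR smooth_on_const smooth_on_subset[OF Fu_smooth N(2)]) auto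
  qed
  have "Om x u = snd (\<gamma> (inv_into UNIV (S x) u))" if x: "x \<in> N" for x u
  proof -
    have xU: "x \<in> U" using x N by auto
    define aw where "aw = \<gamma> (inv_into UNIV (S x) u)"
    have u: "u = T x (fst aw, snd aw)" unfolding aw_def using surj_f_inv_f[OF bij_is_surj[OF bijS[OF x]], of u] by (simp add: S_def)
    have aE: "fst aw \<in> ?E" using \<gamma>(1) by (simp add: aw_def)
    have "omega P H (pt x, vec x u) = alg (snd aw)"
      by (rule omega_eq[OF pt(3)[OF xU] TT(1)[OF x aE] alg(1)], rule vec_eqI[OF xU vec(1)[OF xU] T_tangent[OF x aE]])
        (simp only: vec(2)[OF xU] TT(2)[OF x aE, symmetric] u[symmetric])
    then show ?thesis by (simp add: Om_def alg(2) aw_def)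
  qed
  moreover have "smooth_on N (\<lambda>x. snd (\<gamma> (inv_into UNIV (S x) e)))"
    by (rule smooth_on_linear_compose[of "\<lambda>u. snd (\<gamma> u)", OF linearI smooth_on_inverse_operator[OF N(1) linS bijS smS]])
      (use \<gamma>_lin in auto)
  ultimately have "smooth_on N (\<lambda>x. Om x e)" using smooth_on_cong[of N "\<lambda>x. Om x e"] by simp
  then have "smooth_on (U \<inter> N) (\<lambda>x. Om x e)" by (rule smooth_on_subset) auto
  then show "\<exists>N. open N \<and> x0 \<in> N \<and> smooth_on (U \<inter> N) (\<lambda>x. Om x e)" using N(1) x0N by blast
qed

text \<open>The connection form and the differential of the projection together map each tangent
  space isomorphically onto the product of the model spaces of group and base. The horizontal lift
  of \<open>X\<close> is the inverse of this smooth family at \<open>(0, X)\<close>.\<close>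

lemma hlift_smooth:
  assumes V: "atlas_open (base P) V" and X: "smooth_vector_field (base P) V X"
    and x0: "x0 \<in> U" "proj P (pt x0) \<in> V"
  obtains N where "open N" "x0 \<in> N" "N \<subseteq> U" "\<forall>x\<in>N. proj P (pt x) \<in> V"
    "smooth_on N (\<lambda>x. hlift P H (pt x) (X (proj P (pt x))) c)"
proof -
  let ?D = "{q \<in> points (tot P). proj P q \<in> V}"
  have D: "atlas_open (tot P) ?D" by (rule atlas_open_vimage[OF tot_atlas base_atlas proj_smooth open_tot V])
  have sp: "smooth_map (tot P) ?D (base P) (proj P)" by (rule smooth_map_subset[OF proj_smooth]) auto
  have p0: "pt x0 \<in> ?D" using pt(3)[OF x0(1)] x0(2) by simp
  obtain d where d: "d \<in> base P" "proj P (pt x0) \<in> fst d" by (rule smooth_map_codE[OF sp p0], rule that)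
  obtain N where N: "open N" "snd c (pt x0) \<in> N" "N \<subseteq> snd c ` (?D \<inter> fst c)" "\<forall>x\<in>N. proj P (chart_inv c x) \<in> fst d"
    "smooth_on N (\<lambda>x. snd d (proj P (chart_inv c x)))"
    by (rule smooth_map_openE[OF tot_atlas base_atlas sp D p0 c pt(1)[OF x0(1)] d], rule that)
  define \<pi> where "\<pi> = (\<lambda>x. snd d (proj P (pt x)))"
  have NU: "N \<subseteq> U" using N(3) by (auto simp: U_def)
  have NV: "proj P (pt x) \<in> V" "proj P (pt x) \<in> fst d" if "x \<in> N" for x
    using chart_inv_mem[OF tot_atlas c, of x "?D \<inter> fst c"] N(3,4) that by (auto simp: pt_def)
  have sm\<pi>: "smooth_on N \<pi>" using N(5) by (simp add: \<pi>_def pt_def)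
  have d\<pi>: "dproj (pt x) v d = fderiv \<pi> x (v c)" if x: "x \<in> N" and v: "v \<in> tangent_space (tot P) (pt x)" for x v
  proof -
    have xU: "x \<in> U" using x NU by auto
    show ?thesis using differential_chart[OF tot_atlas base_atlas proj_smooth open_tot pt(3)[OF xU] c pt(1)[OF xU] d(1) NV(2)[OF x] v]
      by (simp add: pt(2)[OF xU] \<pi>_def flip: pt_def)
  qed
  define S where "S = (\<lambda>x e. (Om x e, fderiv \<pi> x e))"
  have linS: "linear (S x)" if x: "x \<in> N" for x
  proof -
    have "linear (Om x)" "linear (fderiv \<pi> x)"
      using Om_linear x NU linear_fderiv[OF smooth_on_differentiable[OF N(1) sm\<pi> x]] by auto
    then show ?thesis unfolding S_def by (intro linearI) (simp_all add: linear_add linear_scale)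
  qed
  have smS: "smooth_on N (\<lambda>x. S x e)" for e unfolding S_def
    by (intro smooth_on_Pair smooth_on_subset[OF Om_smooth NU] smooth_on_fderiv[OF N(1) sm\<pi>])
  have bijS: "bij (S x)" if x: "x \<in> N" for x
  proof (rule bijI)
    have xU: "x \<in> U" using x NU by auto
    note p = pt(3)[OF xU]
    have pr: "proj P (pt x) \<in> points (base P)" by (rule proj_in[OF p])
    show "inj (S x)"
    proof (subst linear_injective_0[OF linS[OF x]], intro allI impI)
      fix e assume e: "S x e = 0"
      have vH: "vec x e \<in> H (pt x)" using Om_zero_iff[OF xU vec(1)[OF xU]] e by (simp add: S_def vec(2)[OF xU] zero_prod_def)
      have "dproj (pt x) (vec x e) d = 0" using d\<pi>[OF x vec(1)[OF xU]] e by (simp add: S_def vec(2)[OF xU] zero_prod_def)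
      then have "dproj (pt x) (vec x e) = 0"
        by (intro tangent_space_eqI[OF dproj_in[OF p vec(1)[OF xU]] zero_in_tangent_space[OF base_atlas] d(1) NV(2)[OF x]]) simp
      then have "vec x e = 0" by (rule horizontal_dproj_zero[OF p vH])
      then show "e = 0" using vec(2)[OF xU, of e] by simp
    qed
    have "\<exists>e. S x e = (w, u)" for w u
    proof -
      let ?X = "tvec (base P) d (proj P (pt x)) u"
      have X': "?X \<in> tangent_space (base P) (proj P (pt x))" by (rule tvec_in[OF base_atlas d(1) NV(2)[OF x]])
      note h = hlift[OF p X']
      let ?f = "fundamental P (alg w) (pt x)" and ?h = "hlift P H (pt x) ?X"
      have t: "?h \<in> tangent_space (tot P) (pt x)" "?f \<in> tangent_space (tot P) (pt x)"
        using H_tangent[OF p h(1)] fundamental_in[OF alg(1) p] by auto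
      have t2: "?h + ?f \<in> tangent_space (tot P) (pt x)" by (rule tangent_space_subspace(2)[OF tot_atlas p t])
      have "Om x ((?h + ?f) c) = w"
        unfolding Om_def vec(3)[OF xU t2] omega_eq[OF p h(1) alg(1) refl] by (rule alg(2))
      moreover have "fderiv \<pi> x ((?h + ?f) c) = u"
        using d\<pi>[OF x t2] dproj_linear(1)[OF p t] h(2) dproj_fundamental[OF p alg(1)] tvec_apply[OF base_atlas d(1) NV(2)[OF x]] by simp
      ultimately show ?thesis by (intro exI[of _ "(?h + ?f) c"]) (simp add: S_def)
    qed
    then show "surj (S x)" unfolding surj_def by (metis prod.collapse)
  qed
  have XT: "X (proj P (pt x)) \<in> tangent_space (base P) (proj P (pt x))" if "x \<in> N" for x
    by (rule vector_field_smooth(2)[OF base_atlas V X d(1) NV(1)[OF that]])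
  have eq: "hlift P H (pt x) (X (proj P (pt x))) c = inv_into UNIV (S x) (0, X (proj P (pt x)) d)" if x: "x \<in> N" for x
  proof -
    have xU: "x \<in> U" using x NU by auto
    note p = pt(3)[OF xU] and h = hlift[OF pt(3)[OF xU] XT[OF x]]
    have "S x (hlift P H (pt x) (X (proj P (pt x))) c) = (0, X (proj P (pt x)) d)"
      unfolding S_def using Om_zero_iff[OF xU H_tangent[OF p h(1)]] h d\<pi>[OF x H_tangent[OF p h(1)]] by simp
    then show ?thesis using inv_f_f[OF bij_is_inj[OF bijS[OF x]]] by metis
  qed
  have Xs: "smooth_on N (\<lambda>x. X (proj P (pt x)) d)"
  proof -
    have "smooth_on N (\<lambda>x. X (chart_inv d (\<pi> x)) d)"
      by (rule smooth_on_compose[OF vector_field_smooth(1)[OF base_atlas V X d(1)] sm\<pi>]) (use NV in \<open>auto simp: \<pi>_def\<close>)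
    then show ?thesis
      by (rule smooth_on_cong[THEN iffD1, rotated]) (use NV chart_inv_left[OF base_atlas d(1)] in \<open>auto simp: \<pi>_def\<close>)
  qed
  have hs: "smooth_on N (\<lambda>x. hlift P H (pt x) (X (proj P (pt x))) c)"
  proof (rule smooth_on_cong[THEN iffD2, OF eq])
    show "smooth_on N (\<lambda>x. inv_into UNIV (S x) (0, X (proj P (pt x)) d))"
      by (rule smooth_on_operator[where T = "\<lambda>x. inv_into UNIV (S x)"])
        (intro linear_inv_into linS bijS smooth_on_inverse_operator[OF N(1) linS bijS smS] smooth_on_Pair smooth_on_const Xs | assumption)+
  qed
  show thesis by (rule that[OF N(1) _ NU _ hs]) (use N(2) pt(2)[OF x0(1)] NV in auto)
qed

end

section \<open>Brackets and curvature in coordinates\<close>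

text \<open>The derivative in both arguments jointly. Since \<open>T x\<close> is linear, its
  partial derivative in the second argument is \<open>T x\<close> itself.\<close>

lemma operator_has_derivative:
  fixes T :: "'a::model_space \<Rightarrow> 'b::model_space \<Rightarrow> 'c::model_space"
  assumes U: "open U" and lin: "\<And>x. x \<in> U \<Longrightarrow> linear (T x)" and sm: "\<And>e. smooth_on U (\<lambda>x. T x e)" and x: "x \<in> U"
  shows "((\<lambda>z. T (fst z) (snd z)) has_derivative (\<lambda>z. fderiv (\<lambda>x. T x e) x (fst z) + T x (snd z))) (at (x, e))"
proof -
  let ?f = "\<lambda>z. T (fst z) (snd z)" and ?W = "U \<times> (UNIV :: 'b set)"
  have W: "open ?W" "(x, e) \<in> ?W" using U x by (auto intro: open_Times)
  have s1: "smooth_on ?W (\<lambda>z. T (fst z) e)" for e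
    by (rule smooth_on_compose[OF sm smooth_on_fst[OF smooth_on_ident]]) auto
  have s: "smooth_on ?W ?f"
    by (rule smooth_on_operator[where T = "\<lambda>z. T (fst z)", OF _ s1 smooth_on_snd[OF smooth_on_ident]]) (auto intro: lin)
  have l: "linear (fderiv ?f (x, e))" by (rule linear_fderiv[OF smooth_on_differentiable[OF W(1) s W(2)]])
  have e: "fderiv (T x) e w = T x w" for w
    using frechet_derivative_at[OF bounded_linear_imp_has_derivative[OF linear_imp_bounded_linear[OF lin[OF x]]], of e] by metis
  have "fderiv ?f (x, e) z = fderiv (\<lambda>x. T x e) x (fst z) + T x (snd z)" for z
    using linear_add[OF l, of "(fst z, 0)" "(0, snd z)"] fderiv_partial(1)[OF W(1) s W(2), of "fst z"]
      fderiv_partial(2)[OF W(1) s W(2), of "snd z"] e by simp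
  then show ?thesis using smooth_on_has_derivative[OF W(1) s W(2)] by presburger
qed

lemma operator_fderiv:
  fixes T :: "'a::model_space \<Rightarrow> 'b::model_space \<Rightarrow> 'c::model_space"
  assumes U: "open U" and lin: "\<And>x. x \<in> U \<Longrightarrow> linear (T x)" and sm: "\<And>e. smooth_on U (\<lambda>x. T x e)" and x: "x \<in> U"
    and f: "f differentiable (at x)"
  shows "fderiv (\<lambda>x. T x (f x)) x v = fderiv (\<lambda>y. T y (f x)) x v + T x (fderiv f x v)"
proof -
  have "((\<lambda>y. (y, f y)) has_derivative (\<lambda>v. (v, fderiv f x v))) (at x)"
    using f unfolding frechet_derivative_works by (intro has_derivative_Pair has_derivative_ident)
  from has_derivative_compose[OF this operator_has_derivative[OF U lin sm x]]
  have "((\<lambda>y. T y (f y)) has_derivative (\<lambda>v. fderiv (\<lambda>y. T y (f x)) x v + T x (fderiv f x v))) (at x)" by simp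
  from frechet_derivative_at[OF this] show ?thesis by metis
qed

text \<open>\<open>lie_bracket\<close> is defined chart by chart. Under a change of chart each of
  its two terms acquires a second derivative of the transition, and these cancel by
  symmetry.\<close>

lemma lie_bracket_tangent:
  assumes A: "smooth_atlas A" and V: "atlas_open A V" "p \<in> V"
    and X: "\<And>q. q \<in> V \<Longrightarrow> X q \<in> tangent_space A q" "\<And>c. c \<in> A \<Longrightarrow> p \<in> fst c \<Longrightarrow> (\<lambda>x. X (chart_inv c x) c) differentiable (at (snd c p))"
    and Y: "\<And>q. q \<in> V \<Longrightarrow> Y q \<in> tangent_space A q" "\<And>c. c \<in> A \<Longrightarrow> p \<in> fst c \<Longrightarrow> (\<lambda>x. Y (chart_inv c x) c) differentiable (at (snd c p))"
  shows "lie_bracket A X Y p \<in> tangent_space A p"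
proof -
  obtain c where c: "c \<in> A" "p \<in> fst c" using V unfolding atlas_open_def by (metis points_iff subsetD)
  show ?thesis
  proof (rule tangent_spaceI[OF A c])
    fix d assume d: "d \<in> A" "p \<in> fst d"
    let ?T = "transition c d" and ?x = "snd c p" and ?y = "snd d p"
    define W where "W = snd c ` (fst c \<inter> fst d)"
    have W: "open W" "smooth_on W ?T" "?x \<in> W" using smooth_atlasD(2,3)[OF A c(1) d(1)] c d by (auto simp: W_def)
    have key: "fderiv (\<lambda>y. F (chart_inv d y) d) ?y (fderiv ?T ?x v) =
        fderiv (\<lambda>z. fderiv ?T z (F p c)) ?x v + fderiv ?T ?x (fderiv (\<lambda>x. F (chart_inv c x) c) ?x v)"
      if F: "\<And>q. q \<in> V \<Longrightarrow> F q \<in> tangent_space A q" "\<And>c. c \<in> A \<Longrightarrow> p \<in> fst c \<Longrightarrow> (\<lambda>x. F (chart_inv c x) c) differentiable (at (snd c p))"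
      for F v
    proof -
      have o: "open (snd c ` ((V \<inter> fst d) \<inter> fst c))"
        using atlas_open_Int[OF A V(1) atlas_open_domain[OF A d(1)]] c(1) by (auto simp: atlas_open_def)
      have "fderiv (\<lambda>y. F (chart_inv d y) d) ?y (fderiv ?T ?x v) = fderiv (\<lambda>x. F (chart_inv d (?T x)) d) ?x v"
        using fderiv_compose[OF transition_differentiable[OF A c(1) d(1) c(2) d(2)], of "\<lambda>y. F (chart_inv d y) d" v]
          F(2)[OF d] by (simp add: transition_snd[OF A c])
      also have "\<dots> = fderiv (\<lambda>x. fderiv ?T x (F (chart_inv c x) c)) ?x v"
      proof (rule fderiv_cong_apply[OF o])
        show "?x \<in> snd c ` ((V \<inter> fst d) \<inter> fst c)" using c d V by auto
        fix x assume "x \<in> snd c ` ((V \<inter> fst d) \<inter> fst c)"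
        then obtain r where r: "r \<in> V" "r \<in> fst d" "r \<in> fst c" "x = snd c r" by auto
        show "F (chart_inv d (?T x)) d = fderiv ?T x (F (chart_inv c x) c)"
          using tangent_spaceD[OF F(1)[OF r(1)] c(1) r(3) d(1) r(2)] r
          by (simp add: transition_snd[OF A c(1)] chart_inv_left[OF A c(1)] chart_inv_left[OF A d(1)])
      qed
      also have "\<dots> = fderiv (\<lambda>z. fderiv ?T z (F (chart_inv c ?x) c)) ?x v + fderiv ?T ?x (fderiv (\<lambda>x. F (chart_inv c x) c) ?x v)"
        by (rule operator_fderiv[OF W(1) _ smooth_on_fderiv[OF W(1,2)] W(3) F(2)[OF c]])
          (rule linear_fderiv[OF smooth_on_differentiable[OF W(1,2)]])
      finally show ?thesis by (simp add: chart_inv_left[OF A c])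
    qed
    have tX: "X p d = fderiv ?T ?x (X p c)" "Y p d = fderiv ?T ?x (Y p c)"
      using tangent_spaceD[OF X(1)[OF V(2)] c d] tangent_spaceD[OF Y(1)[OF V(2)] c d] by auto
    have "lie_bracket A X Y p d = fderiv (\<lambda>y. Y (chart_inv d y) d) ?y (fderiv ?T ?x (X p c)) - fderiv (\<lambda>y. X (chart_inv d y) d) ?y (fderiv ?T ?x (Y p c))"
      using d by (simp add: lie_bracket_def tX)
    also have "\<dots> = fderiv ?T ?x (fderiv (\<lambda>x. Y (chart_inv c x) c) ?x (X p c)) - fderiv ?T ?x (fderiv (\<lambda>x. X (chart_inv c x) c) ?x (Y p c))"
      by (simp add: key[OF X] key[OF Y] second_derivative_symmetric[OF W, of "X p c" "Y p c"])
    also have "\<dots> = fderiv ?T ?x (lie_bracket A X Y p c)"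
      using c by (simp add: lie_bracket_def linear_diff[OF linear_fderiv[OF transition_differentiable[OF A c(1) d(1) c(2) d(2)]]])
    finally show "lie_bracket A X Y p d = fderiv ?T ?x (lie_bracket A X Y p c)" .
  qed (auto simp: lie_bracket_def)
qed

text \<open>The field with constant component \<open>X c\<close> in a chart is a witness for the
  choice in \<open>extension\<close>.\<close>

lemma extension:
  assumes A: "smooth_atlas A" and x: "x \<in> points A" and X: "X \<in> tangent_space A x"
  obtains V where "atlas_open A V" "x \<in> V" "smooth_vector_field A V (extension A x X)" "extension A x X x = X"
proof -
  obtain c where c: "c \<in> A" "x \<in> fst c" using x unfolding points_iff by (elim bexE)
  define F where "F = (\<lambda>p. tvec A c p (X c))"
  have "smooth_map A (fst c) (tangent_atlas A) (\<lambda>p. (p, F p))"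
  proof (rule smooth_mapI[OF A])
    fix p assume p: "p \<in> fst c"
    have i: "chart_inv c y \<in> fst c" "snd c (chart_inv c y) = y" if "y \<in> UNIV \<inter> snd c ` (fst c \<inter> fst c)" for y
      using that chart_inv_in[of y c "fst c"] chart_inv_right[of y c "fst c"] by auto
    have "smooth_on (UNIV \<inter> snd c ` (fst c \<inter> fst c)) (\<lambda>y. snd (tangent_chart A c) (chart_inv c y, F (chart_inv c y)))"
      by (rule smooth_on_cong[THEN iffD2, OF _ smooth_on_Pair[OF smooth_on_ident smooth_on_const]])
        (use i tvec_apply[OF A c(1)] in \<open>simp add: F_def\<close>)
    then show "\<exists>c'\<in>A. \<exists>d\<in>tangent_atlas A. p \<in> fst c' \<and> (p, F p) \<in> fst d \<and> (\<exists>W. open W \<and> snd c' p \<in> W \<and>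
       (\<forall>x\<in>W \<inter> snd c' ` (fst c \<inter> fst c'). (chart_inv c' x, F (chart_inv c' x)) \<in> fst d) \<and>
       smooth_on (W \<inter> snd c' ` (fst c \<inter> fst c')) (\<lambda>x. snd d (chart_inv c' x, F (chart_inv c' x))))"
      using c(1) p i tangent_chart_in[OF c(1)] tvec_in[OF A c(1)]
      by (intro bexI[of _ c] bexI[of _ "tangent_chart A c"] conjI exI[of _ UNIV]) (auto simp: F_def)
  qed
  then have "F x = X \<and> (\<exists>U. openin (atlas_topology A) U \<and> x \<in> U \<and> smooth_vector_field A U F)"
    using tvec_eq[OF A c X] atlas_open_domain[OF A c(1)] c(2)
    by (auto simp: F_def smooth_vector_field_def openin_atlas_topology[OF A])
  then have "extension A x X x = X \<and> (\<exists>U. openin (atlas_topology A) U \<and> x \<in> U \<and> smooth_vector_field A U (extension A x X))"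
    unfolding extension_def
    by (rule someI[where P = "\<lambda>F. F x = X \<and> (\<exists>U. openin (atlas_topology A) U \<and> x \<in> U \<and> smooth_vector_field A U F)"])
  then obtain V where "extension A x X x = X" "openin (atlas_topology A) V" "x \<in> V" "smooth_vector_field A V (extension A x X)"
    by (elim exE conjE)
  then show thesis by (intro that[of V]) (simp_all add: openin_atlas_topology[OF A])
qed

context charted_connection
begin

text \<open>The form is differentiated in the direction \<open>v\<close> with its argument
  \<open>e\<close> frozen in the chart. This depends on the chart; the antisymmetric part in
  \<open>e\<close> and \<open>v\<close> is, up to sign, the exterior derivative.\<close>

abbreviation DOm :: "'e \<Rightarrow> 'e \<Rightarrow> 'e \<Rightarrow> 'h" where "DOm x e v \<equiv> fderiv (\<lambda>y. Om y e) x v"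

lemma ac_e0: "x \<in> U \<Longrightarrow> ac (x, e0) = x"
  using act_one[OF pt(3), of x] pt(2)[of x] by (simp add: ac_def e0_def chart_inv_left[OF grp.atlas k])

lemma chart_inv_k: "y \<in> snd k ` fst k \<Longrightarrow> chart_inv k y \<in> carrier (grp P)"
  using chart_inv_in[OF _ order_refl, of y k] k(1) grp.points points_iff by metis

lemma act_coord:
  assumes W: "open W" "smooth_on W ac" "(x, y) \<in> W"
    "\<forall>z\<in>W. fst z \<in> U \<and> snd z \<in> snd k ` fst k \<and> act P (pt (fst z)) (chart_inv k (snd z)) \<in> fst c"
    and v: "v \<in> tangent_space (tot P) (pt x)"
  shows "differential (tot P) (tot P) (\<lambda>q. act P q (chart_inv k y)) (pt x) v c = fderiv ac (x, y) (v c, 0)"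
    "pt (ac (x, y)) = act P (pt x) (chart_inv k y)" "ac (x, y) \<in> U"
proof -
  have *: "x \<in> U" "chart_inv k y \<in> carrier (grp P)" "act P (pt x) (chart_inv k y) \<in> fst c"
    using bspec[OF W(4,3)] chart_inv_k by auto
  have "differential (tot P) (tot P) (\<lambda>q. act P q (chart_inv k y)) (pt x) v c
      = fderiv (\<lambda>x'. snd c (act P (chart_inv c x') (chart_inv k y))) (snd c (pt x)) (v c)"
    by (rule differential_chart[OF tot_atlas tot_atlas act_smooth_left[OF *(2)] open_tot pt(3)[OF *(1)] c pt(1)[OF *(1)] c *(3) v])
  also have "\<dots> = fderiv (\<lambda>x'. ac (x', y)) x (v c)" by (simp add: pt(2)[OF *(1)] ac_def flip: pt_def)
  also have "\<dots> = fderiv ac (x, y) (v c, 0)" by (rule fderiv_partial(1)[OF W(1-3)])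
  finally show "differential (tot P) (tot P) (\<lambda>q. act P q (chart_inv k y)) (pt x) v c = fderiv ac (x, y) (v c, 0)" .
  show "pt (ac (x, y)) = act P (pt x) (chart_inv k y)" "ac (x, y) \<in> U" using pt_snd[OF *(3)] by (simp_all add: ac_def)
qed

text \<open>A mixed second derivative of the action read in both orders: differentiating first in
  space gives the differential of a right translation, first in the group a fundamental
  field.\<close>

lemma ac_mixed:
  assumes W: "open W" "smooth_on W ac" "(x, e0) \<in> W" and WU: "\<forall>z\<in>W. fst z \<in> U"
  shows "((\<lambda>y. fderiv ac (x, y) (u, 0)) has_derivative (\<lambda>w. fderiv (\<lambda>x. Fu x w) x u)) (at e0)"
proof -
  let ?g = "\<lambda>z. fderiv ac z (u, 0)"
  have sg: "smooth_on W ?g" by (rule smooth_on_fderiv[OF W(1,2)])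
  have "((\<lambda>y. (x, y)) has_derivative (\<lambda>w. (0, w))) (at e0)" by (auto intro!: derivative_eq_intros)
  from has_derivative_compose[OF this smooth_on_has_derivative[OF W(1) sg W(3)]]
  have "((\<lambda>y. fderiv ac (x, y) (u, 0)) has_derivative (\<lambda>w. fderiv ?g (x, e0) (0, w))) (at e0)" .
  moreover have "fderiv ?g (x, e0) (0, w) = fderiv (\<lambda>x. Fu x w) x u" for w
  proof -
    have sw: "smooth_on W (\<lambda>z. fderiv ac z (0, w))" by (rule smooth_on_fderiv[OF W(1,2)])
    have "fderiv ?g (x, e0) (0, w) = fderiv (\<lambda>z. fderiv ac z (0, w)) (x, e0) (u, 0)"
      by (rule second_derivative_symmetric[OF W])
    also have "\<dots> = fderiv (\<lambda>x. fderiv ac (x, e0) (0, w)) x u" by (rule fderiv_partial(1)[OF W(1) sw W(3), symmetric])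
    also have "\<dots> = fderiv (\<lambda>x. Fu x w) x u"
    proof (rule fderiv_cong_apply)
      show "open ((\<lambda>y. (y, e0)) -` W)" by (intro open_vimage W(1) continuous_intros)
      show "x \<in> (\<lambda>y. (y, e0)) -` W" using W(3) by simp
      show "fderiv ac (y, e0) (0, w) = Fu y w" if "y \<in> (\<lambda>y. (y, e0)) -` W" for y
        using Fu_eq[OF W(1,2), of y w] that WU by auto
    qed
    finally show ?thesis .
  qed
  ultimately show ?thesis by simp
qed

text \<open>\<open>X\<close> is invariant under the flow of the fundamental fields. The derivative of this equation
  in the group direction is the vanishing of the bracket.\<close>

lemma invariant_field_bracket:
  assumes N: "open N" "x \<in> N" "N \<subseteq> U" and X: "smooth_on N X"
    and T: "\<And>y. y \<in> N \<Longrightarrow> X y = hlift P H (pt y) (F (proj P (pt y))) c"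
    and F: "\<And>y. y \<in> N \<Longrightarrow> F (proj P (pt y)) \<in> tangent_space (base P) (proj P (pt y))"
  shows "fderiv (\<lambda>x. Fu x w) x (X x) = fderiv X x (Fu x w)"
proof -
  have x: "x \<in> U" using N by auto
  obtain W where W: "open W" "(x, e0) \<in> W" "smooth_on W ac"
    "\<forall>z\<in>W. fst z \<in> U \<and> snd z \<in> snd k ` fst k \<and> act P (pt (fst z)) (chart_inv k (snd z)) \<in> fst c"
    by (rule ac_local[OF x], rule that)
  \<comment> \<open>Group coordinates \<open>y\<close> that move \<open>x\<close> to a point still
    in \<open>N\<close>; only there can the field at the moved point be compared with the translated
    field.\<close>
  define M where "M = (\<lambda>y. (x, y)) -` (W \<inter> ac -` N)"
  have "open (W \<inter> ac -` N)" by (rule continuous_open_preimage[OF smooth_on_continuous_on[OF W(3)] W(1) N(1)])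
  then have M: "open M" unfolding M_def by (intro open_vimage continuous_intros)
  have eM: "e0 \<in> M" using W(2) N(2) ac_e0[OF x] by (simp add: M_def)
  have inv: "fderiv ac (x, y) (X x, 0) = X (ac (x, y))" if y: "y \<in> M" for y
  proof -
    have yW: "(x, y) \<in> W" "ac (x, y) \<in> N" using y by (auto simp: M_def)
    let ?g = "chart_inv k y" and ?F = "F (proj P (pt x))"
    have g: "?g \<in> carrier (grp P)" using bspec[OF W(4) yW(1)] chart_inv_k by auto
    note h = hlift[OF pt(3)[OF x] F[OF N(2)]]
    note a = act_coord[OF W(1,3) yW(1) W(4) H_tangent[OF pt(3)[OF x] h(1)]]
    have "differential (tot P) (tot P) (\<lambda>q. act P q ?g) (pt x) (hlift P H (pt x) ?F) = hlift P H (act P (pt x) ?g) ?F"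
      using invariant pt(3)[OF x] g F[OF N(2)] unfolding invariant_distribution_def by blast
    moreover have "proj P (pt (ac (x, y))) = proj P (pt x)" using proj_act[OF pt(3)[OF x] g] a(2) by simp
    ultimately show ?thesis using a(1,2) T[OF N(2)] T[OF yW(2)] by simp
  qed
  have 1: "((\<lambda>y. fderiv ac (x, y) (X x, 0)) has_derivative (\<lambda>w. fderiv (\<lambda>x. Fu x w) x (X x))) (at e0)"
    by (rule ac_mixed[OF W(1,3,2)]) (use W(4) in blast)
  have 2: "((\<lambda>y. ac (x, y)) has_derivative (\<lambda>w. Fu x w)) (at e0)"
  proof -
    have "((\<lambda>y. (x, y)) has_derivative (\<lambda>w. (0, w))) (at e0)" by (auto intro!: derivative_eq_intros)
    from has_derivative_compose[OF this smooth_on_has_derivative[OF W(1,3,2)]] show ?thesis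
      by (simp add: Fu_eq[OF W(1,3,2) x])
  qed
  have "(X has_derivative fderiv X x) (at (ac (x, e0)))" using smooth_on_has_derivative[OF N(1) X N(2)] by (simp add: ac_e0[OF x])
  from has_derivative_compose[OF 2 this]
  have "((\<lambda>y. X (ac (x, y))) has_derivative (\<lambda>w. fderiv X x (Fu x w))) (at e0)" .
  then have "((\<lambda>y. fderiv ac (x, y) (X x, 0)) has_derivative (\<lambda>w. fderiv X x (Fu x w))) (at e0)"
    by (rule has_derivative_transform_within_open[OF _ M eM]) (simp add: inv)
  from has_derivative_unique[OF 1 this] show ?thesis by metis
qed

section \<open>The brackets that define \<B> and the curvature\<close>

lemma horizontal_extension:
  assumes x: "x \<in> U" and X: "X \<in> tangent_space (base P) (proj P (pt x))"
  obtains N where "open N" "x \<in> N" "N \<subseteq> U"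
    "smooth_on N (\<lambda>y. hlift P H (pt y) (extension (base P) (proj P (pt x)) X (proj P (pt y))) c)"
    "\<forall>y\<in>N. extension (base P) (proj P (pt x)) X (proj P (pt y)) \<in> tangent_space (base P) (proj P (pt y))"
    "extension (base P) (proj P (pt x)) X (proj P (pt x)) = X"
proof -
  let ?X = "extension (base P) (proj P (pt x)) X"
  have b: "proj P (pt x) \<in> points (base P)" by (rule proj_in[OF pt(3)[OF x]])
  obtain V where V: "atlas_open (base P) V" "proj P (pt x) \<in> V" "smooth_vector_field (base P) V ?X" "?X (proj P (pt x)) = X"
    by (rule extension[OF base_atlas b X], rule that)
  obtain d where d: "d \<in> base P" using b unfolding points_iff by (elim bexE)
  obtain N where N: "open N" "x \<in> N" "N \<subseteq> U" "\<forall>y\<in>N. proj P (pt y) \<in> V" "smooth_on N (\<lambda>y. hlift P H (pt y) (?X (proj P (pt y))) c)"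
    by (rule hlift_smooth[OF V(1,3) x V(2)], rule that)
  have "\<forall>y\<in>N. ?X (proj P (pt y)) \<in> tangent_space (base P) (proj P (pt y))"
    using N(4) vector_field_smooth(2)[OF base_atlas V(1,3) d] by blast
  then show thesis by (rule that[OF N(1,2,3,5) _ V(4)])
qed

lemma Om_hlift:
  assumes "y \<in> U" "X \<in> tangent_space (base P) (proj P (pt y))"
  shows "Om y (hlift P H (pt y) X c) = 0"
  using Om_zero_iff[OF assms(1) H_tangent[OF pt(3)[OF assms(1)]]] hlift(1)[OF pt(3) assms(2)] assms(1) by blast

text \<open>The product rule trades a derivative of the field for a derivative of the form. For two
  fields on which \<open>Om\<close> is constant it says that the form of their bracket is minus its
  exterior derivative.\<close>

lemma Om_derivative_zero:
  assumes N: "open N" "x \<in> N" "N \<subseteq> U" and X: "smooth_on N X" and z: "\<And>y. y \<in> N \<Longrightarrow> Om y (X y) = k0"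
  shows "Om x (fderiv X x v) = - DOm x (X x) v"
proof -
  have x: "x \<in> U" using N by auto
  have "fderiv (\<lambda>y. Om y (X y)) x v = DOm x (X x) v + Om x (fderiv X x v)"
    by (rule operator_fderiv[OF open_U Om_linear Om_smooth x smooth_on_differentiable[OF N(1) X N(2)]])
  moreover have "fderiv (\<lambda>y. Om y (X y)) x v = fderiv (\<lambda>y. k0) x v"
    by (rule fderiv_cong_apply[OF N(1,2)]) (rule z)
  ultimately show ?thesis by (simp add: add_eq_0_iff)
qed

text \<open>The coordinate form of the vanishing of \<B>. \<open>Om\<close> is constant both on the
  lifted field and on the fundamental field, and these fields commute.\<close>

lemma DOm_fundamental:
  assumes x: "x \<in> U" and v: "v \<in> H (pt x)"
  shows "DOm x (v c) (Fu x w) = DOm x (Fu x w) (v c)"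
proof -
  let ?X = "dproj (pt x) v"
  note p = pt(3)[OF x]
  have X: "?X \<in> tangent_space (base P) (proj P (pt x))" by (rule dproj_in[OF p H_tangent[OF p v]])
  let ?E = "extension (base P) (proj P (pt x)) ?X"
  obtain N where N: "open N" "x \<in> N" "N \<subseteq> U" "smooth_on N (\<lambda>y. hlift P H (pt y) (?E (proj P (pt y))) c)"
    "\<forall>y\<in>N. ?E (proj P (pt y)) \<in> tangent_space (base P) (proj P (pt y))" "?E (proj P (pt x)) = ?X"
    by (rule horizontal_extension[OF x X], rule that)
  let ?Xh = "\<lambda>y. hlift P H (pt y) (?E (proj P (pt y))) c"
  have X0: "?Xh x = v c" by (simp add: N(6) hlift_eq[OF p v refl])
  have "Om x (fderiv ?Xh x (Fu x w)) = - DOm x (?Xh x) (Fu x w)"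
    by (rule Om_derivative_zero[OF N(1-4)]) (use N(3,5) Om_hlift in blast)
  moreover have "Om x (fderiv (\<lambda>y. Fu y w) x (v c)) = - DOm x (Fu x w) (v c)"
    by (rule Om_derivative_zero[OF open_U x order_refl Fu_smooth Om_Fu])
  moreover have "fderiv (\<lambda>x. Fu x w) x (?Xh x) = fderiv ?Xh x (Fu x w)"
    by (rule invariant_field_bracket[OF N(1-4) refl]) (use N(5) in blast)
  ultimately show ?thesis unfolding X0 by simp
qed

text \<open>The whole bracket vanishes, not merely its vertical part, because the lifted field is
  preserved by the flow of the fundamental field.\<close>

lemma bracket_fundamental_zero:
  assumes x: "x \<in> U" and X: "X \<in> tangent_space (base P) (proj P (pt x))" and a: "a \<in> liealg P"
  shows "lie_bracket (tot P) (\<lambda>q'. hlift P H q' (extension (base P) (proj P (pt x)) X (proj P q'))) (fundamental P a) (pt x) c = 0"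
proof -
  let ?E = "extension (base P) (proj P (pt x)) X"
  obtain N where N: "open N" "x \<in> N" "N \<subseteq> U" "smooth_on N (\<lambda>y. hlift P H (pt y) (?E (proj P (pt y))) c)"
    "\<forall>y\<in>N. ?E (proj P (pt y)) \<in> tangent_space (base P) (proj P (pt y))" "?E (proj P (pt x)) = X"
    by (rule horizontal_extension[OF x X], rule that)
  have "fderiv (\<lambda>x. Fu x (a k)) x (hlift P H (pt x) (?E (proj P (pt x))) c)
      = fderiv (\<lambda>y. hlift P H (pt y) (?E (proj P (pt y))) c) x (Fu x (a k))"
    by (rule invariant_field_bracket[OF N(1-4) refl]) (use N(5) in blast)
  then show ?thesis using c pt(1)[OF x]
    by (simp add: lie_bracket_def Fu_alg[OF a] pt(2)[OF x] flip: pt_def)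
qed

text \<open>The lift of the bracket on the base is horizontal and is killed by the form;
  \<open>Om_derivative_zero\<close> evaluates the rest. The chosen extensions disappear, so the
  expression depends on \<open>v\<close> and \<open>w\<close> alone.\<close>

lemma curvature_coord:
  assumes x: "x \<in> U" and v: "v \<in> H (pt x)" and w: "w \<in> H (pt x)"
  shows "curvature P H (pt x) (dproj (pt x) v) (dproj (pt x) w) = alg (DOm x (v c) (w c) - DOm x (w c) (v c))"
proof -
  note p = pt(3)[OF x]
  let ?X = "dproj (pt x) v" and ?Y = "dproj (pt x) w"
  have X: "?X \<in> tangent_space (base P) (proj P (pt x))" by (rule dproj_in[OF p H_tangent[OF p v]])
  have Y: "?Y \<in> tangent_space (base P) (proj P (pt x))" by (rule dproj_in[OF p H_tangent[OF p w]])
  let ?E = "extension (base P) (proj P (pt x)) ?X" and ?F = "extension (base P) (proj P (pt x)) ?Y"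
  define Xh where "Xh = (\<lambda>q'. hlift P H q' (?E (proj P q')))"
  define Yh where "Yh = (\<lambda>q'. hlift P H q' (?F (proj P q')))"
  note b = proj_in[OF p]
  obtain V1 where V1: "atlas_open (base P) V1" "proj P (pt x) \<in> V1" "smooth_vector_field (base P) V1 ?E" "?E (proj P (pt x)) = ?X"
    by (rule extension[OF base_atlas b X], rule that)
  obtain V2 where V2: "atlas_open (base P) V2" "proj P (pt x) \<in> V2" "smooth_vector_field (base P) V2 ?F" "?F (proj P (pt x)) = ?Y"
    by (rule extension[OF base_atlas b Y], rule that)
  define V where "V = V1 \<inter> V2"
  have V: "atlas_open (base P) V" "proj P (pt x) \<in> V" unfolding V_def using atlas_open_Int[OF base_atlas V1(1) V2(1)] V1(2) V2(2) by auto
  have field: "(\<lambda>y. G (chart_inv d y) d) differentiable (at (snd d (proj P (pt x))))"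
    if G: "atlas_open (base P) V'" "proj P (pt x) \<in> V'" "smooth_vector_field (base P) V' G" and d: "d \<in> base P" "proj P (pt x) \<in> fst d" for V' G d
  proof (rule smooth_on_differentiable[OF _ vector_field_smooth(1)[OF base_atlas G(1,3) d(1)]])
    show "open (snd d ` (V' \<inter> fst d))" using G(1) d(1) by (auto simp: atlas_open_def)
  qed (use G(2) d(2) in blast)
  obtain d0 where d0: "d0 \<in> base P" using b unfolding points_iff by (elim bexE)
  have brM: "lie_bracket (base P) ?E ?F (proj P (pt x)) \<in> tangent_space (base P) (proj P (pt x))"
    by (rule lie_bracket_tangent[OF base_atlas V])
      (use vector_field_smooth(2)[OF base_atlas V1(1,3) d0] vector_field_smooth(2)[OF base_atlas V2(1,3) d0]
        field[OF V1(1-3)] field[OF V2(1-3)] in \<open>auto simp: V_def\<close>)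
  let ?D = "{q \<in> points (tot P). proj P q \<in> V}"
  have D: "atlas_open (tot P) ?D" by (rule atlas_open_vimage[OF tot_atlas base_atlas proj_smooth open_tot V(1)])
  have lift: "hlift P H q (G (proj P q)) \<in> tangent_space (tot P) q"
    if "q \<in> points (tot P)" "G (proj P q) \<in> tangent_space (base P) (proj P q)" for q G
    using H_tangent[OF that(1) hlift(1)[OF that]] .
  \<comment> \<open>\<open>lie_bracket_tangent\<close> asks for differentiability in every chart
    around the point, so the coordinate development is interpreted again with an arbitrary chart
    \<open>c'\<close>.\<close>
  have liftd: "(\<lambda>y. hlift P H (chart_inv c' y) (G (proj P (chart_inv c' y))) c') differentiable (at (snd c' (pt x)))"
    if G: "atlas_open (base P) V'" "proj P (pt x) \<in> V'" "smooth_vector_field (base P) V' G" and c': "c' \<in> tot P" "pt x \<in> fst c'" for V' G c'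
  proof -
    interpret C': charted_connection P H c' k by unfold_locales (rule c'(1) k)+
    have px: "C'.pt (snd c' (pt x)) = pt x" and xU: "snd c' (pt x) \<in> C'.U" using C'.pt_snd[OF c'(2)] by auto
    have px': "proj P (C'.pt (snd c' (pt x))) \<in> V'" unfolding px by (rule G(2))
    obtain N where N: "open N" "snd c' (pt x) \<in> N" "smooth_on N (\<lambda>y. hlift P H (C'.pt y) (G (proj P (C'.pt y))) c')"
      by (rule C'.hlift_smooth[OF G(1,3) xU px'], rule that)
    show ?thesis using smooth_on_differentiable[OF N(1,3,2)] by (simp only: C'.pt_def)
  qed
  have xD: "pt x \<in> ?D" using p V(2) by simp
  have brQ: "lie_bracket (tot P) Xh Yh (pt x) \<in> tangent_space (tot P) (pt x)"
    unfolding Xh_def Yh_def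
    by (rule lie_bracket_tangent[OF tot_atlas D xD])
      (use vector_field_smooth(2)[OF base_atlas V1(1,3) d0] vector_field_smooth(2)[OF base_atlas V2(1,3) d0] lift
        liftd[OF V1(1-3)] liftd[OF V2(1-3)] in \<open>auto simp: V_def\<close>)
  note h = hlift(1)[OF p brM]
  have "curvature P H (pt x) ?X ?Y = omega P H (pt x, lie_bracket (tot P) Xh Yh (pt x) - hlift P H (pt x) (lie_bracket (base P) ?E ?F (proj P (pt x))))"
    by (simp add: curvature_def Let_def Xh_def Yh_def)
  also have "\<dots> = omega P H (pt x, lie_bracket (tot P) Xh Yh (pt x))"
    using omega_linear(2)[OF p brQ H_tangent[OF p h]] omega_horizontal[OF p h] by simp
  also have "\<dots> = alg (Om x (lie_bracket (tot P) Xh Yh (pt x) c))" by (rule Om_omega[OF x brQ])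
  finally have cu: "curvature P H (pt x) ?X ?Y = alg (Om x (lie_bracket (tot P) Xh Yh (pt x) c))" .
  obtain N1 where N1: "open N1" "x \<in> N1" "N1 \<subseteq> U" "smooth_on N1 (\<lambda>y. hlift P H (pt y) (?E (proj P (pt y))) c)"
    "\<forall>y\<in>N1. ?E (proj P (pt y)) \<in> tangent_space (base P) (proj P (pt y))"
    by (rule horizontal_extension[OF x X], rule that)
  obtain N2 where N2: "open N2" "x \<in> N2" "N2 \<subseteq> U" "smooth_on N2 (\<lambda>y. hlift P H (pt y) (?F (proj P (pt y))) c)"
    "\<forall>y\<in>N2. ?F (proj P (pt y)) \<in> tangent_space (base P) (proj P (pt y))"
    by (rule horizontal_extension[OF x Y], rule that)
  have X0: "Xh (pt x) = v" "Yh (pt x) = w" using hlift_eq[OF p v refl] hlift_eq[OF p w refl] V1(4) V2(4) by (simp_all add: Xh_def Yh_def)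
  have 1: "Om x (fderiv (\<lambda>y. Xh (pt y) c) x u) = - DOm x (v c) u" for u
    using Om_derivative_zero[OF N1(1-4), of 0 u] N1(3,5) Om_hlift X0(1) unfolding Xh_def by fastforce
  have 2: "Om x (fderiv (\<lambda>y. Yh (pt y) c) x u) = - DOm x (w c) u" for u
    using Om_derivative_zero[OF N2(1-4), of 0 u] N2(3,5) Om_hlift X0(2) unfolding Yh_def by fastforce
  have "lie_bracket (tot P) Xh Yh (pt x) c = fderiv (\<lambda>y. Yh (pt y) c) x (v c) - fderiv (\<lambda>y. Xh (pt y) c) x (w c)"
    using c pt(1)[OF x] by (simp add: lie_bracket_def X0 pt(2)[OF x] flip: pt_def)
  then have "Om x (lie_bracket (tot P) Xh Yh (pt x) c) = DOm x (v c) (w c) - DOm x (w c) (v c)"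
    by (simp add: linear_diff[OF Om_linear[OF x]] 1 2)
  then show ?thesis using cu by simp
qed

end

section \<open>Variations\<close>

lemma tangent_transition:
  assumes A: "smooth_atlas A" and c: "c \<in> A" "d \<in> A" and x: "x \<in> snd c ` (fst c \<inter> fst d)"
  shows "transition (tangent_chart A c) (tangent_chart A d) (x, e) = (transition c d x, fderiv (transition c d) x e)"
proof -
  have x': "x \<in> snd c ` fst c" using x by auto
  have "chart_inv c x \<in> fst d" using chart_inv_mem[OF A c(1) x] by auto
  then show ?thesis
    unfolding transition_def[of "tangent_chart A c"] tangent_chart_inv[OF A c(1) x']
    using c(2) chart_inv_right[OF x'] by (simp add: transition_def[of c d] tvec_def)
qed

lemma tangent_transition_fderiv:
  assumes A: "smooth_atlas A" and c: "c \<in> A" "d \<in> A" and p: "p \<in> fst c" "p \<in> fst d"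
  shows "fderiv (transition (tangent_chart A c) (tangent_chart A d)) (snd c p, e) z =
    (fderiv (transition c d) (snd c p) (fst z),
     fderiv (\<lambda>x. fderiv (transition c d) x e) (snd c p) (fst z) + fderiv (transition c d) (snd c p) (snd z))"
proof -
  let ?T = "transition c d"
  define W where "W = snd c ` (fst c \<inter> fst d)"
  have W: "open W" "smooth_on W ?T" "snd c p \<in> W" using smooth_atlasD(2,3)[OF A c] p by (auto simp: W_def)
  have 1: "((\<lambda>z. fderiv ?T (fst z) (snd z)) has_derivative
      (\<lambda>z. fderiv (\<lambda>x. fderiv ?T x e) (snd c p) (fst z) + fderiv ?T (snd c p) (snd z))) (at (snd c p, e))"
    by (rule operator_has_derivative[OF W(1) _ smooth_on_fderiv[OF W(1,2)] W(3)])
      (rule linear_fderiv[OF smooth_on_differentiable[OF W(1,2)]])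
  have 2: "((\<lambda>z. ?T (fst z)) has_derivative (\<lambda>z. fderiv ?T (snd c p) (fst z))) (at (snd c p, e))"
  proof -
    have "(?T has_derivative fderiv ?T (snd c p)) (at (fst (snd c p, e)))" using smooth_on_has_derivative[OF W] by simp
    from has_derivative_compose[OF bounded_linear_imp_has_derivative[OF bounded_linear_fst] this] show ?thesis .
  qed
  have "fderiv (transition (tangent_chart A c) (tangent_chart A d)) (snd c p, e) z
      = fderiv (\<lambda>z. (?T (fst z), fderiv ?T (fst z) (snd z))) (snd c p, e) z"
  proof (rule fderiv_cong_apply[OF open_Times[OF W(1) open_UNIV]])
    show "(snd c p, e) \<in> W \<times> UNIV" using W(3) by simp
    fix y assume "y \<in> W \<times> (UNIV :: 'b set)"
    then show "transition (tangent_chart A c) (tangent_chart A d) y = (?T (fst y), fderiv ?T (fst y) (snd y))"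
      using tangent_transition[OF A c, of "fst y" "snd y"] by (simp add: W_def mem_Times_iff)
  qed
  also have "\<dots> = (fderiv ?T (snd c p) (fst z), fderiv (\<lambda>x. fderiv ?T x e) (snd c p) (fst z) + fderiv ?T (snd c p) (snd z))"
    unfolding frechet_derivative_at[OF has_derivative_Pair[OF 2 1], symmetric] by (rule refl)
  finally show ?thesis .
qed

lemma tangent_curveE:
  assumes A: "smooth_atlas A" and \<xi>: "smooth_map model_atlas J (tangent_atlas A) \<xi>" and t: "t \<in> J"
    and c: "c \<in> A" "fst (\<xi> t) \<in> fst c"
  obtains W where "open W" "t \<in> W" "\<forall>s\<in>W \<inter> J. fst (\<xi> s) \<in> fst c" "smooth_on (W \<inter> J) (\<lambda>s. snd c (fst (\<xi> s)))"
    "smooth_on (W \<inter> J) (\<lambda>s. snd (\<xi> s) c)"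
proof -
  have m: "\<xi> t \<in> fst (tangent_chart A c)"
    using smooth_map_points[OF \<xi> t] c by (simp add: tangent_chart_mem points_tangent)
  obtain W where W: "open W" "t \<in> W" "\<forall>s\<in>W \<inter> J. \<xi> s \<in> fst (tangent_chart A c)"
    "smooth_on (W \<inter> J) (\<lambda>s. snd (tangent_chart A c) (\<xi> s))"
    by (rule smooth_curveE[OF smooth_atlas_tangent[OF A] \<xi> t tangent_chart_in[OF c(1)] m], rule that)
  show thesis
    by (rule that[OF W(1,2)])
      (use W(3) smooth_on_fst[OF W(4)] smooth_on_snd[OF W(4)] in \<open>auto simp: tangent_chart_mem snd_tangent_chart\<close>)
qed

lemma tangent_curveI:
  assumes \<xi>: "\<And>t. t \<in> J \<Longrightarrow> snd (\<xi> t) \<in> tangent_space A (fst (\<xi> t))"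
    and loc: "\<And>t. t \<in> J \<Longrightarrow> \<exists>c\<in>A. \<exists>W. open W \<and> t \<in> W \<and> (\<forall>s\<in>W \<inter> J. fst (\<xi> s) \<in> fst c) \<and>
      smooth_on (W \<inter> J) (\<lambda>s. snd c (fst (\<xi> s))) \<and> smooth_on (W \<inter> J) (\<lambda>s. snd (\<xi> s) c)"
  shows "smooth_map model_atlas J (tangent_atlas A) \<xi>"
proof (rule smooth_curveI)
  fix t assume t: "t \<in> J"
  obtain c W where c: "c \<in> A" and W: "open W" "t \<in> W" "\<forall>s\<in>W \<inter> J. fst (\<xi> s) \<in> fst c"
      "smooth_on (W \<inter> J) (\<lambda>s. snd c (fst (\<xi> s)))" "smooth_on (W \<inter> J) (\<lambda>s. snd (\<xi> s) c)"
    using loc[OF t] by (elim bexE exE conjE)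
  have "smooth_on (W \<inter> J) (\<lambda>s. snd (tangent_chart A c) (\<xi> s))"
    using smooth_on_Pair[OF W(4,5)] by (simp add: snd_tangent_chart)
  then show "\<exists>d\<in>tangent_atlas A. \<xi> t \<in> fst d \<and> (\<exists>W. open W \<and> t \<in> W \<and> (\<forall>x\<in>W \<inter> J. \<xi> x \<in> fst d) \<and>
      smooth_on (W \<inter> J) (\<lambda>x. snd d (\<xi> x)))"
    using tangent_chart_in[OF c] W t \<xi>
    by (intro bexI[of _ "tangent_chart A c"] conjI exI[of _ W]) (auto simp: tangent_chart_mem)
qed

lemma tangent_curve_derivative:
  assumes A: "smooth_atlas A" and \<xi>: "smooth_map model_atlas J (tangent_atlas A) \<xi>" and t: "t \<in> J" "at t within J \<noteq> bot"
    and c: "c \<in> A" "fst (\<xi> t) \<in> fst c"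
  shows "((\<lambda>s. snd c (fst (\<xi> s))) has_vector_derivative fst (velocity (tangent_atlas A) J \<xi> t (tangent_chart A c))) (at t within J)"
    "((\<lambda>s. snd (\<xi> s) c) has_vector_derivative snd (velocity (tangent_atlas A) J \<xi> t (tangent_chart A c))) (at t within J)"
proof -
  have m: "\<xi> t \<in> fst (tangent_chart A c)"
    using smooth_map_points[OF \<xi> t(1)] c by (simp add: tangent_chart_mem points_tangent)
  note d = velocity_has_derivative[OF smooth_atlas_tangent[OF A] \<xi> t(1) tangent_chart_in[OF c(1)] m]
  show "((\<lambda>s. snd c (fst (\<xi> s))) has_vector_derivative fst (velocity (tangent_atlas A) J \<xi> t (tangent_chart A c))) (at t within J)"
    using bounded_linear.has_vector_derivative[OF bounded_linear_fst d] by (simp add: snd_tangent_chart)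
  show "((\<lambda>s. snd (\<xi> s) c) has_vector_derivative snd (velocity (tangent_atlas A) J \<xi> t (tangent_chart A c))) (at t within J)"
    using bounded_linear.has_vector_derivative[OF bounded_linear_snd d] by (simp add: snd_tangent_chart)
qed

text \<open>In the chart induced by \<open>c\<close> the flip exchanges the generator with the
  velocity of the base curve. That the result is a tangent vector at the lifted velocity,
  consistently over all charts, is the symmetry of second derivatives of transitions.\<close>

lemma variation_coord:
  assumes A: "smooth_atlas A" and \<xi>: "smooth_map model_atlas J (tangent_atlas A) \<xi>" and t: "t \<in> J" "at t within J \<noteq> bot"
    and q: "smooth_map model_atlas J A q" and base: "\<And>s. s \<in> J \<Longrightarrow> fst (\<xi> s) = q s"
  shows "c \<in> A \<Longrightarrow> q t \<in> fst c \<Longrightarrow>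
      snd (variation A J \<xi> t) (tangent_chart A c) = (snd (\<xi> t) c, vector_derivative (\<lambda>s. snd (\<xi> s) c) (at t within J))"
    "snd (variation A J \<xi> t) \<in> tangent_space (tangent_atlas A) (q t, velocity A J q t)"
proof -
  let ?TA = "tangent_atlas A" and ?tc = "tangent_chart A"
  note TA = smooth_atlas_tangent[OF A]
  define u where "u = velocity ?TA J \<xi> t"
  define v where "v = snd (\<xi> t)"
  have p: "fst (\<xi> t) = q t" by (rule base[OF t(1)])
  have vT: "v \<in> tangent_space A (q t)" using smooth_map_points[OF \<xi> t(1)] p by (simp add: points_tangent v_def)
  have u1: "fst (u (?tc c)) = velocity A J q t c" if c: "c \<in> A" "q t \<in> fst c" for c
  proof -
    have "((\<lambda>s. snd c (fst (\<xi> s))) has_vector_derivative fst (u (?tc c))) (at t within J)"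
      unfolding u_def by (rule tangent_curve_derivative(1)[OF A \<xi> t]) (use c p in auto)
    then have "((\<lambda>s. snd c (q s)) has_vector_derivative fst (u (?tc c))) (at t within J)"
      by (rule has_vector_derivative_transform[OF t(1), rotated]) (simp add: base)
    from velocity_eqI[OF this t(2) c] show ?thesis by simp
  qed
  have u2: "vector_derivative (\<lambda>s. snd (\<xi> s) c) (at t within J) = snd (u (?tc c))" if c: "c \<in> A" "q t \<in> fst c" for c
    unfolding u_def by (rule vector_derivative_within[OF t(2) tangent_curve_derivative(2)[OF A \<xi> t]]) (use c p in auto)
  \<comment> \<open>The base vector of the flip collects components for all \<open>c\<close>, so the
    identity is needed even for \<open>c\<close> outside the atlas or away from \<open>q t\<close>.
    There both sides are 0; injectivity of \<open>?tc\<close> excludes that the induced chart comes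
    from another chart.\<close>
  have u0: "fst (u (?tc c)) = velocity A J q t c" for c
  proof (cases "c \<in> A \<and> q t \<in> fst c")
    case False
    have "\<not> (?tc c \<in> ?TA \<and> \<xi> t \<in> fst (?tc c))"
    proof
      assume *: "?tc c \<in> ?TA \<and> \<xi> t \<in> fst (?tc c)"
      then obtain d where "d \<in> A" "?tc c = ?tc d" by (auto simp: tangent_atlas_def)
      then have "c \<in> A" using tangent_chart_inj[OF A] by blast
      then show False using False * p by (simp add: tangent_chart_mem)
    qed
    then show ?thesis using False by (simp add: u_def velocity_outside)
  qed (use u1 in blast)
  have var: "snd (variation A J \<xi> t) = (\<lambda>C. if C \<in> ?TA \<and> (q t, velocity A J q t) \<in> fst C
      then (v (the_inv_into A ?tc C), snd (u C)) else 0)"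
  proof -
    have "variation A J \<xi> t = canonical_flip A ((q t, v), u)"
      by (simp add: variation_def tangent_lift_def u_def v_def flip: p)
    then show ?thesis by (simp add: canonical_flip_def Let_def u0)
  qed
  have qv: "(q t, velocity A J q t) \<in> fst (?tc c)" if "q t \<in> fst c" for c
    using that velocity_in[OF A q t] by simp
  have inj: "inj_on ?tc A" using tangent_chart_inj[OF A] by (rule inj_onI)
  have w: "snd (variation A J \<xi> t) (?tc c) = (v c, snd (u (?tc c)))" if c: "c \<in> A" "q t \<in> fst c" for c
    unfolding var using c qv[OF c(2)] tangent_chart_in[OF c(1)] by (simp add: the_inv_into_f_f[OF inj])
  show "snd (variation A J \<xi> t) (?tc c) = (snd (\<xi> t) c, vector_derivative (\<lambda>s. snd (\<xi> s) c) (at t within J))"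
    if "c \<in> A" "q t \<in> fst c" by (simp add: w[OF that] u2[OF that] v_def)
  obtain c where c: "c \<in> A" "q t \<in> fst c" by (rule smooth_map_codE[OF q t(1)], rule that)
  show "snd (variation A J \<xi> t) \<in> tangent_space ?TA (q t, velocity A J q t)"
  proof (rule tangent_spaceI[OF TA tangent_chart_in[OF c(1)] qv[OF c(2)]])
    fix D assume D: "D \<in> ?TA" "(q t, velocity A J q t) \<in> fst D"
    then obtain d where d: "d \<in> A" "D = ?tc d" "q t \<in> fst d" by (auto simp: tangent_atlas_def)
    let ?T = "transition c d" and ?x = "snd c (q t)"
    have W: "open (snd c ` (fst c \<inter> fst d))" "smooth_on (snd c ` (fst c \<inter> fst d)) ?T" "?x \<in> snd c ` (fst c \<inter> fst d)"
      using smooth_atlasD(2,3)[OF A c(1) d(1)] c d by auto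
    have "u \<in> tangent_space ?TA (\<xi> t)" unfolding u_def by (rule velocity_in[OF TA \<xi> t])
    moreover have "\<xi> t = (q t, v)" by (simp add: v_def flip: p)
    ultimately have uT: "u \<in> tangent_space ?TA (q t, v)" by simp
    have ud: "u (?tc d) = fderiv (transition (?tc c) (?tc d)) (snd (?tc c) (q t, v)) (u (?tc c))"
      by (rule tangent_spaceD[OF uT tangent_chart_in[OF c(1)] _ tangent_chart_in[OF d(1)]]) (use c d vT in simp_all)
    have "snd (u (?tc d)) = fderiv (\<lambda>x. fderiv ?T x (v c)) ?x (velocity A J q t c) + fderiv ?T ?x (snd (u (?tc c)))"
      unfolding ud by (simp add: tangent_transition_fderiv[OF A c(1) d(1) c(2) d(3)] u1[OF c])
    moreover have "v d = fderiv ?T ?x (v c)" by (rule tangent_spaceD[OF vT c d(1,3)])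
    \<comment> \<open>For \<open>u\<close> the second derivative of \<open>?T\<close> is taken at
      the generator in the direction of the velocity, for the flipped vector the other way
      round.\<close>
    ultimately show "snd (variation A J \<xi> t) D =
        fderiv (transition (?tc c) D) (snd (?tc c) (q t, velocity A J q t)) (snd (variation A J \<xi> t) (?tc c))"
      unfolding d(2) w[OF c] w[OF d(1,3)]
      by (simp add: tangent_transition_fderiv[OF A c(1) d(1) c(2) d(3)] second_derivative_symmetric[OF W, of "v c"])
  qed (auto simp: var)
qed

text \<open>The test function is a primitive of \<open>f\<close> minus its mean; the hypothesis then
  says that the square of this deviation has integral 0.\<close>

lemma du_bois_reymond:
  fixes f :: "real \<Rightarrow> real"
  assumes t: "t0 < t1" and f: "smooth_on {t0..t1} f"
    and z: "\<And>\<beta>. smooth_on {t0..t1} \<beta> \<Longrightarrow> \<beta> t0 = 0 \<Longrightarrow> \<beta> t1 = 0 \<Longrightarrow>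
      integral {t0..t1} (\<lambda>t. vector_derivative \<beta> (at t within {t0..t1}) * f t) = 0"
    and s: "s \<in> {t0..t1}"
  shows "f s = f t0"
proof -
  let ?J = "{t0..t1}"
  have cf: "continuous_on ?J f" by (rule smooth_on_continuous_on[OF f])
  \<comment> \<open>Subtracting the mean makes the primitive of \<open>g\<close> vanish at
    \<open>t1\<close> as well as at \<open>t0\<close>.\<close>
  define m where "m = integral ?J f / (t1 - t0)"
  define g where "g = (\<lambda>t. f t - m)"
  have cg: "continuous_on ?J g" unfolding g_def by (intro continuous_intros cf)
  have sg: "smooth_on ?J g" unfolding g_def by (intro smooth_on_diff f smooth_on_const)
  have ig: "integral ?J g = 0"
  proof -
    have "integral ?J g = integral ?J f - m * (t1 - t0)"
      unfolding g_def
      by (subst Henstock_Kurzweil_Integration.integral_diff[OF integrable_continuous_real[OF cf] integrable_const_ivl])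
        (use t in simp)
    then show ?thesis using t by (simp add: m_def)
  qed
  define \<beta> where "\<beta> = (\<lambda>t. integral {t0..t} g)"
  have d: "(\<beta> has_vector_derivative g t) (at t within ?J)" if "t \<in> ?J" for t
    unfolding \<beta>_def by (rule integral_has_vector_derivative[OF cg that])
  have vd: "vector_derivative \<beta> (at t within ?J) = g t" if "t \<in> ?J" for t
    by (rule vector_derivative_within[OF at_within_interval_neq_bot[OF t that] d[OF that]])
  have "integral ?J (\<lambda>t. vector_derivative \<beta> (at t within ?J) * f t) = 0"
    by (rule z[OF smooth_on_antiderivative[OF d sg]]) (auto simp: \<beta>_def ig)
  then have 1: "integral ?J (\<lambda>t. g t * f t) = 0"
    using integral_cong[of ?J "\<lambda>t. vector_derivative \<beta> (at t within ?J) * f t" "\<lambda>t. g t * f t"] vd by simp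
  \<comment> \<open>The correction \<open>m * g t\<close> integrates to 0, so the integral of
    \<open>g t * f t\<close> is that of a square.\<close>
  have "integral ?J (\<lambda>t. g t * g t) = integral ?J (\<lambda>t. g t * f t - m * g t)"
    by (intro integral_cong) (simp add: g_def algebra_simps)
  also have "\<dots> = integral ?J (\<lambda>t. g t * f t) - integral ?J (\<lambda>t. m * g t)"
    by (intro Henstock_Kurzweil_Integration.integral_diff integrable_continuous_real continuous_intros cg cf)
  finally have "integral ?J (\<lambda>t. g t * g t) = 0" using 1 ig by simp
  moreover have "continuous_on ?J (\<lambda>t. g t * g t)" by (intro continuous_intros cg)
  ultimately have "\<forall>t\<in>?J. g t * g t = 0"
    using integral_eq_0_iff[of t0 t1 "\<lambda>t. g t * g t"] t by simp
  then have "g s = 0" "g t0 = 0" using s t by auto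
  then show ?thesis by (simp add: g_def)
qed

section \<open>Tangency to \<open>HQ\<close> and derivatives of the Lagrangian in
  coordinates\<close>

context charted_connection
begin

lemma tangent_chart_inv_pt: "x \<in> U \<Longrightarrow> chart_inv (tangent_chart (tot P) c) (x, e) = (pt x, vec x e)"
  using tangent_chart_inv[OF tot_atlas c] by (simp add: U_def pt_def vec_def)

text \<open>In coordinates \<open>HQ P H\<close> is the zero set of \<open>Om y e\<close>, and the
  condition is the vanishing of the derivative of this function. As \<open>tangent_to\<close> is
  defined by curves, sufficiency requires an actual curve inside \<open>HQ P H\<close>.\<close>

lemma tangent_to_HQ:
  assumes x: "x \<in> U" and v: "v \<in> H (pt x)"
    and w: "w \<in> tangent_space (tangent_atlas (tot P)) (pt x, v)" "w (tangent_chart (tot P) c) = (\<sigma>, \<sigma>')"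
  shows "w \<in> tangent_to (tangent_atlas (tot P)) (HQ P H) (pt x, v) \<longleftrightarrow> DOm x (v c) \<sigma> + Om x \<sigma>' = 0"
proof
  let ?TA = "tangent_atlas (tot P)" and ?tc = "tangent_chart (tot P) c"
  note TA = smooth_atlas_tangent[OF tot_atlas] and tc = tangent_chart_in[OF c]
  note p = pt(3)[OF x] and vT = H_tangent[OF pt(3)[OF x] v]
  have m: "(pt x, v) \<in> fst ?tc" using pt(1)[OF x] vT by simp
  have dOm: "((\<lambda>z. Om (fst z) (snd z)) has_derivative (\<lambda>z. DOm x (v c) (fst z) + Om x (snd z))) (at (x, v c))"
    by (rule operator_has_derivative[OF open_U Om_linear Om_smooth x])
  have Om0: "Om x (v c) = 0" using Om_zero_iff[OF x vT] v by simp
  show "DOm x (v c) \<sigma> + Om x \<sigma>' = 0" if "w \<in> tangent_to ?TA (HQ P H) (pt x, v)"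
  proof -
    obtain \<gamma> \<epsilon> where g: "w = velocity ?TA UNIV \<gamma> 0" "\<gamma> 0 = (pt x, v)" "\<epsilon> > 0"
      "smooth_map model_atlas {-\<epsilon><..<\<epsilon>} ?TA \<gamma>" "\<gamma> ` {-\<epsilon><..<\<epsilon>} \<subseteq> HQ P H"
      using \<open>w \<in> tangent_to ?TA (HQ P H) (pt x, v)\<close> unfolding tangent_to_def by blast
    let ?I = "{-\<epsilon><..<\<epsilon>}"
    have I: "open ?I" "0 \<in> ?I" using g(3) by auto
    have fc: "fst (\<gamma> 0) \<in> fst c" using g(2) pt(1)[OF x] by simp
    obtain W where W: "open W" "0 \<in> W" "\<forall>s\<in>W \<inter> ?I. fst (\<gamma> s) \<in> fst c"
      by (rule tangent_curveE[OF tot_atlas g(4) I(2) c fc], rule that)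
    have "w = velocity ?TA ?I \<gamma> 0" unfolding g(1) by (rule velocity_open[OF I, symmetric])
    then have "((\<lambda>s. snd ?tc (\<gamma> s)) has_vector_derivative (\<sigma>, \<sigma>')) (at 0 within ?I)"
      using velocity_has_derivative[OF TA g(4) I(2) tc] g(2) m w(2) by simp
    then have d: "((\<lambda>s. snd ?tc (\<gamma> s)) has_vector_derivative (\<sigma>, \<sigma>')) (at 0)"
      by (simp only: at_within_open[OF I(2,1)])
    have "((\<lambda>z. Om (fst z) (snd z)) \<circ> (\<lambda>s. snd ?tc (\<gamma> s)) has_vector_derivative DOm x (v c) \<sigma> + Om x \<sigma>') (at 0)"
      using vector_derivative_diff_chain_within[OF d, of "\<lambda>z. Om (fst z) (snd z)" "\<lambda>z. DOm x (v c) (fst z) + Om x (snd z)"] dOm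
      by (simp add: g(2) pt(2)[OF x] has_derivative_at_withinI)
    then have 1: "((\<lambda>s. 0) has_vector_derivative DOm x (v c) \<sigma> + Om x \<sigma>') (at 0)"
    proof (rule has_vector_derivative_transform_within_open[of _ _ _ "W \<inter> ?I"])
      fix s assume s: "s \<in> W \<inter> ?I"
      have fs: "fst (\<gamma> s) \<in> fst c" using W(3) s by blast
      have "\<gamma> s \<in> HQ P H" using g(5) s by blast
      then have hs: "snd (\<gamma> s) \<in> H (fst (\<gamma> s))" "fst (\<gamma> s) \<in> points (tot P)" by (auto simp: HQ_def)
      have "Om (snd c (fst (\<gamma> s))) (snd (\<gamma> s) c) = 0"
        using Om_zero_iff[OF pt_snd(2)[OF fs], of "snd (\<gamma> s)"] H_tangent[OF hs(2,1)] hs(1) by (simp add: pt_snd(1)[OF fs])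
      then show "((\<lambda>z. Om (fst z) (snd z)) \<circ> (\<lambda>s. snd ?tc (\<gamma> s))) s = 0" by (simp add: snd_tangent_chart)
    qed (use W I in auto)
    show ?thesis by (rule vector_derivative_unique_at[OF 1 has_vector_derivative_const])
  qed
  show "w \<in> tangent_to ?TA (HQ P H) (pt x, v)" if cond: "DOm x (v c) \<sigma> + Om x \<sigma>' = 0"
  proof -
    define y where "y = (\<lambda>s::real. x + s *\<^sub>R \<sigma>)"
    define e where "e = (\<lambda>s::real. v c + s *\<^sub>R \<sigma>')"
    \<comment> \<open>The straight line \<open>(y, e)\<close> has the right velocity but may leave
      the distribution, so its vertical part is removed. The condition \<open>cond\<close> makes the
      removed part vanish to first order at 0, and the velocity is unchanged.\<close>
    define \<eta> where "\<eta> = (\<lambda>s. e s - Fu (y s) (Om (y s) (e s)))"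
    have sy: "smooth_on I y" and se: "smooth_on I e" for I
      unfolding y_def e_def by (intro smooth_on_add smooth_on_scaleR smooth_on_ident smooth_on_const)+
    have y0: "y 0 = x" "e 0 = v c" by (auto simp: y_def e_def)
    have "open (y -` U)" by (rule open_vimage[OF open_U smooth_on_continuous_on[OF sy]])
    moreover have "0 \<in> y -` U" using x y0 by simp
    ultimately obtain \<epsilon> where ep: "\<epsilon> > 0" "ball 0 \<epsilon> \<subseteq> y -` U" using open_contains_ball by blast
    let ?I = "{-\<epsilon><..<\<epsilon>}"
    have yU: "y s \<in> U" if "s \<in> ?I" for s using ep(2) that by (auto simp: subset_eq dist_real_def)
    have I: "open ?I" "0 \<in> ?I" using ep(1) by auto
    have sOm: "smooth_on ?I (\<lambda>s. Om (y s) (e s))"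
      by (rule smooth_on_operator[where T = "\<lambda>s. Om (y s)"])
        (use yU in \<open>auto intro: Om_linear smooth_on_compose[OF Om_smooth sy] se\<close>)
    have s\<eta>: "smooth_on ?I \<eta>" unfolding \<eta>_def
      by (rule smooth_on_diff[OF se], rule smooth_on_operator[where T = "\<lambda>s. Fu (y s)", OF _ _ sOm])
        (use yU in \<open>auto intro: Fu_linear smooth_on_compose[OF Fu_smooth sy]\<close>)
    define \<gamma> where "\<gamma> = (\<lambda>s. chart_inv ?tc (y s, \<eta> s))"
    have g: "\<gamma> s = (pt (y s), vec (y s) (\<eta> s))" if "s \<in> ?I" for s
      unfolding \<gamma>_def by (rule tangent_chart_inv_pt[OF yU[OF that]])
    have im: "(y s, \<eta> s) \<in> snd ?tc ` fst ?tc" if "s \<in> ?I" for s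
      using pt[OF yU[OF that]] vec(1,2)[OF yU[OF that]] by (intro image_eqI[of _ _ "(pt (y s), vec (y s) (\<eta> s))"]) auto
    have sm: "smooth_map model_atlas ?I ?TA \<gamma>" unfolding \<gamma>_def
      by (rule smooth_map_chart_inv[OF TA tc smooth_on_Pair[OF sy s\<eta>] im])
    have "\<gamma> s \<in> HQ P H" if s: "s \<in> ?I" for s
    proof -
      have "Om (y s) (\<eta> s) = 0" unfolding \<eta>_def
        by (simp add: linear_diff[OF Om_linear[OF yU[OF s]]] Om_Fu[OF yU[OF s]])
      then have "vec (y s) (\<eta> s) \<in> H (pt (y s))"
        using Om_zero_iff[OF yU[OF s] vec(1)[OF yU[OF s]]] by (simp add: vec(2)[OF yU[OF s]])
      then show ?thesis using g[OF s] pt(3)[OF yU[OF s]] by (simp add: HQ_def)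
    qed
    then have img: "\<gamma> ` ?I \<subseteq> HQ P H" by blast
    have Fu0: "Fu z 0 = 0" if "z \<in> U" for z by (rule linear_0[OF Fu_linear[OF that]])
    have \<eta>0: "\<eta> 0 = v c" unfolding \<eta>_def using y0 Om0 Fu0[OF x] by simp
    have g0: "\<gamma> 0 = (pt x, v)" using g[OF I(2)] y0 \<eta>0 vec(3)[OF x vT] by simp
    have dy: "(y has_vector_derivative \<sigma>) (at 0)" and de: "(e has_vector_derivative \<sigma>') (at 0)"
      unfolding y_def e_def by (auto intro!: derivative_eq_intros)
    have dOm0: "((\<lambda>s. Om (y s) (e s)) has_vector_derivative 0) (at 0)"
    proof -
      have "((\<lambda>z. Om (fst z) (snd z)) has_derivative (\<lambda>z. DOm x (v c) (fst z) + Om x (snd z))) (at (y 0, e 0) within (\<lambda>s. (y s, e s)) ` UNIV)"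
        using dOm unfolding y0 by (rule has_derivative_at_withinI)
      from vector_derivative_diff_chain_within[OF has_vector_derivative_Pair[OF dy de] this]
      show ?thesis using cond by (simp add: o_def)
    qed
    have dFu: "((\<lambda>s. Fu (y s) (Om (y s) (e s))) has_vector_derivative 0) (at 0)"
    proof -
      have "((\<lambda>z. Fu (fst z) (snd z)) has_derivative (\<lambda>z. fderiv (\<lambda>y. Fu y 0) x (fst z) + Fu x (snd z))) (at (x, 0))"
        by (rule operator_has_derivative[OF open_U Fu_linear Fu_smooth x])
      then have "((\<lambda>z. Fu (fst z) (snd z)) has_derivative (\<lambda>z. fderiv (\<lambda>y. Fu y 0) x (fst z) + Fu x (snd z)))
          (at (y 0, Om (y 0) (e 0)) within (\<lambda>s. (y s, Om (y s) (e s))) ` UNIV)"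
        unfolding y0 Om0 by (rule has_derivative_at_withinI)
      from vector_derivative_diff_chain_within[OF has_vector_derivative_Pair[OF dy dOm0] this]
      have "((\<lambda>s. Fu (y s) (Om (y s) (e s))) has_vector_derivative fderiv (\<lambda>y. Fu y 0) x \<sigma> + Fu x 0) (at 0)" by (simp add: o_def)
      moreover have "fderiv (\<lambda>y. Fu y 0) x \<sigma> = fderiv (\<lambda>y. 0 :: 'e) x \<sigma>" by (rule fderiv_cong_apply[OF open_U x Fu0])
      ultimately show ?thesis using Fu0[OF x] by simp
    qed
    have "(\<eta> has_vector_derivative \<sigma>' - 0) (at 0)" unfolding \<eta>_def by (rule has_vector_derivative_diff[OF de dFu])
    then have "((\<lambda>s. (y s, \<eta> s)) has_vector_derivative (\<sigma>, \<sigma>')) (at 0)" using has_vector_derivative_Pair[OF dy] by simp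
    then have "((\<lambda>s. snd ?tc (\<gamma> s)) has_vector_derivative (\<sigma>, \<sigma>')) (at 0)"
      by (rule has_vector_derivative_transform_within_open[OF _ I])
        (simp add: \<gamma>_def chart_inv_right[OF im order_refl] del: tangent_chart_simps)
    from velocity_eqI[OF this _ tc] have "velocity ?TA UNIV \<gamma> 0 ?tc = w ?tc" using g0 m w(2) by simp
    moreover have "velocity ?TA UNIV \<gamma> 0 \<in> tangent_space ?TA (pt x, v)"
      using velocity_in[OF TA sm I(2) at_within_open_neq_bot[OF I]] g0 velocity_open[OF I, of ?TA \<gamma>] by simp
    ultimately have "velocity ?TA UNIV \<gamma> 0 = w" using tangent_space_eqI[OF _ w(1) tc m] by blast
    then show ?thesis unfolding tangent_to_def using g0 ep(1) sm img by blast
  qed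
qed

definition lift :: "(('q, 'e) tb \<Rightarrow> real) \<Rightarrow> 'e \<times> 'e \<Rightarrow> real" where
  "lift f z = f (pt (fst z), vec (fst z) (snd z))"

abbreviation smooth_function :: "(('q, 'e) tb \<Rightarrow> real) \<Rightarrow> bool" where
  "smooth_function \<equiv> smooth_map (tangent_atlas (tot P)) (points (tangent_atlas (tot P))) model_atlas"

lemma open_UxUNIV: "open (U \<times> (UNIV :: 'e set))" by (intro open_Times open_U open_UNIV)

lemma lift_smooth:
  assumes f: "smooth_function f" shows "smooth_on (U \<times> UNIV) (lift f)"
proof (rule smooth_on_local)
  fix z :: "'e \<times> 'e" assume "z \<in> U \<times> UNIV"
  then have x: "fst z \<in> U" by auto
  let ?Z = "(pt (fst z), vec (fst z) (snd z))" and ?tc = "tangent_chart (tot P) c"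
  note TA = smooth_atlas_tangent[OF tot_atlas]
  have Z: "?Z \<in> points (tangent_atlas (tot P))" "?Z \<in> fst ?tc" using pt[OF x] vec(1)[OF x] by (simp_all add: points_tangent)
  obtain W where W: "open W" "snd ?tc ?Z \<in> W" "smooth_on W (\<lambda>z. f (chart_inv ?tc z))"
    by (rule smooth_functionE[OF TA f atlas_open_points[OF TA] Z(1) tangent_chart_in[OF c] Z(2)], rule that)
  have "smooth_on (U \<times> UNIV \<inter> W) (lift f)"
    by (rule smooth_on_cong[THEN iffD2, OF _ smooth_on_subset[OF W(3)]]) (auto simp: lift_def tangent_chart_inv_pt)
  then show "\<exists>W. open W \<and> z \<in> W \<and> smooth_on (U \<times> UNIV \<inter> W) (lift f)"
    using W(1,2) by (intro exI[of _ W]) (simp add: pt(2)[OF x] vec(2)[OF x])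
qed

lemma d_fun_lift:
  assumes f: "smooth_function f" and x: "x \<in> U" and v: "v \<in> tangent_space (tot P) (pt x)"
    and w: "w \<in> tangent_space (tangent_atlas (tot P)) (pt x, v)"
  shows "d_fun (tangent_atlas (tot P)) f (pt x, v) w = fderiv (lift f) (x, v c) (w (tangent_chart (tot P) c))"
proof -
  let ?tc = "tangent_chart (tot P) c"
  note TA = smooth_atlas_tangent[OF tot_atlas]
  have Z: "(pt x, v) \<in> points (tangent_atlas (tot P))" "(pt x, v) \<in> fst ?tc" using pt[OF x] v by (simp_all add: points_tangent)
  have "d_fun (tangent_atlas (tot P)) f (pt x, v) w = fderiv (\<lambda>z. f (chart_inv ?tc z)) (x, v c) (w ?tc)"
    using differential_chart[OF TA smooth_atlas_model f atlas_open_points[OF TA] Z(1) tangent_chart_in[OF c] Z(2) _ _ w, of "(UNIV, \<lambda>x. x)"]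
    by (simp add: d_fun_def pt(2)[OF x])
  also have "\<dots> = fderiv (lift f) (x, v c) (w ?tc)"
    by (rule fderiv_cong_apply[OF open_UxUNIV]) (use x in \<open>auto simp: lift_def tangent_chart_inv_pt\<close>)
  finally show ?thesis .
qed

text \<open>An invariant Lagrangian is constant along the lifted flow of a fundamental field.\<close>

lemma invariant_lagrangian_fundamental:
  assumes L: "smooth_function L" and inv: "invariant_lagrangian P L" and x: "x \<in> U"
  shows "fderiv (lift L) (x, e) (Fu x w, fderiv (\<lambda>x. Fu x w) x e) = 0"
proof -
  obtain W where W: "open W" "(x, e0) \<in> W" "smooth_on W ac"
    "\<forall>z\<in>W. fst z \<in> U \<and> snd z \<in> snd k ` fst k \<and> act P (pt (fst z)) (chart_inv k (snd z)) \<in> fst c"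
    by (rule ac_local[OF x], rule that)
  define M where "M = (\<lambda>y. (x, y)) -` W"
  have M: "open M" "e0 \<in> M" unfolding M_def using W(2) by (auto intro!: open_vimage W(1) continuous_intros)
  have const: "lift L (ac (x, y), fderiv ac (x, y) (e, 0)) = lift L (x, e)" if "y \<in> M" for y
  proof -
    have yW: "(x, y) \<in> W" using that by (simp add: M_def)
    have g: "chart_inv k y \<in> carrier (grp P)" using bspec[OF W(4) yW] chart_inv_k by auto
    note a = act_coord[OF W(1,3) yW W(4) vec(1)[OF x, of e]]
    let ?v = "differential (tot P) (tot P) (\<lambda>q. act P q (chart_inv k y)) (pt x) (vec x e)"
    have "?v \<in> tangent_space (tot P) (act P (pt x) (chart_inv k y))"
      by (rule differential_in[OF tot_atlas tot_atlas act_smooth_left[OF g] open_tot pt(3)[OF x] vec(1)[OF x]])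
    then have "vec (ac (x, y)) (?v c) = ?v" using vec(3)[OF a(3)] a(2) by simp
    then have "lift L (ac (x, y), fderiv ac (x, y) (e, 0)) = L (act P (pt x) (chart_inv k y), ?v)"
      using a(1,2) by (simp add: lift_def vec(2)[OF x])
    also have "\<dots> = L (tangent_map (tot P) (tot P) (\<lambda>q. act P q (chart_inv k y)) (pt x, vec x e))"
      by (simp add: tangent_map_def)
    also have "\<dots> = L (pt x, vec x e)"
      using inv g pt(3)[OF x] vec(1)[OF x] unfolding invariant_lagrangian_def by (simp add: points_tangent)
    finally show ?thesis by (simp add: lift_def)
  qed
  have ac0: "fderiv ac (x, e0) (e, 0) = e"
  proof -
    have "fderiv ac (x, e0) (e, 0) = fderiv (\<lambda>x. ac (x, e0)) x e" by (rule fderiv_partial(1)[OF W(1,3,2), symmetric])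
    also have "\<dots> = fderiv (\<lambda>x. x) x e" by (rule fderiv_cong_apply[OF open_U x]) (rule ac_e0)
    finally show ?thesis by simp
  qed
  have "((\<lambda>y. (x, y)) has_derivative (\<lambda>w. (0, w))) (at e0)" by (auto intro!: derivative_eq_intros)
  from has_derivative_compose[OF this smooth_on_has_derivative[OF W(1,3,2)]]
  have 1: "((\<lambda>y. ac (x, y)) has_derivative (\<lambda>w. Fu x w)) (at e0)" by (simp add: Fu_eq[OF W(1,3,2) x])
  have 2: "((\<lambda>y. fderiv ac (x, y) (e, 0)) has_derivative (\<lambda>w. fderiv (\<lambda>x. Fu x w) x e)) (at e0)"
    by (rule ac_mixed[OF W(1,3,2)]) (use W(4) in blast)
  have "(lift L has_derivative fderiv (lift L) (x, e)) (at (ac (x, e0), fderiv ac (x, e0) (e, 0)))"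
    unfolding ac0 ac_e0[OF x] using smooth_on_has_derivative[OF open_UxUNIV lift_smooth[OF L]] x by simp
  from has_derivative_compose[OF has_derivative_Pair[OF 1 2] this]
  have "((\<lambda>y. lift L (ac (x, y), fderiv ac (x, y) (e, 0))) has_derivative
    (\<lambda>w. fderiv (lift L) (x, e) (Fu x w, fderiv (\<lambda>x. Fu x w) x e))) (at e0)" .
  then have "((\<lambda>y. lift L (x, e)) has_derivative (\<lambda>w. fderiv (lift L) (x, e) (Fu x w, fderiv (\<lambda>x. Fu x w) x e))) (at e0)"
    by (rule has_derivative_transform_within_open[OF _ M]) (rule const)
  from has_derivative_unique[OF this has_derivative_const] show ?thesis by metis
qed

lemma FL_coord:
  assumes L: "smooth_function L" and x: "x \<in> U" and v: "v \<in> tangent_space (tot P) (pt x)" and a: "a \<in> liealg P"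
  shows "FL P L (pt x, v) a = fderiv (lift L) (x, v c) (0, Fu x (a k))"
proof -
  let ?f = "fundamental P a (pt x)"
  note p = pt(3)[OF x] and fT = fundamental_in[OF a pt(3)[OF x]]
  have eq: "L (pt x, v + tscale t ?f) = lift L (x, v c + t *\<^sub>R Fu x (a k))" for t
  proof -
    have "v + tscale t ?f \<in> tangent_space (tot P) (pt x)"
      by (intro tangent_space_subspace(2,4)[OF tot_atlas p] v fT)
    from vec(3)[OF x this] show ?thesis by (simp add: lift_def Fu_alg[OF a] tscale_def)
  qed
  have "((\<lambda>t::real. (x, v c + t *\<^sub>R Fu x (a k))) has_derivative (\<lambda>t. (0, t *\<^sub>R Fu x (a k)))) (at 0)"
    by (auto intro!: derivative_eq_intros)
  moreover have z: "(x, v c) \<in> U \<times> UNIV" using x by simp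
  have "(lift L has_derivative fderiv (lift L) (x, v c)) (at (x, v c + 0 *\<^sub>R Fu x (a k)))"
    using smooth_on_has_derivative[OF open_UxUNIV lift_smooth[OF L] z] by simp
  ultimately have "((\<lambda>t. lift L (x, v c + t *\<^sub>R Fu x (a k))) has_derivative (\<lambda>t. fderiv (lift L) (x, v c) (0, t *\<^sub>R Fu x (a k)))) (at 0)"
    by (rule has_derivative_compose)
  moreover have "fderiv (lift L) (x, v c) (0, t *\<^sub>R Fu x (a k)) = fderiv (lift L) (x, v c) (0, Fu x (a k)) * t" for t
    using linear_scale[OF linear_fderiv[OF smooth_on_differentiable[OF open_UxUNIV lift_smooth[OF L] z]], of t "(0, Fu x (a k))"]
    by (simp add: mult.commute)
  ultimately have "((\<lambda>t. lift L (x, v c + t *\<^sub>R Fu x (a k))) has_field_derivative fderiv (lift L) (x, v c) (0, Fu x (a k))) (at 0)"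
    by (simp add: has_field_derivative_def)
  from DERIV_imp_deriv[OF this] show ?thesis by (simp add: FL_def eq)
qed

end

section \<open>Horizontal paths\<close>

lemma lie_dualD:
  assumes "\<mu> \<in> lie_dual G A" "a \<in> lie_alg G A"
  shows "b \<in> lie_alg G A \<Longrightarrow> \<mu> (a + b) = \<mu> a + \<mu> b" "\<mu> (tscale r a) = r * \<mu> a"
  using assms by (auto simp: lie_dual_def)

lemma smooth_lie_curve_smooth: "smooth_lie_curve P J b \<Longrightarrow> smooth_on J (\<lambda>t. b t c)"
  unfolding smooth_lie_curve_def by (elim conjE allE)

context connection
begin

text \<open>Invariance of \<open>H\<close> makes the lift at a translated point the translate of the
  given vector; invariance of \<open>L\<close> then makes the differentiated function
  constant.\<close>

lemma HL_zero:
  assumes L: "invariant_lagrangian P L" and Z: "Z \<in> HQ P H" and b: "b \<in> liealg P"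
  shows "HL P H L Z b = 0"
proof -
  obtain q v where qv: "Z = (q, v)" "q \<in> points (tot P)" "v \<in> H q" using Z by (auto simp: HQ_def)
  have vT: "v \<in> tangent_space (tot P) q" by (rule H_tangent[OF qv(2,3)])
  have X: "dproj q v \<in> tangent_space (base P) (proj P q)" by (rule dproj_in[OF qv(2) vT])
  have "L (act P q g, hlift P H (act P q g) (dproj q v)) = L (q, v)" if g: "g \<in> carrier (grp P)" for g
  proof -
    have "differential (tot P) (tot P) (\<lambda>q. act P q g) q v = hlift P H (act P q g) (dproj q v)"
      using invariant qv(2) g X hlift_eq[OF qv(2,3) refl] unfolding invariant_distribution_def by metis
    then have "tangent_map (tot P) (tot P) (\<lambda>q. act P q g) (q, v) = (act P q g, hlift P H (act P q g) (dproj q v))"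
      by (simp add: tangent_map_def)
    moreover have "(q, v) \<in> points (tangent_atlas (tot P))" using qv(2) vT by (simp add: points_tangent)
    ultimately show ?thesis using L g unfolding invariant_lagrangian_def by metis
  qed
  from this[OF expo_in[OF b]] show ?thesis by (simp add: HL_def Let_def qv(1))
qed

lemma B_map_zero:
  assumes q: "q \<in> points (tot P)" and X: "X \<in> tangent_space (base P) (proj P q)" and a: "a \<in> liealg P"
  shows "B_map P H q X a = 0"
proof -
  obtain k where k: "k \<in> grp_atlas P" "\<one>\<^bsub>grp P\<^esub> \<in> fst k" using G.one_closed grp.points by (metis points_iff)
  let ?B = "lie_bracket (tot P) (\<lambda>q'. hlift P H q' (extension (base P) (proj P q) X (proj P q'))) (fundamental P a) q"
  have "?B c = 0" for c
  proof (cases "c \<in> tot P \<and> q \<in> fst c")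
    case True
    then have c: "c \<in> tot P" "q \<in> fst c" by auto
    interpret C: charted_connection P H c k by unfold_locales (rule c(1) k)+
    show ?thesis using C.bracket_fundamental_zero[OF C.pt_snd(2)[OF c(2)] _ a, of X] X C.pt_snd(1)[OF c(2)] by simp
  qed (auto simp: lie_bracket_def)
  then have "?B = 0" by auto
  then show ?thesis using omega_horizontal[OF q H_subspace(3)[OF q]] by (simp add: B_map_def Let_def)
qed

end

text \<open>The base curve \<open>q\<close> of the path is named explicitly. \<open>J\<close> has no
  isolated points, so derivatives within it are unique; it becomes the interval
  \<open>{t0..t1}\<close> only for the extremals.\<close>

locale path = connection P H
  for P :: "('q, 'e::model_space, 'm, 'd::model_space, 'g, 'h::model_space) bundle_data" and H +
  fixes J :: "real set" and q :: "real \<Rightarrow> 'q" and Z :: "real \<Rightarrow> ('q, 'e) tb"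
  assumes nb: "t \<in> J \<Longrightarrow> at t within J \<noteq> bot" and q: "smooth_map model_atlas J (tot P) q"
    and Z: "t \<in> J \<Longrightarrow> Z t = (q t, velocity (tot P) J q t)" and hor: "t \<in> J \<Longrightarrow> velocity (tot P) J q t \<in> H (q t)"
begin

abbreviation TQ :: "(('q, 'e) tb, 'e \<times> 'e) atlas" where "TQ \<equiv> tangent_atlas (tot P)"
abbreviation vel :: "real \<Rightarrow> ('q, 'e) tvec" where "vel t \<equiv> velocity (tot P) J q t"
abbreviation var :: "(real \<Rightarrow> ('q, 'e) tb) \<Rightarrow> real \<Rightarrow> (('q, 'e) tb, 'e \<times> 'e) tvec" where
  "var \<xi> t \<equiv> snd (variation (tot P) J \<xi> t)"
abbreviation hat_deriv :: "('q, 'e) chart \<Rightarrow> (real \<Rightarrow> ('q, 'e) tb) \<Rightarrow> real \<Rightarrow> 'e" where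
  "hat_deriv c \<xi> t \<equiv> vector_derivative (\<lambda>s. snd (\<xi> s) c) (at t within J)"

definition gen :: "(real \<Rightarrow> ('q, 'e) tb) \<Rightarrow> bool" where
  "gen \<xi> \<longleftrightarrow> smooth_map model_atlas J TQ \<xi> \<and> (\<forall>t\<in>J. fst (\<xi> t) = q t)"

definition horizontal_gen :: "(real \<Rightarrow> ('q, 'e) tb) \<Rightarrow> bool" where
  "horizontal_gen Y \<longleftrightarrow> gen Y \<and> (\<forall>t\<in>J. snd (Y t) \<in> H (q t))"

lemma generator_iff_gen: "generator (tot P) J Z \<xi> \<longleftrightarrow> gen \<xi>"
  using Z by (auto simp: generator_def gen_def)

lemma genD:
  assumes "gen \<xi>" shows "smooth_map model_atlas J TQ \<xi>" "t \<in> J \<Longrightarrow> fst (\<xi> t) = q t"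
    "t \<in> J \<Longrightarrow> snd (\<xi> t) \<in> tangent_space (tot P) (q t)"
  using assms smooth_map_points[of model_atlas J TQ \<xi> t] by (auto simp: gen_def points_tangent)

lemma q_points: "t \<in> J \<Longrightarrow> q t \<in> points (tot P)"
  using smooth_map_points[OF q] by simp

lemma horizontal_genI: "gen Y \<Longrightarrow> \<forall>t\<in>J. Y t \<in> HQ P H \<Longrightarrow> horizontal_gen Y"
  using genD(2)[of Y] by (auto simp: horizontal_gen_def HQ_def split_beta)

lemma horizontal_gen_HQ: "horizontal_gen Y \<Longrightarrow> t \<in> J \<Longrightarrow> Y t \<in> HQ P H"
  using genD(2)[of Y t] q_points[of t] by (auto simp: horizontal_gen_def HQ_def split_beta)

lemma var_tangent: "gen \<xi> \<Longrightarrow> t \<in> J \<Longrightarrow> var \<xi> t \<in> tangent_space TQ (q t, vel t)"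
  by (rule variation_coord(2)[OF tot_atlas genD(1) _ nb q genD(2)])

text \<open>The derivative is taken separately in each chart. All values of \<open>b\<close> lie in
  one tangent space, so the components are related by fixed linear maps, and these commute with
  differentiation.\<close>

lemma lie_curve_deriv_in:
  assumes b: "smooth_lie_curve P J b" and t: "t \<in> J"
  shows "lie_curve_deriv J b t \<in> liealg P"
    "((\<lambda>s. b s c) has_vector_derivative lie_curve_deriv J b t c) (at t within J)"
proof -
  have bl: "b s \<in> liealg P" if "s \<in> J" for s using b that by (simp add: smooth_lie_curve_def)
  have d: "((\<lambda>s. b s c) has_vector_derivative lie_curve_deriv J b t c) (at t within J)" for c
    unfolding lie_curve_deriv_def by (rule smooth_on_has_vector_derivative[OF smooth_lie_curve_smooth[OF b] t])
  then show "((\<lambda>s. b s c) has_vector_derivative lie_curve_deriv J b t c) (at t within J)" .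
  obtain k where k: "k \<in> grp_atlas P" "\<one>\<^bsub>grp P\<^esub> \<in> fst k" using G.one_closed grp.points by (metis points_iff)
  show "lie_curve_deriv J b t \<in> liealg P"
    unfolding liealg_one
  proof (rule tangent_spaceI[OF grp.atlas k])
    fix d' assume d': "d' \<in> grp_atlas P" "\<one>\<^bsub>grp P\<^esub> \<in> fst d'"
    let ?T = "fderiv (transition k d') (snd k \<one>\<^bsub>grp P\<^esub>)"
    have "linear ?T" by (rule linear_fderiv[OF transition_differentiable[OF grp.atlas k(1) d'(1) k(2) d'(2)]])
    then have "((\<lambda>s. ?T (b s k)) has_vector_derivative ?T (lie_curve_deriv J b t k)) (at t within J)"
      by (rule bounded_linear.has_vector_derivative[OF linear_imp_bounded_linear d])
    then have "((\<lambda>s. b s d') has_vector_derivative ?T (lie_curve_deriv J b t k)) (at t within J)"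
      by (rule has_vector_derivative_transform[OF t, rotated])
        (rule tangent_spaceD[OF bl[unfolded liealg_one] k d'])
    from vector_derivative_within[OF nb[OF t] this] show "lie_curve_deriv J b t d' = ?T (lie_curve_deriv J b t k)"
      by (simp add: lie_curve_deriv_def)
  next
    fix d' assume d': "\<not> (d' \<in> grp_atlas P \<and> \<one>\<^bsub>grp P\<^esub> \<in> fst d')"
    have "((\<lambda>s. b s d') has_vector_derivative 0) (at t within J)"
      by (rule has_vector_derivative_transform[OF t _ has_vector_derivative_const])
        (rule tangent_space_outside[OF bl[unfolded liealg_one] d'])
    from vector_derivative_within[OF nb[OF t] this] show "lie_curve_deriv J b t d' = 0" by (simp add: lie_curve_deriv_def)
  qed
qed

lemma add_fundamental_simps:
  "gen Y \<Longrightarrow> t \<in> J \<Longrightarrow> fst (add_fundamental P Y b t) = q t"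
  "gen Y \<Longrightarrow> t \<in> J \<Longrightarrow> snd (add_fundamental P Y b t) = snd (Y t) + fundamental P (b t) (q t)"
  by (simp_all add: add_fundamental_def genD(2))

end

section \<open>The path, its generators and their variations in one chart\<close>

locale charted_path = path P H J q Z + charted_connection P H c k
  for P :: "('q, 'e::model_space, 'm, 'd::model_space, 'g, 'h::model_space) bundle_data" and H J q Z c k
begin

lemma coord: assumes "q t \<in> fst c" shows "pt (snd c (q t)) = q t" "snd c (q t) \<in> U"
  using pt_snd[OF assms] by auto

lemma q_has_derivative: "t \<in> J \<Longrightarrow> q t \<in> fst c \<Longrightarrow> ((\<lambda>s. snd c (q s)) has_vector_derivative vel t c) (at t within J)"
  by (rule velocity_has_derivative[OF tot_atlas q _ c])

lemma gen_has_derivative: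
  assumes \<xi>: "gen \<xi>" and t: "t \<in> J" "q t \<in> fst c"
  shows "((\<lambda>s. snd (\<xi> s) c) has_vector_derivative hat_deriv c \<xi> t) (at t within J)"
proof -
  have "fst (\<xi> t) \<in> fst c" using genD(2)[OF \<xi> t(1)] t(2) by simp
  note d = tangent_curve_derivative(2)[OF tot_atlas genD(1)[OF \<xi>] t(1) nb[OF t(1)] c this]
  show ?thesis unfolding vector_derivative_within[OF nb[OF t(1)] d] by (rule d)
qed

lemma var_coord:
  "gen \<xi> \<Longrightarrow> t \<in> J \<Longrightarrow> q t \<in> fst c \<Longrightarrow> var \<xi> t (tangent_chart (tot P) c) = (snd (\<xi> t) c, hat_deriv c \<xi> t)"
  by (rule variation_coord(1)[OF tot_atlas genD(1) _ nb q genD(2) c])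

lemma gen_coord:
  assumes \<xi>: "gen \<xi>" and t: "t \<in> J" "q t \<in> fst c"
  obtains W where "open W" "t \<in> W" "\<forall>s\<in>W \<inter> J. q s \<in> fst c" "smooth_on (W \<inter> J) (\<lambda>s. snd c (q s))"
    "smooth_on (W \<inter> J) (\<lambda>s. snd (\<xi> s) c)"
proof -
  have m: "fst (\<xi> t) \<in> fst c" using genD(2)[OF \<xi> t(1)] t(2) by simp
  obtain W where W: "open W" "t \<in> W" "\<forall>s\<in>W \<inter> J. fst (\<xi> s) \<in> fst c" "smooth_on (W \<inter> J) (\<lambda>s. snd c (fst (\<xi> s)))"
    "smooth_on (W \<inter> J) (\<lambda>s. snd (\<xi> s) c)"
    by (rule tangent_curveE[OF tot_atlas genD(1)[OF \<xi>] t(1) c m], rule that)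
  have "smooth_on (W \<inter> J) (\<lambda>s. snd c (q s))"
    by (rule smooth_on_cong[THEN iffD1, OF _ W(4)]) (simp add: genD(2)[OF \<xi>])
  then show thesis by (intro that[of W] W) (use W(3) genD(2)[OF \<xi>] in auto)
qed

lemma smooth_on_local_derivative:
  fixes f :: "real \<Rightarrow> 'x::model_space"
  assumes "open W" "smooth_on (W \<inter> J) f"
  shows "smooth_on (W \<inter> J) (\<lambda>s. vector_derivative f (at s within J))"
proof -
  have e: "at s within (W \<inter> J) = at s within J" if "s \<in> W \<inter> J" for s
    using at_within_Int_open[OF assms(1)] that by blast
  have "smooth_on (W \<inter> J) (\<lambda>s. vector_derivative f (at s within (W \<inter> J)))"
    by (rule smooth_on_vector_derivative[OF assms(2)]) (use nb e in simp)
  then show ?thesis by (rule smooth_on_cong[THEN iffD1, rotated]) (simp add: e)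
qed

lemma vel_smooth:
  assumes "open W" "\<forall>s\<in>W \<inter> J. q s \<in> fst c" "smooth_on (W \<inter> J) (\<lambda>s. snd c (q s))"
  shows "smooth_on (W \<inter> J) (\<lambda>s. vel s c)"
  by (rule smooth_on_cong[THEN iffD1, OF _ smooth_on_local_derivative[OF assms(1,3)]])
    (use assms(2) c in \<open>simp add: velocity_def\<close>)

lemma add_fundamental_coord:
  assumes Y: "gen Y" and b: "smooth_lie_curve P J b" and s: "s \<in> J" "q s \<in> fst c"
  shows "snd (add_fundamental P Y b s) c = snd (Y s) c + Fu (snd c (q s)) (b s k)"
  using b s coord(1)[OF s(2)] by (simp add: add_fundamental_simps[OF Y] Fu_alg smooth_lie_curve_def)

lemma lift_variation:
  assumes f: "smooth_function f" and \<xi>: "gen \<xi>" and t: "t \<in> J" "q t \<in> fst c"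
  shows "d_fun TQ f (q t, vel t) (var \<xi> t) = fderiv (lift f) (snd c (q t), vel t c) (snd (\<xi> t) c, hat_deriv c \<xi> t)"
  using d_fun_lift[OF f coord(2)[OF t(2)], of "vel t" "var \<xi> t"] coord(1)[OF t(2)] var_tangent[OF \<xi> t(1)]
    velocity_in[OF tot_atlas q t(1) nb[OF t(1)]] var_coord[OF \<xi> t] by simp

lemma action_density_smooth:
  assumes f: "smooth_function f" and \<xi>: "gen \<xi>" and t: "t \<in> J" "q t \<in> fst c"
  shows "\<exists>W. open W \<and> t \<in> W \<and> smooth_on (J \<inter> W) (\<lambda>t. d_fun TQ f (q t, vel t) (var \<xi> t))"
proof -
  obtain W where W: "open W" "t \<in> W" "\<forall>s\<in>W \<inter> J. q s \<in> fst c" "smooth_on (W \<inter> J) (\<lambda>s. snd c (q s))"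
    "smooth_on (W \<inter> J) (\<lambda>s. snd (\<xi> s) c)" by (rule gen_coord[OF \<xi> t], rule that)
  have "smooth_on (W \<inter> J) (\<lambda>s. fderiv (lift f) (snd c (q s), vel s c) (snd (\<xi> s) c, hat_deriv c \<xi> s))"
    by (rule smooth_on_fderiv_apply[OF open_UxUNIV lift_smooth[OF f] smooth_on_Pair[OF W(4) vel_smooth[OF W(1,3,4)]]
          smooth_on_Pair[OF W(5) smooth_on_local_derivative[OF W(1,5)]]]) (use W(3) coord(2) in auto)
  then have "smooth_on (W \<inter> J) (\<lambda>t. d_fun TQ f (q t, vel t) (var \<xi> t))"
    by (rule smooth_on_cong[THEN iffD2, rotated]) (use W(3) lift_variation[OF f \<xi>] in simp)
  then show ?thesis using W(1,2) by (intro exI[of _ W]) (simp add: Int_commute)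
qed

lemma FL_path:
  assumes f: "smooth_function f" and t: "t \<in> J" "q t \<in> fst c" and a: "a \<in> liealg P"
  shows "FL P f (q t, vel t) a = fderiv (lift f) (snd c (q t), vel t c) (0, Fu (snd c (q t)) (a k))"
  using FL_coord[OF f coord(2)[OF t(2)] _ a, of "vel t"] coord(1)[OF t(2)] velocity_in[OF tot_atlas q t(1) nb[OF t(1)]] by simp

lemma FL_local_smooth:
  assumes f: "smooth_function f" and t: "t \<in> J" "q t \<in> fst c" and a: "a \<in> liealg P"
  shows "\<exists>W. open W \<and> t \<in> W \<and> smooth_on (J \<inter> W) (\<lambda>t. FL P f (q t, vel t) a)"
proof -
  obtain W where W: "open W" "t \<in> W" "\<forall>s\<in>W \<inter> J. q s \<in> fst c" "smooth_on (W \<inter> J) (\<lambda>s. snd c (q s))"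
    by (rule smooth_curveE[OF tot_atlas q t(1) c t(2)], rule that)
  have "smooth_on (W \<inter> J) (\<lambda>s. fderiv (lift f) (snd c (q s), vel s c) (0, Fu (snd c (q s)) (a k)))"
    by (rule smooth_on_fderiv_apply[OF open_UxUNIV lift_smooth[OF f] smooth_on_Pair[OF W(4) vel_smooth[OF W(1,3,4)]]
          smooth_on_Pair[OF smooth_on_const smooth_on_compose[OF Fu_smooth W(4)]]]) (use W(3) coord(2) in auto)
  then have "smooth_on (W \<inter> J) (\<lambda>t. FL P f (q t, vel t) a)"
    by (rule smooth_on_cong[THEN iffD2, rotated]) (use W(3) FL_path[OF f _ _ a] in simp)
  then show ?thesis using W(1,2) by (intro exI[of _ W]) (simp add: Int_commute)
qed

lemma FL_lie_dual:
  assumes f: "smooth_function f" and t: "t \<in> J" "q t \<in> fst c"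
  shows "FL P f (q t, vel t) \<in> lie_dual (grp P) (grp_atlas P)"
proof -
  let ?D = "fderiv (lift f) (snd c (q t), vel t c)"
  have l: "linear ?D" by (rule linear_fderiv[OF smooth_on_differentiable[OF open_UxUNIV lift_smooth[OF f]]]) (simp add: coord(2)[OF t(2)])
  note F = Fu_linear[OF coord(2)[OF t(2)]]
  have "FL P f (q t, vel t) (a + b) = FL P f (q t, vel t) a + FL P f (q t, vel t) b" if "a \<in> liealg P" "b \<in> liealg P" for a b
    using that liealg_subspace(2)[OF that] linear_add[OF l, of "(0, Fu (snd c (q t)) (a k))" "(0, Fu (snd c (q t)) (b k))"]
    by (simp add: FL_path[OF f t] linear_add[OF F])
  moreover have "FL P f (q t, vel t) (tscale r a) = r * FL P f (q t, vel t) a" if "a \<in> liealg P" for r a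
    using that liealg_subspace(4)[OF that, of r] linear_scale[OF l, of r "(0, Fu (snd c (q t)) (a k))"]
    by (simp add: FL_path[OF f t] linear_scale[OF F] tscale_def)
  ultimately show ?thesis by (simp add: lie_dual_def)
qed

lemma Fu_curve_derivative:
  assumes b: "smooth_lie_curve P J b" and t: "t \<in> J" "q t \<in> fst c"
  shows "((\<lambda>s. Fu (snd c (q s)) (b s k)) has_vector_derivative
    fderiv (\<lambda>y. Fu y (b t k)) (snd c (q t)) (vel t c) + Fu (snd c (q t)) (lie_curve_deriv J b t k)) (at t within J)"
proof -
  have "((\<lambda>z. Fu (fst z) (snd z)) has_derivative (\<lambda>z. fderiv (\<lambda>y. Fu y (b t k)) (snd c (q t)) (fst z) + Fu (snd c (q t)) (snd z)))
      (at (snd c (q t), b t k) within (\<lambda>s. (snd c (q s), b s k)) ` J)"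
    by (rule has_derivative_at_withinI[OF operator_has_derivative[OF open_U Fu_linear Fu_smooth coord(2)[OF t(2)]]])
  from vector_derivative_diff_chain_within[OF has_vector_derivative_Pair[OF q_has_derivative[OF t] lie_curve_deriv_in(2)[OF b t(1)]] this]
  show ?thesis by (simp add: o_def)
qed

lemma Lagrangian_variation:
  assumes L: "smooth_function L" "invariant_lagrangian P L" and Y: "gen Y" and b: "smooth_lie_curve P J b"
    and \<xi>: "gen (add_fundamental P Y b)" and t: "t \<in> J" "q t \<in> fst c"
  shows "d_fun TQ L (q t, vel t) (var (add_fundamental P Y b) t)
    = d_fun TQ L (q t, vel t) (var Y t) + FL P L (q t, vel t) (lie_curve_deriv J b t)"
proof -
  let ?x = "snd c (q t)" and ?\<xi> = "add_fundamental P Y b" and ?b' = "lie_curve_deriv J b t"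
  let ?D = "fderiv (lift L) (?x, vel t c)" and ?y = "snd (Y t) c" and ?y' = "hat_deriv c Y t"
  let ?F' = "fderiv (\<lambda>y. Fu y (b t k)) ?x (vel t c)"
  obtain W where W: "open W" "t \<in> W" "\<forall>s\<in>W \<inter> J. q s \<in> fst c"
    by (rule smooth_curveE[OF tot_atlas q t(1) c t(2)], rule that)
  have "((\<lambda>s. snd (Y s) c + Fu (snd c (q s)) (b s k)) has_vector_derivative ?y' + (?F' + Fu ?x (?b' k))) (at t within J)"
    by (intro has_vector_derivative_add gen_has_derivative[OF Y t] Fu_curve_derivative[OF b t])
  moreover have "\<forall>\<^sub>F s in at t within J. snd (Y s) c + Fu (snd c (q s)) (b s k) = snd (?\<xi> s) c"
    unfolding eventually_at_topological
    by (intro exI[of _ W] conjI W(1,2) ballI impI) (rule add_fundamental_coord[OF Y b, symmetric]; use W(3) in blast)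
  ultimately have "((\<lambda>s. snd (?\<xi> s) c) has_vector_derivative ?y' + (?F' + Fu ?x (?b' k))) (at t within J)"
    unfolding has_vector_derivative_def
    by (rule has_derivative_transform_eventually) (simp_all add: add_fundamental_coord[OF Y b t] t(1))
  from vector_derivative_within[OF nb[OF t(1)] this]
  have d: "hat_deriv c ?\<xi> t = ?y' + (?F' + Fu ?x (?b' k))" .
  have l: "linear ?D" by (rule linear_fderiv[OF smooth_on_differentiable[OF open_UxUNIV lift_smooth[OF L(1)]]]) (simp add: coord(2)[OF t(2)])
  \<comment> \<open>Besides the variation by \<open>Y\<close> there are two terms: the variation by
    a fundamental field with \<open>b\<close> frozen, which invariance of \<open>L\<close> kills,
    and a pure fibre direction, which is the fibre derivative \<open>FL\<close>.\<close>
  have split: "(?y + Fu ?x (b t k), ?y' + (?F' + Fu ?x (?b' k))) = (?y, ?y') + ((Fu ?x (b t k), ?F') + (0, Fu ?x (?b' k)))" by simp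
  have "d_fun TQ L (q t, vel t) (var ?\<xi> t) = ?D (?y + Fu ?x (b t k), ?y' + (?F' + Fu ?x (?b' k)))"
    by (simp only: lift_variation[OF L(1) \<xi> t] add_fundamental_coord[OF Y b t] d)
  also have "\<dots> = ?D (?y, ?y') + (?D (Fu ?x (b t k), ?F') + ?D (0, Fu ?x (?b' k)))"
    unfolding split by (simp only: linear_add[OF l])
  also have "\<dots> = ?D (?y, ?y') + ?D (0, Fu ?x (?b' k))"
    using invariant_lagrangian_fundamental[OF L coord(2)[OF t(2)]] by simp
  finally show ?thesis
    by (simp only: lift_variation[OF L(1) Y t] FL_path[OF L(1) t lie_curve_deriv_in(1)[OF b t(1)]])
qed

lemma curvature_along_coord:
  assumes Y: "horizontal_gen Y" and t: "t \<in> J" "q t \<in> fst c"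
  shows "curvature_along P H Z Y t
    = alg (DOm (snd c (q t)) (vel t c) (snd (Y t) c) - DOm (snd c (q t)) (snd (Y t) c) (vel t c))"
  using curvature_coord[OF coord(2)[OF t(2)], of "vel t" "snd (Y t)"] coord(1)[OF t(2)] Y t hor[OF t(1)] Z[OF t(1)] genD(2)[of Y t]
  by (simp add: curvature_along_def tangent_map_def horizontal_gen_def)

text \<open>Differentiating \<open>Om (q t) (\<xi> t) = b t\<close> along the path gives the second term on the left.\<close>

lemma omega_variation:
  assumes Y: "horizontal_gen Y" and b: "smooth_lie_curve P J b" and \<xi>: "gen (add_fundamental P Y b)" and t: "t \<in> J" "q t \<in> fst c"
  shows "DOm (snd c (q t)) (vel t c) (snd (add_fundamental P Y b t) c) + Om (snd c (q t)) (hat_deriv c (add_fundamental P Y b) t)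
    = (lie_curve_deriv J b t + curvature_along P H Z Y t) k"
proof -
  let ?x = "snd c (q t)" and ?\<xi> = "add_fundamental P Y b"
  let ?y = "snd (Y t) c" and ?s = "snd (?\<xi> t) c" and ?s' = "hat_deriv c ?\<xi> t" and ?v = "vel t c"
  note x = coord(2)[OF t(2)]
  have Yg: "gen Y" using Y by (simp add: horizontal_gen_def)
  obtain W where W: "open W" "t \<in> W" "\<forall>s\<in>W \<inter> J. q s \<in> fst c"
    by (rule smooth_curveE[OF tot_atlas q t(1) c t(2)], rule that)
  have Om_b: "Om (snd c (q s)) (snd (?\<xi> s) c) = b s k" if s: "s \<in> J" "q s \<in> fst c" for s
  proof -
    have "snd (Y s) \<in> H (pt (snd c (q s)))" using Y s coord(1)[OF s(2)] by (simp add: horizontal_gen_def)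
    then have "Om (snd c (q s)) (snd (Y s) c) = 0"
      using Om_zero_iff[OF coord(2)[OF s(2)]] genD(3)[OF Yg s(1)] coord(1)[OF s(2)] by simp
    then show ?thesis
      by (simp add: add_fundamental_coord[OF Yg b s] linear_add[OF Om_linear[OF coord(2)[OF s(2)]]] Om_Fu[OF coord(2)[OF s(2)]])
  qed
  have "((\<lambda>z. Om (fst z) (snd z)) has_derivative (\<lambda>z. DOm ?x ?s (fst z) + Om ?x (snd z)))
      (at (snd c (q t), ?s) within (\<lambda>s. (snd c (q s), snd (?\<xi> s) c)) ` J)"
    by (rule has_derivative_at_withinI[OF operator_has_derivative[OF open_U Om_linear Om_smooth x]])
  from vector_derivative_diff_chain_within[OF has_vector_derivative_Pair[OF q_has_derivative[OF t] gen_has_derivative[OF \<xi> t]] this]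
  have "((\<lambda>s. Om (snd c (q s)) (snd (?\<xi> s) c)) has_vector_derivative DOm ?x ?s ?v + Om ?x ?s') (at t within J)" by (simp add: o_def)
  moreover have "\<forall>\<^sub>F s in at t within J. Om (snd c (q s)) (snd (?\<xi> s) c) = b s k"
    unfolding eventually_at_topological
    by (intro exI[of _ W] conjI W(1,2) ballI impI) (rule Om_b; use W(3) in blast)
  ultimately have "((\<lambda>s. b s k) has_vector_derivative DOm ?x ?s ?v + Om ?x ?s') (at t within J)"
    unfolding has_vector_derivative_def
    by (rule has_derivative_transform_eventually) (simp_all add: Om_b t)
  from vector_derivative_unique_within[OF nb[OF t(1)] this lie_curve_deriv_in(2)[OF b t(1)]]
  have 1: "DOm ?x ?s ?v + Om ?x ?s' = lie_curve_deriv J b t k" .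
  have dif: "(\<lambda>y. Om y e) differentiable (at ?x)" for e by (rule smooth_on_differentiable[OF open_U Om_smooth x])
  have "fderiv (\<lambda>y. Om y (?y + Fu ?x (b t k))) ?x ?v = fderiv (\<lambda>y. Om y ?y + Om y (Fu ?x (b t k))) ?x ?v"
    by (rule fderiv_cong_apply[OF open_U x]) (rule linear_add[OF Om_linear])
  also have "\<dots> = DOm ?x ?y ?v + DOm ?x (Fu ?x (b t k)) ?v"
    unfolding frechet_derivative_at[OF has_derivative_add[OF dif[unfolded frechet_derivative_works] dif[unfolded frechet_derivative_works]], symmetric] by (rule refl)
  finally have 2: "DOm ?x ?s ?v = DOm ?x ?y ?v + DOm ?x (Fu ?x (b t k)) ?v" by (simp only: add_fundamental_coord[OF Yg b t])
  have 3: "DOm ?x ?v ?s = DOm ?x ?v ?y + DOm ?x ?v (Fu ?x (b t k))"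
    unfolding add_fundamental_coord[OF Yg b t] by (rule linear_add[OF linear_fderiv[OF dif]])
  \<comment> \<open>Here the vanishing of \<B> enters: the velocity is horizontal, so the two terms
    containing \<open>Fu ?x (b t k)\<close> cancel and only the curvature of velocity and
    \<open>Y\<close> is left.\<close>
  have "vel t \<in> H (pt ?x)" using hor[OF t(1)] coord(1)[OF t(2)] by simp
  from DOm_fundamental[OF x this] have 4: "DOm ?x ?v (Fu ?x (b t k)) = DOm ?x (Fu ?x (b t k)) ?v" .
  show ?thesis using 1 2 3 4 by (simp add: curvature_along_coord[OF Y t] alg(2) algebra_simps)
qed

end

section \<open>Chart-free statements along the path\<close>

context path
begin

lemma chart_at:
  assumes "t \<in> J" obtains c k where "q t \<in> fst c" "charted_path P H J q Z c k"
proof -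
  obtain c where c: "c \<in> tot P" "q t \<in> fst c" by (rule smooth_map_codE[OF q assms], rule that)
  obtain k where k: "k \<in> grp_atlas P" "\<one>\<^bsub>grp P\<^esub> \<in> fst k" using G.one_closed grp.points by (metis points_iff)
  show thesis by (rule that[OF c(2), of k]) (unfold_locales; rule c(1) k)
qed

abbreviation smooth_Lagrangian :: "(('q, 'e) tb \<Rightarrow> real) \<Rightarrow> bool" where
  "smooth_Lagrangian \<equiv> smooth_map TQ (points TQ) model_atlas"

lemma action_density_smooth:
  assumes f: "smooth_Lagrangian f" and \<xi>: "gen \<xi>"
  shows "smooth_on J (\<lambda>t. d_fun TQ f (q t, vel t) (var \<xi> t))"
proof (rule smooth_on_local)
  fix t assume t: "t \<in> J"
  obtain c k where ck: "q t \<in> fst c" "charted_path P H J q Z c k" by (rule chart_at[OF t], rule that)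
  interpret C: charted_path P H J q Z c k by (rule ck)
  show "\<exists>W. open W \<and> t \<in> W \<and> smooth_on (J \<inter> W) (\<lambda>t. d_fun TQ f (q t, vel t) (var \<xi> t))"
    by (rule C.action_density_smooth[OF f \<xi> t ck(1)])
qed

lemma FL_smooth:
  assumes f: "smooth_Lagrangian f" and a: "a \<in> liealg P"
  shows "smooth_on J (\<lambda>t. FL P f (q t, vel t) a)"
proof (rule smooth_on_local)
  fix t assume t: "t \<in> J"
  obtain c k where ck: "q t \<in> fst c" "charted_path P H J q Z c k" by (rule chart_at[OF t], rule that)
  interpret C: charted_path P H J q Z c k by (rule ck)
  show "\<exists>W. open W \<and> t \<in> W \<and> smooth_on (J \<inter> W) (\<lambda>t. FL P f (q t, vel t) a)"
    by (rule C.FL_local_smooth[OF f t ck(1) a])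
qed

lemma FL_in_lie_dual:
  assumes f: "smooth_Lagrangian f" and t: "t \<in> J" shows "FL P f (q t, vel t) \<in> lie_dual (grp P) (grp_atlas P)"
proof -
  obtain c k where ck: "q t \<in> fst c" "charted_path P H J q Z c k" by (rule chart_at[OF t], rule that)
  interpret C: charted_path P H J q Z c k by (rule ck)
  show ?thesis by (rule C.FL_lie_dual[OF f t ck(1)])
qed

lemma curvature_along_in:
  assumes Y: "horizontal_gen Y" and t: "t \<in> J" shows "curvature_along P H Z Y t \<in> liealg P"
proof -
  obtain c k where ck: "q t \<in> fst c" "charted_path P H J q Z c k" by (rule chart_at[OF t], rule that)
  interpret C: charted_path P H J q Z c k by (rule ck)
  show ?thesis unfolding C.curvature_along_coord[OF Y t ck(1)] by (rule C.alg(1))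
qed

lemma add_fundamental_gen:
  assumes Y: "gen Y" and b: "smooth_lie_curve P J b" shows "gen (add_fundamental P Y b)"
proof -
  let ?\<xi> = "add_fundamental P Y b"
  note s = add_fundamental_simps[OF Y]
  have bl: "b t \<in> liealg P" if "t \<in> J" for t using b that by (simp add: smooth_lie_curve_def)
  have "smooth_map model_atlas J TQ ?\<xi>"
  proof (rule tangent_curveI)
    fix t assume t: "t \<in> J"
    show "snd (?\<xi> t) \<in> tangent_space (tot P) (fst (?\<xi> t))"
      unfolding s[OF t] by (intro tangent_space_subspace(2)[OF tot_atlas q_points[OF t]] genD(3)[OF Y t] fundamental_in bl t q_points)
    obtain c k where ck: "q t \<in> fst c" "charted_path P H J q Z c k" by (rule chart_at[OF t], rule that)
    interpret C: charted_path P H J q Z c k by (rule ck)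
    obtain W where W: "open W" "t \<in> W" "\<forall>s\<in>W \<inter> J. q s \<in> fst c" "smooth_on (W \<inter> J) (\<lambda>s. snd c (q s))"
      "smooth_on (W \<inter> J) (\<lambda>s. snd (Y s) c)" by (rule C.gen_coord[OF Y t ck(1)], rule that)
    have bs: "smooth_on (W \<inter> J) (\<lambda>s. b s k)"
      by (rule smooth_on_subset[OF smooth_lie_curve_smooth[OF b]]) auto
    have "smooth_on (W \<inter> J) (\<lambda>s. snd (Y s) c + C.Fu (snd c (q s)) (b s k))"
      by (rule smooth_on_add[OF W(5)], rule smooth_on_operator[where T = "\<lambda>s. C.Fu (snd c (q s))", OF _ _ bs])
        (use W(3) C.coord(2) in \<open>auto intro: C.Fu_linear smooth_on_compose[OF C.Fu_smooth W(4)]\<close>)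
    then have 1: "smooth_on (W \<inter> J) (\<lambda>s. snd (?\<xi> s) c)"
      by (rule smooth_on_cong[THEN iffD2, rotated]) (use W(3) C.add_fundamental_coord[OF Y b] in simp)
    have 2: "smooth_on (W \<inter> J) (\<lambda>s. snd c (fst (?\<xi> s)))"
      by (rule smooth_on_cong[THEN iffD2, OF _ W(4)]) (simp add: s(1))
    show "\<exists>c\<in>tot P. \<exists>W. open W \<and> t \<in> W \<and> (\<forall>s\<in>W \<inter> J. fst (?\<xi> s) \<in> fst c) \<and>
      smooth_on (W \<inter> J) (\<lambda>s. snd c (fst (?\<xi> s))) \<and> smooth_on (W \<inter> J) (\<lambda>s. snd (?\<xi> s) c)"
      using C.c W(1-3) 1 2 by (intro bexI[of _ c] exI[of _ W] conjI) (auto simp: s(1))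
  qed
  then show ?thesis by (simp add: gen_def s(1))
qed

lemma smooth_lie_curve_uminus:
  assumes b: "smooth_lie_curve P J b" shows "smooth_lie_curve P J (\<lambda>t. - b t)"
proof -
  have "- b t = tscale (-1) (b t)" for t by (simp add: tscale_def fun_eq_iff)
  then have "- b t \<in> liealg P" if "t \<in> J" for t
    using liealg_subspace(4)[of "b t" "-1"] b that by (simp add: smooth_lie_curve_def)
  moreover have "smooth_on J (\<lambda>t. - b t c)" for c
    by (rule smooth_on_linear_compose[of uminus, OF _ smooth_lie_curve_smooth[OF b]]) (simp add: linear_iff)
  ultimately show ?thesis by (simp add: smooth_lie_curve_def)
qed

text \<open>\<open>b\<close> is the connection form of \<xi>. Smoothness is checked in a single
  component of the Lie algebra; the other components follow by fixed linear transitions. The last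
  clause carries vanishing at the end-points over to both parts.\<close>

lemma gen_decomposition:
  assumes \<xi>: "gen \<xi>"
  obtains Y b where "horizontal_gen Y" "smooth_lie_curve P J b" "add_fundamental P Y b = \<xi>"
    "\<forall>t\<in>J. snd (\<xi> t) = 0 \<longrightarrow> b t = 0 \<and> snd (Y t) = 0"
proof -
  define b where "b = (\<lambda>t. omega P H (\<xi> t))"
  define Y where "Y = add_fundamental P \<xi> (\<lambda>t. - b t)"
  have \<xi>t: "\<xi> t = (q t, snd (\<xi> t))" if "t \<in> J" for t using genD(2)[OF \<xi> that] by (simp add: prod_eq_iff)
  have om: "b t \<in> liealg P" "snd (\<xi> t) - fundamental P (b t) (q t) \<in> H (q t)" if "t \<in> J" for t
    using omega_decomposition[OF q_points[OF that] genD(3)[OF \<xi> that]] by (simp_all add: b_def flip: \<xi>t[OF that])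
  obtain k where k: "k \<in> grp_atlas P" "\<one>\<^bsub>grp P\<^esub> \<in> fst k" using G.one_closed grp.points by (metis points_iff)
  have bk: "smooth_on J (\<lambda>t. b t k)"
  proof (rule smooth_on_local)
    fix t assume t: "t \<in> J"
    obtain c where c: "c \<in> tot P" "q t \<in> fst c" by (rule smooth_map_codE[OF q t], rule that)
    interpret C: charted_path P H J q Z c k by unfold_locales (rule c k)+
    obtain W where W: "open W" "t \<in> W" "\<forall>s\<in>W \<inter> J. q s \<in> fst c" "smooth_on (W \<inter> J) (\<lambda>s. snd c (q s))"
      "smooth_on (W \<inter> J) (\<lambda>s. snd (\<xi> s) c)" by (rule C.gen_coord[OF \<xi> t c(2)], rule that)
    have "smooth_on (W \<inter> J) (\<lambda>s. C.Om (snd c (q s)) (snd (\<xi> s) c))"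
      by (rule smooth_on_operator[where T = "\<lambda>s. C.Om (snd c (q s))", OF _ _ W(5)])
        (use W(3) C.coord(2) in \<open>auto intro: C.Om_linear smooth_on_compose[OF C.Om_smooth W(4)]\<close>)
    moreover have "b s k = C.Om (snd c (q s)) (snd (\<xi> s) c)" if s: "s \<in> W \<inter> J" for s
      using C.Om_omega[OF C.coord(2), of s "snd (\<xi> s)"] C.coord(1)[of s] W(3) s genD(3)[OF \<xi>, of s] \<xi>t[of s]
      by (simp add: b_def C.alg(2))
    ultimately have "smooth_on (J \<inter> W) (\<lambda>t. b t k)"
      using smooth_on_cong[of "W \<inter> J" "\<lambda>t. b t k"] by (simp add: Int_commute)
    then show "\<exists>W. open W \<and> t \<in> W \<and> smooth_on (J \<inter> W) (\<lambda>t. b t k)" using W(1,2) by blast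
  qed
  have b: "smooth_lie_curve P J b"
    unfolding smooth_lie_curve_def
  proof (intro conjI ballI allI)
    fix d show "smooth_on J (\<lambda>t. b t d)"
    proof (cases "d \<in> grp_atlas P \<and> \<one>\<^bsub>grp P\<^esub> \<in> fst d")
      case True
      let ?T = "fderiv (transition k d) (snd k \<one>\<^bsub>grp P\<^esub>)"
      have "linear ?T" using True by (intro linear_fderiv transition_differentiable[OF grp.atlas k(1) _ k(2)]) auto
      from smooth_on_linear_compose[OF this bk] have "smooth_on J (\<lambda>t. ?T (b t k))" .
      then show ?thesis
        by (rule smooth_on_cong[THEN iffD2, rotated])
          (use True tangent_spaceD[OF om(1)[unfolded liealg_one] k] in auto)
    next
      case False
      have "smooth_on J (\<lambda>t. 0 :: 'h)" by (rule smooth_on_const)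
      then show ?thesis
        by (rule smooth_on_cong[THEN iffD2, rotated]) (use tangent_space_outside[OF om(1)[unfolded liealg_one] False] in auto)
    qed
  qed (rule om(1))
  have mb: "smooth_lie_curve P J (\<lambda>t. - b t)" by (rule smooth_lie_curve_uminus[OF b])
  have f: "fundamental P (- b t) (q t) = - fundamental P (b t) (q t)" if "t \<in> J" for t
    using fundamental_linear(2)[OF liealg_subspace(1) om(1)[OF that] q_points[OF that]] by (simp add: fundamental_zero[OF q_points[OF that]])
  have Yg: "gen Y" unfolding Y_def by (rule add_fundamental_gen[OF \<xi> mb])
  have Yt: "snd (Y t) = snd (\<xi> t) - fundamental P (b t) (q t)" if "t \<in> J" for t
    using add_fundamental_simps(2)[OF \<xi> that, of "\<lambda>t. - b t"] f[OF that] by (simp add: Y_def)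
  have Yh: "horizontal_gen Y" using Yg Yt om(2) by (simp add: horizontal_gen_def)
  \<comment> \<open>\<open>Y\<close> has the right values only on \<open>J\<close>.
    \<open>Y'\<close> subtracts the fundamental vector literally, so that the sum with
    \<open>b\<close> gives back \<xi> as a function on all of the real line.\<close>
  define Y' where "Y' = (\<lambda>t. (fst (\<xi> t), snd (\<xi> t) - fundamental P (b t) (fst (\<xi> t))))"
  have Y'Y: "Y' t = Y t" if "t \<in> J" for t
    using Yt[OF that] genD(2)[OF \<xi> that] genD(2)[OF Yg that] by (simp add: Y'_def prod_eq_iff)
  have "smooth_map model_atlas J TQ Y'" by (rule smooth_map_cong[OF smooth_atlas_model genD(1)[OF Yg]]) (simp add: Y'Y)
  then have "horizontal_gen Y'" using Yh Y'Y by (simp add: horizontal_gen_def gen_def)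
  moreover have "add_fundamental P Y' b = \<xi>" by (auto simp: add_fundamental_def Y'_def)
  moreover have "\<forall>t\<in>J. snd (\<xi> t) = 0 \<longrightarrow> b t = 0 \<and> snd (Y' t) = 0"
  proof (intro ballI impI)
    fix t assume t: "t \<in> J" "snd (\<xi> t) = 0"
    have "b t = 0" using omega_horizontal[OF q_points[OF t(1)] H_subspace(3)[OF q_points[OF t(1)]]] \<xi>t[OF t(1)] t(2) by (simp add: b_def)
    then show "b t = 0 \<and> snd (Y' t) = 0"
      using t(2) genD(2)[OF \<xi> t(1)] fundamental_zero[OF q_points[OF t(1)]] by (simp add: Y'_def)
  qed
  ultimately show thesis by (intro that[of Y' b] b)
qed

text \<open>\<open>tangent_to_HQ\<close> decides tangency in one chart around \<open>q t\<close>,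
  and \<open>omega_variation\<close> rewrites its condition as the \<open>k\<close>-component of a
  Lie algebra element, which determines that element.\<close>

lemma vakonomic_iff:
  assumes Y: "horizontal_gen Y" and b: "smooth_lie_curve P J b"
  shows "vakonomic_variation P H J Z (add_fundamental P Y b) \<longleftrightarrow>
    (\<forall>t\<in>J. lie_curve_deriv J b t + curvature_along P H Z Y t = 0)"
  unfolding vakonomic_variation_def
proof (rule ball_cong[OF refl])
  fix t assume t: "t \<in> J"
  let ?\<xi> = "add_fundamental P Y b"
  have \<xi>: "gen ?\<xi>" using Y b by (intro add_fundamental_gen) (simp_all add: horizontal_gen_def)
  obtain c k where ck: "q t \<in> fst c" "charted_path P H J q Z c k" by (rule chart_at[OF t], rule that)
  interpret C: charted_path P H J q Z c k by (rule ck)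
  let ?x = "snd c (q t)"
  have v: "vel t \<in> H (C.pt ?x)" using hor[OF t] C.coord(1)[OF ck(1)] by simp
  have w: "var ?\<xi> t \<in> tangent_space TQ (C.pt ?x, vel t)" using var_tangent[OF \<xi> t] C.coord(1)[OF ck(1)] by simp
  have "var ?\<xi> t \<in> tangent_to TQ (HQ P H) (Z t) \<longleftrightarrow>
      C.DOm ?x (vel t c) (snd (?\<xi> t) c) + C.Om ?x (hat_deriv c ?\<xi> t) = 0"
    using C.tangent_to_HQ[OF C.coord(2)[OF ck(1)] v w C.var_coord[OF \<xi> t ck(1)]] by (simp add: Z[OF t] C.coord(1)[OF ck(1)])
  also have "\<dots> \<longleftrightarrow> (lie_curve_deriv J b t + curvature_along P H Z Y t) k = (0 :: ('g, 'h) tvec) k"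
    by (simp only: C.omega_variation[OF Y b \<xi> t ck(1)] zero_fun_apply)
  also have "\<dots> \<longleftrightarrow> lie_curve_deriv J b t + curvature_along P H Z Y t = 0"
    using C.alg_eqI[OF liealg_subspace(2)[OF lie_curve_deriv_in(1)[OF b t] curvature_along_in[OF Y t]] liealg_subspace(1)] by metis
  finally show "var ?\<xi> t \<in> tangent_to TQ (HQ P H) (Z t) \<longleftrightarrow> lie_curve_deriv J b t + curvature_along P H Z Y t = 0" .
qed

lemma Lagrangian_variation:
  assumes L: "smooth_Lagrangian L" "invariant_lagrangian P L" and Y: "gen Y" and b: "smooth_lie_curve P J b" and t: "t \<in> J"
  shows "d_fun TQ L (q t, vel t) (var (add_fundamental P Y b) t)
    = d_fun TQ L (q t, vel t) (var Y t) + FL P L (q t, vel t) (lie_curve_deriv J b t)"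
proof -
  obtain c k where ck: "q t \<in> fst c" "charted_path P H J q Z c k" by (rule chart_at[OF t], rule that)
  interpret C: charted_path P H J q Z c k by (rule ck)
  show ?thesis by (rule C.Lagrangian_variation[OF L Y b add_fundamental_gen[OF Y b] t ck(1)])
qed

text \<open>Adding fundamental vectors to it yields the purely vertical generators, which serve as
  test variations for (ii) and (iv).\<close>

definition zero_gen :: "real \<Rightarrow> ('q, 'e) tb" where "zero_gen t = (q t, 0)"

lemma zero_gen: "horizontal_gen zero_gen"
proof -
  have "smooth_map model_atlas J TQ zero_gen"
  proof (rule tangent_curveI)
    fix t assume t: "t \<in> J"
    show "snd (zero_gen t) \<in> tangent_space (tot P) (fst (zero_gen t))"
      by (simp add: zero_gen_def zero_in_tangent_space[OF tot_atlas])
    obtain c where c: "c \<in> tot P" "q t \<in> fst c" by (rule smooth_map_codE[OF q t], rule that)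
    obtain W where W: "open W" "t \<in> W" "\<forall>s\<in>W \<inter> J. q s \<in> fst c" "smooth_on (W \<inter> J) (\<lambda>s. snd c (q s))"
      by (rule smooth_curveE[OF tot_atlas q t c], rule that)
    show "\<exists>c\<in>tot P. \<exists>W. open W \<and> t \<in> W \<and> (\<forall>s\<in>W \<inter> J. fst (zero_gen s) \<in> fst c) \<and>
      smooth_on (W \<inter> J) (\<lambda>s. snd c (fst (zero_gen s))) \<and> smooth_on (W \<inter> J) (\<lambda>s. snd (zero_gen s) c)"
      using c(1) W by (intro bexI[of _ c] exI[of _ W] conjI) (auto simp: zero_gen_def)
  qed
  then show ?thesis using H_subspace(3)[OF q_points] by (simp add: horizontal_gen_def gen_def zero_gen_def)
qed

lemma lie_curve_scale:
  assumes \<beta>: "smooth_on J \<beta>" and a: "a \<in> liealg P"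
  shows "smooth_lie_curve P J (\<lambda>t. tscale (\<beta> t) a)"
    "t \<in> J \<Longrightarrow> lie_curve_deriv J (\<lambda>t. tscale (\<beta> t) a) t = tscale (vector_derivative \<beta> (at t within J)) a"
proof -
  show "smooth_lie_curve P J (\<lambda>t. tscale (\<beta> t) a)"
    using liealg_subspace(4)[OF a] by (auto simp: smooth_lie_curve_def tscale_def intro!: smooth_on_scaleR \<beta>)
  assume t: "t \<in> J"
  show "lie_curve_deriv J (\<lambda>t. tscale (\<beta> t) a) t = tscale (vector_derivative \<beta> (at t within J)) a"
  proof
    fix d
    have "((\<lambda>s. \<beta> s *\<^sub>R a d) has_vector_derivative vector_derivative \<beta> (at t within J) *\<^sub>R a d) (at t within J)"
      by (rule bounded_linear.has_vector_derivative[OF bounded_linear_scaleR_left smooth_on_has_vector_derivative[OF \<beta> t]])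
    from vector_derivative_within[OF nb[OF t] this]
    show "lie_curve_deriv J (\<lambda>t. tscale (\<beta> t) a) t d = tscale (vector_derivative \<beta> (at t within J)) a d"
      by (simp add: lie_curve_deriv_def tscale_def)
  qed
qed

text \<open>The multiplier is frozen at its value \<mu> at one time, since \<open>dS\<close>
  differentiates in the bundle variable only. For a vertical generator the curvature term vanishes,
  so the form varies by exactly the derivative of \<open>b\<close>.\<close>

lemma multiplier_variation:
  assumes L: "smooth_Lagrangian L" "invariant_lagrangian P L" and \<mu>: "\<mu> \<in> lie_dual (grp P) (grp_atlas P)"
    and b: "smooth_lie_curve P J b" and t: "t \<in> J"
  shows "d_fun TQ (\<lambda>z. L z - \<mu> (omega P H z)) (q t, vel t) (var (add_fundamental P zero_gen b) t)
    = FL P L (q t, vel t) (lie_curve_deriv J b t) - \<mu> (lie_curve_deriv J b t)"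
proof -
  let ?\<xi> = "add_fundamental P zero_gen b" and ?f = "\<lambda>z. L z - \<mu> (omega P H z)" and ?b' = "lie_curve_deriv J b t"
  note TA = smooth_atlas_tangent[OF tot_atlas]
  have zg: "gen zero_gen" using zero_gen by (simp add: horizontal_gen_def)
  have \<xi>: "gen ?\<xi>" by (rule add_fundamental_gen[OF zg b])
  obtain k where k: "k \<in> grp_atlas P" "\<one>\<^bsub>grp P\<^esub> \<in> fst k" using G.one_closed grp.points by (metis points_iff)
  \<comment> \<open>Stated for an arbitrary chart before any interpretation, because smoothness of
    \<open>?f\<close> on the whole tangent bundle needs all charts.\<close>
  have lift: "smooth_on (charted_connection.U c \<times> UNIV) (charted_connection.lift P c ?f) \<and>
      linear (\<lambda>w. \<mu> (charted_connection.alg P k w)) \<and>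
      (\<forall>x\<in>charted_connection.U c. \<forall>e. charted_connection.lift P c ?f (x, e)
        = charted_connection.lift P c L (x, e) - \<mu> (charted_connection.alg P k (charted_connection.Om P H c k x e)))"
    if c: "c \<in> tot P" for c
  proof -
    interpret C: charted_connection P H c k by unfold_locales (rule c k)+
    have lin: "linear (\<lambda>w. \<mu> (C.alg w))"
      using lie_dualD[OF \<mu> C.alg(1)] C.alg(1) by (intro linearI) (simp_all add: C.alg(4,5))
    have eq: "C.lift ?f (x, e) = C.lift L (x, e) - \<mu> (C.alg (C.Om x e))" if "x \<in> C.U" for x e
      by (simp add: C.lift_def C.Om_omega[OF that C.vec(1)[OF that]] C.vec(2)[OF that])
    have 1: "smooth_on (C.U \<times> (UNIV :: 'e set)) (\<lambda>z. C.Om (fst z) e)" for e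
      by (rule smooth_on_compose[OF C.Om_smooth smooth_on_fst[OF smooth_on_ident]]) auto
    have "smooth_on (C.U \<times> (UNIV :: 'e set)) (\<lambda>z. C.Om (fst z) (snd z))"
      by (rule smooth_on_operator[where T = "\<lambda>z. C.Om (fst z)", OF _ 1 smooth_on_snd[OF smooth_on_ident]]) (auto intro: C.Om_linear)
    then have "smooth_on (C.U \<times> UNIV) (\<lambda>z. C.lift L z - \<mu> (C.alg (C.Om (fst z) (snd z))))"
      by (intro smooth_on_diff C.lift_smooth[OF L(1)] smooth_on_linear_compose[OF lin])
    then have "smooth_on (C.U \<times> UNIV) (C.lift ?f)"
      by (rule smooth_on_cong[THEN iffD2, rotated]) (use eq in auto)
    then show ?thesis using lin eq by blast
  qed
  \<comment> \<open>The coordinate formula for the variation presupposes a smooth function on the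
    tangent bundle, so this must be known for the modified Lagrangian too.\<close>
  have f: "smooth_Lagrangian ?f"
  proof (rule smooth_mapI[OF TA])
    fix Z' assume "Z' \<in> points TQ"
    then have Z': "fst Z' \<in> points (tot P)" "snd Z' \<in> tangent_space (tot P) (fst Z')" by (auto simp: points_tangent)
    obtain c where c: "c \<in> tot P" "fst Z' \<in> fst c" using Z'(1) unfolding points_iff by (elim bexE)
    interpret C: charted_connection P H c k by unfold_locales (rule c k)+
    let ?tc = "tangent_chart (tot P) c" and ?W = "C.U \<times> (UNIV :: 'e set)"
    have "smooth_on (?W \<inter> snd ?tc ` (points TQ \<inter> fst ?tc)) (\<lambda>z. ?f (chart_inv ?tc z))"
      by (rule smooth_on_cong[THEN iffD2, OF _ smooth_on_subset[of ?W "C.lift ?f"]])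
        (use lift[OF c(1)] in \<open>auto simp: C.lift_def C.tangent_chart_inv_pt\<close>)
    then show "\<exists>c\<in>TQ. \<exists>d\<in>model_atlas. Z' \<in> fst c \<and> ?f Z' \<in> fst d \<and> (\<exists>W. open W \<and> snd c Z' \<in> W \<and>
        (\<forall>x\<in>W \<inter> snd c ` (points TQ \<inter> fst c). ?f (chart_inv c x) \<in> fst d) \<and>
        smooth_on (W \<inter> snd c ` (points TQ \<inter> fst c)) (\<lambda>x. snd d (?f (chart_inv c x))))"
      using tangent_chart_in[OF c(1)] C.open_UxUNIV C.pt_snd(2)[OF c(2)] c(2) Z'(2)
      by (intro bexI[of _ ?tc] bexI[of _ "(UNIV, \<lambda>x. x)"] conjI exI[of _ ?W]) (auto simp: tangent_chart_mem snd_tangent_chart)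
  qed
  obtain c where c: "c \<in> tot P" "q t \<in> fst c" by (rule smooth_map_codE[OF q t], rule that)
  interpret C: charted_path P H J q Z c k by unfold_locales (rule c k)+
  let ?x = "snd c (q t)" and ?v = "vel t c" and ?s = "snd (?\<xi> t) c" and ?s' = "hat_deriv c ?\<xi> t"
  note x = C.coord(2)[OF c(2)]
  have lin: "linear (\<lambda>w. \<mu> (C.alg w))" using lift[OF c(1)] by blast
  have dL: "(C.lift L has_derivative fderiv (C.lift L) (?x, ?v)) (at (?x, ?v))"
    by (rule smooth_on_has_derivative[OF C.open_UxUNIV C.lift_smooth[OF L(1)]]) (simp add: x)
  have "((\<lambda>z. C.lift L z - \<mu> (C.alg (C.Om (fst z) (snd z)))) has_derivative
      (\<lambda>z. fderiv (C.lift L) (?x, ?v) z - \<mu> (C.alg (C.DOm ?x ?v (fst z) + C.Om ?x (snd z))))) (at (?x, ?v))"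
    by (intro has_derivative_diff dL bounded_linear.has_derivative[OF linear_imp_bounded_linear[OF lin]]
        operator_has_derivative[OF C.open_U C.Om_linear C.Om_smooth x])
  then have "(C.lift ?f has_derivative
      (\<lambda>z. fderiv (C.lift L) (?x, ?v) z - \<mu> (C.alg (C.DOm ?x ?v (fst z) + C.Om ?x (snd z))))) (at (?x, ?v))"
    by (rule has_derivative_transform_within_open[OF _ C.open_UxUNIV]) (use x lift[OF c(1)] in auto)
  from fun_cong[OF frechet_derivative_at[OF this], of "(?s, ?s')"]
  have "fderiv (C.lift ?f) (?x, ?v) (?s, ?s') = fderiv (C.lift L) (?x, ?v) (?s, ?s') - \<mu> (C.alg (C.DOm ?x ?v ?s + C.Om ?x ?s'))" by simp
  then have "d_fun TQ ?f (q t, vel t) (var ?\<xi> t) = d_fun TQ L (q t, vel t) (var ?\<xi> t) - \<mu> (C.alg ((?b' + curvature_along P H Z zero_gen t) k))"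
    by (simp only: C.lift_variation[OF f \<xi> t c(2)] C.lift_variation[OF L(1) \<xi> t c(2)] C.omega_variation[OF zero_gen b \<xi> t c(2)])
  moreover have "curvature_along P H Z zero_gen t = 0"
  proof -
    have "C.DOm ?x 0 ?v = fderiv (\<lambda>y. 0 :: 'h) ?x ?v"
      by (rule fderiv_cong_apply[OF C.open_U x]) (rule linear_0[OF C.Om_linear])
    moreover have "C.DOm ?x ?v 0 = 0"
      by (rule linear_0[OF linear_fderiv[OF smooth_on_differentiable[OF C.open_U C.Om_smooth x]]])
    ultimately show ?thesis unfolding C.curvature_along_coord[OF zero_gen t c(2)] by (simp add: zero_gen_def C.alg(6))
  qed
  moreover have "d_fun TQ L (q t, vel t) (var zero_gen t) = 0"
  proof -
    have "hat_deriv c zero_gen t = 0"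
      by (rule vector_derivative_within[OF nb[OF t]]) (simp add: zero_gen_def)
    then have "d_fun TQ L (q t, vel t) (var zero_gen t) = fderiv (C.lift L) (?x, ?v) 0"
      by (simp add: C.lift_variation[OF L(1) zg t c(2)] zero_gen_def zero_prod_def)
    also have "\<dots> = 0" by (rule linear_0[OF has_derivative_linear[OF dL]])
    finally show ?thesis .
  qed
  ultimately show ?thesis
    using Lagrangian_variation[OF L zg b t] C.alg(3)[OF lie_curve_deriv_in(1)[OF b t]] by simp
qed

end

section \<open>Extremals\<close>

locale interval_path = path P H "{t0..t1}" q Z
  for P :: "('q, 'e::model_space, 'm, 'd::model_space, 'g, 'h::model_space) bundle_data" and H t0 t1 q Z +
  fixes L :: "('q, 'e) tb \<Rightarrow> real"
  assumes t01: "t0 < t1" and L: "smooth_Lagrangian L" "invariant_lagrangian P L"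
begin

abbreviation I :: "real set" where "I \<equiv> {t0..t1}"
abbreviation dSL :: "(real \<Rightarrow> ('q, 'e) tb) \<Rightarrow> real" where "dSL \<equiv> dS (tot P) I (\<lambda>z t. L z) Z"
abbreviation FL_path :: "real \<Rightarrow> ('g, 'h) tvec \<Rightarrow> real" where "FL_path t \<equiv> FL P L (Z t)"

lemma ends: "t0 \<in> I" "t1 \<in> I"
  using t01 by auto

lemma FL_path_lie_dual: "t \<in> I \<Longrightarrow> FL_path t \<in> lie_dual (grp P) (grp_atlas P)"
  using FL_in_lie_dual[OF L(1)] Z by simp

lemma FL_path_smooth: "a \<in> liealg P \<Longrightarrow> smooth_on I (\<lambda>t. FL_path t a)"
  by (rule smooth_on_cong[THEN iffD2, OF _ FL_smooth[OF L(1)]]) (simp_all add: Z)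

text \<open>The pointwise formula can be integrated term by term because the action densities of
  both generators are smooth on the compact interval.\<close>

lemma dS_add_fundamental:
  assumes Y: "gen Y" and b: "smooth_lie_curve P I b"
  shows "dSL (add_fundamental P Y b) = dSL Y + integral I (\<lambda>t. FL_path t (lie_curve_deriv I b t))"
proof -
  let ?\<xi> = "add_fundamental P Y b"
  have \<xi>: "gen ?\<xi>" by (rule add_fundamental_gen[OF Y b])
  let ?d = "\<lambda>\<xi> t. d_fun TQ L (q t, vel t) (var \<xi> t)"
  have i: "?d \<zeta> integrable_on I" if "gen \<zeta>" for \<zeta>
    using smooth_on_continuous_on[OF action_density_smooth[OF L(1) that]] by (rule integrable_continuous_real)
  have dS: "dSL \<zeta> = integral I (?d \<zeta>)" for \<zeta>
    unfolding dS_def by (rule integral_cong) (simp add: Z)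
  have "integral I (\<lambda>t. FL_path t (lie_curve_deriv I b t)) = integral I (\<lambda>t. ?d ?\<xi> t - ?d Y t)"
    by (rule integral_cong) (simp add: Z Lagrangian_variation[OF L Y b])
  also have "\<dots> = integral I (?d ?\<xi>) - integral I (?d Y)"
    by (rule Henstock_Kurzweil_Integration.integral_diff[OF i[OF \<xi>] i[OF Y]])
  finally show ?thesis by (simp add: dS)
qed

lemma vanishes_add_fundamental:
  assumes "gen Y" "vanishes_at_ends t0 t1 Y" "b t0 = 0" "b t1 = 0"
  shows "vanishes_at_ends t0 t1 (add_fundamental P Y b)"
  using assms add_fundamental_simps(2)[OF assms(1)] ends fundamental_zero q_points by (simp add: vanishes_at_ends_def)

lemma horizontal_gen_gen: "horizontal_gen Y \<Longrightarrow> gen Y"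
  by (simp add: horizontal_gen_def)

lemma zero_gen_vanishes: "vanishes_at_ends t0 t1 zero_gen"
  by (simp add: vanishes_at_ends_def zero_gen_def)

lemma horizontal_generator_iff:
  "generator (tot P) I Z Y \<and> (\<forall>t\<in>I. Y t \<in> HQ P H) \<longleftrightarrow> horizontal_gen Y"
  using horizontal_genI[of Y] horizontal_gen_gen[of Y] horizontal_gen_HQ[of Y] generator_iff_gen[of Y] by metis

lemma nonholonomicD:
  assumes "nonholonomic_extremal P H t0 t1 (\<lambda>z t. L z) Z" "horizontal_gen Y" "vanishes_at_ends t0 t1 Y"
  shows "dSL Y = 0"
  using assms horizontal_generator_iff[of Y] unfolding nonholonomic_extremal_def by metis

lemma decomposition_vanishing:
  assumes \<xi>: "generator (tot P) I Z \<xi>" "vanishes_at_ends t0 t1 \<xi>"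
  obtains Y b where "horizontal_gen Y" "smooth_lie_curve P I b" "add_fundamental P Y b = \<xi>"
    "vanishes_at_ends t0 t1 Y" "b t0 = 0" "b t1 = 0"
proof -
  have g: "gen \<xi>" using \<xi>(1) generator_iff_gen by metis
  obtain Y b where Y: "horizontal_gen Y" "smooth_lie_curve P I b" "add_fundamental P Y b = \<xi>"
    "\<forall>t\<in>I. snd (\<xi> t) = 0 \<longrightarrow> b t = 0 \<and> snd (Y t) = 0" by (rule gen_decomposition[OF g], rule that)
  then have "\<forall>t\<in>{t0, t1}. b t = 0 \<and> snd (Y t) = 0" using \<xi>(2) ends by (auto simp: vanishes_at_ends_def)
  then show thesis by (intro that[OF Y(1-3)]) (simp_all add: vanishes_at_ends_def)
qed

text \<open>A fixed linear functional commutes with differentiation, so the integrand is the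
  derivative of \<mu> applied to \<open>b\<close> and its integral is a difference of end-point
  values.\<close>

lemma integral_constant_dual:
  assumes \<mu>: "\<mu> \<in> lie_dual (grp P) (grp_atlas P)" and b: "smooth_lie_curve P I b" "b t0 = 0" "b t1 = 0"
  shows "integral I (\<lambda>t. \<mu> (lie_curve_deriv I b t)) = 0"
proof -
  obtain c k where ck: "q t0 \<in> fst c" "charted_path P H I q Z c k" by (rule chart_at[OF ends(1)], rule that)
  interpret C: charted_path P H I q Z c k by (rule ck)
  have lin: "linear (\<lambda>w. \<mu> (C.alg w))"
    using lie_dualD[OF \<mu> C.alg(1)] C.alg(1) by (intro linearI) (simp_all add: C.alg(4,5))
  have d: "((\<lambda>s. \<mu> (C.alg (b s k))) has_vector_derivative \<mu> (lie_curve_deriv I b t)) (at t within I)" if t: "t \<in> I" for t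
  proof -
    have "((\<lambda>s. \<mu> (C.alg (b s k))) has_vector_derivative \<mu> (C.alg (lie_curve_deriv I b t k))) (at t within I)"
      by (rule bounded_linear.has_vector_derivative[OF linear_imp_bounded_linear[OF lin] lie_curve_deriv_in(2)[OF b(1) t]])
    then show ?thesis by (simp only: C.alg(3)[OF lie_curve_deriv_in(1)[OF b(1) t]])
  qed
  have "((\<lambda>t. \<mu> (lie_curve_deriv I b t)) has_integral \<mu> (C.alg (b t1 k)) - \<mu> (C.alg (b t0 k))) I"
    by (rule fundamental_theorem_of_calculus[OF less_imp_le[OF t01] d])
  then show ?thesis using b(2,3) by (simp add: integral_unique)
qed

lemma du_bois_reymond_lie_dual:
  assumes \<Lambda>: "\<And>t. t \<in> I \<Longrightarrow> \<Lambda> t \<in> lie_dual (grp P) (grp_atlas P)" "\<And>a. a \<in> liealg P \<Longrightarrow> smooth_on I (\<lambda>t. \<Lambda> t a)"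
    and z: "\<And>b. smooth_lie_curve P I b \<Longrightarrow> b t0 = 0 \<Longrightarrow> b t1 = 0 \<Longrightarrow> integral I (\<lambda>t. \<Lambda> t (lie_curve_deriv I b t)) = 0"
    and t: "t \<in> I" and a: "a \<in> liealg P"
  shows "\<Lambda> t a = \<Lambda> t0 a"
proof (rule du_bois_reymond[OF t01 \<Lambda>(2)[OF a] _ t])
  fix \<beta> :: "real \<Rightarrow> real" assume \<beta>: "smooth_on I \<beta>" "\<beta> t0 = 0" "\<beta> t1 = 0"
  have "integral I (\<lambda>t. vector_derivative \<beta> (at t within I) * \<Lambda> t a)
      = integral I (\<lambda>t. \<Lambda> t (lie_curve_deriv I (\<lambda>t. tscale (\<beta> t) a) t))"
    by (rule integral_cong) (simp add: lie_curve_scale(2)[OF \<beta>(1) a] lie_dualD(2)[OF \<Lambda>(1) a])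
  also have "\<dots> = 0"
    by (rule z[OF lie_curve_scale(1)[OF \<beta>(1) a]]) (simp_all add: \<beta> tscale_def fun_eq_iff)
  finally show "integral I (\<lambda>t. vector_derivative \<beta> (at t within I) * \<Lambda> t a) = 0" .
qed

text \<open>Necessity is tested on vertical generators. For sufficiency a generator is split:
  nonholonomic extremality disposes of the horizontal part, and against a constant functional the
  vertical part contributes a total derivative.\<close>

lemma unconstrained_iff:
  assumes nh: "nonholonomic_extremal P H t0 t1 (\<lambda>z t. L z) Z"
  shows "unconstrained_extremal P t0 t1 (\<lambda>z t. L z) Z \<longleftrightarrow>
    (\<exists>\<mu>\<in>lie_dual (grp P) (grp_atlas P). \<forall>t\<in>I. \<forall>b\<in>liealg P. FL_path t b = \<mu> b)"
proof
  assume u: "unconstrained_extremal P t0 t1 (\<lambda>z t. L z) Z"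
  have "integral I (\<lambda>t. FL_path t (lie_curve_deriv I b t)) = 0"
    if b: "smooth_lie_curve P I b" "b t0 = 0" "b t1 = 0" for b
  proof -
    note zg = horizontal_gen_gen[OF zero_gen]
    have "generator (tot P) I Z (add_fundamental P zero_gen b)"
      using generator_iff_gen add_fundamental_gen[OF zg b(1)] by metis
    then have "dSL (add_fundamental P zero_gen b) = 0"
      using u vanishes_add_fundamental[OF zg zero_gen_vanishes b(2,3)] unfolding unconstrained_extremal_def by metis
    then show ?thesis
      using dS_add_fundamental[OF zg b(1)] nonholonomicD[OF nh zero_gen zero_gen_vanishes] by simp
  qed
  from du_bois_reymond_lie_dual[OF FL_path_lie_dual FL_path_smooth this]
  show "\<exists>\<mu>\<in>lie_dual (grp P) (grp_atlas P). \<forall>t\<in>I. \<forall>b\<in>liealg P. FL_path t b = \<mu> b"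
    by (intro bexI[OF _ FL_path_lie_dual[OF ends(1)]] ballI)
next
  assume "\<exists>\<mu>\<in>lie_dual (grp P) (grp_atlas P). \<forall>t\<in>I. \<forall>b\<in>liealg P. FL_path t b = \<mu> b"
  then obtain \<mu> where \<mu>: "\<mu> \<in> lie_dual (grp P) (grp_atlas P)" "\<forall>t\<in>I. \<forall>b\<in>liealg P. FL_path t b = \<mu> b" by (elim bexE)
  show "unconstrained_extremal P t0 t1 (\<lambda>z t. L z) Z"
    unfolding unconstrained_extremal_def
  proof (intro allI impI, elim conjE)
    fix \<xi> assume \<xi>: "generator (tot P) I Z \<xi>" "vanishes_at_ends t0 t1 \<xi>"
    obtain Y b where Y: "horizontal_gen Y" "smooth_lie_curve P I b" "add_fundamental P Y b = \<xi>"
      "vanishes_at_ends t0 t1 Y" "b t0 = 0" "b t1 = 0" by (rule decomposition_vanishing[OF \<xi>], rule that)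
    have "integral I (\<lambda>t. FL_path t (lie_curve_deriv I b t)) = integral I (\<lambda>t. \<mu> (lie_curve_deriv I b t))"
      by (rule integral_cong) (simp add: \<mu>(2) lie_curve_deriv_in(1)[OF Y(2)])
    then show "dSL \<xi> = 0"
      using dS_add_fundamental[OF horizontal_gen_gen[OF Y(1)] Y(2)] nonholonomicD[OF nh Y(1,4)]
        integral_constant_dual[OF \<mu>(1) Y(2,5,6)] by (simp add: Y(3))
  qed
qed

text \<open>Nonholonomic extremality removes the contribution of \<open>Y\<close>; in the remaining
  integral the constraint replaces the derivative of \<open>b\<close> by minus the
  curvature.\<close>

lemma dS_vakonomic:
  assumes nh: "nonholonomic_extremal P H t0 t1 (\<lambda>z t. L z) Z"
    and Y: "horizontal_gen Y" "vanishes_at_ends t0 t1 Y" and b: "smooth_lie_curve P I b"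
    and v: "\<forall>t\<in>I. lie_curve_deriv I b t + curvature_along P H Z Y t = 0"
  shows "dSL (add_fundamental P Y b) = - integral I (\<lambda>t. FL_path t (curvature_along P H Z Y t))"
proof -
  have "FL_path t (lie_curve_deriv I b t) = - FL_path t (curvature_along P H Z Y t)" if t: "t \<in> I" for t
  proof -
    note R = curvature_along_in[OF Y(1) t]
    have "lie_curve_deriv I b t = - curvature_along P H Z Y t"
      using v t by (simp add: eq_neg_iff_add_eq_0)
    also have "\<dots> = tscale (-1) (curvature_along P H Z Y t)" by (simp add: tscale_def fun_eq_iff)
    finally show ?thesis using lie_dualD(2)[OF FL_path_lie_dual[OF t] R, of "-1"] by simp
  qed
  then have "integral I (\<lambda>t. FL_path t (lie_curve_deriv I b t)) = integral I (\<lambda>t. - FL_path t (curvature_along P H Z Y t))"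
    by (rule integral_cong)
  then show ?thesis
    using dS_add_fundamental[OF horizontal_gen_gen[OF Y(1)] b] nonholonomicD[OF nh Y] by simp
qed

text \<open>Every vanishing vakonomic generator is a sum of \<open>Y\<close> and \<open>b\<close>
  that satisfies the constraint and vanishes at the end-points, and conversely; on these
  \<open>dS_vakonomic\<close> evaluates the action.\<close>

lemma vakonomic_extremal_iff:
  assumes nh: "nonholonomic_extremal P H t0 t1 (\<lambda>z t. L z) Z"
  shows "vakonomic_extremal P H t0 t1 (\<lambda>z t. L z) Z \<longleftrightarrow>
    (\<forall>Y b. horizontal_gen Y \<and> smooth_lie_curve P I b \<and> vanishes_at_ends t0 t1 Y \<and> b t0 = 0 \<and> b t1 = 0 \<and>
       (\<forall>t\<in>I. lie_curve_deriv I b t + curvature_along P H Z Y t = 0) \<longrightarrow>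
     integral I (\<lambda>t. FL_path t (curvature_along P H Z Y t)) = 0)"
proof
  assume vak: "vakonomic_extremal P H t0 t1 (\<lambda>z t. L z) Z"
  show "\<forall>Y b. horizontal_gen Y \<and> smooth_lie_curve P I b \<and> vanishes_at_ends t0 t1 Y \<and> b t0 = 0 \<and> b t1 = 0 \<and>
       (\<forall>t\<in>I. lie_curve_deriv I b t + curvature_along P H Z Y t = 0) \<longrightarrow>
     integral I (\<lambda>t. FL_path t (curvature_along P H Z Y t)) = 0"
  proof (intro allI impI, elim conjE)
    fix Y b assume Y: "horizontal_gen Y" "vanishes_at_ends t0 t1 Y"
      and b: "smooth_lie_curve P I b" "b t0 = 0" "b t1 = 0"
      and v: "\<forall>t\<in>I. lie_curve_deriv I b t + curvature_along P H Z Y t = 0"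
    note Yg = horizontal_gen_gen[OF Y(1)]
    have "generator (tot P) I Z (add_fundamental P Y b)"
      using generator_iff_gen add_fundamental_gen[OF Yg b(1)] by metis
    moreover have "vakonomic_variation P H I Z (add_fundamental P Y b)"
      using vakonomic_iff[OF Y(1) b(1)] v by metis
    ultimately have "dSL (add_fundamental P Y b) = 0"
      using vak vanishes_add_fundamental[OF Yg Y(2) b(2,3)] unfolding vakonomic_extremal_def by metis
    then show "integral I (\<lambda>t. FL_path t (curvature_along P H Z Y t)) = 0"
      using dS_vakonomic[OF nh Y b(1) v] by simp
  qed
next
  assume R: "\<forall>Y b. horizontal_gen Y \<and> smooth_lie_curve P I b \<and> vanishes_at_ends t0 t1 Y \<and> b t0 = 0 \<and> b t1 = 0 \<and>
       (\<forall>t\<in>I. lie_curve_deriv I b t + curvature_along P H Z Y t = 0) \<longrightarrow>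
     integral I (\<lambda>t. FL_path t (curvature_along P H Z Y t)) = 0"
  show "vakonomic_extremal P H t0 t1 (\<lambda>z t. L z) Z"
    unfolding vakonomic_extremal_def
  proof (intro allI impI, elim conjE)
    fix \<xi> assume \<xi>: "generator (tot P) I Z \<xi>" "vanishes_at_ends t0 t1 \<xi>" "vakonomic_variation P H I Z \<xi>"
    obtain Y b where Y: "horizontal_gen Y" "smooth_lie_curve P I b" "add_fundamental P Y b = \<xi>"
      "vanishes_at_ends t0 t1 Y" "b t0 = 0" "b t1 = 0" by (rule decomposition_vanishing[OF \<xi>(1,2)], rule that)
    have v: "\<forall>t\<in>I. lie_curve_deriv I b t + curvature_along P H Z Y t = 0"
      using vakonomic_iff[OF Y(1,2)] \<xi>(3) unfolding Y(3) by metis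
    have "integral I (\<lambda>t. FL_path t (curvature_along P H Z Y t)) = 0"
      by (rule R[rule_format, OF conjI[OF Y(1) conjI[OF Y(2) conjI[OF Y(4) conjI[OF Y(5) conjI[OF Y(6) v]]]]]])
    then show "dSL \<xi> = 0" using dS_vakonomic[OF nh Y(1,4,2) v] by (simp add: Y(3))
  qed
qed

text \<open>A vertical generator sees only the difference of \<open>FL\<close> and the multiplier,
  paired with the derivative of \<open>b\<close>. This difference is again a smooth curve of linear
  functionals.\<close>

lemma multiplier_eq_FL:
  assumes m: "multiplier_extremal P H t0 t1 L \<Lambda> Z"
  shows "\<exists>\<mu>\<in>lie_dual (grp P) (grp_atlas P). \<forall>t\<in>I. \<forall>b\<in>liealg P. \<Lambda> t b = FL_path t b + \<mu> b"
proof -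
  have \<Lambda>: "\<Lambda> t \<in> lie_dual (grp P) (grp_atlas P)" if "t \<in> I" for t
    using m that by (simp add: multiplier_extremal_def smooth_multiplier_def)
  have \<Lambda>s: "smooth_on I (\<lambda>t. \<Lambda> t a)" if "a \<in> liealg P" for a
    using m that by (simp add: multiplier_extremal_def smooth_multiplier_def)
  have u: "unconstrained_extremal P t0 t1 (\<lambda>z t. L z - \<Lambda> t (omega P H z)) Z"
    using m by (simp add: multiplier_extremal_def)
  let ?D = "\<lambda>t a. FL_path t a - \<Lambda> t a"
  have D: "?D t \<in> lie_dual (grp P) (grp_atlas P)" if t: "t \<in> I" for t
    using lie_dualD[OF \<Lambda>[OF t]] lie_dualD[OF FL_path_lie_dual[OF t]] by (simp add: lie_dual_def algebra_simps)
  have Ds: "smooth_on I (\<lambda>t. ?D t a)" if "a \<in> liealg P" for a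
    by (rule smooth_on_diff[OF FL_path_smooth[OF that] \<Lambda>s[OF that]])
  have "integral I (\<lambda>t. ?D t (lie_curve_deriv I b t)) = 0"
    if b: "smooth_lie_curve P I b" "b t0 = 0" "b t1 = 0" for b
  proof -
    note zg = horizontal_gen_gen[OF zero_gen]
    have "generator (tot P) I Z (add_fundamental P zero_gen b)"
      using generator_iff_gen add_fundamental_gen[OF zg b(1)] by metis
    then have "dS (tot P) I (\<lambda>z t. L z - \<Lambda> t (omega P H z)) Z (add_fundamental P zero_gen b) = 0"
      by (intro u[unfolded unconstrained_extremal_def, rule_format] conjI vanishes_add_fundamental[OF zg zero_gen_vanishes b(2,3)])
    moreover have "dS (tot P) I (\<lambda>z t. L z - \<Lambda> t (omega P H z)) Z (add_fundamental P zero_gen b)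
        = integral I (\<lambda>t. ?D t (lie_curve_deriv I b t))"
      unfolding dS_def by (rule integral_cong) (simp add: Z multiplier_variation[OF L \<Lambda> b(1)])
    ultimately show ?thesis by simp
  qed
  then have c: "?D t a = ?D t0 a" if "t \<in> I" "a \<in> liealg P" for t a
    by (intro du_bois_reymond_lie_dual[where \<Lambda> = ?D, OF D Ds _ that])
  \<comment> \<open>The constant is the value of the difference at the initial time.\<close>
  let ?\<mu> = "\<lambda>a. \<Lambda> t0 a - FL_path t0 a"
  have "?\<mu> \<in> lie_dual (grp P) (grp_atlas P)"
    using lie_dualD[OF \<Lambda>[OF ends(1)]] lie_dualD[OF FL_path_lie_dual[OF ends(1)]] by (simp add: lie_dual_def algebra_simps)
  moreover have "\<Lambda> t a = FL_path t a + ?\<mu> a" if "t \<in> I" "a \<in> liealg P" for t a using c[OF that] by simp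
  ultimately show ?thesis by (intro bexI[of _ ?\<mu>] ballI)
qed

end

theorem corollary4p13:
  fixes P :: "('q, 'e::model_space, 'm, 'd::model_space, 'g, 'h::model_space) bundle_data"
    and H :: "'q \<Rightarrow> ('q, 'e) tvec set"
    and L :: "('q, 'e) tb \<Rightarrow> real"
    and t0 t1 :: real
  assumes "standard_chaplygin_system P H L" and "t0 < t1"
  shows "(\<forall>q\<in>points (tot P). \<forall>X\<in>tangent_space (base P) (proj P q). \<forall>a\<in>liealg P.
            B_map P H q X a = 0) \<and>
         (\<forall>Z\<in>HQ P H. \<forall>b\<in>liealg P. HL P H L Z b = 0) \<and>
         (\<forall>Z. horizontal_admissible_path P H {t0..t1} Z \<longrightarrow>
            (\<forall>Y b. generator (tot P) {t0..t1} Z Y \<and> (\<forall>t\<in>{t0..t1}. Y t \<in> HQ P H) \<and>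
                   smooth_lie_curve P {t0..t1} b \<longrightarrow>
               (vakonomic_variation P H {t0..t1} Z (add_fundamental P Y b) \<longleftrightarrow>
                (\<forall>t\<in>{t0..t1}. lie_curve_deriv {t0..t1} b t + curvature_along P H Z Y t = 0))) \<and>
            (nonholonomic_extremal P H t0 t1 (\<lambda>z t. L z) Z \<longrightarrow>
               (unconstrained_extremal P t0 t1 (\<lambda>z t. L z) Z \<longleftrightarrow>
                (\<exists>\<mu>\<in>lie_dual (grp P) (grp_atlas P).
                   \<forall>t\<in>{t0..t1}. \<forall>b\<in>liealg P. FL P L (Z t) b = \<mu> b))) \<and>
            (nonholonomic_extremal P H t0 t1 (\<lambda>z t. L z) Z \<longrightarrow>
               (vakonomic_extremal P H t0 t1 (\<lambda>z t. L z) Z \<longleftrightarrow>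
                (\<forall>Y b. generator (tot P) {t0..t1} Z Y \<and> (\<forall>t\<in>{t0..t1}. Y t \<in> HQ P H) \<and>
                       smooth_lie_curve P {t0..t1} b \<and>
                       vanishes_at_ends t0 t1 Y \<and> b t0 = 0 \<and> b t1 = 0 \<and>
                       (\<forall>t\<in>{t0..t1}. lie_curve_deriv {t0..t1} b t + curvature_along P H Z Y t = 0) \<longrightarrow>
                   integral {t0..t1} (\<lambda>t. FL P L (Z t) (curvature_along P H Z Y t)) = 0))) \<and>
            (\<forall>\<Lambda>. multiplier_extremal P H t0 t1 L \<Lambda> Z \<longrightarrow>
               (\<exists>\<mu>\<in>lie_dual (grp P) (grp_atlas P).
                  \<forall>t\<in>{t0..t1}. \<forall>b\<in>liealg P. \<Lambda> t b = FL P L (Z t) b + \<mu> b)))"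
proof -
  have P: "principal_bundle P" "horizontal_distribution P H" "invariant_distribution P H"
    and L: "smooth_map (tangent_atlas (tot P)) (points (tangent_atlas (tot P))) model_atlas L" "invariant_lagrangian P L"
    using assms(1) by (simp_all add: standard_chaplygin_system_def)
  interpret connection P H by unfold_locales (rule P)+
  \<comment> \<open>Admissibility only asserts that a base curve exists; naming it makes the
    development along the path available.\<close>
  have path: "\<exists>q. interval_path P H t0 t1 q Z L" if Z: "horizontal_admissible_path P H {t0..t1} Z" for Z
  proof -
    obtain q where q: "smooth_map model_atlas {t0..t1} (tot P) q" "\<forall>t\<in>{t0..t1}. Z t = tangent_lift (tot P) {t0..t1} q t"
      and h: "\<forall>t\<in>{t0..t1}. Z t \<in> HQ P H"
      using Z unfolding horizontal_admissible_path_def by (elim conjE exE)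
    have "interval_path P H t0 t1 q Z L"
    proof unfold_locales
      fix t assume t: "t \<in> {t0..t1}"
      then show "at t within {t0..t1} \<noteq> bot" using assms(2) by (intro at_within_interval_neq_bot)
      show Zt: "Z t = (q t, velocity (tot P) {t0..t1} q t)" using q(2) t by (simp add: tangent_lift_def)
      show "velocity (tot P) {t0..t1} q t \<in> H (q t)" using h[rule_format, OF t] by (simp add: Zt HQ_def)
    qed (rule q(1) assms(2) L)+
    then show ?thesis by (rule exI[of _ q])
  qed
  show ?thesis
  proof (rule conjI[OF _ conjI], goal_cases)
    case 1 show ?case by (intro ballI) (rule B_map_zero)
  next
    case 2 show ?case by (intro ballI) (rule HL_zero[OF L(2)])
  next
    case 3 show ?case
    proof (intro allI impI)
      fix Z assume "horizontal_admissible_path P H {t0..t1} Z"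
      from path[OF this] obtain q where ip: "interval_path P H t0 t1 q Z L" by (elim exE)
      interpret interval_path P H t0 t1 q Z L by (rule ip)
      \<comment> \<open>The free conclusion \<open>B\<close> lets one equation rewrite the premises
        on \<open>Y\<close> in both (i) and (iii), whatever conjuncts follow them.\<close>
      have conj: "generator (tot P) I Z Y \<and> (\<forall>t\<in>I. Y t \<in> HQ P H) \<and> B \<longleftrightarrow> horizontal_gen Y \<and> B" for Y B
        using horizontal_generator_iff[of Y] by metis
      show "(\<forall>Y b. generator (tot P) I Z Y \<and> (\<forall>t\<in>I. Y t \<in> HQ P H) \<and> smooth_lie_curve P I b \<longrightarrow>
               (vakonomic_variation P H I Z (add_fundamental P Y b) \<longleftrightarrow>
                (\<forall>t\<in>I. lie_curve_deriv I b t + curvature_along P H Z Y t = 0))) \<and>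
            (nonholonomic_extremal P H t0 t1 (\<lambda>z t. L z) Z \<longrightarrow>
               (unconstrained_extremal P t0 t1 (\<lambda>z t. L z) Z \<longleftrightarrow>
                (\<exists>\<mu>\<in>lie_dual (grp P) (grp_atlas P). \<forall>t\<in>I. \<forall>b\<in>liealg P. FL P L (Z t) b = \<mu> b))) \<and>
            (nonholonomic_extremal P H t0 t1 (\<lambda>z t. L z) Z \<longrightarrow>
               (vakonomic_extremal P H t0 t1 (\<lambda>z t. L z) Z \<longleftrightarrow>
                (\<forall>Y b. generator (tot P) I Z Y \<and> (\<forall>t\<in>I. Y t \<in> HQ P H) \<and> smooth_lie_curve P I b \<and>
                       vanishes_at_ends t0 t1 Y \<and> b t0 = 0 \<and> b t1 = 0 \<and>
                       (\<forall>t\<in>I. lie_curve_deriv I b t + curvature_along P H Z Y t = 0) \<longrightarrow>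
                   integral I (\<lambda>t. FL P L (Z t) (curvature_along P H Z Y t)) = 0))) \<and>
            (\<forall>\<Lambda>. multiplier_extremal P H t0 t1 L \<Lambda> Z \<longrightarrow>
               (\<exists>\<mu>\<in>lie_dual (grp P) (grp_atlas P).
                  \<forall>t\<in>I. \<forall>b\<in>liealg P. \<Lambda> t b = FL P L (Z t) b + \<mu> b))"
        unfolding conj
        by (intro conjI allI impI unconstrained_iff vakonomic_extremal_iff multiplier_eq_FL)
          (elim conjE, rule vakonomic_iff)
    qed
  qed
qed

end
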